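(* Let $C$ be a reduced, equidimensional, non-degenerate curve of degree $d$ in $\mathbb{P}^3$ ($C$ may be reducible, disconnected, and/or singular; note that $d\ge 2$ since $C$ is non-degenerate, with $C$ being two skew lines if $d=2$). Let $P\in\mathbb{P}^3$ be a general point. Then the cone $S_P=S_P(C)$ over $C$ with vertex $P$ is an unexpected surface of degree $d$ for $C$ with multiplicity $d$ at $P$. It is the unique unexpected surface of this degree and multiplicity.
   Context: $\mathbb{K}$ is an algebraically closed field of characteristic $0$, $\mathbb{P}^n=\mathbb{P}^n_{\mathbb{K}}$, $R=\mathbb{K}[x_0,\ldots,x_n]$ (here $n=3$). For a closed subscheme $V\subseteq\mathbb{P}^n$, $I_V\subseteq R$ is its saturated homogeneous ideal, and $[I]_t$ is the $\mathbb{K}$-vector space of forms of degree $t$ in a homogeneous ideal $I$. For a point $P$, $I_P$ is the ideal generated by the forms vanishing at $P$. Given $V$, a general point $P$ and integers $d\ge m$, $V$ admits an unexpected hypersurface (surface if $n=3$) of degree $d$ with multiplicity $m$ at $P$ if $$\dim [I_V\cap (I_P)^m]_d>\max\left\{0,\ \dim [I_V]_d-\binom{m-1+n}{n}\right\};$$ in that case the hypersurfaces defined by the nonzero elements of $[I_V\cap (I_P)^m]_d$ are called unexpected hypersurfaces for $V$ of degree $d$ and multiplicity $m$ at $P$. "General point" means that the assertion holds for all $P$ in a nonempty Zariski open subset. Non-degenerate means not contained in any hyperplane. The cone over $C$ with vertex $P$ is the union of all lines joining $P$ to points of $C$. *)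

theory Defs
  imports
    "HOL-Analysis.Analysis"
    "HOL-Library.Poly_Mapping"
    "HOL-Library.Extended_Nat"
    "HOL-Library.Numeral_Type"
    "HOL-Computational_Algebra.Polynomial"
begin

section \<open>The polynomial ring\<close>

text \<open>
  The finite type \<^typ>\<open>'n\<close> indexes the variables (and the homogeneous coordinates), so projective
  \<open>n\<close>-space has \<open>CARD('n) = n + 1\<close>; for projective 3-space \<^typ>\<open>'n\<close> is the four-element type
  \<^typ>\<open>4\<close>.
\<close>

type_synonym ('k, 'n) mpoly = "('n \<Rightarrow>\<^sub>0 nat) \<Rightarrow>\<^sub>0 'k"

definition scale_poly :: "'k::field \<Rightarrow> ('k, 'n) mpoly \<Rightarrow> ('k, 'n) mpoly" where
  "scale_poly c f = Poly_Mapping.single 0 c * f"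

interpretation mpoly: vector_space "scale_poly :: 'k::field \<Rightarrow> ('k, 'n) mpoly \<Rightarrow> _"
  by unfold_locales
     (simp_all add: scale_poly_def distrib_left distrib_right single_add mult.assoc[symmetric] mult_single)

interpretation mpoly_ring: module "(*) :: ('k::field, 'n) mpoly \<Rightarrow> _ \<Rightarrow> _"
  by unfold_locales (simp_all add: algebra_simps)

abbreviation is_ideal :: "('k::field, 'n) mpoly set \<Rightarrow> bool" where
  "is_ideal I \<equiv> mpoly_ring.subspace I"

abbreviation ideal_gen :: "('k::field, 'n) mpoly set \<Rightarrow> ('k, 'n) mpoly set" where
  "ideal_gen S \<equiv> mpoly_ring.span S"

definition ideal_power :: "('k::field, 'n) mpoly set \<Rightarrow> nat \<Rightarrow> ('k, 'n) mpoly set" where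
  "ideal_power I m = ideal_gen {prod_list fs | fs. length fs = m \<and> set fs \<subseteq> I}"

definition mono_deg :: "('n::finite \<Rightarrow>\<^sub>0 nat) \<Rightarrow> nat" where
  "mono_deg a = (\<Sum>i\<in>UNIV. Poly_Mapping.lookup a i)"

definition is_form :: "nat \<Rightarrow> ('k::field, 'n::finite) mpoly \<Rightarrow> bool" where
  "is_form t f \<longleftrightarrow> (\<forall>a\<in>Poly_Mapping.keys f. mono_deg a = t)"

definition homogeneous :: "('k::field, 'n::finite) mpoly \<Rightarrow> bool" where
  "homogeneous f \<longleftrightarrow> (\<exists>t. is_form t f)"

definition graded_part :: "('k::field, 'n::finite) mpoly set \<Rightarrow> nat \<Rightarrow> ('k, 'n) mpoly set" where
  "graded_part I t = {f \<in> I. is_form t f}"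

definition homogeneous_ideal :: "('k::field, 'n::finite) mpoly set \<Rightarrow> bool" where
  "homogeneous_ideal I \<longleftrightarrow> is_ideal I \<and> I = ideal_gen {f \<in> I. homogeneous f}"

definition irrelevant_ideal :: "('k::field, 'n::finite) mpoly set" where
  "irrelevant_ideal = ideal_gen (range (\<lambda>i. Poly_Mapping.single (Poly_Mapping.single i 1) 1))"

definition saturated :: "('k::field, 'n::finite) mpoly set \<Rightarrow> bool" where
  "saturated I \<longleftrightarrow> (\<forall>f k. (\<forall>g\<in>ideal_power irrelevant_ideal k. f * g \<in> I) \<longrightarrow> f \<in> I)"

definition eval_poly :: "('k::field, 'n::finite) mpoly \<Rightarrow> 'k ^ 'n \<Rightarrow> 'k" where
  "eval_poly f v = (\<Sum>a\<in>Poly_Mapping.keys f.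
     Poly_Mapping.lookup f a * (\<Prod>i\<in>UNIV. (v $ i) ^ Poly_Mapping.lookup a i))"

lemma eval_poly_superset:
  assumes "finite A" "Poly_Mapping.keys f \<subseteq> A"
  shows "eval_poly f v =
    (\<Sum>a\<in>A. Poly_Mapping.lookup f a * (\<Prod>i\<in>UNIV. (v $ i) ^ Poly_Mapping.lookup a i))"
  unfolding eval_poly_def by (rule sum.mono_neutral_left) (use assms in \<open>auto simp: in_keys_iff\<close>)

lemma eval_poly_add: "eval_poly (f + g) v = eval_poly f v + eval_poly g v"
proof -
  let ?A = "Poly_Mapping.keys f \<union> Poly_Mapping.keys g"
  show ?thesis
    using keys_add[of f g]
    by (simp add: eval_poly_superset[of ?A] lookup_add distrib_right sum.distrib)
qed

lemma eval_poly_zero [simp]: "eval_poly 0 v = 0"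
  by (simp add: eval_poly_def)

lemma eval_poly_single:
  "eval_poly (Poly_Mapping.single a c) v = c * (\<Prod>i\<in>UNIV. (v $ i) ^ Poly_Mapping.lookup a i)"
  by (simp add: eval_poly_def)

lemma eval_poly_one [simp]: "eval_poly 1 v = 1"
  using eval_poly_single[of 0 1 v] by simp

lemma mpoly_induct [case_names zero add_single]:
  fixes f :: "('k::field, 'n) mpoly"
  assumes "P 0" "\<And>a c f. P f \<Longrightarrow> P (Poly_Mapping.single a c + f)"
  shows "P f"
proof (induction f rule: update_induct)
  case const
  show ?case by fact
next
  case (update f a b)
  have "Poly_Mapping.update a b f = Poly_Mapping.single a b + f"
    by (rule poly_mapping_eqI)
       (use update in \<open>auto simp: lookup_add lookup_single lookup_update in_keys_iff when_def\<close>)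
  with assms(2)[OF update(3)] show ?case by simp
qed

lemma eval_poly_mult: "eval_poly (f * g) v = eval_poly f v * eval_poly g v"
proof (induction f rule: mpoly_induct)
  case (add_single a c f)
  have "eval_poly (Poly_Mapping.single a c * g) v = eval_poly (Poly_Mapping.single a c) v * eval_poly g v"
    by (induction g rule: mpoly_induct)
       (simp_all add: distrib_left eval_poly_add mult_single eval_poly_single lookup_add power_add
          prod.distrib algebra_simps)
  with add_single show ?case by (simp add: distrib_right eval_poly_add)
qed simp

lemma homogeneous_mult:
  assumes "homogeneous f" "homogeneous g"
  shows "homogeneous (f * g)"
proof -
  obtain s t where st: "is_form s f" "is_form t g"
    using assms by (auto simp: homogeneous_def)
  have "is_form (s + t) (f * g)"
    unfolding is_form_def
  proof
    fix a assume "a \<in> Poly_Mapping.keys (f * g)"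
    then obtain b c where "a = b + c" "b \<in> Poly_Mapping.keys f" "c \<in> Poly_Mapping.keys g"
      using keys_mult[of f g] by blast
    with st show "mono_deg a = s + t"
      by (auto simp: is_form_def mono_deg_def lookup_add sum.distrib)
  qed
  then show ?thesis by (auto simp: homogeneous_def)
qed


section \<open>Projective space and its Zariski topology\<close>

definition proj_rel :: "'k::field ^ 'n \<Rightarrow> 'k ^ 'n \<Rightarrow> bool" where
  "proj_rel u v \<longleftrightarrow> u \<noteq> 0 \<and> v \<noteq> 0 \<and> (\<exists>c. v = c *s u)"

lemma part_equivp_proj_rel: "part_equivp (proj_rel :: 'k::field ^ 'n \<Rightarrow> _)"
proof (rule part_equivpI)
  show "\<exists>u :: 'k ^ 'n. proj_rel u u"
    by (rule exI[of _ "vec 1"]) (auto simp: proj_rel_def vec_eq_iff intro!: exI[of _ 1])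
  show "symp (proj_rel :: 'k ^ 'n \<Rightarrow> _)"
  proof (rule sympI)
    fix u v :: "'k ^ 'n" assume "proj_rel u v"
    then obtain c where c: "u \<noteq> 0" "v \<noteq> 0" "v = c *s u" by (auto simp: proj_rel_def)
    then have "c \<noteq> 0" by auto
    with c(3) have "u = inverse c *s v" by (simp add: vec_eq_iff)
    with c(1,2) show "proj_rel v u" unfolding proj_rel_def by blast
  qed
  show "transp (proj_rel :: 'k ^ 'n \<Rightarrow> _)"
  proof (rule transpI)
    fix u v w :: "'k ^ 'n" assume "proj_rel u v" "proj_rel v w"
    then obtain b c where "u \<noteq> 0" "w \<noteq> 0" "v = b *s u" "w = c *s v" by (auto simp: proj_rel_def)
    moreover from this have "w = (c * b) *s u" by simp
    ultimately show "proj_rel u w" unfolding proj_rel_def by blast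
  qed
qed

quotient_type (overloaded) ('k, 'n) proj = "('k::field) ^ 'n" / partial: proj_rel
  by (rule part_equivp_proj_rel)

text \<open>
  \<^term>\<open>rep_proj P\<close> is some choice of homogeneous coordinates of \<^term>\<open>P\<close>. All notions below are
  independent of this choice; in particular evaluation at \<^term>\<open>rep_proj P\<close> is used for forms only.
\<close>

definition zero_locus :: "('k::field, 'n::finite) mpoly set \<Rightarrow> ('k, 'n) proj set" where
  "zero_locus S = {P. \<forall>f\<in>S. homogeneous f \<longrightarrow> eval_poly f (rep_proj P) = 0}"

definition vanishing_ideal :: "('k::field, 'n::finite) proj set \<Rightarrow> ('k, 'n) mpoly set" where
  "vanishing_ideal X = ideal_gen {f. homogeneous f \<and> (\<forall>P\<in>X. eval_poly f (rep_proj P) = 0)}"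

definition zariski :: "('k::field, 'n::finite) proj topology" where
  "zariski = topology (\<lambda>U. \<exists>S. U = - zero_locus S)"

lemma istopology_zariski:
  "istopology (\<lambda>U :: ('k::field, 'n::finite) proj set. \<exists>S. U = - zero_locus S)"
  unfolding istopology_def
proof (intro conjI allI impI)
  fix U V :: "('k, 'n) proj set"
  assume "\<exists>S. U = - zero_locus S" "\<exists>S. V = - zero_locus S"
  then obtain S T where ST: "U = - zero_locus S" "V = - zero_locus T" by blast
  have "U \<inter> V = - zero_locus {f * g | f g. f \<in> S \<and> g \<in> T \<and> homogeneous f \<and> homogeneous g}"
    unfolding ST zero_locus_def by (fastforce simp: eval_poly_mult intro: homogeneous_mult)
  then show "\<exists>S. U \<inter> V = - zero_locus S" by blast
next
  fix \<U> :: "('k, 'n) proj set set"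
  assume "\<forall>U\<in>\<U>. \<exists>S. U = - zero_locus S"
  then obtain S where "\<forall>U\<in>\<U>. U = - zero_locus (S U)" by metis
  then have "\<Union>\<U> = (\<Union>U\<in>\<U>. - zero_locus (S U))" by auto
  also have "\<dots> = - zero_locus (\<Union>U\<in>\<U>. S U)"
    unfolding zero_locus_def by blast
  finally have "\<Union>\<U> = - zero_locus (\<Union>U\<in>\<U>. S U)" .
  then show "\<exists>S. \<Union>\<U> = - zero_locus S" by blast
qed

lemma openin_zariski: "openin zariski U \<longleftrightarrow> (\<exists>S. U = - zero_locus S)"
  by (simp add: zariski_def topology_inverse'[OF istopology_zariski])

lemma topspace_zariski [simp]: "topspace zariski = UNIV"
proof -
  have "UNIV = - zero_locus {1 :: ('k::field, 'n::finite) mpoly}"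
    by (auto simp: zero_locus_def homogeneous_def is_form_def mono_deg_def)
  then show ?thesis
    by (metis openin_zariski openin_subset top.extremum_uniqueI)
qed

definition irreducible_closed :: "('k::field, 'n::finite) proj set \<Rightarrow> bool" where
  "irreducible_closed Z \<longleftrightarrow> closedin zariski Z \<and> Z \<noteq> {} \<and>
     (\<forall>A B. closedin zariski A \<and> closedin zariski B \<and> Z = A \<union> B \<longrightarrow> Z = A \<or> Z = B)"

definition irreducible_component :: "('k::field, 'n::finite) proj set \<Rightarrow> ('k, 'n) proj set \<Rightarrow> bool" where
  "irreducible_component Z X \<longleftrightarrow> irreducible_closed Z \<and> Z \<subseteq> X \<and>
     (\<forall>Y. irreducible_closed Y \<and> Z \<subseteq> Y \<and> Y \<subseteq> X \<longrightarrow> Y = Z)"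

text \<open>Krull dimension of a closed set. The empty set gets dimension 0 instead of \<open>-\<infinity>\<close>.\<close>

definition zariski_dim :: "('k::field, 'n::finite) proj set \<Rightarrow> enat" where
  "zariski_dim X = Sup {enat r | r. \<exists>Z. (\<forall>i\<le>r. irreducible_closed (Z i) \<and> Z i \<subseteq> X) \<and>
     (\<forall>i<r. Z i \<subset> Z (Suc i))}"

definition proj_line :: "('k::field, 'n::finite) proj \<Rightarrow> ('k, 'n) proj \<Rightarrow> ('k, 'n) proj set" where
  "proj_line P Q = {R. rep_proj R \<in> vec.span {rep_proj P, rep_proj Q}}"

definition is_line :: "('k::field, 'n::finite) proj set \<Rightarrow> bool" where
  "is_line L \<longleftrightarrow> (\<exists>P Q. P \<noteq> Q \<and> L = proj_line P Q)"

definition proj_cone :: "('k::field, 'n::finite) proj \<Rightarrow> ('k, 'n) proj set \<Rightarrow> ('k, 'n) proj set" where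
  "proj_cone P X = (\<Union>Q\<in>X - {P}. proj_line P Q)"


section \<open>Closed subschemes\<close>

text \<open>
  A closed subscheme \<open>V\<close> of projective space is represented by its saturated homogeneous ideal
  \<open>I\<^sub>V\<close>; its underlying set of closed points is \<^term>\<open>zero_locus I\<close>. The reduced subscheme on a
  closed set \<^term>\<open>X\<close> is \<^term>\<open>vanishing_ideal X\<close>.
\<close>

definition closed_subscheme :: "('k::field, 'n::finite) mpoly set \<Rightarrow> bool" where
  "closed_subscheme I \<longleftrightarrow> homogeneous_ideal I \<and> saturated I"

definition is_reduced :: "('k::field, 'n::finite) mpoly set \<Rightarrow> bool" where
  "is_reduced I \<longleftrightarrow> (\<forall>f k. f ^ k \<in> I \<longrightarrow> f \<in> I)"

definition is_curve :: "('k::field, 'n::finite) mpoly set \<Rightarrow> bool" where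
  "is_curve I \<longleftrightarrow> zariski_dim (zero_locus I) = 1"

definition equidimensional :: "('k::field, 'n::finite) mpoly set \<Rightarrow> bool" where
  "equidimensional I \<longleftrightarrow>
     (\<forall>Z. irreducible_component Z (zero_locus I) \<longrightarrow> zariski_dim Z = zariski_dim (zero_locus I))"

text \<open>
  The inclusion of subschemes \<open>V \<subseteq> W\<close> is \<open>I\<^sub>W \<subseteq> I\<^sub>V\<close>.
\<close>

definition nondegenerate :: "('k::field, 'n::finite) mpoly set \<Rightarrow> bool" where
  "nondegenerate I \<longleftrightarrow> \<not> (\<exists>l. is_form 1 l \<and> l \<noteq> 0 \<and> ideal_gen {l} \<subseteq> I)"

text \<open>The dimension of the degree \<open>t\<close> part of the homogeneous coordinate ring \<open>R/I\<close>.\<close>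

definition hilbert_function :: "('k::field, 'n::finite) mpoly set \<Rightarrow> nat \<Rightarrow> nat" where
  "hilbert_function I t =
     mpoly.dim (graded_part (UNIV :: ('k, 'n) mpoly set) t) - mpoly.dim (graded_part I t)"

definition is_hilbert_polynomial :: "('k::field, 'n::finite) mpoly set \<Rightarrow> rat poly \<Rightarrow> bool" where
  "is_hilbert_polynomial I p \<longleftrightarrow>
     (\<forall>\<^sub>F t in sequentially. poly p (of_nat t) = of_nat (hilbert_function I t))"

text \<open>
  The degree of a subscheme of dimension \<open>r\<close> is \<open>r!\<close> times the leading coefficient of its Hilbert
  polynomial (which has degree \<open>r\<close>).
\<close>

definition has_degree :: "('k::field, 'n::finite) mpoly set \<Rightarrow> nat \<Rightarrow> bool" where
  "has_degree I d \<longleftrightarrow>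
     (\<exists>p. is_hilbert_polynomial I p \<and> of_nat d = fact (Polynomial.degree p) * lead_coeff p)"


section \<open>Unexpected hypersurfaces\<close>

text \<open>
  With \<open>n = CARD('n) - 1\<close>, the binomial coefficient is written with \<open>m + n - 1\<close> rather than
  \<open>m - 1 + n\<close>, so that truncated subtraction does not interfere when \<open>m = 0\<close>.
\<close>

definition unexpected_at :: "('k::field, 'n::finite) mpoly set \<Rightarrow> nat \<Rightarrow> nat \<Rightarrow> ('k, 'n) proj \<Rightarrow> bool" where
  "unexpected_at I d m P \<longleftrightarrow> m \<le> d \<and>
     (let n = CARD('n) - 1 in
       int (mpoly.dim (graded_part (I \<inter> ideal_power (vanishing_ideal {P}) m) d)) >
       max 0 (int (mpoly.dim (graded_part I d)) - int ((m + n - 1) choose n)))"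

text \<open>The hypersurface defined by a form \<open>F\<close> is represented, as a subscheme, by the ideal \<open>(F)\<close>.\<close>

definition unexpected_hypersurface ::
  "('k::field, 'n::finite) mpoly set \<Rightarrow> nat \<Rightarrow> nat \<Rightarrow> ('k, 'n) proj \<Rightarrow> ('k, 'n) mpoly set \<Rightarrow> bool" where
  "unexpected_hypersurface I d m P S \<longleftrightarrow> unexpected_at I d m P \<and>
     (\<exists>F\<in>graded_part (I \<inter> ideal_power (vanishing_ideal {P}) m) d. F \<noteq> 0 \<and> S = ideal_gen {F})"

definition for_general_point :: "(('k::field, 'n::finite) proj \<Rightarrow> bool) \<Rightarrow> bool" where
  "for_general_point Q \<longleftrightarrow> (\<exists>U. openin zariski U \<and> U \<noteq> {} \<and> (\<forall>P\<in>U. Q P))"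

end

theory Submission
  imports Defs
begin

text \<open>
  Let \<open>P\<close> be a point off the curve. In coordinates \<open>w, x, y, z\<close> such that \<open>x, y, z\<close> vanish at \<open>P\<close>, the
  forms of degree \<open>d\<close> with multiplicity \<open>d\<close> at \<open>P\<close> are the forms in \<open>x, y, z\<close>. Those that vanish on the curve
  are the equations of degree \<open>d\<close> of its image under the projection from \<open>P\<close>. This image is a plane
  curve, so its equations are the multiples of a single form \<open>F\<close>, of degree \<open>e\<close> say, and the zeros of \<open>F\<close> form
  the cone. If \<open>e = d\<close>, then the forms of degree and multiplicity \<open>d\<close> are the multiples of \<open>F\<close> by constants, which gives
  existence and uniqueness as soon as the expected dimension is not positive
  (\<open>graded_part_cone\<close>, \<open>vanishing_ideal_cone\<close>, \<open>unexpected_cone\<close>).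

  \<^bold>\<open>The expected dimension.\<close> It is at most zero if the Hilbert function of the curve has at least the
  value \<open>(d + 2 choose 2)\<close> in degree \<open>d\<close>. The forms in \<open>x, y, z\<close> contribute one less than that, having the single relation
  \<open>F\<close>. One more dimension comes from a product of \<open>w\<close> with a power of \<open>x\<close> or \<open>y\<close>: if both of the powers of
  degree \<open>d - 1\<close> failed, \<open>w\<close> would be a linear form in \<open>x, y, z\<close> on the curve, which would then lie in a
  plane (\<open>proj_hf_ge\<close>).

  \<^bold>\<open>The degree of the projection.\<close> By Noether normalization the homogeneous coordinate ring of the
  curve is a finite module over a polynomial ring \<open>K[x, y]\<close>; equidimensionality makes it torsion-free
  (\<open>parameters_torsion_free\<close>), and the slope of its Hilbert function is \<open>d\<close> (\<open>curve_hf_step\<close>). The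
  form \<open>F\<close> can be chosen monic in \<open>z\<close>, and \<open>1, z, \<dots>, z\<^sup>e\<^sup>-\<^sup>1\<close> are independent over \<open>K[x, y]\<close> by Gauss's lemma
  (\<open>no_relation_of_small_degree\<close>), so \<open>e \<le> d\<close>. For the other inequality, a suitable plane section
  consists of at least \<open>d\<close> points: in characteristic zero the coordinates satisfy separable relations,
  so a general fibre is reduced (\<open>plane_section_points\<close>). From some point of space these points
  have different images, and then no nonzero form of degree less than \<open>d\<close> vanishes on the image
  (\<open>no_ternary_relation\<close>). This is a statement of linear independence, so it remains true on an
  open set of centres (\<open>general_centre_exists_open\<close>, \<open>general_centre_on_open_set\<close>).

  \<^bold>\<open>Small degrees.\<close> If \<open>d = 1\<close>, then \<open>F\<close> is a linear form vanishing on the curve, which is excluded. If \<open>d = 2\<close>,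
  a plane through three points of the curve cannot meet it properly, so the curve has two parts,
  each of degree one; these parts are lines, and they are skew because the curve lies in no plane
  (\<open>degree_two_curve\<close>).

  The topological hypotheses are used only to obtain a radical homogeneous ideal whose quotient is unmixed of
  dimension two (\<open>curve_ideal_if_curve\<close>). All later arguments are about such ideals, which has
  the advantage that they also apply to the colon ideals of the parts.
\<close>

section \<open>Ideals and subrings of a commutative ring\<close>

interpretation idl: module "(*) :: 'a::comm_ring_1 \<Rightarrow> 'a \<Rightarrow> 'a"
  by unfold_locales (simp_all add: algebra_simps)

text \<open>As a rewrite rule this would undo \<^prop>\<open>a * b * c = a * (b * c)\<close>.\<close>

declare idl.scale_scale [simp del] mpoly_ring.scale_scale [simp del]

lemma ideal_mult_left: "idl.subspace I \<Longrightarrow> x \<in> I \<Longrightarrow> r * x \<in> I"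
  by (rule idl.subspace_scale)

lemma ideal_mult_right: "idl.subspace I \<Longrightarrow> x \<in> I \<Longrightarrow> x * r \<in> I"
  by (subst mult.commute) (rule idl.subspace_scale)

lemma mem_span_insert_ideal:
  "idl.subspace I \<Longrightarrow> x \<in> idl.span (insert f I) \<longleftrightarrow> (\<exists>k. x - k * f \<in> I)"
  unfolding idl.span_breakdown_eq by (simp only: idl.span_eq_iff[THEN iffD2])

definition radical_ideal :: "'a::comm_ring_1 set \<Rightarrow> bool" where
  "radical_ideal I \<longleftrightarrow> idl.subspace I \<and> (\<forall>f k. f ^ k \<in> I \<longrightarrow> f \<in> I)"

lemma radical_idealD2: "radical_ideal I \<Longrightarrow> f * f \<in> I \<Longrightarrow> f \<in> I"
  unfolding radical_ideal_def by (metis power2_eq_square)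

definition prime_ideal :: "'a::comm_ring_1 set \<Rightarrow> bool" where
  "prime_ideal M \<longleftrightarrow> idl.subspace M \<and> 1 \<notin> M \<and> (\<forall>f g. f * g \<in> M \<longrightarrow> f \<in> M \<or> g \<in> M)"

definition colon :: "'a::comm_ring_1 set \<Rightarrow> 'a \<Rightarrow> 'a set" where
  "colon I f = {g. f * g \<in> I}"

lemma mem_colon: "g \<in> colon I f \<longleftrightarrow> f * g \<in> I"
  by (simp add: colon_def)

lemma ideal_colon:
  assumes I: "idl.subspace I" shows "idl.subspace (colon I f)"
proof (rule idl.subspaceI)
  show "c * x \<in> colon I f" if "x \<in> colon I f" for c x
    using ideal_mult_left[OF I, of "f * x" c] that unfolding mem_colon by (metis mult.left_commute)
qed (use I in \<open>auto simp: colon_def distrib_left idl.subspace_0 idl.subspace_add\<close>)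

lemma colon_superset: "idl.subspace I \<Longrightarrow> I \<subseteq> colon I f"
  by (auto simp: colon_def ideal_mult_left)

lemma radical_colon:
  assumes "radical_ideal I" shows "radical_ideal (colon I f)"
  unfolding radical_ideal_def
proof (intro conjI allI impI)
  have I: "idl.subspace I" using assms by (simp add: radical_ideal_def)
  then show "idl.subspace (colon I f)" by (rule ideal_colon)
  fix g k assume g: "g ^ k \<in> colon I f"
  have "f ^ k * g * (f * g ^ k) \<in> I"
    using g by (rule_tac ideal_mult_left[OF I]) (simp add: mem_colon)
  also have "f ^ k * g * (f * g ^ k) = (f * g) ^ Suc k"
    by (simp only: power_mult_distrib power_Suc power_Suc2 mult_ac)
  finally have "(f * g) ^ Suc k \<in> I" .
  then show "g \<in> colon I f" using assms unfolding radical_ideal_def colon_def by blast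
qed

definition subring_set :: "'a::comm_ring_1 set \<Rightarrow> bool" where
  "subring_set B \<longleftrightarrow> 1 \<in> B \<and> (\<forall>a\<in>B. \<forall>b\<in>B. a - b \<in> B \<and> a * b \<in> B)"

lemma subring_one: "subring_set B \<Longrightarrow> 1 \<in> B"
  and subring_diff: "subring_set B \<Longrightarrow> a \<in> B \<Longrightarrow> b \<in> B \<Longrightarrow> a - b \<in> B"
  and subring_mult: "subring_set B \<Longrightarrow> a \<in> B \<Longrightarrow> b \<in> B \<Longrightarrow> a * b \<in> B"
  by (auto simp: subring_set_def)

lemma subring_zero: "subring_set B \<Longrightarrow> 0 \<in> B"
  using subring_diff[of B 1 1] subring_one by force

lemma subring_minus: "subring_set B \<Longrightarrow> a \<in> B \<Longrightarrow> - a \<in> B"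
  using subring_diff[of B 0 a] subring_zero by force

lemma subring_add: "subring_set B \<Longrightarrow> a \<in> B \<Longrightarrow> b \<in> B \<Longrightarrow> a + b \<in> B"
  using subring_diff[of B a "- b"] subring_minus by force

lemma subring_sum: "subring_set B \<Longrightarrow> (\<And>i. i \<in> A \<Longrightarrow> f i \<in> B) \<Longrightarrow> sum f A \<in> B"
  by (induction A rule: infinite_finite_induct) (auto simp: subring_zero subring_add)

lemma subring_power: "subring_set B \<Longrightarrow> a \<in> B \<Longrightarrow> a ^ n \<in> B"
  by (induction n) (auto simp: subring_one subring_mult)

lemma subring_of_nat: "subring_set B \<Longrightarrow> of_nat n \<in> B"
  by (induction n) (auto simp: subring_zero subring_add subring_one)

lemmas subring_closed = subring_zero subring_one subring_add subring_diff subring_minus subring_mult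
  subring_sum subring_power subring_of_nat

lemma ideal_chain_Union:
  assumes "subset.chain \<A> \<C>" "\<C> \<noteq> {}" "\<And>J. J \<in> \<A> \<Longrightarrow> idl.subspace J"
  shows "idl.subspace (\<Union>\<C>)"
proof (rule idl.subspaceI)
  have sub: "idl.subspace J" if "J \<in> \<C>" for J
    using that assms(1,3) unfolding subset.chain_def by blast
  show "0 \<in> \<Union>\<C>" using assms(2) sub idl.subspace_0 by blast
  show "x + y \<in> \<Union>\<C>" if xy: "x \<in> \<Union>\<C>" "y \<in> \<Union>\<C>" for x y
  proof -
    obtain J K where JK: "J \<in> \<C>" "K \<in> \<C>" "x \<in> J" "y \<in> K" using xy by blast
    then have "J \<subseteq> K \<or> K \<subseteq> J" using assms(1) unfolding subset_chain_def by blast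
    with JK sub show ?thesis by (meson Union_iff idl.subspace_add subsetD)
  qed
  show "c * x \<in> \<Union>\<C>" if "x \<in> \<Union>\<C>" for c x
    using that sub ideal_mult_left by (metis Union_iff)
qed

text \<open>An ideal that is maximal among those disjoint from a multiplicative set is prime; the
  predicate \<open>Q\<close> allows the search to be confined to a class of ideals, such as the homogeneous ones.\<close>

lemma maximal_avoiding_ideal:
  assumes "Q J" "J \<inter> E = {}"
    and Q: "\<And>J. Q J \<Longrightarrow> idl.subspace J"
    and Un: "\<And>\<C>. \<C> \<noteq> {} \<Longrightarrow> subset.chain (Collect Q) \<C> \<Longrightarrow> Q (\<Union>\<C>)"
  obtains M where "J \<subseteq> M" "Q M" "M \<inter> E = {}"
    "\<And>N. Q N \<Longrightarrow> M \<subset> N \<Longrightarrow> N \<inter> E \<noteq> {}"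
proof -
  define \<A> where "\<A> = {N. Q N \<and> J \<subseteq> N \<and> N \<inter> E = {}}"
  have "\<exists>M\<in>\<A>. \<forall>N\<in>\<A>. M \<subseteq> N \<longrightarrow> N = M"
  proof (rule subset_Zorn_nonempty)
    show "\<A> \<noteq> {}" using assms unfolding \<A>_def by blast
    fix \<C> assume C: "\<C> \<noteq> {}" "subset.chain \<A> \<C>"
    then have "subset.chain (Collect Q) \<C>" unfolding subset.chain_def \<A>_def by blast
    with Un C(1) have "Q (\<Union>\<C>)" by blast
    then show "\<Union>\<C> \<in> \<A>" using C unfolding subset.chain_def \<A>_def by blast
  qed
  then obtain M where M: "M \<in> \<A>" "\<And>N. N \<in> \<A> \<Longrightarrow> M \<subseteq> N \<Longrightarrow> N = M" by blast
  show ?thesis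
  proof (rule that[of M])
    show "N \<inter> E \<noteq> {}" if "Q N" "M \<subset> N" for N
      using M that unfolding \<A>_def by blast
  qed (use M in \<open>auto simp: \<A>_def\<close>)
qed

lemma maximal_ideal_prime:
  fixes J :: "'a::comm_ring_1 set"
  assumes J: "idl.subspace J" "1 \<notin> J"
  obtains M where "J \<subseteq> M" "prime_ideal M"
proof -
  obtain M where M: "J \<subseteq> M" "idl.subspace M" "M \<inter> {1} = {}"
    "\<And>N. idl.subspace N \<Longrightarrow> M \<subset> N \<Longrightarrow> N \<inter> {1} \<noteq> {}"
  proof (rule maximal_avoiding_ideal[of idl.subspace J "{1}"])
    show "idl.subspace (\<Union>\<C>)" if "\<C> \<noteq> {}" "subset.chain (Collect idl.subspace) \<C>"
      for \<C> :: "'a set set"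
      using ideal_chain_Union[OF that(2,1)] by simp
  qed (use J in auto)
  have "f \<in> M \<or> g \<in> M" if fg: "f * g \<in> M" for f g
  proof (rule ccontr)
    assume neg: "\<not> (f \<in> M \<or> g \<in> M)"
    have "1 \<in> idl.span (insert h M)" if "h \<notin> M" for h
    proof -
      have "M \<subset> idl.span (insert h M)" using that idl.span_superset[of "insert h M"] by blast
      then show ?thesis using M(4) by fastforce
    qed
    then obtain a b where "1 - a * f \<in> M" "1 - b * g \<in> M"
      using neg mem_span_insert_ideal[OF M(2)] by blast
    then have "(1 - a * f) * (b * g) + (1 - b * g) + (a * b) * (f * g) \<in> M"
      using fg ideal_mult_left[OF M(2) fg, of "a * b"] ideal_mult_right[OF M(2), of "1 - a * f" "b * g"]
      by (intro idl.subspace_add[OF M(2)]) simp_all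
    then have "1 \<in> M" by (simp add: algebra_simps)
    then show False using M(3) by blast
  qed
  then show ?thesis using that M unfolding prime_ideal_def by blast
qed


section \<open>Modules of finite type over a subring, modulo an ideal\<close>

definition module_finite :: "'a::comm_ring_1 set \<Rightarrow> 'a set \<Rightarrow> bool" where
  "module_finite B I \<longleftrightarrow> (\<exists>(n::nat) u. \<forall>f. \<exists>c. (\<forall>i<n. c i \<in> B) \<and> f - (\<Sum>i<n. c i * u i) \<in> I)"

lemma module_finite_mono:
  assumes "module_finite B I" "I \<subseteq> J" shows "module_finite B J"
  using assms unfolding module_finite_def by (meson subsetD)

text \<open>Fewer linear equations than unknowns over a domain: one unknown is eliminated without
  dividing.\<close>

lemma homogeneous_system_solvable:
  fixes c :: "'i \<Rightarrow> 'j \<Rightarrow> 'a::idom"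
  assumes B: "subring_set B" and "finite A" "finite D" "card A < card D"
    and "\<And>i j. i \<in> A \<Longrightarrow> j \<in> D \<Longrightarrow> c i j \<in> B"
  shows "\<exists>b. (\<forall>j\<in>D. b j \<in> B) \<and> (\<exists>j\<in>D. b j \<noteq> 0) \<and> (\<forall>i\<in>A. (\<Sum>j\<in>D. c i j * b j) = 0)"
  using assms(2-)
proof (induction A arbitrary: D c rule: finite_induct)
  case empty
  then have "D \<noteq> {}" by auto
  then show ?case using B by (intro exI[of _ "\<lambda>_. 1"]) (auto simp: subring_closed)
next
  case (insert r A)
  show ?case
  proof (cases "\<forall>j\<in>D. c r j = 0")
    case True
    have "\<exists>b. (\<forall>j\<in>D. b j \<in> B) \<and> (\<exists>j\<in>D. b j \<noteq> 0) \<and> (\<forall>i\<in>A. (\<Sum>j\<in>D. c i j * b j) = 0)"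
      by (rule insert.IH) (use insert in auto)
    with True show ?thesis by auto
  next
    case False
    then obtain p where p: "p \<in> D" "c r p \<noteq> 0" by blast
    define D' where "D' = D - {p}"
    have D: "D = insert p D'" "p \<notin> D'" "finite D'" using p insert.prems by (auto simp: D'_def)
    define c' where "c' i j = c r p * c i j - c r j * c i p" for i j
    have "\<exists>b. (\<forall>j\<in>D'. b j \<in> B) \<and> (\<exists>j\<in>D'. b j \<noteq> 0) \<and> (\<forall>i\<in>A. (\<Sum>j\<in>D'. c' i j * b j) = 0)"
    proof (rule insert.IH)
      show "card A < card D'" using insert.prems insert.hyps D by simp
    qed (use insert.prems D B p in \<open>auto simp: c'_def intro!: subring_closed\<close>)
    then obtain b where b: "\<forall>j\<in>D'. b j \<in> B" "\<exists>j\<in>D'. b j \<noteq> 0"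
      "\<forall>i\<in>A. (\<Sum>j\<in>D'. c' i j * b j) = 0" by blast
    define b' where "b' j = (if j = p then - (\<Sum>j\<in>D'. c r j * b j) else c r p * b j)" for j
    have sum: "(\<Sum>j\<in>D. c i j * b' j) = (\<Sum>j\<in>D'. c' i j * b j)" for i
    proof -
      have "(\<Sum>j\<in>D'. c i j * b' j) = (\<Sum>j\<in>D'. c i j * (c r p * b j))"
        using D by (intro sum.cong) (auto simp: b'_def)
      moreover have "c i p * b' p = - (\<Sum>j\<in>D'. c i p * (c r j * b j))"
        by (simp add: b'_def sum_distrib_left)
      ultimately show ?thesis
        using D by (simp add: c'_def sum_subtractf algebra_simps)
    qed
    have "(\<Sum>j\<in>D. c r j * b' j) = 0" unfolding sum by (simp add: c'_def)
    moreover have "\<forall>j\<in>D. b' j \<in> B"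
      using b(1) p insert.prems D B unfolding b'_def by (auto intro!: subring_closed)
    moreover have "\<exists>j\<in>D. b' j \<noteq> 0" using b(2) p D unfolding b'_def by auto
    ultimately show ?thesis using sum b(3) by (intro exI[of _ b']) auto
  qed
qed

definition poly_over :: "'a::comm_ring_1 set \<Rightarrow> 'a poly \<Rightarrow> bool" where
  "poly_over B p \<longleftrightarrow> (\<forall>i. coeff p i \<in> B)"

lemma poly_over_0: "subring_set B \<Longrightarrow> poly_over B 0"
  and poly_over_add: "subring_set B \<Longrightarrow> poly_over B p \<Longrightarrow> poly_over B q \<Longrightarrow> poly_over B (p + q)"
  and poly_over_diff: "subring_set B \<Longrightarrow> poly_over B p \<Longrightarrow> poly_over B q \<Longrightarrow> poly_over B (p - q)"
  and poly_over_smult: "subring_set B \<Longrightarrow> c \<in> B \<Longrightarrow> poly_over B p \<Longrightarrow> poly_over B (smult c p)"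
  and poly_over_monom: "subring_set B \<Longrightarrow> c \<in> B \<Longrightarrow> poly_over B (monom c n)"
  and poly_over_pCons: "subring_set B \<Longrightarrow> c \<in> B \<Longrightarrow> poly_over B p \<Longrightarrow> poly_over B (pCons c p)"
  by (auto simp: poly_over_def subring_closed coeff_monom coeff_pCons split: nat.splits)

lemma poly_over_pderiv: "subring_set B \<Longrightarrow> poly_over B p \<Longrightarrow> poly_over B (pderiv p)"
  by (auto simp: poly_over_def coeff_pderiv subring_mult subring_of_nat[of B "Suc _"] simp del: of_nat_Suc)

lemma poly_over_mult: "subring_set B \<Longrightarrow> poly_over B p \<Longrightarrow> poly_over B q \<Longrightarrow> poly_over B (p * q)"
  by (auto simp: poly_over_def coeff_mult intro!: subring_closed)

lemma poly_over_one: "subring_set B \<Longrightarrow> poly_over B 1"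
  by (auto simp: poly_over_def coeff_1 subring_closed)

lemma poly_over_power: "subring_set B \<Longrightarrow> poly_over B p \<Longrightarrow> poly_over B (p ^ n)"
  by (induction n) (auto simp: poly_over_one poly_over_mult)

lemmas poly_over_closed = poly_over_0 poly_over_one poly_over_add poly_over_diff poly_over_smult
  poly_over_monom poly_over_pCons poly_over_mult poly_over_power

text \<open>The powers \<open>f\<^sup>0, \<dots>, f\<^sup>n\<close> have coordinates in \<open>n\<close> generators, and \<open>n\<close> linear equations in
  \<open>n + 1\<close> unknowns have a nonzero solution in \<open>B\<close>. The relation need not be monic, so no determinants
  are involved.\<close>

lemma algebraic_over:
  fixes f :: "'a::idom"
  assumes B: "subring_set B" and I: "idl.subspace I" and finite_over: "module_finite B I"
  obtains p where "p \<noteq> 0" "poly_over B p" "poly p f \<in> I"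
proof -
  obtain n :: nat and u where nu: "\<And>f. \<exists>c. (\<forall>i<n. c i \<in> B) \<and> f - (\<Sum>i<n. c i * u i) \<in> I"
    using finite_over unfolding module_finite_def by blast
  then have "\<exists>c. (\<forall>i<n. c i \<in> B) \<and> f ^ j - (\<Sum>i<n. c i * u i) \<in> I" for j by blast
  then obtain c where c: "\<And>i j. i < n \<Longrightarrow> c j i \<in> B" "\<And>j. f ^ j - (\<Sum>i<n. c j i * u i) \<in> I"
    by metis
  have "\<exists>b. (\<forall>j\<in>{..n}. b j \<in> B) \<and> (\<exists>j\<in>{..n}. b j \<noteq> 0) \<and> (\<forall>i\<in>{..<n}. (\<Sum>j\<in>{..n}. c j i * b j) = 0)"
    by (rule homogeneous_system_solvable[OF B]) (use c in auto)
  then obtain b where b: "\<And>j. j \<le> n \<Longrightarrow> b j \<in> B" "\<exists>j\<le>n. b j \<noteq> 0"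
    "\<And>i. i < n \<Longrightarrow> (\<Sum>j\<le>n. c j i * b j) = 0" by auto
  define p where "p = (\<Sum>j\<le>n. monom (b j) j)"
  have coeff: "coeff p i = (if i \<le> n then b i else 0)" for i
    by (simp add: p_def coeff_sum coeff_monom if_distrib sum.delta cong: if_cong)
  show ?thesis
  proof
    show "p \<noteq> 0" using b(2) coeff by (metis coeff_0)
    show "poly_over B p" using b(1) B by (auto simp: poly_over_def coeff subring_closed)
    have "(\<Sum>j\<le>n. b j * (\<Sum>i<n. c j i * u i)) = (\<Sum>i<n. (\<Sum>j\<le>n. c j i * b j) * u i)"
      by (simp add: sum_distrib_left sum_distrib_right sum.swap[of _ "{..<n}"] mult_ac)
    also have "\<dots> = 0" using b(3) by simp
    finally have "poly p f = (\<Sum>j\<le>n. b j * (f ^ j - (\<Sum>i<n. c j i * u i)))"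
      by (simp add: p_def poly_sum poly_monom right_diff_distrib sum_subtractf)
    also have "\<dots> \<in> I" by (intro idl.subspace_sum[OF I] ideal_mult_left[OF I] c(2))
    finally show "poly p f \<in> I" .
  qed
qed

text \<open>If \<open>f\<close> is a nonzerodivisor modulo \<open>I\<close>, a polynomial relation for \<open>f\<close> over \<open>B\<close> can be divided
  by powers of \<open>f\<close> until its constant term is nonzero. That term is an element of \<open>B\<close> in the ideal
  generated by \<open>f\<close> and \<open>I\<close>.\<close>

lemma nonzerodivisor_contraction:
  fixes f :: "'a::idom"
  assumes B: "subring_set B" and I: "idl.subspace I" and finite_over: "module_finite B I"
    and nzd: "\<And>g. f * g \<in> I \<Longrightarrow> g \<in> I"
  obtains b r where "b \<in> B" "b \<noteq> 0" "b - r * f \<in> I"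
proof -
  define P where "P p \<longleftrightarrow> p \<noteq> 0 \<and> poly_over B p \<and> poly p f \<in> I" for p
  have "\<exists>p. P p" using algebraic_over[OF B I finite_over, of f] unfolding P_def by blast
  then obtain p where p: "P p" "\<And>q. P q \<Longrightarrow> degree p \<le> degree q"
    by (metis arg_min_natI arg_min_nat_le)
  obtain a q where aq: "p = pCons a q" by (cases p) auto
  have q: "poly_over B q" using p(1) aq unfolding P_def poly_over_def
    by (metis coeff_pCons_Suc)
  have "a \<noteq> 0"
  proof
    assume "a = 0"
    then have "f * poly q f \<in> I" "q \<noteq> 0" using p(1) aq unfolding P_def by auto
    then have "P q" using nzd q unfolding P_def by blast
    from p(2)[OF this] \<open>q \<noteq> 0\<close> show False by (simp add: aq)
  qed
  moreover have "a \<in> B" using p(1) aq unfolding P_def poly_over_def by (metis coeff_pCons_0)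
  moreover have "a - (- poly q f) * f \<in> I" using p(1) aq unfolding P_def by (simp add: mult.commute)
  ultimately show ?thesis using that by blast
qed

text \<open>A form of Nakayama's lemma: if the quotient by \<open>J\<close> equals its multiple by the ideal \<open>\<aa>\<close> of
  \<open>B\<close>, it is killed by an element of \<open>1 + \<aa>\<close>. The generators are removed one after the other.\<close>

lemma nakayama:
  fixes J :: "'a::comm_ring_1 set"
  assumes B: "subring_set B" and J: "idl.subspace J" and finite_over: "module_finite B J"
    and aa: "\<aa> \<subseteq> B" "0 \<in> \<aa>" "\<And>a b. a \<in> \<aa> \<Longrightarrow> b \<in> \<aa> \<Longrightarrow> a + b \<in> \<aa>" "\<And>a b. a \<in> \<aa> \<Longrightarrow> b \<in> B \<Longrightarrow> b * a \<in> \<aa>"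
    and one: "1 \<in> idl.span (\<aa> \<union> J)"
  obtains a where "a \<in> \<aa>" "1 - a \<in> J"
proof -
  obtain n :: nat and u where nu: "\<And>f. \<exists>c. (\<forall>i<n. c i \<in> B) \<and> f - (\<Sum>i<n. c i * u i) \<in> J"
    using finite_over unfolding module_finite_def by blast
  define M where "M m = {f. \<exists>c. (\<forall>i. c i \<in> \<aa>) \<and> f - (\<Sum>i\<in>{m..<n}. c i * u i) \<in> J}" for m
  have MI: "f \<in> M m" if "\<And>i. c i \<in> \<aa>" "f - (\<Sum>i\<in>{m..<n}. c i * u i) \<in> J" for f m c
    using that unfolding M_def by blast
  have addM: "f + g \<in> M m" if fM: "f \<in> M m" and gM: "g \<in> M m" for f g m
  proof -
    from fM obtain c where c: "\<And>i. c i \<in> \<aa>" "f - (\<Sum>i\<in>{m..<n}. c i * u i) \<in> J" unfolding M_def by blast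
    from gM obtain d where d: "\<And>i. d i \<in> \<aa>" "g - (\<Sum>i\<in>{m..<n}. d i * u i) \<in> J" unfolding M_def by blast
    have "f + g - (\<Sum>i\<in>{m..<n}. (c i + d i) * u i) \<in> J"
      using idl.subspace_add[OF J c(2) d(2)] by (simp add: algebra_simps sum.distrib)
    then show ?thesis using c(1) d(1) aa(3) by (intro MI[of "\<lambda>i. c i + d i"]) auto
  qed
  have scaleM: "b * f \<in> M m" if b: "b \<in> B" and fM: "f \<in> M m" for b f m
  proof -
    from fM obtain c where c: "\<And>i. c i \<in> \<aa>" "f - (\<Sum>i\<in>{m..<n}. c i * u i) \<in> J" unfolding M_def by blast
    have "b * f - (\<Sum>i\<in>{m..<n}. (b * c i) * u i) \<in> J"
      using ideal_mult_left[OF J c(2), of b] by (simp add: algebra_simps sum_distrib_left)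
    then show ?thesis using c(1) b aa(4) by (intro MI[of "\<lambda>i. b * c i"]) auto
  qed
  have JM: "J \<subseteq> M m" for m using aa(2) by (auto intro!: MI[of "\<lambda>_. 0"])
  have base: "f \<in> M 0" if "f \<in> idl.span (\<aa> \<union> J)" for f
    using that
  proof (induction rule: idl.span_induct_alt)
    case base
    show ?case using JM J idl.subspace_0 by blast
  next
    case (step r x y)
    have "r * x \<in> M 0"
    proof (cases "x \<in> J")
      case True
      then show ?thesis using JM J ideal_mult_left by blast
    next
      case False
      with step have x: "x \<in> \<aa>" by blast
      obtain c where c: "\<And>i. i < n \<Longrightarrow> c i \<in> B" "r - (\<Sum>i<n. c i * u i) \<in> J" using nu by blast
      define c' where "c' i = (if i < n then c i * x else 0)" for i
      have "(\<Sum>i\<in>{0..<n}. c' i * u i) = x * (\<Sum>i<n. c i * u i)"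
        by (simp add: c'_def sum_distrib_left lessThan_atLeast0 mult_ac)
      then have "r * x - (\<Sum>i\<in>{0..<n}. c' i * u i) \<in> J"
        using ideal_mult_left[OF J c(2), of x] by (simp add: algebra_simps)
      then show ?thesis using c(1) x aa by (intro MI[of c']) (auto simp: c'_def)
    qed
    with step show ?case using addM by blast
  qed
  have all: "f \<in> M 0" for f
  proof -
    have "f * 1 \<in> idl.span (\<aa> \<union> J)" using one by (rule idl.span_scale)
    then show ?thesis using base by simp
  qed
  have "\<exists>a\<in>\<aa>. \<forall>f. (1 - a) * f \<in> M m" if "m \<le> n" for m
    using that
  proof (induction m)
    case 0
    show ?case using all aa(2) by (auto intro!: bexI[of _ 0])
  next
    case (Suc m)
    then obtain a where a: "a \<in> \<aa>" "\<And>f. (1 - a) * f \<in> M m" by auto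
    have split: "\<exists>c\<in>\<aa>. f - c * u m \<in> M (Suc m)" if "f \<in> M m" for f
    proof -
      obtain c where c: "\<And>i. c i \<in> \<aa>" "f - (\<Sum>i\<in>{m..<n}. c i * u i) \<in> J"
        using \<open>f \<in> M m\<close> unfolding M_def by blast
      have "f - c m * u m \<in> M (Suc m)"
      proof (rule MI)
        show "f - c m * u m - (\<Sum>i\<in>{Suc m..<n}. c i * u i) \<in> J"
          using c(2) Suc.prems by (simp add: sum.atLeast_Suc_lessThan algebra_simps)
      qed (use c in auto)
      then show ?thesis using c(1) by blast
    qed
    obtain d where d: "d \<in> \<aa>" "(1 - a) * u m - d * u m \<in> M (Suc m)"
      using split[OF a(2)] by blast
    define a' where "a' = a + (1 - a) * (a + d)"
    have "a + d \<in> \<aa>" using a d aa by blast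
    have aB: "1 - a \<in> B" and abB: "1 - a - d \<in> B" using a d aa B by (auto intro!: subring_closed)
    have prod: "1 - a' = (1 - a - d) * (1 - a)" by (simp add: a'_def algebra_simps)
    have "a' \<in> \<aa>"
      unfolding a'_def by (rule aa(3)[OF a(1) aa(4)[OF \<open>a + d \<in> \<aa>\<close> aB]])
    moreover have "(1 - a') * f \<in> M (Suc m)" for f
    proof -
      obtain c where c: "c \<in> \<aa>" "(1 - a) * f - c * u m \<in> M (Suc m)" using split[OF a(2)] by blast
      have "(1 - a - d) * ((1 - a) * f - c * u m) + c * ((1 - a) * u m - d * u m) \<in> M (Suc m)"
        using c d(2) abB aa(1) by (intro addM scaleM) auto
      also have "(1 - a - d) * ((1 - a) * f - c * u m) + c * ((1 - a) * u m - d * u m) = (1 - a') * f"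
        unfolding prod by (simp add: algebra_simps)
      finally show ?thesis .
    qed
    ultimately show ?case by blast
  qed
  from this[of n] obtain a where a: "a \<in> \<aa>" "\<And>f. (1 - a) * f \<in> M n" by auto
  from a(2)[of 1] have "1 - a \<in> J" by (auto simp: M_def)
  with a(1) that show ?thesis by blast
qed


section \<open>Separability in characteristic zero\<close>

lemma pseudo_division_over:
  fixes p q :: "'a::idom poly"
  assumes B: "subring_set B" and q: "poly_over B q" "q \<noteq> 0" and p: "poly_over B p"
  shows "\<exists>c Q r. c \<in> B \<and> c \<noteq> 0 \<and> poly_over B Q \<and> poly_over B r \<and> smult c p = Q * q + r \<and>
    (r = 0 \<or> degree r < degree q) \<and> (lead_coeff q = 1 \<longrightarrow> c = 1)"
  using p
proof (induction "degree p" arbitrary: p rule: less_induct)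
  case less
  show ?case
  proof (cases "p = 0 \<or> degree p < degree q")
    case True
    then show ?thesis using less.prems B
      by (intro exI[of _ 1] exI[of _ 0] exI[of _ p]) (auto simp: subring_closed poly_over_closed)
  next
    case False
    define l where "l = lead_coeff q"
    have l: "l \<in> B" "l \<noteq> 0" using q unfolding l_def poly_over_def by auto
    define m where "m = monom (lead_coeff p) (degree p - degree q)"
    have m: "poly_over B m" unfolding m_def using less.prems B
      by (intro poly_over_closed) (auto simp: poly_over_def)
    have deg_m: "degree (m * q) = degree p"
      unfolding m_def using False q(2) by (subst degree_mult_eq) (auto simp: monom_eq_0_iff degree_monom_eq)
    define p2 where "p2 = smult l p - m * q"
    have over: "poly_over B p2" unfolding p2_def
      using less.prems B m q l by (intro poly_over_closed) auto
    have "coeff (m * q) (degree p) = lead_coeff m * lead_coeff q"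
      using deg_m lead_coeff_mult[of m q] by simp
    then have "coeff p2 (degree p) = 0"
      unfolding p2_def using False by (simp add: m_def l_def degree_monom_eq)
    moreover have "degree p2 \<le> degree p"
      unfolding p2_def using deg_m by (intro degree_diff_le) auto
    ultimately have lt: "p2 = 0 \<or> degree p2 < degree p"
      by (metis le_neq_implies_less leading_coeff_0_iff)
    have "\<exists>c Q r. c \<in> B \<and> c \<noteq> 0 \<and> poly_over B Q \<and> poly_over B r \<and> smult c p2 = Q * q + r \<and>
        (r = 0 \<or> degree r < degree q) \<and> (lead_coeff q = 1 \<longrightarrow> c = 1)"
    proof (cases "p2 = 0")
      case True
      then show ?thesis using B
        by (intro exI[of _ 1] exI[of _ 0]) (auto simp: subring_closed poly_over_closed)
    next
      case False
      then show ?thesis using lt over less.hyps by blast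
    qed
    then obtain c Q r where IH: "c \<in> B" "c \<noteq> 0" "poly_over B Q" "poly_over B r"
      "smult c p2 = Q * q + r" "r = 0 \<or> degree r < degree q" "lead_coeff q = 1 \<longrightarrow> c = 1" by blast
    have "smult (c * l) p = (Q + smult c m) * q + r"
      using IH(5) unfolding p2_def by (simp add: algebra_simps smult_diff_right)
    moreover have "poly_over B (Q + smult c m)" using IH m B by (intro poly_over_closed) auto
    moreover have "c * l \<in> B" "c * l \<noteq> 0" using IH l B by (auto intro: subring_closed)
    ultimately show ?thesis using IH l_def by (intro exI[of _ "c * l"] exI[of _ "Q + smult c m"] exI[of _ r]) auto
  qed
qed

text \<open>Over the fraction field of \<open>B\<close> the quotient by \<open>I\<close> would be a finite reduced algebra, so in
  characteristic zero the minimal polynomial \<open>p\<close> of \<open>z\<close> would be separable and \<open>p'(z)\<close> a unit. The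
  proof clears denominators throughout. If \<open>p'(z)\<close> were a zerodivisor, choose \<open>h\<close> killed by it
  such that the minimal polynomial \<open>q\<close> of \<open>z\<close> on the module generated by \<open>h\<close> has least degree. Then
  \<open>q\<close> is a double factor of \<open>p\<close>, which is impossible since \<open>I\<close> is radical.\<close>

lemma separable_relation:
  fixes I :: "'a::{idom,ring_char_0} set"
  assumes B: "subring_set B" and rad: "radical_ideal I" and finite_over: "module_finite B I"
    and one: "1 \<notin> I" and tf: "\<And>b f. b \<in> B \<Longrightarrow> b \<noteq> 0 \<Longrightarrow> b * f \<in> I \<Longrightarrow> f \<in> I"
  obtains p b r where "p \<noteq> 0" "poly_over B p" "poly p z \<in> I"
    "b \<in> B" "b \<noteq> 0" "b - r * poly (pderiv p) z \<in> I"
proof -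
  have I: "idl.subspace I" using rad by (simp add: radical_ideal_def)
  define ann where "ann h q \<longleftrightarrow> q \<noteq> 0 \<and> poly_over B q \<and> poly q z * h \<in> I" for h q
  have degree_pos: "degree q > 0" if "ann h q" "h \<notin> I" for h q
  proof (rule ccontr)
    assume "\<not> degree q > 0"
    then obtain c where c: "q = [:c:]" using degree_eq_zeroE by blast
    with that(1) have "c \<in> B" "c \<noteq> 0" "c * h \<in> I"
      unfolding ann_def poly_over_def by (auto dest: spec[of _ 0])
    then show False using tf that(2) by blast
  qed
  obtain p where p: "ann 1 p" "\<And>q. ann 1 q \<Longrightarrow> degree p \<le> degree q"
  proof -
    obtain q0 where "q0 \<noteq> 0" "poly_over B q0" "poly q0 z \<in> I"
      using algebraic_over[OF B I finite_over, of z] by blast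
    then have "ann 1 q0" unfolding ann_def by auto
    then show ?thesis by (metis arg_min_natI arg_min_nat_le that)
  qed
  have p': "p \<noteq> 0" "poly_over B p" "poly p z \<in> I" using p(1) unfolding ann_def by auto
  have deg_p: "degree p > 0" using degree_pos[OF p(1)] one by blast
  define g where "g = poly (pderiv p) z"
  have nzd: "h \<in> I" if gh: "g * h \<in> I" for h
  proof (rule ccontr)
    assume "h \<notin> I"
    define Z where "Z = {(h, q). h \<notin> I \<and> g * h \<in> I \<and> ann h q}"
    have "poly p z * h \<in> I" using p'(3) I by (rule_tac ideal_mult_right)
    then have "(h, p) \<in> Z" using \<open>h \<notin> I\<close> gh p' unfolding Z_def ann_def by blast
    then obtain h q where hq: "(h, q) \<in> Z" "\<And>h' q'. (h', q') \<in> Z \<Longrightarrow> degree q \<le> degree q'"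
      using ex_has_least_nat[of "\<lambda>x. x \<in> Z" "(h, p)" "\<lambda>x. degree (snd x)"] by fastforce
    have h: "h \<notin> I" "g * h \<in> I" and q: "ann h q" using hq(1) unfolding Z_def by auto
    have q': "q \<noteq> 0" "poly_over B q" "poly q z * h \<in> I" using q unfolding ann_def by auto
    have deg_q: "degree q > 0" using degree_pos[OF q h(1)] .
    have divides: "\<exists>c Q. c \<in> B \<and> c \<noteq> 0 \<and> poly_over B Q \<and> smult c f = Q * q"
      if f: "poly_over B f" "poly f z * h' \<in> I" and h': "h' \<notin> I" "g * h' \<in> I" "poly q z * h' \<in> I"
      for f h'
    proof -
      obtain c Q r where div: "c \<in> B" "c \<noteq> 0" "poly_over B Q" "poly_over B r"
        "smult c f = Q * q + r" "r = 0 \<or> degree r < degree q"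
        using pseudo_division_over[OF B q'(2,1) f(1)] by blast
      have "r = 0"
      proof (rule ccontr)
        assume "r \<noteq> 0"
        have "r = smult c f - Q * q" using div(5) by simp
        then have "poly r z = c * poly f z - poly Q z * poly q z" by simp
        then have "poly r z * h' = c * (poly f z * h') - poly Q z * (poly q z * h')"
          by (simp only: left_diff_distrib mult.assoc)
        then have "poly r z * h' \<in> I"
          using idl.subspace_diff[OF I ideal_mult_left[OF I f(2)] ideal_mult_left[OF I h'(3)]] by simp
        then have "(h', r) \<in> Z" using \<open>r \<noteq> 0\<close> div h' unfolding Z_def ann_def by blast
        then show False using hq(2) div(6) \<open>r \<noteq> 0\<close> by fastforce
      qed
      then show ?thesis using div by auto
    qed
    have "poly p z * h \<in> I" using p'(3) I by (rule_tac ideal_mult_right)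
    then obtain c Q where cQ: "c \<in> B" "c \<noteq> 0" "poly_over B Q" "smult c p = Q * q"
      using divides[of p h] p' h q' by blast
    define h2 where "h2 = poly (pderiv q) z * h"
    have dq: "pderiv q \<noteq> 0" "degree (pderiv q) < degree q"
      using deg_q by (auto simp: pderiv_eq_0_iff degree_pderiv)
    have h2: "h2 \<notin> I"
    proof
      assume "h2 \<in> I"
      then have "(h, pderiv q) \<in> Z"
        using dq h poly_over_pderiv[OF B q'(2)] unfolding h2_def Z_def ann_def by blast
      then show False using hq(2) dq(2) by fastforce
    qed
    have "g * h2 \<in> I" "poly q z * h2 \<in> I"
      using ideal_mult_left[OF I h(2), of "poly (pderiv q) z"] ideal_mult_left[OF I q'(3), of "poly (pderiv q) z"]
      unfolding h2_def by (simp_all add: mult_ac)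
    moreover have "poly Q z * h2 \<in> I"
    proof -
      have "smult c (pderiv p) = pderiv Q * q + Q * pderiv q"
        using arg_cong[OF cQ(4), of pderiv] by (simp add: pderiv_smult pderiv_mult algebra_simps)
      then have "c * g = poly (pderiv Q) z * poly q z + poly Q z * poly (pderiv q) z"
        unfolding g_def by (metis poly_add poly_mult poly_smult)
      then have "poly Q z * poly (pderiv q) z = c * g - poly (pderiv Q) z * poly q z" by simp
      then have "poly Q z * h2 = (c * g - poly (pderiv Q) z * poly q z) * h"
        unfolding h2_def by (metis mult.assoc)
      then have "poly Q z * h2 = c * (g * h) - poly (pderiv Q) z * (poly q z * h)"
        by (simp add: algebra_simps)
      then show ?thesis
        using idl.subspace_diff[OF I ideal_mult_left[OF I h(2)] ideal_mult_left[OF I q'(3)]] by simp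
    qed
    ultimately obtain c2 Q2 where c2: "c2 \<in> B" "c2 \<noteq> 0" "poly_over B Q2" "smult c2 Q = Q2 * q"
      using divides[of Q h2] cQ h2 by blast
    have eq: "smult (c2 * c) p = Q2 * q * q"
      using cQ(4) c2(4) by (metis mult_smult_left smult_smult)
    have nz: "Q2 * q \<noteq> 0" using eq p' cQ c2 by auto
    have "poly (Q2 * q) z * poly (Q2 * q) z = poly Q2 z * (c2 * c * poly p z)"
      using arg_cong[OF eq, of "\<lambda>p. poly p z"] by (simp add: algebra_simps)
    also have "\<dots> \<in> I" by (intro ideal_mult_left[OF I] p'(3))
    finally have "poly (Q2 * q) z * poly (Q2 * q) z \<in> I" .
    then have "poly (Q2 * q) z \<in> I" using radical_idealD2[OF rad] by blast
    then have "ann 1 (Q2 * q)" using nz c2 q' B unfolding ann_def by (auto intro: poly_over_closed)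
    then have le: "degree p \<le> degree (Q2 * q)" by (rule p(2))
    have "degree p = degree (smult (c2 * c) p)" using c2 cQ by simp
    also have "\<dots> = degree (Q2 * q) + degree q" unfolding eq using nz q' by (subst degree_mult_eq) auto
    finally show False using le deg_q by simp
  qed
  obtain b r where "b \<in> B" "b \<noteq> 0" "b - r * g \<in> I"
    using nonzerodivisor_contraction[OF B I finite_over nzd] by blast
  then show ?thesis using that p' unfolding g_def by blast
qed

section \<open>Evaluation, homogeneous components and linear forms\<close>

abbreviation cst :: "'k::field \<Rightarrow> ('k, 'n) mpoly" where
  "cst c \<equiv> Poly_Mapping.single 0 c"

abbreviation var :: "'n \<Rightarrow> ('k::field, 'n) mpoly" where
  "var i \<equiv> Poly_Mapping.single (Poly_Mapping.single i 1) 1"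

lemma cst_add: "cst (a + b) = cst a + cst b"
  and cst_mult: "cst (a * b) = cst a * cst b"
  and cst_diff: "cst (a - b) = cst a - cst b"
  and cst_one: "cst 1 = 1"
  by (simp_all add: single_add mult_single single_diff)

lemma cst_inject: "cst a = (cst b :: ('k::field, 'n) mpoly) \<longleftrightarrow> a = b"
  by (metis lookup_single_eq)

lemma cst_inverse: "c \<noteq> 0 \<Longrightarrow> cst (inverse c) * (cst c * f) = (f :: ('k::field, 'n) mpoly)"
  by (simp add: mult_single flip: mult.assoc)

lemma ideal_cst_cancel:
  fixes f :: "('k::field, 'n) mpoly"
  assumes "idl.subspace I" "c \<noteq> 0" "cst c * f \<in> I" shows "f \<in> I"
  using ideal_mult_left[OF assms(1,3), of "cst (inverse c)"] by (simp only: cst_inverse[OF assms(2)])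

lemma eval_cst [simp]: "eval_poly (cst c) v = c"
  by (simp add: eval_poly_single)

lemma eval_var: "eval_poly (var i) v = v $ i"
proof -
  have "(\<Prod>j\<in>UNIV. (v $ j) ^ Poly_Mapping.lookup (Poly_Mapping.single i (1::nat)) j)
      = (\<Prod>j\<in>UNIV. if j = i then v $ i else 1)"
    by (rule prod.cong) (auto simp: lookup_single when_def)
  then show ?thesis by (simp add: eval_poly_single)
qed

declare eval_var [simp] eval_var [unfolded One_nat_def, simp]

lemma eval_poly_minus: "eval_poly (- f) v = - eval_poly f v"
  using eval_poly_add[of f "- f" v] by (simp add: eq_neg_iff_add_eq_0 add.commute)

lemma eval_poly_diff: "eval_poly (f - g) v = eval_poly f v - eval_poly g v"
  using eval_poly_add[of f "- g" v] by (simp add: eval_poly_minus)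

lemma eval_poly_sum: "eval_poly (sum f A) v = (\<Sum>i\<in>A. eval_poly (f i) v)"
  by (induction A rule: infinite_finite_induct) (auto simp: eval_poly_add)

lemma eval_poly_prod: "eval_poly (prod f A) v = (\<Prod>i\<in>A. eval_poly (f i) v)"
  by (induction A rule: infinite_finite_induct) (auto simp: eval_poly_mult)

lemma eval_poly_power: "eval_poly (f ^ n) v = eval_poly f v ^ n"
  by (induction n) (auto simp: eval_poly_mult)

lemma eval_poly_poly: "eval_poly (poly p f) v = (\<Sum>k\<le>degree p. eval_poly (coeff p k) v * eval_poly f v ^ k)"
  by (simp add: poly_altdef eval_poly_sum eval_poly_mult eval_poly_power)

lemmas eval_poly_simps = eval_poly_add eval_poly_mult eval_poly_minus eval_poly_diff eval_poly_sum
  eval_poly_prod eval_poly_power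

lemma monomial_eq_prod_var:
  fixes a :: "'n::finite \<Rightarrow>\<^sub>0 nat"
  shows "Poly_Mapping.single a (1::'k::field) = (\<Prod>i\<in>UNIV. var i ^ Poly_Mapping.lookup a i)"
proof -
  have pow: "(var i :: ('k, 'n) mpoly) ^ n = Poly_Mapping.single (Poly_Mapping.single i n) 1" for i n
    by (induction n) (auto simp: mult_single simp flip: single_add)
  have "(\<Prod>i\<in>A. Poly_Mapping.single (g i) (1::'k)) = Poly_Mapping.single (\<Sum>i\<in>A. g i) 1"
    if "finite A" for A :: "'n set" and g :: "'n \<Rightarrow> 'n \<Rightarrow>\<^sub>0 nat"
    using that by (induction A rule: finite_induct) (auto simp: mult_single)
  moreover have "(\<Sum>i\<in>UNIV. Poly_Mapping.single i (Poly_Mapping.lookup a i)) = a"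
    by (rule poly_mapping_eqI) (simp add: lookup_sum lookup_single when_def)
  ultimately show ?thesis by (simp only: pow finite)
qed

lemma mpoly_ring_induct [case_names cst var add mult]:
  fixes f :: "('k::field, 'n::finite) mpoly"
  assumes "\<And>c. P (cst c)" "\<And>i. P (var i)" "\<And>f g. P f \<Longrightarrow> P g \<Longrightarrow> P (f + g)" "\<And>f g. P f \<Longrightarrow> P g \<Longrightarrow> P (f * g)"
  shows "P f"
proof -
  have one: "P 1" using assms(1)[of 1] by simp
  have pow: "P (g ^ n)" if "P g" for g n
    by (induction n) (use one that assms(4) in auto)
  have prod: "P (prod g A)" if "\<And>i. P (g i)" for g and A :: "'n set"
    by (induction A rule: infinite_finite_induct) (use one that assms(4) in auto)
  have "P (Poly_Mapping.single a c)" for a :: "'n \<Rightarrow>\<^sub>0 nat" and c :: 'k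
  proof -
    have "P (cst c * (\<Prod>i\<in>UNIV. var i ^ Poly_Mapping.lookup a i))"
      by (rule assms(4)[OF assms(1) prod[OF pow[OF assms(2)]]])
    also have "cst c * (\<Prod>i\<in>UNIV. var i ^ Poly_Mapping.lookup a i) = Poly_Mapping.single a c"
      by (simp only: mult_single add_0_left mult_1_right flip: monomial_eq_prod_var)
    finally show ?thesis .
  qed
  then show ?thesis using assms(1)[of 0] assms(3) by (induction f rule: mpoly_induct) auto
qed

text \<open>Restricted to one variable, a vanishing polynomial function has vanishing coefficients, since the
  field is infinite; these coefficients are polynomial functions in fewer variables.\<close>

lemma monomials_independent:
  fixes c :: "('n \<Rightarrow> nat) \<Rightarrow> 'k::{field, ring_char_0}"
  assumes "finite V" "finite A" "inj_on (\<lambda>a. restrict a V) A"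
    and "\<And>v. (\<Sum>a\<in>A. c a * (\<Prod>i\<in>V. v i ^ a i)) = 0" and "a \<in> A"
  shows "c a = 0"
  using assms
proof (induction V arbitrary: A a rule: finite_induct)
  case empty
  have "A = {a}" using empty by (auto simp: inj_on_def)
  with empty(3) show ?case by simp
next
  case (insert j V)
  define A' where "A' = {b\<in>A. b j = a j}"
  show ?case
  proof (rule insert.IH[of A' a])
    show "inj_on (\<lambda>a. restrict a V) A'"
    proof (rule inj_onI)
      fix b b' assume b: "b \<in> A'" "b' \<in> A'" "restrict b V = restrict b' V"
      then have "b x = b' x" if "x \<in> V" for x using that b(3) by (metis restrict_apply')
      then have "restrict b (insert j V) = restrict b' (insert j V)"
        using b(1,2) unfolding A'_def by (auto simp: restrict_def)
      with b insert.prems(2) show "b = b'" unfolding A'_def inj_on_def by blast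
    qed
    fix v :: "'n \<Rightarrow> 'k"
    define p where "p = (\<Sum>a\<in>A. monom (c a * (\<Prod>i\<in>V. v i ^ a i)) (a j))"
    have "poly p t = 0" for t
    proof -
      have "(\<Prod>i\<in>V. (v(j := t)) i ^ b i) = (\<Prod>i\<in>V. v i ^ b i)" for b
        using insert.hyps(2) by (intro prod.cong) auto
      then have "poly p t = (\<Sum>a\<in>A. c a * (\<Prod>i\<in>insert j V. (v(j := t)) i ^ a i))"
        using insert.hyps by (simp add: p_def poly_sum poly_monom mult_ac)
      then show ?thesis using insert.prems(3) by simp
    qed
    then have "p = 0" using poly_all_0_iff_0 by blast
    then have "0 = coeff p (a j)" by simp
    also have "\<dots> = (\<Sum>b\<in>A. if b j = a j then c b * (\<Prod>i\<in>V. v i ^ b i) else 0)"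
      by (simp add: p_def coeff_sum coeff_monom)
    also have "\<dots> = (\<Sum>b\<in>A'. c b * (\<Prod>i\<in>V. v i ^ b i))"
      using insert.prems(1) unfolding A'_def by (simp add: sum.inter_filter)
    finally show "(\<Sum>b\<in>A'. c b * (\<Prod>i\<in>V. v i ^ b i)) = 0" by simp
  qed (use insert.prems in \<open>auto simp: A'_def\<close>)
qed

lemma exists_nonzero_value:
  fixes f :: "('k::{field, ring_char_0}, 'n::finite) mpoly"
  assumes "f \<noteq> 0" obtains v where "eval_poly f v \<noteq> 0"
proof (rule ccontr)
  assume "\<not> thesis"
  then have z: "eval_poly f v = 0" for v using that by blast
  obtain a where a: "a \<in> Poly_Mapping.keys f" using assms keys_eq_empty by blast
  define L where "L = (Poly_Mapping.lookup :: ('n \<Rightarrow>\<^sub>0 nat) \<Rightarrow> 'n \<Rightarrow> nat)"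
  have inj: "inj L" unfolding L_def by (simp add: inj_def lookup_inject)
  have "(\<lambda>b. Poly_Mapping.lookup f (inv L b)) (L a) = 0"
  proof (rule monomials_independent[of UNIV "L ` Poly_Mapping.keys f"])
    fix v :: "'n \<Rightarrow> 'k"
    have "(\<Sum>b\<in>L ` Poly_Mapping.keys f. Poly_Mapping.lookup f (inv L b) * (\<Prod>i\<in>UNIV. v i ^ b i))
        = eval_poly f (\<chi> i. v i)"
      unfolding eval_poly_def using inj
      by (subst sum.reindex) (auto simp: inj_on_def inj_def L_def[symmetric] intro!: sum.cong)
    then show "(\<Sum>b\<in>L ` Poly_Mapping.keys f. Poly_Mapping.lookup f (inv L b) * (\<Prod>i\<in>UNIV. v i ^ b i)) = 0"
      using z by simp
  qed (use a in \<open>auto simp: inj_on_def restrict_def fun_eq_iff\<close>)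
  then show False using a inj by (simp add: in_keys_iff)
qed

definition hcomp :: "nat \<Rightarrow> ('k::field, 'n::finite) mpoly \<Rightarrow> ('k, 'n) mpoly" where
  "hcomp t f = (\<Sum>a | a \<in> Poly_Mapping.keys f \<and> mono_deg a = t. Poly_Mapping.single a (Poly_Mapping.lookup f a))"

lemma lookup_hcomp: "Poly_Mapping.lookup (hcomp t f) a = (if mono_deg a = t then Poly_Mapping.lookup f a else 0)"
proof -
  have "Poly_Mapping.lookup (hcomp t f) a
      = (\<Sum>b | b \<in> Poly_Mapping.keys f \<and> mono_deg b = t. if b = a then Poly_Mapping.lookup f a else 0)"
    unfolding hcomp_def lookup_sum by (rule sum.cong) (auto simp: lookup_single when_def)
  also have "\<dots> = (if mono_deg a = t then Poly_Mapping.lookup f a else 0)"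
    by (subst sum.delta) (auto simp: in_keys_iff)
  finally show ?thesis .
qed

lemma hcomp_add: "hcomp t (f + g) = hcomp t f + hcomp t g"
  and hcomp_zero [simp]: "hcomp t 0 = 0"
  and hcomp_diff: "hcomp t (f - g) = hcomp t f - hcomp t g"
  and hcomp_minus: "hcomp t (- f) = - hcomp t f"
  by (rule poly_mapping_eqI; simp add: lookup_hcomp lookup_add lookup_minus)+

lemma hcomp_sum: "hcomp t (sum f A) = (\<Sum>i\<in>A. hcomp t (f i))"
  by (induction A rule: infinite_finite_induct) (auto simp: hcomp_add)

lemma hcomp_single: "hcomp t (Poly_Mapping.single a c) = (if mono_deg a = t then Poly_Mapping.single a c else 0)"
  by (rule poly_mapping_eqI) (auto simp: lookup_hcomp lookup_single when_def)

lemma mono_deg_add: "mono_deg (a + b) = mono_deg a + mono_deg b"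
  by (simp add: mono_deg_def lookup_add sum.distrib)

lemma hcomp_mult: "hcomp t (f * g) = (\<Sum>i\<le>t. hcomp i f * hcomp (t - i) g)"
proof (induction f rule: mpoly_induct)
  case (add_single a c f)
  have "hcomp t (Poly_Mapping.single a c * g) = (\<Sum>i\<le>t. hcomp i (Poly_Mapping.single a c) * hcomp (t - i) g)"
  proof (induction g rule: mpoly_induct)
    case (add_single b d g)
    have "(\<Sum>i\<le>t. hcomp i (Poly_Mapping.single a c) * hcomp (t - i) (Poly_Mapping.single b d))
        = (\<Sum>i\<le>t. if i = mono_deg a then (if mono_deg b = t - i then Poly_Mapping.single (a + b) (c * d) else 0) else 0)"
      by (rule sum.cong) (auto simp: hcomp_single mult_single)
    also have "\<dots> = hcomp t (Poly_Mapping.single a c * Poly_Mapping.single b d)"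
      by (subst sum.delta) (auto simp: hcomp_single mult_single mono_deg_add)
    finally show ?case using add_single by (simp add: distrib_left hcomp_add sum.distrib)
  qed simp
  with add_single show ?case by (simp add: distrib_right hcomp_add sum.distrib)
qed simp

lemma is_form_zero [simp]: "is_form t 0" by (simp add: is_form_def)

lemma is_form_iff_lookup: "is_form t f \<longleftrightarrow> (\<forall>a. mono_deg a \<noteq> t \<longrightarrow> Poly_Mapping.lookup f a = 0)"
  by (auto simp: is_form_def in_keys_iff)

lemma is_form_hcomp [simp]: "is_form t (hcomp t f)"
  by (simp add: is_form_iff_lookup lookup_hcomp)

lemma hcomp_form: "is_form t f \<Longrightarrow> hcomp s f = (if s = t then f else 0)"
  by (rule poly_mapping_eqI) (auto simp: lookup_hcomp is_form_iff_lookup)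

lemma is_form_add: "is_form t f \<Longrightarrow> is_form t g \<Longrightarrow> is_form t (f + g)"
  and is_form_diff: "is_form t f \<Longrightarrow> is_form t g \<Longrightarrow> is_form t (f - g)"
  and is_form_minus: "is_form t f \<Longrightarrow> is_form t (- f)"
  by (auto simp: is_form_iff_lookup lookup_add lookup_minus)

lemma is_form_sum: "(\<And>i. i \<in> A \<Longrightarrow> is_form t (f i)) \<Longrightarrow> is_form t (sum f A)"
  by (induction A rule: infinite_finite_induct) (auto intro: is_form_add)

lemma is_form_mult:
  assumes f: "is_form s f" and g: "is_form t g" shows "is_form (s + t) (f * g)"
proof -
  have "hcomp (s + t) (f * g) = (\<Sum>i\<le>s + t. if i = s then f * g else 0)"
    unfolding hcomp_mult by (rule sum.cong) (auto simp: hcomp_form[OF f] hcomp_form[OF g])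
  then have "hcomp (s + t) (f * g) = f * g" by simp
  then show ?thesis by (metis is_form_hcomp)
qed

lemma is_form_cst: "is_form 0 (cst c)"
  by (auto simp: is_form_iff_lookup lookup_single when_def mono_deg_def)

lemma is_form_one: "is_form 0 1"
  using is_form_cst[of 1] by simp

lemma is_form_var: "is_form 1 (var i)"
  by (auto simp: is_form_iff_lookup lookup_single when_def mono_deg_def)

lemma is_form_scale: "is_form t f \<Longrightarrow> is_form t (cst c * f)"
  using is_form_mult[OF is_form_cst, of t f c] by simp

lemma is_form_power: "is_form t f \<Longrightarrow> is_form (n * t) (f ^ n)"
  by (induction n) (auto simp: is_form_one intro: is_form_mult)

lemma is_form_power1: "is_form 1 f \<Longrightarrow> is_form n (f ^ n)"
  using is_form_power[of 1 f n] by simp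

lemma hcomp_mult_form: "is_form s f \<Longrightarrow> hcomp (s + t) (f * g) = f * hcomp t g"
proof -
  assume f: "is_form s f"
  have "hcomp (s + t) (f * g) = (\<Sum>i\<le>s + t. if i = s then f * hcomp t g else 0)"
    unfolding hcomp_mult by (rule sum.cong) (auto simp: hcomp_form[OF f])
  then show ?thesis by simp
qed

lemma hcomp_mult_form_less: "is_form s f \<Longrightarrow> t < s \<Longrightarrow> hcomp t (f * g) = 0"
  unfolding hcomp_mult by (rule sum.neutral) (auto simp: hcomp_form)

lemma hcomp_cst_mult: "hcomp t (cst c * g) = cst c * hcomp t g"
  using hcomp_mult_form[OF is_form_cst, of t c g] by simp

lemma sum_hcomp:
  obtains N where "f = (\<Sum>t<N. hcomp t f)" "\<And>t. t \<ge> N \<Longrightarrow> hcomp t f = 0"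
proof -
  define N where "N = Suc (\<Sum>a\<in>Poly_Mapping.keys f. mono_deg a)"
  have bound: "mono_deg a < N" if "a \<in> Poly_Mapping.keys f" for a
    unfolding N_def using that by (simp add: le_imp_less_Suc member_le_sum)
  show ?thesis
  proof
    show "f = (\<Sum>t<N. hcomp t f)"
    proof (rule poly_mapping_eqI)
      fix a
      show "Poly_Mapping.lookup f a = Poly_Mapping.lookup (\<Sum>t<N. hcomp t f) a"
        using bound[of a] by (auto simp: lookup_sum lookup_hcomp in_keys_iff)
    qed
    show "hcomp t f = 0" if "t \<ge> N" for t
      by (rule poly_mapping_eqI) (use bound that in \<open>fastforce simp: lookup_hcomp in_keys_iff\<close>)
  qed
qed

lemma form_zero_eq_cst: "is_form 0 f \<Longrightarrow> \<exists>c. f = cst c"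
proof -
  assume f: "is_form 0 f"
  have "Poly_Mapping.lookup f a = 0" if "a \<noteq> 0" for a
  proof -
    have "\<exists>i. Poly_Mapping.lookup a i \<noteq> 0" using that poly_mapping_eqI[of a 0] by (metis lookup_zero)
    then obtain i where "Poly_Mapping.lookup a i \<noteq> 0" by blast
    then have "mono_deg a \<noteq> 0" unfolding mono_deg_def by auto
    with f show ?thesis by (simp add: is_form_iff_lookup)
  qed
  then have "f = cst (Poly_Mapping.lookup f 0)"
    by (intro poly_mapping_eqI) (auto simp: lookup_single when_def)
  then show ?thesis ..
qed

lemma eval_form_scale:
  assumes "is_form t f" shows "eval_poly f (c *s v) = c ^ t * eval_poly f v"
proof -
  have "(\<Prod>i\<in>UNIV. ((c *s v) $ i) ^ Poly_Mapping.lookup a i)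
      = c ^ t * (\<Prod>i\<in>UNIV. (v $ i) ^ Poly_Mapping.lookup a i)" if "mono_deg a = t" for a
  proof -
    have "(\<Prod>i\<in>UNIV. c ^ Poly_Mapping.lookup a i) = c ^ t"
      using that unfolding mono_deg_def by (simp flip: power_sum)
    then show ?thesis by (simp add: power_mult_distrib prod.distrib)
  qed
  with assms show ?thesis
    unfolding eval_poly_def is_form_def by (simp add: sum_distrib_left mult_ac)
qed

lemma eval_form_zero: "is_form t f \<Longrightarrow> 0 < t \<Longrightarrow> eval_poly f 0 = 0"
  using eval_form_scale[of t f 0 0] by (simp add: power_0_left)

lemma linear_form_expand:
  fixes l :: "('k::field, 'n::finite) mpoly"
  assumes "is_form 1 l" shows "\<exists>c. l = (\<Sum>i\<in>UNIV. cst (c i) * var i)"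
proof -
  have key: "\<exists>i. a = Poly_Mapping.single i 1" if a: "mono_deg a = 1" for a :: "'n \<Rightarrow>\<^sub>0 nat"
  proof -
    obtain i where i: "Poly_Mapping.lookup a i \<noteq> 0" using a unfolding mono_deg_def by force
    have "mono_deg a = Poly_Mapping.lookup a i + (\<Sum>j\<in>UNIV - {i}. Poly_Mapping.lookup a j)"
      unfolding mono_deg_def by (simp add: sum.remove)
    then have one: "Poly_Mapping.lookup a i = 1" and "(\<Sum>j\<in>UNIV - {i}. Poly_Mapping.lookup a j) = 0"
      using a i by linarith+
    then have "\<forall>j\<in>UNIV - {i}. Poly_Mapping.lookup a j = 0" by simp
    with one have "Poly_Mapping.lookup a i = 1" "\<forall>j\<in>UNIV - {i}. Poly_Mapping.lookup a j = 0"
      by blast+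
    then have "a = Poly_Mapping.single i 1"
      by (intro poly_mapping_eqI) (auto simp: lookup_single when_def)
    then show ?thesis ..
  qed
  have inj: "Poly_Mapping.single i (1::nat) = Poly_Mapping.single j 1 \<longleftrightarrow> i = j" for i j :: 'n
    by (metis lookup_single_eq lookup_single_not_eq zero_neq_one)
  have "l = (\<Sum>i\<in>UNIV. cst (Poly_Mapping.lookup l (Poly_Mapping.single i 1)) * var i)"
  proof (rule poly_mapping_eqI)
    fix a
    show "Poly_Mapping.lookup l a
        = Poly_Mapping.lookup (\<Sum>i\<in>UNIV. cst (Poly_Mapping.lookup l (Poly_Mapping.single i 1)) * var i) a"
    proof (cases "mono_deg a = 1")
      case True
      then obtain i where i: "a = Poly_Mapping.single i 1" using key by blast
      show ?thesis
        unfolding i by (simp add: lookup_sum mult_single lookup_single when_def inj[unfolded One_nat_def])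
    next
      case False
      then have "Poly_Mapping.single i 1 \<noteq> a" for i by (auto simp: mono_deg_def lookup_single when_def)
      then show ?thesis using False assms
        by (simp add: is_form_iff_lookup lookup_sum mult_single lookup_single when_def)
    qed
  qed
  then show ?thesis by (rule exI[of _ "\<lambda>i. Poly_Mapping.lookup l (Poly_Mapping.single i 1)"])
qed

lemma eval_linear_form:
  assumes "is_form 1 l"
  shows "eval_poly l (v + w) = eval_poly l v + eval_poly l w"
    and "eval_poly l (c *s v) = c * eval_poly l v"
    and "eval_poly l (v - w) = eval_poly l v - eval_poly l w"
    and "eval_poly l 0 = 0"
proof -
  obtain c' where "l = (\<Sum>i\<in>UNIV. cst (c' i) * var i)" using linear_form_expand[OF assms] by blast
  then have ev: "eval_poly l v = (\<Sum>i\<in>UNIV. c' i * v $ i)" for v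
    by (simp add: eval_poly_sum eval_poly_mult)
  show "eval_poly l (v + w) = eval_poly l v + eval_poly l w"
    "eval_poly l (v - w) = eval_poly l v - eval_poly l w" "eval_poly l 0 = 0"
    by (simp_all add: ev sum.distrib sum_subtractf algebra_simps)
  show "eval_poly l (c *s v) = c * eval_poly l v"
    using eval_form_scale[OF assms] by simp
qed

text \<open>Closure under components is a form of homogeneity that can be checked on elements, unlike generation
  by homogeneous elements, with which it agrees.\<close>

definition hideal :: "('k::field, 'n::finite) mpoly set \<Rightarrow> bool" where
  "hideal J \<longleftrightarrow> idl.subspace J \<and> (\<forall>f\<in>J. \<forall>t. hcomp t f \<in> J)"

lemma hideal_ideal: "hideal J \<Longrightarrow> idl.subspace J"
  and hideal_hcomp: "hideal J \<Longrightarrow> f \<in> J \<Longrightarrow> hcomp t f \<in> J"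
  by (auto simp: hideal_def)

lemma hideal_memI:
  assumes "hideal J" "\<And>t. hcomp t f \<in> J" shows "f \<in> J"
proof -
  obtain N where "f = (\<Sum>t<N. hcomp t f)" using sum_hcomp by blast
  then show ?thesis using idl.subspace_sum[OF hideal_ideal[OF assms(1)], of "{..<N}" "\<lambda>t. hcomp t f"] assms(2) by simp
qed

lemma hideal_span:
  assumes "\<And>f t. f \<in> S \<Longrightarrow> hcomp t f \<in> idl.span S"
  shows "hideal (idl.span S)"
proof -
  have "hcomp t f \<in> idl.span S" if "f \<in> idl.span S" for f t
    using that
  proof (induction rule: idl.span_induct_alt)
    case (step c x y)
    have "hcomp t (c * x) \<in> idl.span S"
      unfolding hcomp_mult by (intro idl.span_sum idl.span_scale assms step)
    with step show ?case by (simp add: hcomp_add idl.span_add)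
  qed (simp add: idl.span_zero)
  then show ?thesis by (auto simp: hideal_def)
qed

lemma hideal_span_forms:
  assumes "\<And>f. f \<in> S \<Longrightarrow> homogeneous f" "hideal J"
  shows "hideal (idl.span (S \<union> J))"
proof (rule hideal_span)
  fix f t assume "f \<in> S \<union> J"
  then show "hcomp t f \<in> idl.span (S \<union> J)"
  proof
    assume "f \<in> S"
    then have "hcomp t f = f \<or> hcomp t f = 0" using assms(1) hcomp_form unfolding homogeneous_def by metis
    with \<open>f \<in> S\<close> show ?thesis using idl.span_base[of f "S \<union> J"] idl.span_zero by auto
  next
    assume "f \<in> J"
    then show ?thesis using hideal_hcomp[OF assms(2)] by (intro idl.span_base) blast
  qed
qed

lemma hideal_span_homogeneous:
  assumes "\<And>f. f \<in> S \<Longrightarrow> homogeneous f"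
  shows "hideal (idl.span S)"
proof (rule hideal_span)
  fix f t assume f: "f \<in> S"
  then obtain u where "is_form u f" using assms by (auto simp: homogeneous_def)
  then have "hcomp t f = f \<or> hcomp t f = 0" using hcomp_form[of u f t] by simp
  then show "hcomp t f \<in> idl.span S"
  proof
    assume "hcomp t f = f"
    then show ?thesis using idl.span_base[OF f] by (simp only:)
  next
    assume "hcomp t f = 0"
    then show ?thesis using idl.span_zero by (simp only:)
  qed
qed

lemma homogeneous_ideal_imp_hideal:
  assumes "homogeneous_ideal I" shows "hideal I"
proof -
  have "hideal (idl.span {f \<in> I. homogeneous f})" by (rule hideal_span_homogeneous) simp
  then show ?thesis using assms by (simp add: homogeneous_ideal_def)
qed

lemma hideal_colon:
  assumes "hideal J" "is_form s f" shows "hideal (colon J f)"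
  unfolding hideal_def
proof (intro conjI ballI allI)
  show "idl.subspace (colon J f)" by (rule ideal_colon[OF hideal_ideal[OF assms(1)]])
  fix g t assume "g \<in> colon J f"
  then have "hcomp (s + t) (f * g) \<in> J" using hideal_hcomp[OF assms(1)] by (simp add: mem_colon)
  then show "hcomp t g \<in> colon J f" by (simp add: mem_colon hcomp_mult_form[OF assms(2)])
qed


section \<open>Subalgebras generated by linear forms\<close>

inductive_set alg :: "('k::field, 'n::finite) mpoly set \<Rightarrow> ('k, 'n) mpoly set" for S where
  alg_cst: "cst c \<in> alg S"
| alg_base: "s \<in> S \<Longrightarrow> s \<in> alg S"
| alg_add: "f \<in> alg S \<Longrightarrow> g \<in> alg S \<Longrightarrow> f + g \<in> alg S"
| alg_mult: "f \<in> alg S \<Longrightarrow> g \<in> alg S \<Longrightarrow> f * g \<in> alg S"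

lemma alg_subring: "subring_set (alg (S :: ('a::field, 'b::finite) mpoly set))"
proof -
  have "f - g \<in> alg S" if "f \<in> alg S" "g \<in> alg S" for f g :: "('a, 'b) mpoly"
  proof -
    have "cst (-1) = (- 1 :: ('a, 'b) mpoly)" by (simp only: single_uminus cst_one)
    then have eq: "f - g = f + cst (-1) * g" by simp
    show ?thesis unfolding eq by (intro alg.intros that)
  qed
  moreover have "1 \<in> alg S" using alg_cst[of 1 S] by simp
  ultimately show ?thesis by (auto simp: subring_set_def alg_mult)
qed

lemmas alg_closed = subring_closed[OF alg_subring]

lemma alg_subset:
  assumes "\<And>s. s \<in> S \<Longrightarrow> s \<in> alg T" shows "alg S \<subseteq> alg T"
proof
  fix f assume "f \<in> alg S"
  then show "f \<in> alg T" by induction (auto intro: alg.intros assms)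
qed

lemma alg_mono: "S \<subseteq> T \<Longrightarrow> alg S \<subseteq> alg T"
  by (rule alg_subset) (auto intro: alg_base)

lemma hcomp_alg:
  assumes S: "\<And>s. s \<in> S \<Longrightarrow> is_form 1 s" and f: "f \<in> alg S"
  shows "hcomp t f \<in> alg S"
  using f
proof (induction arbitrary: t)
  case (alg_cst c)
  show ?case by (simp add: hcomp_form[OF is_form_cst] alg.alg_cst alg_closed)
next
  case (alg_base s)
  then have "hcomp t s = s \<or> hcomp t s = 0" using hcomp_form[OF S] by simp
  with alg_base show ?case using alg.alg_base alg_closed(1) by metis
next
  case (alg_mult f g)
  then show ?case unfolding hcomp_mult by (intro alg_closed)
qed (simp add: hcomp_add alg_add)

lemma eval_alg_cong:
  assumes "f \<in> alg S" "\<And>s. s \<in> S \<Longrightarrow> eval_poly s v = eval_poly s w"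
  shows "eval_poly f v = eval_poly f w"
  using assms(1) by induction (auto simp: assms(2) eval_poly_add eval_poly_mult)

text \<open>Modulo the generators \<open>s - s(v)\<close>, every element of the subalgebra is its value at \<open>v\<close>.\<close>

lemma alg_minus_value:
  assumes "f \<in> alg S" "idl.subspace I" "\<And>s. s \<in> S \<Longrightarrow> s - cst (eval_poly s v) \<in> I"
  shows "f - cst (eval_poly f v) \<in> I"
  using assms(1)
proof induction
  case (alg_cst c)
  show ?case using assms(2) idl.subspace_0 by simp
next
  case (alg_base s)
  then show ?case by (rule assms(3))
next
  case (alg_add f g)
  have "(f - cst (eval_poly f v)) + (g - cst (eval_poly g v)) \<in> I"
    by (intro idl.subspace_add[OF assms(2)] alg_add)
  then show ?case by (simp add: eval_poly_add cst_add algebra_simps)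
next
  case (alg_mult f g)
  have "g * (f - cst (eval_poly f v)) + cst (eval_poly f v) * (g - cst (eval_poly g v)) \<in> I"
    by (intro idl.subspace_add[OF assms(2)] ideal_mult_left[OF assms(2)] alg_mult)
  then show ?case by (simp only: eval_poly_mult cst_mult) (simp add: algebra_simps)
qed

lemma alg_insert:
  assumes "f \<in> alg (insert l S)"
  obtains p where "poly_over (alg S) p" "f = poly p l"
proof -
  have "\<exists>p. poly_over (alg S) p \<and> f = poly p l"
    using assms
  proof induction
    case (alg_cst c)
    show ?case
      using poly_over_pCons[OF alg_subring alg.alg_cst poly_over_0[OF alg_subring], of S c]
      by (intro exI[of _ "[:cst c:]"] conjI) (assumption, simp)
  next
    case (alg_base s)
    show ?case
    proof (cases "s = l")
      case True
      then show ?thesis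
        by (intro exI[of _ "[:0, 1:]"]) (simp add: poly_over_pCons[OF alg_subring] poly_over_0[OF alg_subring] alg_closed)
    next
      case False
      with alg_base show ?thesis
        by (intro exI[of _ "[:s:]"]) (simp add: poly_over_pCons[OF alg_subring] poly_over_0[OF alg_subring] alg.alg_base)
    qed
  next
    case (alg_add f g)
    then show ?case by (metis alg_subring poly_add poly_over_add)
  next
    case (alg_mult f g)
    then show ?case by (metis alg_subring poly_mult poly_over_mult)
  qed
  with that show ?thesis by blast
qed

lemma poly_in_alg_insert:
  assumes "poly_over (alg S) p" shows "poly p l \<in> alg (insert l S)"
proof -
  have "coeff p k \<in> alg (insert l S)" for k
    using assms alg_mono[of S "insert l S"] unfolding poly_over_def by blast
  moreover have "l \<in> alg (insert l S)" by (simp add: alg_base)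
  ultimately show ?thesis unfolding poly_altdef by (intro alg_closed)
qed

section \<open>Noether normalization by linear forms\<close>

text \<open>Linear independence, witnessed by a dual basis: this is the form in which it is used, and it
  survives the eliminations below without computation.\<close>

definition coords :: "('k::field, 'n::finite) mpoly set \<Rightarrow> bool" where
  "coords S \<longleftrightarrow> finite S \<and> (\<forall>s\<in>S. is_form 1 s) \<and>
     (\<forall>s\<in>S. \<exists>e. eval_poly s e = 1 \<and> (\<forall>t\<in>S - {s}. eval_poly t e = 0))"

text \<open>The quotient by \<open>J\<close> is finite over the subalgebra generated by \<open>S\<close> as soon as the irrelevant
  ideal lies in the radical of \<open>(S) + J\<close>.\<close>

definition finite_over :: "('k::field, 'n::finite) mpoly set \<Rightarrow> ('k, 'n) mpoly set \<Rightarrow> bool" where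
  "finite_over S J \<longleftrightarrow> (\<forall>i. \<exists>N. var i ^ N \<in> idl.span (S \<union> J))"

definition zeros :: "('k::field, 'n::finite) mpoly set \<Rightarrow> ('k ^ 'n) set" where
  "zeros J = {v. \<forall>f\<in>J. eval_poly f v = 0}"

lemma coords_form: "coords S \<Longrightarrow> s \<in> S \<Longrightarrow> is_form 1 s"
  and coords_finite: "coords S \<Longrightarrow> finite S"
  and coords_dual: "coords S \<Longrightarrow> s \<in> S \<Longrightarrow> \<exists>e. eval_poly s e = 1 \<and> (\<forall>t\<in>S - {s}. eval_poly t e = 0)"
  by (auto simp: coords_def)

lemma coords_subset: "coords S \<Longrightarrow> T \<subseteq> S \<Longrightarrow> coords T"
  unfolding coords_def by (meson DiffD1 DiffD2 DiffI finite_subset subsetD)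

lemma alg_vars: "f \<in> alg (range var)"
  by (induction f rule: mpoly_ring_induct) (auto intro: alg.intros)

lemma coords_vars: "coords (range var :: ('k::field, 'n::finite) mpoly set)"
  unfolding coords_def
proof (intro conjI ballI)
  fix s :: "('k, 'n) mpoly" assume "s \<in> range var"
  then obtain i where i: "s = var i" by blast
  show "\<exists>e. eval_poly s e = 1 \<and> (\<forall>t\<in>range var - {s}. eval_poly t e = 0)"
    by (rule exI[of _ "axis i 1"]) (auto simp: i axis_def split: if_splits)
qed (auto simp: is_form_var[unfolded One_nat_def])

lemma card_vars: "card (range var :: ('k::field, 'n::finite) mpoly set) = CARD('n)"
proof (rule card_image, rule injI)
  fix i j :: 'n assume eq: "(var i :: ('k, 'n) mpoly) = var j"
  have "eval_poly (var i :: ('k, 'n) mpoly) (axis i 1) = eval_poly (var j) (axis i 1)"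
    by (simp only: eq)
  then show "i = j" by (simp add: axis_def split: if_splits)
qed

lemma finite_over_vars: "finite_over (range var) J"
  unfolding finite_over_def by (intro allI exI[of _ 1]) (auto intro: idl.span_base)

lemma finite_over_trans:
  assumes "finite_over S J" "S \<union> J \<subseteq> idl.span (T \<union> K)" shows "finite_over T K"
  using assms idl.span_minimal[OF assms(2)] unfolding finite_over_def by (meson idl.subspace_span subsetD)

lemma finite_over_mono: "finite_over S J \<Longrightarrow> S \<subseteq> T \<Longrightarrow> J \<subseteq> K \<Longrightarrow> finite_over T K"
  by (rule finite_over_trans) (auto intro: idl.span_base)

lemma mem_span_finite_Un:
  assumes "finite S" "idl.subspace J" "f \<in> idl.span (S \<union> J)"
  shows "\<exists>g. f - (\<Sum>s\<in>S. s * g s) \<in> J"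
  using assms(1,3)
proof (induction S arbitrary: f rule: finite_induct)
  case empty
  then show ?case using assms(2) by (simp add: idl.span_eq_iff[THEN iffD2])
next
  case (insert s S)
  then obtain k where "f - k * s \<in> idl.span (S \<union> J)" by (auto simp: idl.span_insert)
  then obtain g where g: "f - k * s - (\<Sum>s\<in>S. s * g s) \<in> J" using insert.IH by blast
  have "(\<Sum>t\<in>S. t * (g(s := k)) t) = (\<Sum>t\<in>S. t * g t)"
    using insert.hyps by (intro sum.cong) auto
  then have "f - (\<Sum>t\<in>insert s S. t * (g(s := k)) t) = f - k * s - (\<Sum>t\<in>S. t * g t)"
    using insert.hyps by (simp add: algebra_simps)
  with g show ?case by metis
qed

lemma finite_bounded_degree: "finite {a :: 'n::finite \<Rightarrow>\<^sub>0 nat. mono_deg a < D}"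
proof (rule finite_imageD)
  have "Poly_Mapping.lookup a i \<le> mono_deg a" for a :: "'n \<Rightarrow>\<^sub>0 nat" and i
    unfolding mono_deg_def by (rule member_le_sum) auto
  then have "Poly_Mapping.lookup ` {a :: 'n \<Rightarrow>\<^sub>0 nat. mono_deg a < D} \<subseteq> (\<Pi>\<^sub>E i\<in>UNIV. {..<D})"
    by (auto intro: le_less_trans)
  then show "finite (Poly_Mapping.lookup ` {a :: 'n \<Rightarrow>\<^sub>0 nat. mono_deg a < D})"
    by (rule finite_subset) (simp add: finite_PiE)
qed (auto simp: inj_on_def lookup_inject)

lemma form_eq_sum_monomials:
  assumes "is_form t f"
  shows "f = (\<Sum>a | a \<in> Poly_Mapping.keys f \<and> mono_deg a = t. Poly_Mapping.single a (Poly_Mapping.lookup f a))"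
  using hcomp_form[OF assms, of t] unfolding hcomp_def by simp

lemma finite_over_imp_large_monomials:
  fixes J :: "('k::field, 'n::finite) mpoly set"
  assumes "finite_over S J"
  obtains D where "0 < D"
    "\<And>a :: 'n \<Rightarrow>\<^sub>0 nat. D \<le> mono_deg a \<Longrightarrow> Poly_Mapping.single a 1 \<in> idl.span (S \<union> J)"
proof -
  obtain N where N: "\<And>i. var i ^ N i \<in> idl.span (S \<union> J)" using assms unfolding finite_over_def by metis
  define D where "D = Suc (\<Sum>i\<in>UNIV. N i)"
  have "Poly_Mapping.single a 1 \<in> idl.span (S \<union> J)" if "D \<le> mono_deg a" for a :: "'n \<Rightarrow>\<^sub>0 nat"
  proof -
    have "\<exists>i. N i \<le> Poly_Mapping.lookup a i"
    proof (rule ccontr)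
      assume "\<not> ?thesis"
      then have "mono_deg a \<le> (\<Sum>i\<in>UNIV. N i)"
        unfolding mono_deg_def by (intro sum_mono) (auto simp: not_le intro: less_imp_le)
      with that show False by (simp add: D_def)
    qed
    then obtain i where i: "N i \<le> Poly_Mapping.lookup a i" by blast
    have "(\<Prod>j\<in>UNIV. var j ^ Poly_Mapping.lookup a j)
        = (\<Prod>j\<in>UNIV - {i}. var j ^ Poly_Mapping.lookup a j) * (var i ^ (Poly_Mapping.lookup a i - N i) * (var i ^ N i :: ('k, 'n) mpoly))"
      using i by (simp add: prod.remove[of UNIV i] mult.commute flip: power_add)
    moreover have "\<dots> \<in> idl.span (S \<union> J)" using N by (intro idl.span_scale)
    ultimately show ?thesis using monomial_eq_prod_var[of a, where 'k = 'k] by metis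
  qed
  then show ?thesis using that[of D] by (simp add: D_def)
qed

lemma finite_over_imp_large_forms:
  assumes "finite_over S J"
  obtains D where "\<And>t f. D \<le> t \<Longrightarrow> is_form t f \<Longrightarrow> f \<in> idl.span (S \<union> J)"
proof -
  obtain D where D: "\<And>a. D \<le> mono_deg a \<Longrightarrow> Poly_Mapping.single a 1 \<in> idl.span (S \<union> J)"
    using finite_over_imp_large_monomials[OF assms] by blast
  have "f \<in> idl.span (S \<union> J)" if t: "D \<le> t" and f: "is_form t f" for t f
  proof -
    have "cst c * Poly_Mapping.single a 1 \<in> idl.span (S \<union> J)" if "mono_deg a = t" for a c
      using D[of a] that t by (intro idl.span_scale) simp
    then have "Poly_Mapping.single a c \<in> idl.span (S \<union> J)" if "mono_deg a = t" for a c
      using that by (simp add: mult_single)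
    then show ?thesis by (subst form_eq_sum_monomials[OF f]) (auto intro!: idl.span_sum)
  qed
  with that show ?thesis by blast
qed

text \<open>Monomials of large degree lie in \<open>(S) + J\<close>, so the monomials of small degree generate the quotient:
  taking forms of the same degree as the monomial, its coefficients at the elements of \<open>S\<close> have smaller
  degree.\<close>

lemma finite_over_imp_module_finite:
  fixes J :: "('k::field, 'n::finite) mpoly set"
  assumes S: "finite S" "\<And>s. s \<in> S \<Longrightarrow> is_form 1 s" and J: "hideal J" and finite_over: "finite_over S J"
  shows "module_finite (alg S) J"
proof -
  note idJ = hideal_ideal[OF J]
  obtain D where D: "0 < D" and big: "\<And>a :: 'n \<Rightarrow>\<^sub>0 nat. D \<le> mono_deg a \<Longrightarrow> Poly_Mapping.single a 1 \<in> idl.span (S \<union> J)"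
    using finite_over_imp_large_monomials[OF finite_over] by blast
  define A where "A = {a :: 'n \<Rightarrow>\<^sub>0 nat. mono_deg a < D}"
  have finA: "finite A" unfolding A_def by (rule finite_bounded_degree)
  define M where "M = {f. \<exists>c. (\<forall>a. c a \<in> alg S) \<and> f - (\<Sum>a\<in>A. c a * Poly_Mapping.single a 1) \<in> J}"
  have MI: "f \<in> M" if "\<And>a. c a \<in> alg S" "f - (\<Sum>a\<in>A. c a * Poly_Mapping.single a 1) \<in> J" for f c
    using that unfolding M_def by blast
  have JM: "f \<in> M" if "f \<in> J" for f using that by (intro MI[of "\<lambda>_. 0"]) (auto simp: alg_closed)
  have addM: "f + g \<in> M" if fM: "f \<in> M" and gM: "g \<in> M" for f g
  proof -
    from fM obtain c where c: "\<And>a. c a \<in> alg S" "f - (\<Sum>a\<in>A. c a * Poly_Mapping.single a 1) \<in> J" unfolding M_def by blast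
    from gM obtain d where d: "\<And>a. d a \<in> alg S" "g - (\<Sum>a\<in>A. d a * Poly_Mapping.single a 1) \<in> J" unfolding M_def by blast
    show ?thesis
    proof (rule MI[of "\<lambda>a. c a + d a"])
      show "f + g - (\<Sum>a\<in>A. (c a + d a) * Poly_Mapping.single a 1) \<in> J"
        using idl.subspace_add[OF idJ c(2) d(2)] by (simp add: algebra_simps sum.distrib)
    qed (use c d in \<open>auto intro: alg_closed\<close>)
  qed
  have scaleM: "b * f \<in> M" if b: "b \<in> alg S" and fM: "f \<in> M" for b f
  proof -
    from fM obtain c where c: "\<And>a. c a \<in> alg S" "f - (\<Sum>a\<in>A. c a * Poly_Mapping.single a 1) \<in> J" unfolding M_def by blast
    show ?thesis
    proof (rule MI[of "\<lambda>a. b * c a"])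
      show "b * f - (\<Sum>a\<in>A. b * c a * Poly_Mapping.single a 1) \<in> J"
        using ideal_mult_left[OF idJ c(2), of b] by (simp add: right_diff_distrib sum_distrib_left mult.assoc)
    qed (use b c in \<open>auto intro: alg_closed\<close>)
  qed
  have sumM: "sum g I \<in> M" if "\<And>i. i \<in> I \<Longrightarrow> g i \<in> M" for g and I :: "'b set"
    using that by (induction I rule: infinite_finite_induct) (auto intro: addM JM idl.subspace_0[OF idJ])
  have sumM': "sum g I \<in> M" if "\<And>i. i \<in> I \<Longrightarrow> g i \<in> M" for g and I :: "'c set"
    using that by (induction I rule: infinite_finite_induct) (auto intro: addM JM idl.subspace_0[OF idJ])
  have mono: "Poly_Mapping.single a c \<in> M" if "mono_deg a = t" for a t and c :: 'k
    using that
  proof (induction t arbitrary: a c rule: less_induct)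
    case (less t)
    have eq: "Poly_Mapping.single a c = cst c * Poly_Mapping.single a 1" by (simp add: mult_single)
    show ?case
    proof (cases "t < D")
      case True
      have "(\<Sum>b\<in>A. (if b = a then cst c else 0) * Poly_Mapping.single b 1) = Poly_Mapping.single a c"
        using finA True less.prems by (simp add: A_def mult_single if_distrib[of "\<lambda>x. x * _"] cong: if_cong)
      then show ?thesis
        using idl.subspace_0[OF idJ]
        by (intro MI[of "\<lambda>b. if b = a then cst c else 0"]) (auto intro: alg.intros alg_closed)
    next
      case False
      then have t: "t = 1 + (t - 1)" "t - 1 < t" using D by auto
      obtain g where "Poly_Mapping.single a 1 - (\<Sum>s\<in>S. s * g s) \<in> J"
        using mem_span_finite_Un[OF S(1) idJ big[of a]] False less.prems by auto
      then have "hcomp t (Poly_Mapping.single a 1 - (\<Sum>s\<in>S. s * g s)) \<in> J" by (rule hideal_hcomp[OF J])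
      moreover have "hcomp t (s * g s) = s * hcomp (t - 1) (g s)" if "s \<in> S" for s
        using hcomp_mult_form[OF S(2)[OF that], of "t - 1" "g s"] t(1) by simp
      ultimately have J': "Poly_Mapping.single a 1 - (\<Sum>s\<in>S. s * hcomp (t - 1) (g s)) \<in> J"
        using less.prems by (simp add: hcomp_diff hcomp_sum hcomp_single)
      have "hcomp (t - 1) (g s) \<in> M" for s
        unfolding hcomp_def by (rule sumM') (use less.IH t(2) in auto)
      then have "(\<Sum>s\<in>S. s * hcomp (t - 1) (g s)) \<in> M"
        by (intro sumM scaleM) (auto intro: alg_base)
      from addM[OF JM[OF J'] this] have "Poly_Mapping.single a 1 \<in> M" by simp
      then show ?thesis unfolding eq by (intro scaleM alg_cst)
    qed
  qed
  have all: "f \<in> M" for f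
  proof -
    obtain n where n: "f = (\<Sum>t<n. hcomp t f)" using sum_hcomp by blast
    have "(\<Sum>t<n. hcomp t f) \<in> M"
      unfolding hcomp_def using mono
      by (induction n) (auto intro!: addM sumM' intro: JM idl.subspace_0[OF idJ])
    with n show ?thesis by simp
  qed
  obtain h where h: "bij_betw h {0..<card A} A" using ex_bij_betw_nat_finite[OF finA] by blast
  have "\<exists>c. (\<forall>i<card A. c i \<in> alg S) \<and> f - (\<Sum>i<card A. c i * Poly_Mapping.single (h i) 1) \<in> J" for f
  proof -
    obtain c where c: "\<And>a. c a \<in> alg S" "f - (\<Sum>a\<in>A. c a * Poly_Mapping.single a 1) \<in> J"
      using all[of f] unfolding M_def by blast
    have eq: "(\<Sum>i<card A. c (h i) * Poly_Mapping.single (h i) 1) = (\<Sum>a\<in>A. c a * Poly_Mapping.single a 1)"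
      using sum.reindex_bij_betw[OF h, of "\<lambda>a. c a * Poly_Mapping.single a 1"] by (simp add: lessThan_atLeast0)
    have "f - (\<Sum>i<card A. c (h i) * Poly_Mapping.single (h i) 1) \<in> J" unfolding eq by (rule c(2))
    with c(1) show ?thesis by (intro exI[of _ "\<lambda>i. c (h i)"] conjI allI impI)
  qed
  then have "\<forall>f. \<exists>c. (\<forall>i<card A. c i \<in> alg S) \<and> f - (\<Sum>i<card A. c i * Poly_Mapping.single (h i) 1) \<in> J" ..
  then show ?thesis unfolding module_finite_def
    by (rule_tac exI[of _ "card A"], rule_tac exI[of _ "\<lambda>i. Poly_Mapping.single (h i) 1"])
qed

lemma coords_module_finite:
  "coords S \<Longrightarrow> hideal J \<Longrightarrow> finite_over S J \<Longrightarrow> module_finite (alg S) J"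
  by (rule finite_over_imp_module_finite) (auto simp: coords_def)

text \<open>Elimination of one linear form: the pencil consists of the combinations of elements of \<open>S\<close>
  with \<open>s\<^sub>0\<close> that vanish at \<open>v\<close>.\<close>

definition pencil :: "('k::field, 'n::finite) mpoly set \<Rightarrow> ('k, 'n) mpoly \<Rightarrow> 'k ^ 'n \<Rightarrow> ('k, 'n) mpoly set" where
  "pencil S s0 v = (\<lambda>s. s - cst (eval_poly s v / eval_poly s0 v) * s0) ` (S - {s0})"

context
  fixes S :: "('k::field, 'n::finite) mpoly set" and s0 v
  assumes S: "coords S" and s0: "s0 \<in> S" and v: "eval_poly s0 v \<noteq> 0"
begin

lemma pencil_vanish: "s \<in> pencil S s0 v \<Longrightarrow> eval_poly s v = 0"
  using v by (auto simp: pencil_def eval_poly_simps)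

lemma pencil_notin: "s0 \<notin> pencil S s0 v"
  using pencil_vanish v by blast

lemma coords_insert_pencil: "coords (insert s0 (pencil S s0 v))"
  unfolding coords_def
proof (intro conjI ballI)
  show "finite (insert s0 (pencil S s0 v))" using S by (simp add: pencil_def coords_def)
  fix s assume s: "s \<in> insert s0 (pencil S s0 v)"
  show "is_form 1 s"
    using s coords_form[OF S] s0 by (auto simp: pencil_def intro!: is_form_diff is_form_scale)
  show "\<exists>e. eval_poly s e = 1 \<and> (\<forall>t\<in>insert s0 (pencil S s0 v) - {s}. eval_poly t e = 0)"
  proof (cases "s = s0")
    case True
    have "eval_poly s0 (inverse (eval_poly s0 v) *s v) = 1"
      using eval_linear_form(2)[OF coords_form[OF S s0]] v by simp
    moreover have "eval_poly t (inverse (eval_poly s0 v) *s v) = 0" if "t \<in> pencil S s0 v" for t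
    proof -
      have "is_form 1 t" using that coords_form[OF S] s0 by (auto simp: pencil_def intro!: is_form_diff is_form_scale)
      then show ?thesis using pencil_vanish[OF that] by (simp add: eval_linear_form(2)[unfolded One_nat_def])
    qed
    ultimately show ?thesis using True by blast
  next
    case False
    then obtain r where r: "r \<in> S" "r \<noteq> s0" "s = r - cst (eval_poly r v / eval_poly s0 v) * s0"
      using s by (auto simp: pencil_def)
    obtain e where e: "eval_poly r e = 1" "\<And>t. t \<in> S - {r} \<Longrightarrow> eval_poly t e = 0"
      using coords_dual[OF S r(1)] by blast
    then have e0: "eval_poly s0 e = 0" using s0 r by auto
    have "eval_poly t e = 0" if t: "t \<in> insert s0 (pencil S s0 v) - {s}" for t
    proof (cases "t = s0")
      case True
      then show ?thesis using e0 by simp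
    next
      case False
      then obtain r' where r': "r' \<in> S" "r' \<noteq> s0" "t = r' - cst (eval_poly r' v / eval_poly s0 v) * s0"
        using t by (auto simp: pencil_def)
      then have "r' \<noteq> r" using t r(3) by auto
      then show ?thesis using e r' e0 by (simp add: eval_poly_simps)
    qed
    moreover have "eval_poly s e = 1" using e e0 by (simp add: r(3) eval_poly_simps)
    ultimately show ?thesis by blast
  qed
qed

lemma coords_pencil: "coords (pencil S s0 v)"
  by (rule coords_subset[OF coords_insert_pencil]) auto

lemma card_pencil: "card (pencil S s0 v) = card S - 1"
proof -
  have "inj_on (\<lambda>s. s - cst (eval_poly s v / eval_poly s0 v) * s0) (S - {s0})"
  proof (rule inj_onI, rule ccontr)
    fix s t assume st: "s \<in> S - {s0}" "t \<in> S - {s0}" "s \<noteq> t"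
      and eq: "s - cst (eval_poly s v / eval_poly s0 v) * s0 = t - cst (eval_poly t v / eval_poly s0 v) * s0"
    obtain e where e: "eval_poly s e = 1" "\<And>t. t \<in> S - {s} \<Longrightarrow> eval_poly t e = 0"
      using coords_dual[OF S] st(1) by blast
    then have "eval_poly s0 e = 0" "eval_poly t e = 0" using st s0 by auto
    with e(1) arg_cong[OF eq, of "\<lambda>f. eval_poly f e"] show False by (simp add: eval_poly_simps)
  qed
  then show ?thesis unfolding pencil_def using s0 by (simp add: card_image)
qed

lemma alg_insert_pencil: "alg (insert s0 (pencil S s0 v)) = alg S"
proof
  show "alg (insert s0 (pencil S s0 v)) \<subseteq> alg S"
    by (rule alg_subset) (auto simp: pencil_def s0 intro!: alg_closed intro: alg.intros)
  have "s \<in> alg (insert s0 (pencil S s0 v))" if "s \<in> S" for s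
  proof (cases "s = s0")
    case False
    have "s = (s - cst (eval_poly s v / eval_poly s0 v) * s0) + cst (eval_poly s v / eval_poly s0 v) * s0" by simp
    also have "\<dots> \<in> alg (insert s0 (pencil S s0 v))"
      using that False by (intro alg.alg_add alg.alg_mult alg.alg_cst alg.alg_base) (auto simp: pencil_def)
    finally show ?thesis .
  qed (auto intro: alg_base)
  then show "alg S \<subseteq> alg (insert s0 (pencil S s0 v))" by (rule alg_subset)
qed

lemma subset_span_insert_pencil: "S \<subseteq> idl.span (insert s0 (pencil S s0 v))"
proof
  fix s assume s: "s \<in> S"
  show "s \<in> idl.span (insert s0 (pencil S s0 v))"
  proof (cases "s = s0")
    case False
    have "s = (s - cst (eval_poly s v / eval_poly s0 v) * s0) + cst (eval_poly s v / eval_poly s0 v) * s0" by simp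
    also have "\<dots> \<in> idl.span (insert s0 (pencil S s0 v))"
      using s False by (intro idl.span_add idl.span_scale idl.span_base) (auto simp: pencil_def)
    finally show ?thesis .
  qed (auto intro: idl.span_base)
qed

lemma form_mod_pencil:
  assumes f: "f \<in> alg S" "is_form n f"
  shows "f - cst (eval_poly f v / eval_poly s0 v ^ n) * s0 ^ n \<in> idl.span (pencil S s0 v)"
proof -
  let ?T = "pencil S s0 v"
  have T: "hideal (idl.span ?T)"
    using coords_form[OF coords_pencil] by (intro hideal_span_homogeneous) (auto simp: homogeneous_def)
  have vanish: "eval_poly g v = 0" if "g \<in> idl.span ?T" for g
    using that by (induction rule: idl.span_induct_alt) (auto simp: eval_poly_simps pencil_vanish)
  obtain p where p: "poly_over (alg ?T) p" "f = poly p s0"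
    using alg_insert[of f s0 ?T] f(1) alg_insert_pencil by blast
  have "coeff p k - cst (eval_poly (coeff p k) v) \<in> idl.span ?T" for k
    by (rule alg_minus_value[of _ ?T])
       (use p(1) pencil_vanish in \<open>auto simp: poly_over_def intro: idl.span_base\<close>)
  then have "(\<Sum>k\<le>degree p. s0 ^ k * (coeff p k - cst (eval_poly (coeff p k) v))) \<in> idl.span ?T"
    by (intro idl.span_sum idl.span_scale)
  then have "f - (\<Sum>k\<le>degree p. cst (eval_poly (coeff p k) v) * s0 ^ k) \<in> idl.span ?T"
    unfolding p(2) by (simp add: poly_altdef right_diff_distrib sum_subtractf mult.commute)
  then have "hcomp n (f - (\<Sum>k\<le>degree p. cst (eval_poly (coeff p k) v) * s0 ^ k)) \<in> idl.span ?T"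
    by (rule hideal_hcomp[OF T])
  moreover have "hcomp n (cst c * s0 ^ k) = (if k = n then cst c * s0 ^ n else 0)" for c k
    using hcomp_form[OF is_form_scale[OF is_form_power1[OF coords_form[OF S s0]]], of n c k] by auto
  ultimately have *: "f - (\<Sum>k\<le>degree p. if k = n then cst (eval_poly (coeff p k) v) * s0 ^ n else 0) \<in> idl.span ?T"
    using hcomp_form[OF f(2)] by (simp add: hcomp_diff hcomp_sum)
  define c where "c = (if n \<le> degree p then eval_poly (coeff p n) v else 0)"
  have "(\<Sum>k\<le>degree p. if k = n then cst (eval_poly (coeff p k) v) * s0 ^ n else 0) = cst c * s0 ^ n"
    by (simp add: c_def)
  with * have **: "f - cst c * s0 ^ n \<in> idl.span ?T" by simp
  then have "eval_poly f v = c * eval_poly s0 v ^ n" using vanish by (fastforce simp: eval_poly_simps)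
  then have "eval_poly f v / eval_poly s0 v ^ n = c" using v by simp
  with ** show ?thesis by simp
qed

lemma finite_over_pencil:
  assumes J: "idl.subspace J" and f: "f \<in> alg S" "is_form n f" "f \<in> J" "eval_poly f v \<noteq> 0" and finite_over: "finite_over S J"
  shows "finite_over (pencil S s0 v) J"
  unfolding finite_over_def
proof
  let ?T = "pencil S s0 v"
  let ?Q = "idl.span (?T \<union> J)"
  let ?c = "eval_poly f v / eval_poly s0 v ^ n"
  have "f - cst ?c * s0 ^ n \<in> ?Q"
    using form_mod_pencil[OF f(1,2)] idl.span_mono[of ?T "?T \<union> J"] by blast
  moreover have "f \<in> ?Q" using f(3) by (intro idl.span_base) blast
  ultimately have "cst ?c * s0 ^ n \<in> ?Q" using idl.span_diff[of f ?T] idl.span_diff by fastforce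
  then have s0n: "s0 ^ n \<in> ?Q" by (rule ideal_cst_cancel[OF idl.subspace_span, rotated]) (use f(4) v in simp)
  fix i
  have "S \<union> J \<subseteq> idl.span (insert s0 (?T \<union> J))"
    using subset_span_insert_pencil idl.span_mono[of "insert s0 ?T" "insert s0 (?T \<union> J)"]
    by (auto intro: idl.span_base)
  then have "finite_over (insert s0 ?T) J" using finite_over_trans[OF finite_over, of "insert s0 ?T" J] by simp
  then obtain N where "var i ^ N \<in> idl.span (insert s0 (?T \<union> J))" unfolding finite_over_def by auto
  then obtain k where k: "var i ^ N - k * s0 \<in> ?Q" by (auto simp: idl.span_insert)
  define q where "q = (var i ^ N - k * s0 :: ('k, 'n) mpoly)"
  have "(k * s0 + q) ^ m - (k * s0) ^ m \<in> ?Q" for m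
  proof (induction m)
    case (Suc m)
    have "(k * s0 + q) ^ Suc m - (k * s0) ^ Suc m
        = (k * s0 + q) * ((k * s0 + q) ^ m - (k * s0) ^ m) + (k * s0) ^ m * q" by (simp add: algebra_simps)
    also have "\<dots> \<in> ?Q" using Suc k unfolding q_def[symmetric] by (intro idl.span_add idl.span_scale)
    finally show ?case .
  qed (simp add: idl.span_zero)
  from this[of n] have "var i ^ (N * n) - k ^ n * s0 ^ n \<in> ?Q"
    by (simp add: q_def power_mult_distrib power_mult)
  moreover have "k ^ n * s0 ^ n \<in> ?Q" using s0n by (rule idl.span_scale)
  ultimately have "var i ^ (N * n) \<in> ?Q" using idl.span_add by fastforce
  then show "\<exists>N. var i ^ N \<in> ?Q" ..
qed

end

lemma form_zero_at_common_zero: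
  assumes "f \<in> alg S" "is_form n f" "0 < n" "\<And>s. s \<in> S \<Longrightarrow> is_form 1 s" "\<And>s. s \<in> S \<Longrightarrow> eval_poly s v = 0"
  shows "eval_poly f v = 0"
proof -
  have "eval_poly f v = eval_poly f 0"
    by (rule eval_alg_cong[OF assms(1)]) (use assms(4,5) eval_linear_form(4) in \<open>metis\<close>)
  then show ?thesis using eval_form_zero[OF assms(2,3)] by simp
qed

lemma one_notin_cst: "idl.subspace J \<Longrightarrow> 1 \<notin> J \<Longrightarrow> cst c \<in> J \<Longrightarrow> c = 0"
  using ideal_cst_cancel[of J c 1] by auto

text \<open>As long as the subalgebra meets \<open>J\<close> in a nonzero form \<open>g\<close>, choose a point \<open>v\<close> with
  \<open>g(v) \<noteq> 0\<close> and pass to the pencil of the combinations that vanish at \<open>v\<close>: modulo it, \<open>g\<close> is a nonzero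
  multiple of a power of the eliminated linear form, which is therefore nilpotent modulo the rest.\<close>

lemma noether_normalization:
  fixes S :: "('k::{field, ring_char_0}, 'n::finite) mpoly set"
  assumes "coords S" "hideal J" "1 \<notin> J" "finite_over S J"
  obtains T where "coords T" "card T \<le> card S" "finite_over T J" "alg T \<inter> J = {0}" "T \<subseteq> alg S"
proof -
  have "\<exists>T. coords T \<and> card T \<le> card S \<and> finite_over T J \<and> alg T \<inter> J = {0} \<and> T \<subseteq> alg S"
    using assms(1,4)
  proof (induction "card S" arbitrary: S rule: less_induct)
    case less
    note J = hideal_ideal[OF assms(2)]
    show ?case
    proof (cases "alg S \<inter> J = {0}")
      case True
      then show ?thesis using less.prems by (intro exI[of _ S]) (auto intro: alg_base)
    next
      case False
      then obtain f where f: "f \<in> alg S" "f \<in> J" "f \<noteq> 0"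
        using alg_closed(1) idl.subspace_0[OF J] by blast
      obtain n where n: "hcomp n f \<noteq> 0" using f(3) sum_hcomp[of f] by (metis sum.neutral)
      define g where "g = hcomp n f"
      have g: "g \<in> alg S" "g \<in> J" "is_form n g" "g \<noteq> 0"
        unfolding g_def using hcomp_alg coords_form[OF less.prems(1)] f n hideal_hcomp[OF assms(2)] by auto
      have "n > 0"
      proof (rule ccontr)
        assume "\<not> n > 0"
        then obtain c where "g = cst c" using form_zero_eq_cst g(3) by auto
        then show False using one_notin_cst[OF J assms(3), of c] g(2,4) by auto
      qed
      obtain v where v: "eval_poly g v \<noteq> 0" using exists_nonzero_value[OF g(4)] by blast
      then obtain s0 where s0: "s0 \<in> S" "eval_poly s0 v \<noteq> 0"
        using form_zero_at_common_zero[OF g(1,3) \<open>n > 0\<close> coords_form[OF less.prems(1)]] by blast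
      let ?T = "pencil S s0 v"
      have lt: "card ?T < card S"
        using card_pencil[OF less.prems(1) s0] s0(1) coords_finite[OF less.prems(1)]
        by (metis card_gt_0_iff diff_less empty_iff zero_less_one)
      have "\<exists>T. coords T \<and> card T \<le> card ?T \<and> finite_over T J \<and> alg T \<inter> J = {0} \<and> T \<subseteq> alg ?T"
        by (rule less.hyps[OF lt coords_pencil[OF less.prems(1) s0]
              finite_over_pencil[OF less.prems(1) s0 J g(1,3,2) v less.prems(2)]])
      then obtain T where T: "coords T" "card T \<le> card ?T" "finite_over T J" "alg T \<inter> J = {0}" "T \<subseteq> alg ?T"
        by blast
      moreover have "alg ?T \<subseteq> alg S"
        using alg_mono[of ?T "insert s0 ?T"] alg_insert_pencil[OF less.prems(1) s0] by auto
      ultimately show ?thesis using lt by (intro exI[of _ T] conjI) auto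
    qed
  qed
  with that show ?thesis by blast
qed


section \<open>The Nullstellensatz and lying over\<close>

lemma cst_sum: "cst (sum f A) = (\<Sum>i\<in>A. cst (f i))"
  by (induction A rule: infinite_finite_induct) (auto simp: single_add)

lemma map_poly_cst_mult: "map_poly cst (p * q) = map_poly cst p * (map_poly cst q :: ('k::field, 'n) mpoly poly)"
  by (rule poly_eqI) (simp add: coeff_map_poly coeff_mult cst_sum cst_mult del: mult_single)

lemma subring_range_cst: "subring_set (range cst :: ('k::field, 'n) mpoly set)"
proof -
  have "1 \<in> range (cst :: 'k \<Rightarrow> ('k, 'n) mpoly)" by (metis cst_one rangeI)
  moreover have "cst a - cst b \<in> range (cst :: 'k \<Rightarrow> ('k, 'n) mpoly)" for a b by (metis cst_diff rangeI)
  moreover have "cst a * cst b \<in> range (cst :: 'k \<Rightarrow> ('k, 'n) mpoly)" for a b by (metis cst_mult rangeI)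
  ultimately show ?thesis unfolding subring_set_def by blast
qed

text \<open>This is where the algebraic closedness of the field enters.\<close>

lemma finite_dim_ideal_has_zero:
  fixes J :: "('k::alg_closed_field, 'n::{finite,linorder}) mpoly set"
  assumes J: "idl.subspace J" "1 \<notin> J" and finite_over: "module_finite (range cst) J"
  shows "zeros J \<noteq> {}"
proof -
  obtain M where M: "J \<subseteq> M" "prime_ideal M" using maximal_ideal_prime[OF J] by blast
  then have idM: "idl.subspace M" "1 \<notin> M" by (auto simp: prime_ideal_def)
  have root: "\<exists>a. x - cst a \<in> M" if "q \<noteq> 0" "poly (map_poly cst q) x \<in> M" for q x
    using that
  proof (induction "degree q" arbitrary: q rule: less_induct)
    case less
    show ?case
    proof (cases "degree q = 0")
      case True
      then obtain c where "q = [:c:]" using degree_eq_zeroE by blast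
      with less.prems one_notin_cst[OF idM, of c] show ?thesis by (auto simp: map_poly_pCons)
    next
      case False
      then obtain a where "poly q a = 0" using alg_closed_imp_poly_has_root by blast
      then obtain q' where q': "q = [:- a, 1:] * q'" using poly_eq_0_iff_dvd by blast
      have "(x - cst a) * poly (map_poly cst q') x \<in> M"
        using less.prems(2) unfolding q' map_poly_cst_mult
        by (simp add: map_poly_pCons single_uminus algebra_simps)
      then consider "x - cst a \<in> M" | "poly (map_poly cst q') x \<in> M"
        using M(2) unfolding prime_ideal_def by blast
      then show ?thesis
      proof cases
        case 2
        have "q' \<noteq> 0" using q' less.prems by auto
        moreover from this have "degree q' < degree q" unfolding q' by (subst degree_mult_eq) auto
        ultimately show ?thesis using less.hyps 2 by blast
      qed blast
    qed
  qed
  have "\<exists>a. var i - cst a \<in> M" for i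
  proof -
    obtain p where p: "p \<noteq> 0" "poly_over (range cst) p" "poly p (var i) \<in> J"
      using algebraic_over[OF subring_range_cst J(1) finite_over] by blast
    define q where "q = map_poly (\<lambda>f. Poly_Mapping.lookup f 0) p"
    have "map_poly cst q = p"
    proof (rule poly_eqI)
      fix k
      obtain c where "coeff p k = cst c" using p(2) unfolding poly_over_def by blast
      then show "coeff (map_poly cst q) k = coeff p k" by (simp add: q_def coeff_map_poly)
    qed
    moreover from this have "q \<noteq> 0" using p(1) by auto
    ultimately show ?thesis using root[of q "var i"] p(3) M(1) by auto
  qed
  then obtain a where a: "\<And>i. var i - cst (a i) \<in> M" by metis
  define w where "w = (\<chi> i. a i)"
  have "f - cst (eval_poly f w) \<in> M" for f
    by (rule alg_minus_value[OF alg_vars idM(1)]) (use a in \<open>auto simp: w_def\<close>)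
  then have "eval_poly f w = 0" if "f \<in> J" for f
    using that M(1) one_notin_cst[OF idM, of "eval_poly f w"] idl.subspace_diff[OF idM(1), of f "f - cst (eval_poly f w)"]
    by auto
  then show ?thesis unfolding zeros_def by blast
qed

text \<open>Fixing the values of the generators of the subalgebra leaves a finite-dimensional algebra.\<close>

lemma module_finite_fibre:
  assumes finite_over: "module_finite (alg S) J" and J': "idl.subspace J'" "J \<subseteq> J'"
    and gen: "\<And>s. s \<in> S \<Longrightarrow> s - cst (eval_poly s v0) \<in> J'"
  shows "module_finite (range cst) J'"
proof -
  obtain n :: nat and u where nu: "\<And>f. \<exists>c. (\<forall>i<n. c i \<in> alg S) \<and> f - (\<Sum>i<n. c i * u i) \<in> J"
    using finite_over unfolding module_finite_def by blast
  have val: "b - cst (eval_poly b v0) \<in> J'" if "b \<in> alg S" for b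
    by (rule alg_minus_value[OF that J'(1) gen])
  have "\<exists>c. (\<forall>i<n. c i \<in> range cst) \<and> f - (\<Sum>i<n. c i * u i) \<in> J'" for f
  proof -
    obtain c where c: "\<And>i. i < n \<Longrightarrow> c i \<in> alg S" "f - (\<Sum>i<n. c i * u i) \<in> J" using nu by blast
    have "(\<Sum>i<n. u i * (c i - cst (eval_poly (c i) v0))) \<in> J'"
      by (intro idl.subspace_sum[OF J'(1)] ideal_mult_left[OF J'(1)] val c) auto
    moreover have "f - (\<Sum>i<n. c i * u i) \<in> J'" using c(2) J'(2) by blast
    ultimately have "f - (\<Sum>i<n. c i * u i) + (\<Sum>i<n. u i * (c i - cst (eval_poly (c i) v0))) \<in> J'"
      using idl.subspace_add[OF J'(1)] by blast
    then have "f - (\<Sum>i<n. cst (eval_poly (c i) v0) * u i) \<in> J'"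
      by (simp add: right_diff_distrib sum_subtractf mult.commute)
    then show ?thesis by (intro exI[of _ "\<lambda>i. cst (eval_poly (c i) v0)"]) auto
  qed
  then show ?thesis unfolding module_finite_def by blast
qed

text \<open>By Nakayama's lemma the fibre over \<open>v\<^sub>0\<close> is a nonzero finite-dimensional algebra, and such an
  algebra has a point over an algebraically closed field.\<close>

lemma lying_over:
  fixes J :: "('k::alg_closed_field, 'n::{finite,linorder}) mpoly set"
  assumes J: "idl.subspace J" and finite_over: "module_finite (alg S) J"
    and vanish: "\<And>b. b \<in> alg S \<Longrightarrow> b \<in> J \<Longrightarrow> eval_poly b v0 = 0"
  obtains v where "v \<in> zeros J" "\<And>b. b \<in> alg S \<Longrightarrow> eval_poly b v = eval_poly b v0"
proof -
  define \<aa> where "\<aa> = {b \<in> alg S. eval_poly b v0 = 0}"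
  define J' where "J' = idl.span (\<aa> \<union> J)"
  have "1 \<notin> J'"
  proof
    assume "1 \<in> J'"
    then obtain a where a: "a \<in> \<aa>" "1 - a \<in> J"
      unfolding J'_def
      using nakayama[OF alg_subring J finite_over, of \<aa>]
      by (auto simp: \<aa>_def eval_poly_simps intro: alg.intros alg_closed)
    then have "eval_poly (1 - a) v0 = 0" by (intro vanish) (auto simp: \<aa>_def alg_closed)
    with a show False by (simp add: \<aa>_def eval_poly_simps)
  qed
  have J': "idl.subspace J'" unfolding J'_def by simp
  have aaJ': "b - cst (eval_poly b v0) \<in> J'" if "b \<in> alg S" for b
  proof -
    have "b - cst (eval_poly b v0) \<in> \<aa>" using that by (simp add: \<aa>_def eval_poly_simps alg_closed alg_cst)
    then show ?thesis unfolding J'_def by (intro idl.span_base) blast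
  qed
  have "module_finite (range cst) J'"
  proof (rule module_finite_fibre[OF finite_over J'])
    show "J \<subseteq> J'" unfolding J'_def by (auto intro: idl.span_base)
  qed (rule aaJ'[OF alg_base])
  then obtain v where v: "v \<in> zeros J'" using finite_dim_ideal_has_zero[OF J' \<open>1 \<notin> J'\<close>] by blast
  show ?thesis
  proof
    show "v \<in> zeros J" using v unfolding zeros_def J'_def by (auto intro: idl.span_base)
    show "eval_poly b v = eval_poly b v0" if "b \<in> alg S" for b
      using v aaJ'[OF that] unfolding zeros_def by (auto simp: eval_poly_simps)
  qed
qed

lemma eval_poly_map_cst: "eval_poly (poly (map_poly cst q) f) v = poly q (eval_poly f v)"
  by (induction q) (auto simp: map_poly_pCons eval_poly_simps)

lemma finite_zeros:
  fixes J :: "('k::field, 'n::{finite,linorder}) mpoly set"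
  assumes J: "idl.subspace J" and finite_over: "module_finite (range cst) J"
  shows "finite (zeros J)"
proof -
  have "\<exists>q. q \<noteq> 0 \<and> (\<forall>v\<in>zeros J. poly q (v $ i) = 0)" for i
  proof -
    obtain p where p: "p \<noteq> 0" "poly_over (range cst) p" "poly p (var i) \<in> J"
      using algebraic_over[OF subring_range_cst J finite_over] by blast
    define q where "q = map_poly (\<lambda>f. Poly_Mapping.lookup f 0) p"
    have pq: "p = map_poly cst q"
    proof (rule poly_eqI)
      fix k
      obtain c where "coeff p k = cst c" using p(2) unfolding poly_over_def by blast
      then show "coeff p k = coeff (map_poly cst q) k" by (simp add: q_def coeff_map_poly)
    qed
    then have "\<forall>v\<in>zeros J. poly q (v $ i) = 0"
      using p(3) eval_poly_map_cst[of q "var i"] unfolding zeros_def by fastforce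
    moreover have "q \<noteq> 0" using p(1) pq by auto
    ultimately show ?thesis by blast
  qed
  then obtain q where q: "\<And>i. q i \<noteq> 0" "\<And>i v. v \<in> zeros J \<Longrightarrow> poly (q i) (v $ i) = 0" by metis
  have "($) ` zeros J \<subseteq> (\<Pi>\<^sub>E i\<in>UNIV. {x. poly (q i) x = 0})" using q(2) by auto
  then have "finite (($) ` zeros J)"
    by (rule finite_subset) (use q(1) in \<open>auto intro!: finite_PiE poly_roots_finite\<close>)
  then show ?thesis by (rule finite_imageD) (auto simp: inj_on_def vec_eq_iff)
qed

text \<open>The ideal \<open>(I : f)\<close> is proper, and \<open>f\<close> is a nonzerodivisor modulo it since \<open>I\<close> is radical.
  After Noether normalization, \<open>f\<close> divides a nonzero element \<open>b\<close> of the polynomial subalgebra modulo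
  \<open>(I : f)\<close>; a point of the zero set lying over one with \<open>b \<noteq> 0\<close> has \<open>f \<noteq> 0\<close>.\<close>

lemma nullstellensatz_form:
  fixes I :: "('k::{alg_closed_field, ring_char_0}, 'n::{finite,linorder}) mpoly set"
  assumes I: "hideal I" "radical_ideal I" and f: "is_form t f" "f \<notin> I"
  obtains v where "v \<in> zeros I" "eval_poly f v \<noteq> 0"
proof -
  note idI = hideal_ideal[OF I(1)]
  define J where "J = colon I f"
  have J: "hideal J" unfolding J_def by (rule hideal_colon[OF I(1) f(1)])
  have "1 \<notin> J" using f(2) by (simp add: J_def mem_colon)
  obtain T where T: "coords T" "card T \<le> card (range var :: ('k, 'n) mpoly set)" "finite_over T J"
      "alg T \<inter> J = {0}" "T \<subseteq> alg (range var)"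
    by (rule noether_normalization[OF coords_vars J \<open>1 \<notin> J\<close> finite_over_vars])
  note mf = coords_module_finite[OF T(1) J T(3)]
  have nzd: "g \<in> J" if "f * g \<in> J" for g
  proof -
    have "g * (f * (f * g)) \<in> I" using that ideal_mult_left[OF idI] by (simp add: J_def mem_colon)
    then have "(f * g) * (f * g) \<in> I" by (simp add: mult_ac)
    from radical_idealD2[OF I(2) this] show ?thesis by (simp only: J_def mem_colon)
  qed
  obtain b r where b: "b \<in> alg T" "b \<noteq> 0" "b - r * f \<in> J"
    using nonzerodivisor_contraction[OF alg_subring hideal_ideal[OF J] mf nzd] by blast
  obtain v0 where v0: "eval_poly b v0 \<noteq> 0" using exists_nonzero_value[OF b(2)] by blast
  have vanish: "eval_poly b v0 = 0" if "b \<in> alg T" "b \<in> J" for b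
  proof -
    have "b \<in> {0}" using that T(4) by blast
    then show ?thesis by simp
  qed
  obtain v where v: "v \<in> zeros J" "\<And>b. b \<in> alg T \<Longrightarrow> eval_poly b v = eval_poly b v0"
    by (rule lying_over[OF hideal_ideal[OF J] mf vanish]) blast+
  show ?thesis
  proof
    show "v \<in> zeros I" using v(1) colon_superset[OF idI, of f] unfolding zeros_def J_def by blast
    have "eval_poly (b - r * f) v = 0" using v(1) b(3) unfolding zeros_def by blast
    then show "eval_poly f v \<noteq> 0" using v(2)[OF b(1)] v0 by (auto simp: eval_poly_simps)
  qed
qed

lemma eval_scale_components:
  obtains p where "\<And>c. eval_poly f (c *s v) = poly p c" "\<And>t. coeff p t = eval_poly (hcomp t f) v"
proof -
  obtain N where N: "f = (\<Sum>t<N. hcomp t f)" "\<And>t. t \<ge> N \<Longrightarrow> hcomp t f = 0" using sum_hcomp[of f] by blast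
  define p where "p = (\<Sum>t<N. monom (eval_poly (hcomp t f) v) t)"
  show ?thesis
  proof
    fix c
    have "eval_poly f (c *s v) = (\<Sum>t<N. eval_poly (hcomp t f) (c *s v))"
      by (subst N(1)) (simp add: eval_poly_sum)
    then show "eval_poly f (c *s v) = poly p c"
      by (simp add: p_def poly_sum poly_monom eval_form_scale[OF is_form_hcomp] mult.commute)
  next
    fix t
    show "coeff p t = eval_poly (hcomp t f) v"
      using N(2)[of t] by (simp add: p_def coeff_sum coeff_monom)
  qed
qed

lemma zeros_scale:
  assumes "hideal I" "v \<in> zeros I" shows "c *s v \<in> zeros I"
proof -
  have "eval_poly f (c *s v) = 0" if f: "f \<in> I" for f
  proof -
    obtain p where p: "\<And>c. eval_poly f (c *s v) = poly p c" "\<And>t. coeff p t = eval_poly (hcomp t f) v"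
      using eval_scale_components by blast
    have "p = 0" using p(2) assms hideal_hcomp[OF assms(1) f] unfolding zeros_def by (intro poly_eqI) auto
    then show ?thesis using p(1) by simp
  qed
  then show ?thesis unfolding zeros_def by blast
qed

lemma nullstellensatz:
  fixes I :: "('k::{alg_closed_field, ring_char_0}, 'n::{finite,linorder}) mpoly set"
  assumes I: "hideal I" "radical_ideal I" and f: "\<And>v. v \<in> zeros I \<Longrightarrow> eval_poly f v = 0"
  shows "f \<in> I"
proof (rule hideal_memI[OF I(1)], rule ccontr)
  fix t assume "hcomp t f \<notin> I"
  then obtain v where v: "v \<in> zeros I" "eval_poly (hcomp t f) v \<noteq> 0"
    using nullstellensatz_form[OF I is_form_hcomp] by blast
  obtain p where p: "\<And>c. eval_poly f (c *s v) = poly p c" "\<And>t. coeff p t = eval_poly (hcomp t f) v"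
    using eval_scale_components by blast
  have "poly p c = 0" for c using f[OF zeros_scale[OF I(1) v(1)]] p(1) by simp
  then have "p = 0" using poly_all_0_iff_0 by blast
  then show False using p(2)[of t] v(2) by simp
qed

section \<open>Projective points, closed sets and dimension\<close>

lemma rep_proj_nonzero: "rep_proj P \<noteq> 0"
  using Quotient_rep_reflp[OF Quotient_proj, of P] by (simp add: proj_rel_def)

lemma proj_eq_iff: "P = Q \<longleftrightarrow> (\<exists>c. rep_proj Q = c *s rep_proj P)"
  using Quotient_rel_rep[OF Quotient_proj, of P Q] rep_proj_nonzero[of P] rep_proj_nonzero[of Q]
  by (auto simp: proj_rel_def)

lemma exists_proj_point:
  assumes "v \<noteq> 0" obtains P c where "c \<noteq> 0" "rep_proj P = c *s v"
proof -
  have "proj_rel v v" using assms by (auto simp: proj_rel_def vec_eq_iff intro!: exI[of _ 1])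
  then have "proj_rel (rep_proj (abs_proj v)) v" using Quotient_rep_abs[OF Quotient_proj] by blast
  then have "proj_rel v (rep_proj (abs_proj v))" by (rule part_equivp_symp[OF part_equivp_proj_rel])
  then obtain c where c: "rep_proj (abs_proj v) = c *s v" "rep_proj (abs_proj v) \<noteq> 0" by (auto simp: proj_rel_def)
  then have "c \<noteq> 0" by auto
  with c that show ?thesis by blast
qed

lemma mem_zero_locus_iff:
  assumes "hideal J" shows "P \<in> zero_locus J \<longleftrightarrow> rep_proj P \<in> zeros J"
proof
  assume P: "P \<in> zero_locus J"
  have "eval_poly f (rep_proj P) = 0" if "f \<in> J" for f
  proof -
    obtain N where N: "f = (\<Sum>t<N. hcomp t f)" using sum_hcomp by blast
    have "eval_poly (hcomp t f) (rep_proj P) = 0" for t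
      using P hideal_hcomp[OF assms that, of t] is_form_hcomp[of t f] unfolding zero_locus_def homogeneous_def by blast
    then have "eval_poly (\<Sum>t<N. hcomp t f) (rep_proj P) = 0" by (simp add: eval_poly_sum)
    then show ?thesis using N by simp
  qed
  then show "rep_proj P \<in> zeros J" by (simp add: zeros_def)
qed (auto simp: zero_locus_def zeros_def)

lemma zeros_point:
  assumes "hideal J" "v \<in> zeros J" "v \<noteq> 0"
  obtains P c where "c \<noteq> 0" "rep_proj P = c *s v" "P \<in> zero_locus J"
  using exists_proj_point[OF assms(3)] zeros_scale[OF assms(1,2)] mem_zero_locus_iff[OF assms(1)] by metis

lemma zero_locus_antimono: "J \<subseteq> K \<Longrightarrow> zero_locus K \<subseteq> zero_locus J"
  by (auto simp: zero_locus_def)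

lemma closedin_zariski_iff: "closedin zariski X \<longleftrightarrow> (\<exists>S. X = zero_locus S)"
proof -
  have "closedin zariski X \<longleftrightarrow> (\<exists>S. - X = - zero_locus S)"
    unfolding closedin_def by (simp add: openin_zariski Compl_eq_Diff_UNIV[symmetric])
  then show ?thesis by simp
qed

lemma closedin_zero_locus: "closedin zariski (zero_locus S)"
  using closedin_zariski_iff by blast

lemma proportional_if_linear_forms_vanish:
  fixes p q :: "'k::field ^ 'n::finite"
  assumes "p \<noteq> 0" "\<And>l. is_form 1 l \<Longrightarrow> eval_poly l p = 0 \<Longrightarrow> eval_poly l q = 0"
  obtains c where "q = c *s p"
proof -
  obtain i where i: "p $ i \<noteq> 0" using assms(1) by (auto simp: vec_eq_iff)
  have "q $ j = (q $ i / p $ i) * p $ j" for j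
  proof -
    have "is_form 1 (cst (p $ i) * var j - cst (p $ j) * var i)"
      by (intro is_form_diff is_form_scale is_form_var)
    from assms(2)[OF this] have "p $ i * q $ j = p $ j * q $ i" by (simp add: eval_poly_simps)
    then show ?thesis using i by (simp add: field_simps)
  qed
  then have "q = (q $ i / p $ i) *s p" unfolding vec_eq_iff vector_smult_component by blast
  with that show ?thesis by blast
qed

lemma closedin_zariski_singleton: "closedin zariski {P}"
proof -
  have "zero_locus {l. is_form 1 l \<and> eval_poly l (rep_proj P) = 0} = {P}"
  proof (intro equalityI subsetI)
    fix Q assume Q: "Q \<in> zero_locus {l. is_form 1 l \<and> eval_poly l (rep_proj P) = 0}"
    obtain c where "rep_proj Q = c *s rep_proj P"
      by (rule proportional_if_linear_forms_vanish[OF rep_proj_nonzero[of P], of "rep_proj Q"])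
         (use Q in \<open>auto simp: zero_locus_def homogeneous_def\<close>)
    then show "Q \<in> {P}" using proj_eq_iff[of P Q] by auto
  qed (auto simp: zero_locus_def)
  then show ?thesis using closedin_zero_locus by metis
qed

lemma irreducible_closed_singleton: "irreducible_closed {P}"
  unfolding irreducible_closed_def
proof (intro conjI allI impI)
  fix A B assume "closedin zariski A \<and> closedin zariski B \<and> {P} = A \<union> B"
  then show "{P} = A \<or> {P} = B" by (metis Un_singleton_iff)
qed (auto simp: closedin_zariski_singleton)

lemma finite_irreducible_closed:
  assumes "irreducible_closed Z" "finite Z" "P \<in> Z" shows "Z = {P}"
proof -
  have "closedin zariski (\<Union>Q\<in>Z - {P}. {Q})"
    using assms(2) closedin_zariski_singleton by (intro closedin_Union) auto
  then have "closedin zariski (Z - {P})" by simp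
  moreover have "Z = {P} \<union> (Z - {P})" using assms(3) by blast
  ultimately have "Z = {P} \<or> Z = Z - {P}"
    using assms(1) closedin_zariski_singleton[of P] unfolding irreducible_closed_def by blast
  then show ?thesis using assms(3) by blast
qed

lemma zariski_dim_singleton: "zariski_dim {P} = 0"
proof -
  have zero: "r = 0" if "\<forall>i\<le>r. irreducible_closed (Z i) \<and> Z i \<subseteq> {P}" "\<forall>i<r. Z i \<subset> Z (Suc i)" for r and Z :: "nat \<Rightarrow> ('a, 'b) proj set"
  proof (rule ccontr)
    assume "r \<noteq> 0"
    then have "Z 0 \<noteq> {}" "Z 0 \<subset> Z (Suc 0)" "Z (Suc 0) \<subseteq> {P}"
      using that unfolding irreducible_closed_def by auto
    then show False by auto
  qed
  have "zariski_dim {P} \<le> 0"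
    unfolding zariski_dim_def
  proof (rule Sup_least, elim CollectE exE conjE)
    fix x r and Z :: "nat \<Rightarrow> ('a, 'b) proj set"
    assume "x = enat r" "\<forall>i\<le>r. irreducible_closed (Z i) \<and> Z i \<subseteq> {P}" "\<forall>i<r. Z i \<subset> Z (Suc i)"
    then show "x \<le> 0" using zero by (simp add: zero_enat_def)
  qed
  then show ?thesis by simp
qed

lemma zariski_dim_empty: "zariski_dim {} = 0"
proof -
  have "{enat r |r. \<exists>Z :: nat \<Rightarrow> ('a, 'b) proj set. (\<forall>i\<le>r. irreducible_closed (Z i) \<and> Z i \<subseteq> {}) \<and> (\<forall>i<r. Z i \<subset> Z (Suc i))} = {}"
    unfolding irreducible_closed_def by force
  then show ?thesis unfolding zariski_dim_def by (simp add: Sup_enat_def)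
qed

lemma zariski_dim_mono: "X \<subseteq> Y \<Longrightarrow> zariski_dim X \<le> zariski_dim Y"
  unfolding zariski_dim_def by (rule Sup_subset_mono) blast

lemma zariski_dim_ge_2:
  assumes "irreducible_closed A" "irreducible_closed B" "irreducible_closed C"
    "A \<subset> B" "B \<subset> C" "C \<subseteq> X"
  shows "2 \<le> zariski_dim X"
proof -
  define Z where "Z i = (if i = 0 then A else if i = 1 then B else C)" for i :: nat
  have "(\<forall>i\<le>2. irreducible_closed (Z i) \<and> Z i \<subseteq> X) \<and> (\<forall>i<2. Z i \<subset> Z (Suc i))"
    using assms unfolding Z_def by (auto simp: less_2_cases_iff)
  then have "enat 2 \<le> zariski_dim X" unfolding zariski_dim_def by (intro Sup_upper) blast
  then show ?thesis by (simp add: numeral_eq_enat)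
qed


section \<open>Homogeneous prime ideals\<close>

lemma lowest_component:
  assumes "hideal J" "f \<notin> J"
  obtains j where "hcomp j f \<notin> J" "\<And>i. i < j \<Longrightarrow> hcomp i f \<in> J"
proof -
  have "\<exists>j. hcomp j f \<notin> J" using hideal_memI[OF assms(1)] assms(2) by blast
  then obtain j where "hcomp j f \<notin> J" "\<forall>i<j. \<not> hcomp i f \<notin> J"
    using exists_least_iff[of "\<lambda>j. hcomp j f \<notin> J"] by blast
  then show ?thesis using that by blast
qed

lemma hcomp_mult_lowest:
  assumes J: "hideal J" and g: "\<And>b. b < j \<Longrightarrow> hcomp b g \<in> J"
    and f': "\<And>a b. a < i \<Longrightarrow> hcomp a f * hcomp b g \<in> J" and fg: "f * g \<in> J"
  shows "hcomp i f * hcomp j g \<in> J"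
proof -
  note idJ = hideal_ideal[OF J]
  have "hcomp (i + j) (f * g) \<in> J" using hideal_hcomp[OF J fg] .
  moreover have "hcomp (i + j) (f * g) = hcomp i f * hcomp j g + (\<Sum>a\<in>{..i + j} - {i}. hcomp a f * hcomp (i + j - a) g)"
    unfolding hcomp_mult by (subst sum.remove[of _ i]) auto
  moreover have "(\<Sum>a\<in>{..i + j} - {i}. hcomp a f * hcomp (i + j - a) g) \<in> J"
  proof (rule idl.subspace_sum[OF idJ])
    fix a assume "a \<in> {..i + j} - {i}"
    then consider "a < i" | "i + j - a < j" by force
    then show "hcomp a f * hcomp (i + j - a) g \<in> J"
      by cases (use f' g ideal_mult_left[OF idJ] in auto)
  qed
  ultimately have "hcomp i f * hcomp j g + (\<Sum>a\<in>{..i + j} - {i}. hcomp a f * hcomp (i + j - a) g)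
      - (\<Sum>a\<in>{..i + j} - {i}. hcomp a f * hcomp (i + j - a) g) \<in> J"
    by (intro idl.subspace_diff[OF idJ]) simp_all
  then show ?thesis by simp
qed

lemma prime_ideal_radical: "prime_ideal M \<Longrightarrow> radical_ideal M"
  unfolding radical_ideal_def
proof (intro conjI allI impI)
  assume M: "prime_ideal M"
  then show "idl.subspace M" by (simp add: prime_ideal_def)
  fix f k assume "f ^ k \<in> M"
  then show "f \<in> M" by (induction k) (use M in \<open>auto simp: prime_ideal_def\<close>)
qed

text \<open>An ideal that is maximal among the homogeneous ideals that meet the subalgebra only in \<open>0\<close>.
  Comparing lowest components reduces primality to forms.\<close>

lemma prime_avoiding_subalgebra:
  fixes J :: "('k::field, 'n::{finite,linorder}) mpoly set"
  assumes J: "hideal J" "alg S \<inter> J = {0}"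
  obtains M where "J \<subseteq> M" "hideal M" "prime_ideal M" "alg S \<inter> M = {0}"
proof -
  obtain M where M: "J \<subseteq> M" "hideal M" "M \<inter> (alg S - {0}) = {}"
    "\<And>N. hideal N \<Longrightarrow> M \<subset> N \<Longrightarrow> N \<inter> (alg S - {0}) \<noteq> {}"
  proof (rule maximal_avoiding_ideal[of hideal J "alg S - {0}"])
    fix \<C> :: "('k, 'n) mpoly set set" assume C: "\<C> \<noteq> {}" "subset.chain (Collect hideal) \<C>"
    have "idl.subspace (\<Union>\<C>)" using ideal_chain_Union[OF C(2,1)] hideal_ideal by blast
    moreover have "hcomp t f \<in> \<Union>\<C>" if f: "f \<in> \<Union>\<C>" for f t
    proof -
      obtain K where K: "K \<in> \<C>" "f \<in> K" using f by blast
      then have "hideal K" using C(2) unfolding subset.chain_def by blast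
      then have "hcomp t f \<in> K" using K(2) by (rule hideal_hcomp)
      then show ?thesis using K(1) by blast
    qed
    ultimately show "hideal (\<Union>\<C>)" by (simp add: hideal_def)
  qed (use J hideal_ideal in blast)+
  note idM = hideal_ideal[OF M(2)]
  have one: "1 \<notin> M" using M(3) alg_closed(2)[of S] by auto
  have forms: "f \<in> M \<or> g \<in> M" if f: "is_form s f" and g: "is_form t g" and fg: "f * g \<in> M" for f g s t
  proof (rule ccontr)
    assume neg: "\<not> (f \<in> M \<or> g \<in> M)"
    have ex: "\<exists>b k. b \<in> alg S \<and> b \<noteq> 0 \<and> b - k * h \<in> M" if h: "is_form u h" "h \<notin> M" for h u
    proof -
      have "hideal (idl.span ({h} \<union> M))"
        using h(1) by (intro hideal_span_forms M(2)) (auto simp: homogeneous_def)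
      moreover have "M \<subset> idl.span ({h} \<union> M)" using h(2) idl.span_superset[of "{h} \<union> M"] by blast
      ultimately obtain b where "b \<in> idl.span (insert h M)" "b \<in> alg S" "b \<noteq> 0" using M(4) by auto
      then show ?thesis using mem_span_insert_ideal[OF idM] by blast
    qed
    obtain b k where b: "b \<in> alg S" "b \<noteq> 0" "b - k * f \<in> M" using ex[OF f] neg by blast
    obtain b' k' where b': "b' \<in> alg S" "b' \<noteq> 0" "b' - k' * g \<in> M" using ex[OF g] neg by blast
    have "b' * (b - k * f) + (k * f) * (b' - k' * g) + (k * k') * (f * g) \<in> M"
      by (rule idl.subspace_add[OF idM idl.subspace_add[OF idM ideal_mult_left[OF idM b(3)]
            ideal_mult_left[OF idM b'(3)]] ideal_mult_left[OF idM fg]])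
    then have "b' * b \<in> M" by (simp add: algebra_simps)
    moreover have "b' * b \<in> alg S" "b' * b \<noteq> 0" using b b' by (auto intro: alg_closed)
    ultimately show False using M(3) by blast
  qed
  have "f \<in> M \<or> g \<in> M" if fg: "f * g \<in> M" for f g
  proof (rule ccontr)
    assume neg: "\<not> (f \<in> M \<or> g \<in> M)"
    obtain i where i: "hcomp i f \<notin> M" "\<And>a. a < i \<Longrightarrow> hcomp a f \<in> M" using lowest_component[OF M(2)] neg by blast
    obtain j where j: "hcomp j g \<notin> M" "\<And>a. a < j \<Longrightarrow> hcomp a g \<in> M" using lowest_component[OF M(2)] neg by blast
    have "hcomp i f * hcomp j g \<in> M"
      by (rule hcomp_mult_lowest[OF M(2) j(2) _ fg])
         (use i(2) ideal_mult_right[OF idM] in auto)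
    then show False using forms[OF is_form_hcomp is_form_hcomp] i(1) j(1) by blast
  qed
  then have "prime_ideal M" using idM one unfolding prime_ideal_def by blast
  moreover have "alg S \<inter> M = {0}" using M(3) alg_closed(1)[of S] idl.subspace_0[OF idM] by blast
  ultimately show ?thesis using that M by blast
qed

lemma irreducible_zero_locus_prime:
  fixes M :: "('k::{alg_closed_field, ring_char_0}, 'n::{finite,linorder}) mpoly set"
  assumes M: "hideal M" "prime_ideal M" and ne: "zero_locus M \<noteq> {}"
  shows "irreducible_closed (zero_locus M)"
  unfolding irreducible_closed_def
proof (intro conjI allI impI)
  fix A B assume AB: "closedin zariski A \<and> closedin zariski B \<and> zero_locus M = A \<union> B"
  then obtain S T where ST: "A = zero_locus S" "B = zero_locus T" using closedin_zariski_iff by metis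
  show "zero_locus M = A \<or> zero_locus M = B"
  proof (rule ccontr)
    assume "\<not> ?thesis"
    then obtain P Q where PQ: "P \<in> zero_locus M" "P \<notin> A" "Q \<in> zero_locus M" "Q \<notin> B" using AB by blast
    obtain f where f: "f \<in> S" "homogeneous f" "eval_poly f (rep_proj P) \<noteq> 0"
      using PQ(2) unfolding ST zero_locus_def by blast
    obtain g where g: "g \<in> T" "homogeneous g" "eval_poly g (rep_proj Q) \<noteq> 0"
      using PQ(4) unfolding ST zero_locus_def by blast
    have "f \<notin> M" "g \<notin> M" using f g PQ(1,3) unfolding zero_locus_def by blast+
    then have "f * g \<notin> M" using M(2) unfolding prime_ideal_def by blast
    obtain t where t: "is_form t (f * g)" using homogeneous_mult[OF f(2) g(2)] unfolding homogeneous_def by blast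
    have vanish: "eval_poly (f * g) (rep_proj R) = 0" if "R \<in> zero_locus M" for R
      using that f g AB unfolding ST by (auto simp: zero_locus_def eval_poly_mult)
    obtain v where v: "v \<in> zeros M" "eval_poly (f * g) v \<noteq> 0"
      by (rule nullstellensatz_form[OF M(1) prime_ideal_radical[OF M(2)] t \<open>f * g \<notin> M\<close>])
    show False
    proof (cases "v = 0")
      case True
      then have "t = 0" using eval_form_zero[OF t] v(2) by auto
      then obtain c where "f * g = cst c" using form_zero_eq_cst t by blast
      then show False using vanish[OF PQ(1)] v(2) by simp
    next
      case False
      obtain R c where R: "c \<noteq> 0" "rep_proj R = c *s v" "R \<in> zero_locus M"
        by (rule zeros_point[OF M(1) v(1) False])
      then show False using vanish[OF R(3)] v(2) eval_form_scale[OF t, of c v] by simp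
    qed
  qed
qed (use ne closedin_zero_locus in auto)

text \<open>Cutting with one coordinate hyperplane lowers the dimension of the image by one: by lying over,
  the cut still projects onto the hyperplane.\<close>

lemma prime_in_hyperplane:
  fixes M :: "('k::{alg_closed_field, ring_char_0}, 'n::{finite,linorder}) mpoly set"
  assumes S: "coords S" "y \<in> S" and M: "hideal M" "finite_over S M" "alg S \<inter> M = {0}"
  obtains M' where "M \<subseteq> M'" "y \<in> M'" "hideal M'" "prime_ideal M'" "alg (S - {y}) \<inter> M' = {0}" "finite_over (S - {y}) M'"
proof -
  let ?T = "S - {y}"
  define J where "J = idl.span ({y} \<union> M)"
  have J: "hideal J" unfolding J_def
    using coords_form[OF S] M(1) by (intro hideal_span_forms) (auto simp: homogeneous_def)
  have "b = 0" if b: "b \<in> alg ?T" "b \<in> J" for b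
  proof (rule ccontr)
    assume "b \<noteq> 0"
    then obtain w where w: "eval_poly b w \<noteq> 0" using exists_nonzero_value by blast
    obtain e where e: "eval_poly y e = 1" "\<And>t. t \<in> ?T \<Longrightarrow> eval_poly t e = 0" using coords_dual[OF S] by blast
    define w' where "w' = w - eval_poly y w *s e"
    have y: "eval_poly y w' = 0"
      unfolding w'_def using e(1) eval_linear_form[OF coords_form[OF S]] by simp
    have bw': "eval_poly b w' = eval_poly b w"
    proof (rule eval_alg_cong[OF b(1)])
      fix s assume s: "s \<in> ?T"
      then have "is_form 1 s" using coords_form[OF S(1)] by blast
      then show "eval_poly s w' = eval_poly s w"
        unfolding w'_def using e(2)[OF s] eval_linear_form[of s] by simp
    qed
    have vanish: "eval_poly c w' = 0" if "c \<in> alg S" "c \<in> M" for c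
    proof -
      have "c \<in> {0}" using that M(3) by blast
      then show ?thesis by simp
    qed
    obtain v where v: "v \<in> zeros M" "\<And>c. c \<in> alg S \<Longrightarrow> eval_poly c v = eval_poly c w'"
      by (rule lying_over[OF hideal_ideal[OF M(1)] coords_module_finite[OF S(1) M(1,2)] vanish]) blast+
    have "y \<in> alg S" "b \<in> alg S" using S(2) b(1) alg_mono[of ?T S] by (auto intro: alg_base)
    then have yv: "eval_poly y v = 0" and bv: "eval_poly b v \<noteq> 0" using v(2) y bw' w by auto
    obtain k where "b - k * y \<in> M"
      using b(2) mem_span_insert_ideal[OF hideal_ideal[OF M(1)], of b y] unfolding J_def by auto
    then have "eval_poly (b - k * y) v = 0" using v(1) unfolding zeros_def by blast
    with yv bv show False by (simp add: eval_poly_simps)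
  qed
  then have "alg ?T \<inter> J = {0}" using alg_closed(1)[of ?T] idl.subspace_0[OF hideal_ideal[OF J]] by blast
  then obtain M' where M': "J \<subseteq> M'" "hideal M'" "prime_ideal M'" "alg ?T \<inter> M' = {0}"
    by (rule prime_avoiding_subalgebra[OF J])
  have sub: "{y} \<union> M \<subseteq> M'" using M'(1) idl.span_superset[of "{y} \<union> M"] unfolding J_def by blast
  have "finite_over ?T M'"
    by (rule finite_over_trans[OF M(2)]) (use sub in \<open>auto intro: idl.span_base\<close>)
  then show ?thesis using that M' sub by blast
qed

text \<open>Three independent parameters give a chain of primes, cut out by successive parameters, and their zero
  loci are irreducible and strictly decreasing. In this way the bound on the topological dimension becomes
  a bound on the number of parameters.\<close>

lemma three_coords_imp_dim_ge_2:
  fixes J :: "('k::{alg_closed_field, ring_char_0}, 'n::{finite,linorder}) mpoly set"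
  assumes S: "coords S" and J: "hideal J" "finite_over S J" "alg S \<inter> J = {0}" and card: "3 \<le> card S"
  shows "2 \<le> zariski_dim (zero_locus J)"
proof -
  obtain A where "A \<subseteq> S" "card A = 3" using card obtain_subset_with_card_n by metis
  then obtain y1 y2 y3 where y: "y1 \<in> S" "y2 \<in> S" "y3 \<in> S" "y1 \<noteq> y2" "y1 \<noteq> y3" "y2 \<noteq> y3"
    by (auto simp: card_3_iff)
  obtain M2 where M2: "J \<subseteq> M2" "hideal M2" "prime_ideal M2" "alg S \<inter> M2 = {0}"
    by (rule prime_avoiding_subalgebra[OF J(1,3)])
  have fin2: "finite_over S M2" by (rule finite_over_mono[OF J(2) _ M2(1)]) simp
  obtain M1 where M1: "M2 \<subseteq> M1" "y1 \<in> M1" "hideal M1" "prime_ideal M1" "alg (S - {y1}) \<inter> M1 = {0}" "finite_over (S - {y1}) M1"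
    by (rule prime_in_hyperplane[OF S y(1) M2(2) fin2 M2(4)])
  have S': "coords (S - {y1})" by (rule coords_subset[OF S]) blast
  have "y2 \<in> S - {y1}" using y by blast
  then obtain M0 where M0: "M1 \<subseteq> M0" "y2 \<in> M0" "hideal M0" "prime_ideal M0" "alg (S - {y1} - {y2}) \<inter> M0 = {0}"
      "finite_over (S - {y1} - {y2}) M0"
    by (rule prime_in_hyperplane[OF S' _ M1(3,6,5)])
  have sep: "\<exists>P \<in> zero_locus M. eval_poly y (rep_proj P) \<noteq> 0"
    if M: "hideal M" "prime_ideal M" "alg T \<inter> M = {0}" and T: "y \<in> T" "T \<subseteq> S" for M y T
  proof -
    have yS: "y \<in> S" using T by blast
    then have y: "is_form 1 y" by (rule coords_form[OF S])
    obtain e where "eval_poly y e = 1" using coords_dual[OF S yS] by blast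
    then have "y \<noteq> 0" by auto
    then have "y \<notin> M" using M(3) T(1) alg_base[of y T] by blast
    then obtain v where v: "v \<in> zeros M" "eval_poly y v \<noteq> 0"
      by (rule nullstellensatz_form[OF M(1) prime_ideal_radical[OF M(2)] y])
    then have "v \<noteq> 0" using eval_linear_form(4)[OF y] by auto
    then obtain P c where "c \<noteq> 0" "rep_proj P = c *s v" "P \<in> zero_locus M" by (rule zeros_point[OF M(1) v(1)])
    then show ?thesis using v(2) eval_linear_form(2)[OF y] by (intro bexI[of _ P]) auto
  qed
  have vanish: "eval_poly f (rep_proj P) = 0" if "hideal M" "f \<in> M" "P \<in> zero_locus M" for f M P
    using that mem_zero_locus_iff[OF that(1)] unfolding zeros_def by blast
  have irr: "irreducible_closed (zero_locus M0)" "irreducible_closed (zero_locus M1)" "irreducible_closed (zero_locus M2)"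
    using irreducible_zero_locus_prime[OF M0(3,4)] irreducible_zero_locus_prime[OF M1(3,4)] irreducible_zero_locus_prime[OF M2(2,3)]
      sep[OF M0(3,4,5), of y3] sep[OF M1(3,4,5), of y3] sep[OF M2(2,3,4), of y3] y by blast+
  have "zero_locus M0 \<subset> zero_locus M1"
    using zero_locus_antimono[OF M0(1)] sep[OF M1(3,4,5) \<open>y2 \<in> S - {y1}\<close>] vanish[OF M0(3,2)] by blast
  moreover have "zero_locus M1 \<subset> zero_locus M2"
    using zero_locus_antimono[OF M1(1)] sep[OF M2(2,3,4) y(1)] vanish[OF M1(3,2)] by blast
  moreover have "zero_locus M2 \<subseteq> zero_locus J" by (rule zero_locus_antimono[OF M2(1)])
  ultimately show ?thesis using zariski_dim_ge_2[OF irr] by blast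
qed

section \<open>Unmixed ideals of dimension two\<close>

text \<open>Every nonzero form of the quotient generates a module of dimension at least two, so one linear
  form is never a system of parameters for it.\<close>

definition unmixed :: "('k::field, 'n::finite) mpoly set \<Rightarrow> bool" where
  "unmixed J \<longleftrightarrow> (\<forall>t f y. is_form t f \<longrightarrow> f \<notin> J \<longrightarrow> is_form 1 y \<longrightarrow> \<not> finite_over {y} (colon J f))"

definition curve_ideal :: "('k::field, 'n::finite) mpoly set \<Rightarrow> bool" where
  "curve_ideal J \<longleftrightarrow> hideal J \<and> radical_ideal J \<and> 1 \<notin> J \<and> unmixed J \<and> zariski_dim (zero_locus J) \<le> 1"

lemma finite_over_coord_nonzero:
  assumes "finite_over S J" "v \<in> zeros J" "\<And>s. s \<in> S \<Longrightarrow> eval_poly s v = 0" shows "v = 0"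
proof -
  have "v $ i = 0" for i
  proof -
    obtain N where "var i ^ N \<in> idl.span (S \<union> J)" using assms(1) unfolding finite_over_def by blast
    then have "eval_poly (var i ^ N) v = 0"
      by (induction rule: idl.span_induct_alt)
         (use assms(2,3) in \<open>auto simp: eval_poly_add eval_poly_mult zeros_def\<close>)
    then show ?thesis by (simp add: eval_poly_power)
  qed
  then show ?thesis by (simp add: vec_eq_iff)
qed

text \<open>Every point has a representative with \<open>y = 1\<close>, and the fibre over \<open>y = 1\<close> is finite.\<close>

lemma finite_zero_locus:
  fixes J :: "('k::field, 'n::{finite,linorder}) mpoly set"
  assumes J: "hideal J" and y: "is_form 1 y" and finite_over: "finite_over {y} J"
  shows "finite (zero_locus J)"
proof -
  have mf: "module_finite (alg {y}) J" by (rule finite_over_imp_module_finite) (use assms in auto)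
  define J' where "J' = idl.span (insert (y - 1) J)"
  define V where "V = {v \<in> zeros J. eval_poly y v = 1}"
  define g where "g P = inverse (eval_poly y (rep_proj P)) *s rep_proj P" for P
  have nz: "eval_poly y (rep_proj P) \<noteq> 0" if "P \<in> zero_locus J" for P
    using finite_over_coord_nonzero[OF finite_over, of "rep_proj P"] that mem_zero_locus_iff[OF J] rep_proj_nonzero by blast
  have gV: "g P \<in> V" if "P \<in> zero_locus J" for P
    using nz[OF that] zeros_scale[OF J] that mem_zero_locus_iff[OF J, of P]
    by (simp add: V_def g_def eval_linear_form(2)[OF y])
  have "finite V"
  proof (cases "V = {}")
    case False
    then obtain v0 where v0: "v0 \<in> V" by blast
    have "module_finite (range cst) J'"
    proof (rule module_finite_fibre[OF mf, of J' v0])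
      show "s - cst (eval_poly s v0) \<in> J'" if "s \<in> {y}" for s
        using that v0 by (auto simp: V_def J'_def cst_one intro: idl.span_base)
    qed (auto simp: J'_def intro: idl.span_base)
    then have "finite (zeros J')" by (rule finite_zeros[rotated]) (simp add: J'_def)
    moreover have "V \<subseteq> zeros J'"
    proof
      fix v assume v: "v \<in> V"
      have "eval_poly f v = 0" if "f \<in> J'" for f
        using that unfolding J'_def
        by (induction rule: idl.span_induct_alt)
           (use v in \<open>auto simp: eval_poly_simps V_def zeros_def\<close>)
      then show "v \<in> zeros J'" by (simp add: zeros_def)
    qed
    ultimately show ?thesis using finite_subset by blast
  qed simp
  then have "finite (g ` zero_locus J)" using gV by (meson finite_subset image_subsetI)
  moreover have "inj_on g (zero_locus J)"
  proof (rule inj_onI)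
    fix P Q assume PQ: "P \<in> zero_locus J" "Q \<in> zero_locus J" "g P = g Q"
    have "rep_proj Q = eval_poly y (rep_proj Q) *s g Q" using nz[OF PQ(2)] by (simp add: g_def)
    also have "\<dots> = (eval_poly y (rep_proj Q) * inverse (eval_poly y (rep_proj P))) *s rep_proj P"
      unfolding PQ(3)[symmetric] by (simp add: g_def)
    finally show "P = Q" using proj_eq_iff by blast
  qed
  ultimately show ?thesis by (rule finite_imageD)
qed

text \<open>If a nonzero form \<open>f\<close> of the quotient generated a module of dimension one, a point with
  \<open>f \<noteq> 0\<close> would be an isolated point, hence an irreducible component of dimension zero.\<close>

lemma unmixed_if_equidimensional:
  fixes I :: "('k::{alg_closed_field, ring_char_0}, 'n::{finite,linorder}) mpoly set"
  assumes I: "hideal I" "radical_ideal I" and dim: "zariski_dim (zero_locus I) = 1" and eq: "equidimensional I"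
  shows "unmixed I"
  unfolding unmixed_def
proof (intro allI impI notI)
  fix t f y assume f: "is_form t f" "f \<notin> I" and y: "is_form 1 y" and finite_over: "finite_over {y} (colon I f)"
  have J: "hideal (colon I f)" by (rule hideal_colon[OF I(1) f(1)])
  obtain v where v: "v \<in> zeros I" "eval_poly f v \<noteq> 0" by (rule nullstellensatz_form[OF I f])
  have "\<exists>P\<in>zero_locus I. eval_poly f (rep_proj P) \<noteq> 0"
  proof (cases "v = 0")
    case True
    then have "t = 0" using eval_form_zero[OF f(1)] v(2) by auto
    then obtain c where "f = cst c" using form_zero_eq_cst f(1) by blast
    moreover have "zero_locus I \<noteq> {}" using dim zariski_dim_empty[where 'a='k and 'b='n] by auto
    ultimately show ?thesis using v(2) by auto
  next
    case False
    then obtain P c where "c \<noteq> 0" "rep_proj P = c *s v" "P \<in> zero_locus I" by (rule zeros_point[OF I(1) v(1)])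
    then show ?thesis using v(2) eval_form_scale[OF f(1), of c v] by (intro bexI[of _ P]) auto
  qed
  then obtain P where P: "P \<in> zero_locus I" "eval_poly f (rep_proj P) \<noteq> 0" by blast
  have hom: "homogeneous f" using f(1) by (auto simp: homogeneous_def)
  have "Y = {P}" if Y: "irreducible_closed Y" "{P} \<subseteq> Y" "Y \<subseteq> zero_locus I" for Y
  proof -
    have cl: "closedin zariski (Y \<inter> zero_locus {f})" "closedin zariski (Y \<inter> zero_locus (colon I f))"
      using Y(1) closedin_zero_locus unfolding irreducible_closed_def by blast+
    have "Q \<in> zero_locus {f} \<union> zero_locus (colon I f)" if "Q \<in> Y" for Q
    proof -
      have "eval_poly f (rep_proj Q) * eval_poly a (rep_proj Q) = 0" if "a \<in> colon I f" for a
        using that Y(3) \<open>Q \<in> Y\<close> mem_zero_locus_iff[OF I(1), of Q]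
        by (auto simp: mem_colon zeros_def simp flip: eval_poly_mult)
      then show ?thesis by (auto simp: zero_locus_def)
    qed
    then have "Y = (Y \<inter> zero_locus {f}) \<union> (Y \<inter> zero_locus (colon I f))" by blast
    then have "Y = Y \<inter> zero_locus {f} \<or> Y = Y \<inter> zero_locus (colon I f)"
      using Y(1) cl unfolding irreducible_closed_def by blast
    moreover have "P \<notin> zero_locus {f}" using P(2) hom by (auto simp: zero_locus_def)
    ultimately have "Y \<subseteq> zero_locus (colon I f)" using Y(2) by blast
    then have "finite Y" using finite_zero_locus[OF J y finite_over] finite_subset by blast
    then show ?thesis using finite_irreducible_closed[OF Y(1)] Y(2) by blast
  qed
  then have "irreducible_component {P} (zero_locus I)"
    unfolding irreducible_component_def using P(1) irreducible_closed_singleton by blast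
  then have "zariski_dim {P} = 1" using eq dim unfolding equidimensional_def by metis
  then show False by (simp add: zariski_dim_singleton)
qed

lemma curve_ideal_if_curve:
  fixes C :: "('k::{alg_closed_field, ring_char_0}, 'n::{finite,linorder}) mpoly set"
  assumes "closed_subscheme C" "is_curve C" "is_reduced C" "equidimensional C"
  shows "curve_ideal C"
proof -
  have C: "hideal C" using assms(1) homogeneous_ideal_imp_hideal by (auto simp: closed_subscheme_def)
  have rad: "radical_ideal C" using assms(3) hideal_ideal[OF C] unfolding radical_ideal_def is_reduced_def by blast
  have dim: "zariski_dim (zero_locus C) = 1" using assms(2) by (simp add: is_curve_def)
  have "1 \<notin> C"
  proof
    assume "1 \<in> C"
    then have "zeros C = {}" by (force simp: zeros_def)
    then have "zero_locus C = {}" using mem_zero_locus_iff[OF C] by blast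
    then show False using dim zariski_dim_empty[where 'a='k and 'b='n] by simp
  qed
  then show ?thesis
    using C rad dim unmixed_if_equidimensional[OF C rad dim assms(4)] by (simp add: curve_ideal_def)
qed

lemma curve_idealD:
  assumes "curve_ideal J"
  shows "hideal J" "radical_ideal J" "1 \<notin> J" "unmixed J" "idl.subspace J"
  using assms hideal_ideal by (auto simp: curve_ideal_def)

lemma curve_ideal_colon:
  fixes J :: "('k::field, 'n::finite) mpoly set"
  assumes J: "curve_ideal J" and s: "is_form n s" "s \<notin> J"
  shows "curve_ideal (colon J s)"
proof -
  note D = curve_idealD[OF J]
  have "unmixed (colon J s)"
    unfolding unmixed_def
  proof (intro allI impI)
    fix t and f y :: "('k, 'n) mpoly" assume f: "is_form t f" "f \<notin> colon J s" "is_form 1 y"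
    have "colon (colon J s) f = colon J (s * f)" by (auto simp: mem_colon mult.assoc)
    moreover have "\<not> finite_over {y} (colon J (s * f))"
      using D(4) is_form_mult[OF s(1) f(1)] f(2,3) unfolding unmixed_def mem_colon by blast
    ultimately show "\<not> finite_over {y} (colon (colon J s) f)" by simp
  qed
  moreover have "zariski_dim (zero_locus (colon J s)) \<le> 1"
    using zariski_dim_mono[OF zero_locus_antimono[OF colon_superset[OF D(5), of s]]] J
    unfolding curve_ideal_def by (meson order_trans)
  ultimately show ?thesis
    using D s by (auto simp: curve_ideal_def mem_colon intro: hideal_colon radical_colon)
qed

lemma finite_over_card_ge_2:
  fixes J :: "('k::field, 'n::finite) mpoly set"
  assumes J: "unmixed J" "1 \<notin> J" and T: "coords T" "finite_over T J"
  shows "2 \<le> card T"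
proof (rule ccontr)
  assume "\<not> ?thesis"
  then have "card T = 0 \<or> card T = 1" by linarith
  then obtain y where y: "is_form 1 y" "T \<subseteq> {y}"
    using T(1) is_form_var coords_form[OF T(1)] coords_finite[OF T(1)]
    by (metis card_0_eq card_1_singletonE empty_subsetI insertI1 order_refl)
  have "finite_over {y} J" by (rule finite_over_mono[OF T(2) y(2)]) simp
  moreover have "colon J 1 = J" by (auto simp: mem_colon)
  ultimately show False using J is_form_one y(1) unfolding unmixed_def by metis
qed

lemma curve_normalization_card:
  fixes J :: "('k::{alg_closed_field, ring_char_0}, 'n::{finite,linorder}) mpoly set"
  assumes J: "curve_ideal J" and T: "coords T" "finite_over T J" "alg T \<inter> J = {0}"
  shows "card T = 2"
proof -
  have "\<not> 3 \<le> card T"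
  proof
    assume "3 \<le> card T"
    then have "2 \<le> zariski_dim (zero_locus J)"
      by (rule three_coords_imp_dim_ge_2[OF T(1) curve_idealD(1)[OF J] T(2,3)])
    then have "(2 :: enat) \<le> 1" using J unfolding curve_ideal_def by (meson order_trans)
    then show False by (simp add: numeral_eq_enat one_enat_def)
  qed
  then show ?thesis using finite_over_card_ge_2[OF curve_idealD(4,3)[OF J] T(1,2)] by linarith
qed


section \<open>Binary forms\<close>

text \<open>The homogenization, of degree \<open>n\<close>, of a univariate polynomial.\<close>

definition bform :: "('k::field, 'n::finite) mpoly \<Rightarrow> ('k, 'n) mpoly \<Rightarrow> nat \<Rightarrow> 'k poly \<Rightarrow> ('k, 'n) mpoly" where
  "bform x y n q = (\<Sum>k\<le>n. cst (coeff q k) * (x ^ k * y ^ (n - k)))"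

lemma bform_zero [simp]: "bform x y n 0 = 0"
  by (simp add: bform_def)

lemma bform_add: "bform x y n (p + q) = bform x y n p + bform x y n q"
  by (simp add: bform_def cst_add distrib_right sum.distrib)

lemma bform_smult: "bform x y n (smult c q) = cst c * bform x y n q"
  by (simp add: bform_def cst_mult sum_distrib_left mult.assoc del: mult_single)

lemma bform_sum: "bform x y n (sum p A) = (\<Sum>i\<in>A. bform x y n (p i))"
  by (induction A rule: infinite_finite_induct) (auto simp: bform_add)

lemma bform_pCons: "bform x y (Suc n) (pCons a q) = cst a * y ^ Suc n + x * bform x y n q"
  unfolding bform_def by (subst sum.atMost_Suc_shift) (simp add: sum_distrib_left mult_ac)

lemma bform_shift:
  assumes "degree r \<le> j" shows "bform x y (m + j) r = y ^ m * bform x y j r"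
proof -
  have "bform x y (m + j) r = (\<Sum>k\<le>j. cst (coeff r k) * (x ^ k * y ^ (m + j - k)))"
    unfolding bform_def
    by (rule sum.mono_neutral_right) (use assms in \<open>auto simp: coeff_eq_0\<close>)
  also have "\<dots> = (\<Sum>k\<le>j. y ^ m * (cst (coeff r k) * (x ^ k * y ^ (j - k))))"
  proof (rule sum.cong[OF refl])
    fix k assume "k \<in> {..j}"
    then have "m + j - k = m + (j - k)" by simp
    then have "y ^ (m + j - k) = y ^ m * y ^ (j - k)" by (simp only: power_add)
    then show "cst (coeff r k) * (x ^ k * y ^ (m + j - k)) = y ^ m * (cst (coeff r k) * (x ^ k * y ^ (j - k)))"
      by (simp only: mult_ac)
  qed
  finally show ?thesis by (simp add: bform_def sum_distrib_left)
qed

lemma bform_mult: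
  assumes "degree q \<le> i" "degree r \<le> j"
  shows "bform x y i q * bform x y j r = bform x y (i + j) (q * r)"
  using assms(1)
proof (induction i arbitrary: q)
  case 0
  then obtain c where "q = [:c:]" by (auto elim: degree_eq_zeroE)
  then show ?case by (simp add: bform_smult) (simp add: bform_def)
next
  case (Suc i)
  obtain a q' where q: "q = pCons a q'" by (cases q) auto
  then have q': "degree q' \<le> i" using Suc.prems by (cases "q' = 0") auto
  have "bform x y (Suc i) q * bform x y j r = cst a * (y ^ Suc i * bform x y j r) + x * (bform x y i q' * bform x y j r)"
    unfolding q bform_pCons by (simp add: algebra_simps)
  also have "\<dots> = cst a * bform x y (Suc i + j) r + x * bform x y (i + j) (q' * r)"
    using bform_shift[OF assms(2), of x y "Suc i"] Suc.IH[OF q'] by simp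
  also have "\<dots> = bform x y (Suc i + j) (smult a r) + bform x y (Suc (i + j)) (pCons 0 (q' * r))"
    by (simp add: bform_smult bform_pCons)
  also have "\<dots> = bform x y (Suc i + j) (q * r)"
    by (simp add: q bform_add)
  finally show ?case .
qed

lemma is_form_bform:
  assumes "is_form 1 x" "is_form 1 y" shows "is_form n (bform x y n q)"
  unfolding bform_def
proof (rule is_form_sum)
  fix k assume "k \<in> {..n}"
  then have "is_form (k + (n - k)) (x ^ k * y ^ (n - k))"
    by (intro is_form_mult is_form_power1 assms)
  with \<open>k \<in> {..n}\<close> show "is_form n (cst (coeff q k) * (x ^ k * y ^ (n - k)))"
    by (auto intro: is_form_scale)
qed

lemma hcomp_alg2:
  assumes xy: "is_form 1 x" "is_form 1 y" and b: "b \<in> alg {x, y}"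
  shows "\<exists>q. degree q \<le> n \<and> hcomp n b = bform x y n q"
  using b
proof (induction arbitrary: n)
  case (alg_cst c)
  show ?case
  proof (cases "n = 0")
    case True
    then show ?thesis by (intro exI[of _ "[:c:]"]) (simp add: hcomp_form[OF is_form_cst] bform_def)
  next
    case False
    then show ?thesis by (intro exI[of _ 0]) (simp add: hcomp_form[OF is_form_cst])
  qed
next
  case (alg_base s)
  show ?case
  proof (cases "n = 1")
    case n: True
    show ?thesis
    proof (cases "s = x")
      case True
      then show ?thesis using n xy by (intro exI[of _ "[:0, 1:]"]) (simp add: hcomp_form bform_def)
    next
      case False
      then have "s = y" using alg_base by simp
      then show ?thesis using n xy by (intro exI[of _ "[:1:]"]) (simp add: hcomp_form bform_def)
    qed
  next
    case False
    have "hcomp n s = 0" using False alg_base hcomp_form[OF xy(1), of n] hcomp_form[OF xy(2), of n] by auto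
    then show ?thesis by (intro exI[of _ 0]) simp
  qed
next
  case (alg_add f g)
  then obtain p q where "degree p \<le> n" "hcomp n f = bform x y n p" "degree q \<le> n" "hcomp n g = bform x y n q" by blast
  then show ?case by (intro exI[of _ "p + q"]) (simp add: bform_add hcomp_add degree_add_le)
next
  case (alg_mult f g)
  then obtain p q where p: "\<And>n. degree (p n) \<le> n" "\<And>n. hcomp n f = bform x y n (p n)"
    and q: "\<And>n. degree (q n) \<le> n" "\<And>n. hcomp n g = bform x y n (q n)" by metis
  have "hcomp n (f * g) = (\<Sum>i\<le>n. bform x y n (p i * q (n - i)))"
    unfolding hcomp_mult by (rule sum.cong) (auto simp: p q bform_mult)
  moreover have "degree (\<Sum>i\<le>n. p i * q (n - i)) \<le> n"
  proof (rule degree_sum_le)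
    fix i assume "i \<in> {..n}"
    then show "degree (p i * q (n - i)) \<le> n"
      using degree_mult_le[of "p i" "q (n - i)"] p(1)[of i] q(1)[of "n - i"] by auto
  qed simp
  ultimately show ?case by (intro exI[of _ "\<Sum>i\<le>n. p i * q (n - i)"]) (simp add: bform_sum)
qed

lemma bform_in_alg: "bform x y n q \<in> alg {x, y}"
  unfolding bform_def by (intro alg_closed alg.alg_cst alg.alg_base) auto

text \<open>The linear factors come from the roots of the dehomogenized polynomial, and the factor \<open>y\<close> appears
  when the degree of that polynomial is smaller than the degree of the form.\<close>

lemma bform_split:
  fixes q :: "'k::alg_closed_field poly"
  assumes "degree q \<le> Suc n" "q \<noteq> 0"
  obtains l q' where "l = y \<or> (\<exists>a. l = x - cst a * y)" "degree q' \<le> n" "q' \<noteq> 0"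
    "bform x y (Suc n) q = l * bform x y n q'"
proof (cases "degree q = 0")
  case True
  then show ?thesis using bform_shift[of q n x y 1] assms by (intro that[of y q]) auto
next
  case False
  then obtain a where "poly q a = 0" using alg_closed_imp_poly_has_root by blast
  then obtain q' where q: "q = [:- a, 1:] * q'" using poly_eq_0_iff_dvd by blast
  have "q' \<noteq> 0" using q assms by auto
  moreover have deg: "degree q' \<le> n" using assms(1) \<open>q' \<noteq> 0\<close> unfolding q by (subst (asm) degree_mult_eq) auto
  moreover have "bform x y (1 + n) ([:- a, 1:] * q') = bform x y 1 [:- a, 1:] * bform x y n q'"
    by (rule bform_mult[symmetric]) (use deg in auto)
  moreover have "bform x y 1 [:- a, 1:] = x - cst a * y" by (simp add: bform_def single_uminus)
  ultimately show ?thesis using q by (intro that[of "x - cst a * y" q']) auto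
qed


section \<open>Torsion-freeness over the parameters\<close>

text \<open>If \<open>l\<close> killed a nonzero form \<open>f\<close> of the quotient, then \<open>y\<close> alone would be a parameter for the module
  generated by \<open>f\<close>, against unmixedness.\<close>

lemma linear_nonzerodivisor:
  assumes J: "hideal J" "unmixed J" and l: "is_form 1 l" and y: "is_form 1 y" and finite_over: "finite_over {l, y} J"
    and f: "l * f \<in> J"
  shows "f \<in> J"
proof (rule hideal_memI[OF J(1)], rule ccontr)
  fix t assume t: "hcomp t f \<notin> J"
  have "hcomp (1 + t) (l * f) \<in> J" using f by (rule hideal_hcomp[OF J(1)])
  then have "l * hcomp t f \<in> J" by (simp only: hcomp_mult_form[OF l])
  then have "l \<in> colon J (hcomp t f)" by (simp add: mem_colon mult.commute)
  then have "{l, y} \<union> J \<subseteq> idl.span ({y} \<union> colon J (hcomp t f))"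
    using colon_superset[OF hideal_ideal[OF J(1)], of "hcomp t f"] by (auto intro: idl.span_base)
  then have "finite_over {y} (colon J (hcomp t f))" by (rule finite_over_trans[OF finite_over])
  then show False using J(2) t y is_form_hcomp unfolding unmixed_def by blast
qed

lemma finite_over_linear_change:
  assumes finite_over: "finite_over {x, y} J" and l: "l = y \<or> (\<exists>a. l = x - cst a * y)" and xy: "is_form 1 x" "is_form 1 y"
  obtains y' where "is_form 1 l" "is_form 1 y'" "finite_over {l, y'} J"
proof (cases "l = y")
  case True
  then show ?thesis using that[of x] xy finite_over by (simp add: insert_commute)
next
  case False
  with l obtain a where a: "l = x - cst a * y" by blast
  have "x - 1 * l = cst a * y" by (simp add: a)
  then have "x \<in> idl.span ({l, y} \<union> J)"
    using idl.span_add[OF idl.span_base idl.span_scale[OF idl.span_base], of l "{l, y} \<union> J" y "cst a"] a by simp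
  then have "finite_over {l, y} J" by (intro finite_over_trans[OF finite_over]) (auto intro: idl.span_base)
  moreover have "is_form 1 l" unfolding a by (intro is_form_diff is_form_scale xy)
  ultimately show ?thesis using that xy by blast
qed

lemma bform_nonzerodivisor:
  fixes J :: "('k::alg_closed_field, 'n::finite) mpoly set"
  assumes J: "hideal J" "unmixed J" and xy: "is_form 1 x" "is_form 1 y" and finite_over: "finite_over {x, y} J"
    and q: "q \<noteq> 0" "degree q \<le> n" and f: "bform x y n q * f \<in> J"
  shows "f \<in> J"
  using q f
proof (induction n arbitrary: q)
  case 0
  then obtain c where c: "q = [:c:]" "c \<noteq> 0" by (auto elim: degree_eq_zeroE)
  then have "cst c * f \<in> J" using 0 by (simp add: bform_def)
  then show ?case by (rule ideal_cst_cancel[OF hideal_ideal[OF J(1)] c(2)])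
next
  case (Suc n)
  obtain l q' where lq: "l = y \<or> (\<exists>a. l = x - cst a * y)" "degree q' \<le> n" "q' \<noteq> 0"
    "bform x y (Suc n) q = l * bform x y n q'"
    by (rule bform_split[OF Suc.prems(2,1), where x = x and y = y])
  obtain y' where y': "is_form 1 l" "is_form 1 y'" "finite_over {l, y'} J" by (rule finite_over_linear_change[OF finite_over lq(1) xy])
  have "l * (bform x y n q' * f) \<in> J" using Suc.prems(3) unfolding lq(4) by (simp add: mult.assoc)
  then have "bform x y n q' * f \<in> J" by (rule linear_nonzerodivisor[OF J y'])
  then show ?case by (rule Suc.IH[OF lq(3,2)])
qed

text \<open>A binary form is a product of linear forms, each of which is a parameter and hence a nonzerodivisor.
  For an arbitrary element one compares the lowest components.\<close>

lemma parameters_torsion_free: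
  fixes J :: "('k::alg_closed_field, 'n::finite) mpoly set"
  assumes J: "hideal J" "unmixed J" and xy: "is_form 1 x" "is_form 1 y" and finite_over: "finite_over {x, y} J"
    and b: "b \<in> alg {x, y}" "b \<noteq> 0" and f: "b * f \<in> J"
  shows "f \<in> J"
proof (rule ccontr)
  assume "f \<notin> J"
  obtain j where j: "hcomp j f \<notin> J" "\<And>i. i < j \<Longrightarrow> hcomp i f \<in> J" by (rule lowest_component[OF J(1) \<open>f \<notin> J\<close>]) blast
  have "hideal {0 :: ('k, 'n) mpoly}" by (auto simp: hideal_def)
  then obtain i where i: "hcomp i b \<noteq> 0" "\<And>a. a < i \<Longrightarrow> hcomp a b = 0"
    using lowest_component[of "{0}" b] b(2) by auto
  have "hcomp i b * hcomp j f \<in> J"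
    by (rule hcomp_mult_lowest[OF J(1) j(2) _ f]) (use i(2) idl.subspace_0[OF hideal_ideal[OF J(1)]] in auto)
  moreover obtain q where q: "degree q \<le> i" "hcomp i b = bform x y i q" using hcomp_alg2[OF xy b(1)] by blast
  moreover have "q \<noteq> 0" using q(2) i(1) by auto
  ultimately show False using bform_nonzerodivisor[OF J xy finite_over] j(1) by metis
qed

lemma curve_torsion_free:
  fixes J :: "('k::alg_closed_field, 'n::finite) mpoly set"
  assumes J: "curve_ideal J" and xy: "is_form 1 x" "is_form 1 y" "finite_over {x, y} J"
    and b: "b \<in> alg {x, y}" "b \<noteq> 0" "b * f \<in> J"
  shows "f \<in> J"
  by (rule parameters_torsion_free[OF curve_idealD(1,4)[OF J] xy b])

lemma curve_alg_Int:
  fixes J :: "('k::alg_closed_field, 'n::finite) mpoly set"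
  assumes J: "curve_ideal J" and xy: "is_form 1 x" "is_form 1 y" "finite_over {x, y} J"
  shows "alg {x, y} \<inter> J = {0}"
proof -
  have "b = 0" if "b \<in> alg {x, y}" "b \<in> J" for b
    using curve_torsion_free[OF J xy that(1), of 1] that(2) curve_idealD(3)[OF J] by auto
  then show ?thesis using alg_closed(1) idl.subspace_0[OF curve_idealD(5)[OF J]] by blast
qed

lemma bform_in_curve_ideal:
  fixes J :: "('k::alg_closed_field, 'n::finite) mpoly set"
  assumes J: "curve_ideal J" and xy: "is_form 1 x" "is_form 1 y" "finite_over {x, y} J"
    and q: "degree q \<le> n" "bform x y n q \<in> J"
  shows "q = 0"
  using bform_nonzerodivisor[OF curve_idealD(1,4)[OF J] xy _ q(1), of 1] q(2) curve_idealD(3)[OF J] by auto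

lemma curve_parameters:
  fixes J :: "('k::{alg_closed_field, ring_char_0}, 'n::{finite,linorder}) mpoly set"
  assumes J: "curve_ideal J" and S: "coords S" "finite_over S J"
  obtains x y where "x \<noteq> y" "coords {x, y}" "is_form 1 x" "is_form 1 y" "finite_over {x, y} J" "{x, y} \<subseteq> alg S"
proof -
  obtain T where T: "coords T" "card T \<le> card S" "finite_over T J" "alg T \<inter> J = {0}" "T \<subseteq> alg S"
    by (rule noether_normalization[OF S(1) curve_idealD(1,3)[OF J] S(2)])
  have "card T = 2" by (rule curve_normalization_card[OF J T(1,3,4)])
  then obtain x y where xy: "T = {x, y}" "x \<noteq> y" by (auto simp: card_2_iff)
  show ?thesis
    by (rule that[OF xy(2)]) (use T xy(1) coords_form[OF T(1)] in auto)
qed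

section \<open>Codimension of subspaces\<close>

lemma codim_ge:
  fixes V E :: "('k::field, 'n) mpoly set"
  assumes V: "mpoly.subspace V" "V \<subseteq> E" and E: "finite B0" "E \<subseteq> mpoly.span B0"
    and A: "finite A" "\<And>i. i \<in> A \<Longrightarrow> u i \<in> E"
    and ind: "\<And>c. (\<Sum>i\<in>A. scale_poly (c i) (u i)) \<in> V \<Longrightarrow> \<forall>i\<in>A. c i = 0"
  shows "card A \<le> mpoly.dim E - mpoly.dim V"
proof -
  obtain BV where BV: "BV \<subseteq> V" "mpoly.independent BV" "V \<subseteq> mpoly.span BV" "card BV = mpoly.dim V"
    using mpoly.basis_exists by metis
  have finBV: "finite BV"
    using mpoly.independent_span_bound[OF E(1) BV(2)] BV(1) V(2) E(2) by blast
  have spanBV: "mpoly.span BV \<subseteq> V" using BV(1) V(1) by (rule mpoly.span_minimal)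
  have "mpoly.independent (BV \<union> u ` A') \<and> card (BV \<union> u ` A') = card BV + card A'" if "finite A'" "A' \<subseteq> A" for A'
    using that
  proof (induction A' rule: finite_induct)
    case (insert i A')
    have "u i \<notin> mpoly.span (BV \<union> u ` A')"
    proof
      assume "u i \<in> mpoly.span (BV \<union> u ` A')"
      then obtain v w where vw: "u i = v + w" "v \<in> mpoly.span BV" "w \<in> mpoly.span (u ` A')"
        unfolding mpoly.span_Un by blast
      have "\<exists>c. w = (\<Sum>j\<in>A'. scale_poly (c j) (u j))"
        using vw(3) insert.hyps
      proof (induction rule: mpoly.span_induct_alt)
        case base
        show ?case by (intro exI[of _ "\<lambda>_. 0"]) simp
      next
        case (step c x y)
        then obtain d j where d: "y = (\<Sum>j\<in>A'. scale_poly (d j) (u j))" "j \<in> A'" "x = u j" by blast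
        have "(\<Sum>k\<in>A'. scale_poly ((d(j := d j + c)) k) (u k))
            = (\<Sum>k\<in>A'. scale_poly (d k) (u k) + (if k = j then scale_poly c (u k) else 0))"
          by (rule sum.cong) (auto simp: mpoly.scale_left_distrib)
        also have "\<dots> = scale_poly c x + y" using d insert.hyps by (simp add: sum.distrib add.commute)
        finally show ?case by metis
      qed
      then obtain c where c: "w = (\<Sum>j\<in>A'. scale_poly (c j) (u j))" by blast
      define c' where "c' j = (if j = i then 1 else if j \<in> A' then - c j else 0)" for j
      have "(\<Sum>j\<in>A. scale_poly (c' j) (u j)) = (\<Sum>j\<in>insert i A'. scale_poly (c' j) (u j))"
        by (rule sum.mono_neutral_right) (use A(1) insert.prems in \<open>auto simp: c'_def\<close>)
      also have "\<dots> = u i + (\<Sum>j\<in>A'. scale_poly (c' j) (u j))"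
        using insert.hyps by (simp add: c'_def)
      also have "(\<Sum>j\<in>A'. scale_poly (c' j) (u j)) = - w"
        using insert.hyps unfolding c sum_negf[symmetric]
        by (intro sum.cong) (auto simp: c'_def mpoly.scale_minus_left)
      also have "u i + - w = v" using vw(1) by simp
      finally have "(\<Sum>j\<in>A. scale_poly (c' j) (u j)) \<in> V" using vw(2) spanBV by auto
      then have "c' i = 0" using ind insert.prems by blast
      then show False by (simp add: c'_def)
    qed
    moreover from this have "u i \<notin> BV \<union> u ` A'" using mpoly.span_base[of "u i"] by metis
    moreover have "mpoly.independent (BV \<union> u ` A')" "card (BV \<union> u ` A') = card BV + card A'"
      using insert.IH insert.prems by auto
    moreover have "finite (BV \<union> u ` A')" using finBV insert.hyps(1) by simp
    moreover have "BV \<union> u ` insert i A' = insert (u i) (BV \<union> u ` A')" by simp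
    ultimately show ?case
      using insert.hyps mpoly.independent_insertI[of "u i" "BV \<union> u ` A'"] by simp
  qed (use BV(2) in auto)
  then have *: "mpoly.independent (BV \<union> u ` A)" "card (BV \<union> u ` A) = card BV + card A"
    using A(1) by auto
  obtain BE where BE: "BE \<subseteq> E" "mpoly.independent BE" "E \<subseteq> mpoly.span BE" "card BE = mpoly.dim E"
    using mpoly.basis_exists by metis
  have "finite BE" using mpoly.independent_span_bound[OF E(1) BE(2)] BE(1) E(2) by blast
  then have "card (BV \<union> u ` A) \<le> card BE"
    using mpoly.independent_span_bound[OF _ *(1)] BE(3) BV(1) V(2) A(2) by blast
  then show ?thesis using *(2) BV(4) BE(4) by simp
qed

lemma codim_le:
  fixes V E :: "('k::field, 'n) mpoly set"
  assumes V: "V \<subseteq> E" and E: "finite B0" "E \<subseteq> mpoly.span B0" and A: "finite A"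
    and span: "\<And>f. f \<in> E \<Longrightarrow> \<exists>c. f - (\<Sum>i\<in>A. scale_poly (c i) (u i)) \<in> V"
  shows "mpoly.dim E - mpoly.dim V \<le> card A"
proof -
  obtain BV where BV: "BV \<subseteq> V" "mpoly.independent BV" "V \<subseteq> mpoly.span BV" "card BV = mpoly.dim V"
    using mpoly.basis_exists by metis
  have finBV: "finite BV"
    using mpoly.independent_span_bound[OF E(1) BV(2)] BV(1) V E(2) by blast
  have "E \<subseteq> mpoly.span (BV \<union> u ` A)"
  proof
    fix f assume "f \<in> E"
    then obtain c where c: "f - (\<Sum>i\<in>A. scale_poly (c i) (u i)) \<in> V" using span by blast
    then have "f - (\<Sum>i\<in>A. scale_poly (c i) (u i)) \<in> mpoly.span (BV \<union> u ` A)"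
      using BV(3) mpoly.span_mono[of BV "BV \<union> u ` A"] by blast
    moreover have "(\<Sum>i\<in>A. scale_poly (c i) (u i)) \<in> mpoly.span (BV \<union> u ` A)"
      by (intro mpoly.span_sum mpoly.span_scale mpoly.span_base) auto
    ultimately have "(f - (\<Sum>i\<in>A. scale_poly (c i) (u i))) + (\<Sum>i\<in>A. scale_poly (c i) (u i)) \<in> mpoly.span (BV \<union> u ` A)"
      by (rule mpoly.span_add)
    then show "f \<in> mpoly.span (BV \<union> u ` A)" by simp
  qed
  then have "mpoly.dim E \<le> card (BV \<union> u ` A)" using finBV A by (intro mpoly.dim_le_card) auto
  also have "\<dots> \<le> card BV + card A"
    using card_Un_le[of BV "u ` A"] card_image_le[OF A, of u] by linarith
  finally show ?thesis using BV(4) by simp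
qed

lemma codim_basis:
  fixes V E :: "('k::field, 'n) mpoly set"
  assumes V: "mpoly.subspace V" "V \<subseteq> E" and E: "finite B0" "E \<subseteq> mpoly.span B0"
  obtains T where "finite T" "T \<subseteq> E" "card T = mpoly.dim E - mpoly.dim V"
    "\<And>c. (\<Sum>s\<in>T. scale_poly (c s) s) \<in> V \<Longrightarrow> \<forall>s\<in>T. c s = 0"
    "\<And>f. f \<in> E \<Longrightarrow> \<exists>c. f - (\<Sum>s\<in>T. scale_poly (c s) s) \<in> V"
proof -
  obtain BV where BV: "BV \<subseteq> V" "mpoly.independent BV" "V \<subseteq> mpoly.span BV" "card BV = mpoly.dim V"
    using mpoly.basis_exists by metis
  have spanBV: "mpoly.span BV \<subseteq> V" using BV(1) V(1) by (rule mpoly.span_minimal)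
  obtain BE where BE: "BV \<subseteq> BE" "BE \<subseteq> E" "mpoly.independent BE" "E \<subseteq> mpoly.span BE"
    using mpoly.maximal_independent_subset_extend[OF _ BV(2), of E] BV(1) V(2) by blast
  have finBE: "finite BE"
    using mpoly.independent_span_bound[OF E(1) BE(3)] BE(2) E(2) by blast
  have cardBE: "card BE = mpoly.dim E" by (rule mpoly.basis_card_eq_dim[OF BE(2,4,3)])
  define T where "T = BE - BV"
  have T: "finite T" "T \<subseteq> E" "BE = BV \<union> T" using finBE BE(1,2) by (auto simp: T_def)
  have c1: "card T = mpoly.dim E - mpoly.dim V"
    unfolding T_def using card_Diff_subset[of BV BE] BE(1) finBE finite_subset BV(4) cardBE by metis
  have c2: "\<forall>s\<in>T. c s = 0" if V': "(\<Sum>s\<in>T. scale_poly (c s) s) \<in> V" for c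
  proof (rule ccontr)
    assume "\<not> ?thesis"
    then obtain s0 where s0: "s0 \<in> T" "c s0 \<noteq> 0" by blast
    let ?r = "\<Sum>s\<in>T - {s0}. scale_poly (c s) s"
    have "(\<Sum>s\<in>T. scale_poly (c s) s) = scale_poly (c s0) s0 + ?r" using T(1) s0(1) by (simp add: sum.remove)
    then have eq: "scale_poly (c s0) s0 = (\<Sum>s\<in>T. scale_poly (c s) s) - ?r" by simp
    have "(\<Sum>s\<in>T. scale_poly (c s) s) \<in> mpoly.span (BE - {s0})"
      using V' BV(3) mpoly.span_mono[of BV "BE - {s0}"] s0(1) BE(1) by (auto simp: T_def)
    moreover have "?r \<in> mpoly.span (BE - {s0})"
      by (intro mpoly.span_sum mpoly.span_scale mpoly.span_base) (auto simp: T_def)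
    ultimately have "scale_poly (c s0) s0 \<in> mpoly.span (BE - {s0})" unfolding eq by (rule mpoly.span_diff)
    then have "scale_poly (inverse (c s0)) (scale_poly (c s0) s0) \<in> mpoly.span (BE - {s0})" by (rule mpoly.span_scale)
    then have "s0 \<in> mpoly.span (BE - {s0})" using s0(2) by simp
    then show False using BE(3) s0(1) unfolding mpoly.dependent_def T_def by blast
  qed
  have c3: "\<exists>c. f - (\<Sum>s\<in>T. scale_poly (c s) s) \<in> V" if "f \<in> E" for f
  proof -
    have "f \<in> mpoly.span (BV \<union> T)" using that BE(4) T(3) by auto
    then obtain v w where vw: "f = v + w" "v \<in> mpoly.span BV" "w \<in> mpoly.span T" unfolding mpoly.span_Un by blast
    obtain c where "w = (\<Sum>s\<in>T. scale_poly (c s) s)" using vw(3) mpoly.span_finite[OF T(1)] by auto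
    then have "f - (\<Sum>s\<in>T. scale_poly (c s) s) \<in> V" using vw spanBV by auto
    then show ?thesis by blast
  qed
  show ?thesis by (rule that[OF T(1,2) c1 c2 c3])
qed


section \<open>Hilbert functions\<close>

abbreviation hf :: "('k::field, 'n::finite) mpoly set \<Rightarrow> nat \<Rightarrow> nat" where
  "hf \<equiv> hilbert_function"

lemma forms_span_monomials:
  "graded_part UNIV t \<subseteq> mpoly.span ((\<lambda>a :: 'n::finite \<Rightarrow>\<^sub>0 nat. Poly_Mapping.single a (1::'k::field)) ` {a. mono_deg a = t})"
proof
  fix f :: "('k, 'n) mpoly" assume "f \<in> graded_part UNIV t"
  then have f: "is_form t f" by (simp add: graded_part_def)
  have "scale_poly c (Poly_Mapping.single a 1) \<in> mpoly.span ((\<lambda>a. Poly_Mapping.single a (1::'k)) ` {a :: 'n \<Rightarrow>\<^sub>0 nat. mono_deg a = t})"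
    if "mono_deg a = t" for a c
    using that by (intro mpoly.span_scale mpoly.span_base) auto
  then have "Poly_Mapping.single a c \<in> mpoly.span ((\<lambda>a. Poly_Mapping.single a (1::'k)) ` {a :: 'n \<Rightarrow>\<^sub>0 nat. mono_deg a = t})"
    if "mono_deg a = t" for a c
    using that by (simp add: scale_poly_def mult_single)
  then show "f \<in> mpoly.span ((\<lambda>a. Poly_Mapping.single a 1) ` {a. mono_deg a = t})"
    by (subst form_eq_sum_monomials[OF f]) (auto intro!: mpoly.span_sum)
qed

lemma finite_monomials: "finite ((\<lambda>a :: 'n::finite \<Rightarrow>\<^sub>0 nat. Poly_Mapping.single a (1::'k::field)) ` {a. mono_deg a = t})"
proof -
  have "{a :: 'n \<Rightarrow>\<^sub>0 nat. mono_deg a = t} \<subseteq> {a. mono_deg a < Suc t}" by auto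
  then show ?thesis using finite_bounded_degree finite_subset by blast
qed

lemma subspace_graded_part: "idl.subspace J \<Longrightarrow> mpoly.subspace (graded_part J t)"
  by (rule mpoly.subspaceI)
     (auto simp: graded_part_def idl.subspace_0 idl.subspace_add is_form_add scale_poly_def is_form_scale ideal_mult_left)

lemma hf_ge:
  fixes J :: "('k::field, 'n::finite) mpoly set"
  assumes J: "idl.subspace J" and A: "finite A" "\<And>i. i \<in> A \<Longrightarrow> is_form t (u i)"
    and ind: "\<And>c. (\<Sum>i\<in>A. cst (c i) * u i) \<in> J \<Longrightarrow> \<forall>i\<in>A. c i = 0"
  shows "card A \<le> hf J t"
  unfolding hilbert_function_def
proof (rule codim_ge[OF subspace_graded_part[OF J] _ finite_monomials forms_span_monomials A(1)])
  show "u i \<in> graded_part UNIV t" if "i \<in> A" for i using A(2)[OF that] by (simp add: graded_part_def)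
  show "\<forall>i\<in>A. c i = 0" if "(\<Sum>i\<in>A. scale_poly (c i) (u i)) \<in> graded_part J t" for c
    using that ind[of c] by (simp add: graded_part_def scale_poly_def)
qed (auto simp: graded_part_def)

lemma hf_le:
  fixes J :: "('k::field, 'n::finite) mpoly set"
  assumes A: "finite A" "\<And>i. i \<in> A \<Longrightarrow> is_form t (u i)"
    and span: "\<And>f. is_form t f \<Longrightarrow> \<exists>c. f - (\<Sum>i\<in>A. cst (c i) * u i) \<in> J"
  shows "hf J t \<le> card A"
  unfolding hilbert_function_def
proof (rule codim_le[OF _ finite_monomials forms_span_monomials A(1)])
  fix f :: "('k, 'n) mpoly" assume "f \<in> graded_part UNIV t"
  then have f: "is_form t f" by (simp add: graded_part_def)
  obtain c where c: "f - (\<Sum>i\<in>A. cst (c i) * u i) \<in> J" using span[OF f] by blast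
  have "is_form t (f - (\<Sum>i\<in>A. cst (c i) * u i))"
    by (intro is_form_diff is_form_sum is_form_scale f A(2))
  with c show "\<exists>c. f - (\<Sum>i\<in>A. scale_poly (c i) (u i)) \<in> graded_part J t"
    by (intro exI[of _ c]) (simp add: graded_part_def scale_poly_def)
qed (auto simp: graded_part_def)

lemma hf_basis:
  fixes J :: "('k::field, 'n::finite) mpoly set"
  assumes J: "idl.subspace J"
  obtains T where "finite T" "\<And>s. s \<in> T \<Longrightarrow> is_form t s" "card T = hf J t"
    "\<And>c. (\<Sum>s\<in>T. cst (c s) * s) \<in> J \<Longrightarrow> \<forall>s\<in>T. c s = 0"
    "\<And>f. is_form t f \<Longrightarrow> \<exists>c. f - (\<Sum>s\<in>T. cst (c s) * s) \<in> J"
proof -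
  have sub: "graded_part J t \<subseteq> graded_part UNIV t" by (auto simp: graded_part_def)
  obtain T where T: "finite T" "T \<subseteq> graded_part UNIV t"
    "card T = mpoly.dim (graded_part (UNIV :: ('k, 'n) mpoly set) t) - mpoly.dim (graded_part J t)"
    "\<And>c. (\<Sum>s\<in>T. scale_poly (c s) s) \<in> graded_part J t \<Longrightarrow> \<forall>s\<in>T. c s = 0"
    "\<And>f. f \<in> graded_part UNIV t \<Longrightarrow> \<exists>c. f - (\<Sum>s\<in>T. scale_poly (c s) s) \<in> graded_part J t"
    by (rule codim_basis[OF subspace_graded_part[OF J] sub finite_monomials forms_span_monomials]) blast
  have form: "is_form t s" if "s \<in> T" for s using that T(2) by (auto simp: graded_part_def)
  have i: "\<forall>s\<in>T. c s = 0" if "(\<Sum>s\<in>T. cst (c s) * s) \<in> J" for c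
  proof (rule T(4))
    have "is_form t (\<Sum>s\<in>T. cst (c s) * s)" by (intro is_form_sum is_form_scale form)
    with that show "(\<Sum>s\<in>T. scale_poly (c s) s) \<in> graded_part J t" by (simp add: graded_part_def scale_poly_def)
  qed
  have s: "\<exists>c. f - (\<Sum>s\<in>T. cst (c s) * s) \<in> J" if "is_form t f" for f
  proof -
    have "f \<in> graded_part UNIV t" using that by (simp add: graded_part_def)
    from T(5)[OF this] show ?thesis by (auto simp: graded_part_def scale_poly_def)
  qed
  show ?thesis by (rule that[OF T(1) form _ i s]) (use T(3) in \<open>simp_all add: hilbert_function_def\<close>)
qed

text \<open>A relation would allow one generator to be omitted, leaving too few to span.\<close>

lemma hf_spanning_independent:
  fixes J :: "('k::field, 'n::finite) mpoly set"
  assumes J: "idl.subspace J" and A: "finite A" "\<And>i. i \<in> A \<Longrightarrow> is_form t (u i)" "card A \<le> hf J t"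
    and span: "\<And>f. is_form t f \<Longrightarrow> \<exists>c. f - (\<Sum>i\<in>A. cst (c i) * u i) \<in> J"
    and rel: "(\<Sum>i\<in>A. cst (c i) * u i) \<in> J"
  shows "\<forall>i\<in>A. c i = 0"
proof (rule ccontr)
  assume "\<not> ?thesis"
  then obtain j where j: "j \<in> A" "c j \<noteq> 0" by blast
  have "hf J t \<le> card (A - {j})"
  proof (rule hf_le)
    fix f :: "('k, 'n) mpoly" assume "is_form t f"
    then obtain b where b: "f - (\<Sum>i\<in>A. cst (b i) * u i) \<in> J" using span by blast
    let ?r = "b j / c j"
    have "f - (\<Sum>i\<in>A. cst (b i) * u i) + cst ?r * (\<Sum>i\<in>A. cst (c i) * u i) \<in> J"
      by (rule idl.subspace_add[OF J b ideal_mult_left[OF J rel]])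
    also have "f - (\<Sum>i\<in>A. cst (b i) * u i) + cst ?r * (\<Sum>i\<in>A. cst (c i) * u i)
        = f - (\<Sum>i\<in>A. cst (b i - ?r * c i) * u i)"
    proof -
      have "(\<Sum>i\<in>A. cst (b i - ?r * c i) * u i) = (\<Sum>i\<in>A. cst (b i) * u i) - cst ?r * (\<Sum>i\<in>A. cst (c i) * u i)"
        by (simp only: cst_diff cst_mult left_diff_distrib sum_subtractf sum_distrib_left mult.assoc)
      then show ?thesis by simp
    qed
    also have "(\<Sum>i\<in>A. cst (b i - ?r * c i) * u i) = (\<Sum>i\<in>A - {j}. cst (b i - ?r * c i) * u i)"
      using j A(1) by (simp add: sum.remove[of A j])
    finally show "\<exists>b. f - (\<Sum>i\<in>A - {j}. cst (b i) * u i) \<in> J"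
      by (rule exI[of _ "\<lambda>i. b i - ?r * c i"])
  qed (use A in auto)
  moreover have "card (A - {j}) < card A" using card_Diff1_less[OF A(1) j(1)] .
  ultimately show False using A(3) by linarith
qed

lemma hideal_insert_form:
  assumes "hideal J" "is_form n x" shows "hideal (idl.span (insert x J))"
  using hideal_span_forms[of "{x}" J] assms by (auto simp: homogeneous_def)

text \<open>Multiplication by \<open>x\<close> embeds the quotient by \<open>J\<close>, shifted by one degree, into itself, with cokernel the
  quotient by \<open>J + (x)\<close>; a basis of the first and one of the last combine to a basis of the middle term.\<close>

lemma hf_quotient:
  fixes J :: "('k::field, 'n::finite) mpoly set"
  assumes J: "hideal J" and x: "is_form 1 x" and nzd: "\<And>f. x * f \<in> J \<Longrightarrow> f \<in> J"
  shows "hf J (Suc t) = hf J t + hf (idl.span (insert x J)) (Suc t)"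
proof -
  let ?K = "idl.span (insert x J)"
  note idJ = hideal_ideal[OF J]
  obtain T where T: "finite T" "\<And>s. s \<in> T \<Longrightarrow> is_form t s" "card T = hf J t"
    "\<And>c. (\<Sum>s\<in>T. cst (c s) * s) \<in> J \<Longrightarrow> \<forall>s\<in>T. c s = 0"
    "\<And>f. is_form t f \<Longrightarrow> \<exists>c. f - (\<Sum>s\<in>T. cst (c s) * s) \<in> J"
    by (rule hf_basis[OF idJ, of t]) blast
  have K: "idl.subspace ?K" by simp
  obtain U where U: "finite U" "\<And>s. s \<in> U \<Longrightarrow> is_form (Suc t) s" "card U = hf ?K (Suc t)"
    "\<And>c. (\<Sum>s\<in>U. cst (c s) * s) \<in> ?K \<Longrightarrow> \<forall>s\<in>U. c s = 0"
    "\<And>f. is_form (Suc t) f \<Longrightarrow> \<exists>c. f - (\<Sum>s\<in>U. cst (c s) * s) \<in> ?K"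
    by (rule hf_basis[OF K, of "Suc t"]) blast
  let ?A = "T <+> U"
  let ?u = "case_sum (\<lambda>s. x * s) (\<lambda>s. s)"
  have card: "card ?A = hf J t + hf ?K (Suc t)" using T U by (simp add: card_Plus)
  have form: "is_form (Suc t) (?u i)" if "i \<in> ?A" for i
    using that T(2) U(2) is_form_mult[OF x, of t] by (auto simp: Plus_def)
  have split: "(\<Sum>i\<in>?A. cst (c i) * ?u i) = x * (\<Sum>s\<in>T. cst (c (Inl s)) * s) + (\<Sum>s\<in>U. cst (c (Inr s)) * s)" for c
    using T(1) U(1) by (simp add: sum.Plus sum_distrib_left mult.left_commute)
  have "card ?A \<le> hf J (Suc t)"
  proof (rule hf_ge[OF idJ _ form])
    fix c assume c: "(\<Sum>i\<in>?A. cst (c i) * ?u i) \<in> J"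
    have "(\<Sum>s\<in>U. cst (c (Inr s)) * s) - (- (\<Sum>s\<in>T. cst (c (Inl s)) * s)) * x \<in> J"
      using c unfolding split by (simp add: algebra_simps)
    then have "(\<Sum>s\<in>U. cst (c (Inr s)) * s) \<in> ?K" using mem_span_insert_ideal[OF idJ] by blast
    from U(4)[OF this] have cU: "\<forall>s\<in>U. c (Inr s) = 0" .
    then have "(\<Sum>s\<in>U. cst (c (Inr s)) * s) = 0" by (simp add: sum.neutral)
    then have "x * (\<Sum>s\<in>T. cst (c (Inl s)) * s) \<in> J" using c unfolding split by simp
    from T(4)[OF nzd[OF this]] cU show "\<forall>i\<in>?A. c i = 0" by auto
  qed (use T U in auto)
  moreover have "hf J (Suc t) \<le> card ?A"
  proof (rule hf_le[OF _ form])
    fix f :: "('k, 'n) mpoly" assume f: "is_form (Suc t) f"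
    obtain c where "f - (\<Sum>s\<in>U. cst (c s) * s) \<in> ?K" using U(5)[OF f] by blast
    then obtain k where "f - (\<Sum>s\<in>U. cst (c s) * s) - k * x \<in> J" using mem_span_insert_ideal[OF idJ] by blast
    then have "hcomp (1 + t) (f - (\<Sum>s\<in>U. cst (c s) * s) - x * k) \<in> J"
      by (intro hideal_hcomp[OF J]) (simp add: mult.commute)
    moreover have "is_form (Suc t) (f - (\<Sum>s\<in>U. cst (c s) * s))"
      by (intro is_form_diff is_form_sum is_form_scale f U(2))
    ultimately have J1: "f - (\<Sum>s\<in>U. cst (c s) * s) - x * hcomp t k \<in> J"
      using hcomp_mult_form[OF x, of t k] by (simp add: hcomp_diff[of _ "f - (\<Sum>s\<in>U. cst (c s) * s)"] hcomp_form)
    obtain b where b: "hcomp t k - (\<Sum>s\<in>T. cst (b s) * s) \<in> J" using T(5)[OF is_form_hcomp] by blast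
    have "f - (\<Sum>s\<in>U. cst (c s) * s) - x * hcomp t k + x * (hcomp t k - (\<Sum>s\<in>T. cst (b s) * s)) \<in> J"
      by (rule idl.subspace_add[OF idJ J1 ideal_mult_left[OF idJ b]])
    then have "f - (\<Sum>i\<in>?A. cst (case_sum b c i) * ?u i) \<in> J"
      unfolding split by (simp add: algebra_simps)
    then show "\<exists>c. f - (\<Sum>i\<in>?A. cst (c i) * ?u i) \<in> J" by blast
  qed (use T U in auto)
  ultimately show ?thesis using card by linarith
qed

lemma hf_bounded:
  fixes J :: "('k::field, 'n::finite) mpoly set"
  assumes J: "hideal J" and y: "is_form 1 y" and finite_over: "finite_over {y} J"
  obtains K where "\<And>t. hf J t \<le> K"
proof -
  note idJ = hideal_ideal[OF J]
  obtain n :: nat and u where nu: "\<And>f. \<exists>c. (\<forall>i<n. c i \<in> alg {y}) \<and> f - (\<Sum>i<n. c i * u i) \<in> J"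
    using finite_over_imp_module_finite[OF _ _ J finite_over] y unfolding module_finite_def by auto
  obtain D where D: "\<And>i. i < n \<Longrightarrow> \<forall>j\<ge>D. hcomp j (u i) = 0"
  proof -
    have "\<exists>N. \<forall>j\<ge>N. hcomp j (u i) = 0" for i using sum_hcomp[of "u i"] by metis
    then obtain N where N: "\<And>i. \<forall>j\<ge>N i. hcomp j (u i) = 0" by metis
    have "N i \<le> (\<Sum>i<n. N i)" if "i < n" for i using that by (intro member_le_sum) auto
    then show ?thesis using N that[of "\<Sum>i<n. N i"] by (meson order_trans)
  qed
  have "hf J t \<le> n * D" for t
  proof -
    define A where "A = {..<n} \<times> {..<D}"
    define w where "w = (\<lambda>(i, j). if j \<le> t then y ^ (t - j) * hcomp j (u i) else 0)"
    have "hf J t \<le> card A"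
    proof (rule hf_le)
      fix f :: "('k, 'n) mpoly" assume f: "is_form t f"
      obtain c where c: "\<And>i. i < n \<Longrightarrow> c i \<in> alg {y}" "f - (\<Sum>i<n. c i * u i) \<in> J" using nu by blast
      have "\<exists>a. hcomp m (c i) = cst a * y ^ m" if i: "i < n" for i m
      proof -
        have "c i \<in> alg {0, y}" using c(1)[OF i] alg_mono[of "{y}" "{0, y}"] by blast
        then obtain q where "hcomp m (c i) = bform 0 y m q"
          using hcomp_alg2[OF is_form_zero y] by blast
        then show ?thesis unfolding bform_def
          by (intro exI[of _ "coeff q 0"]) (simp add: sum.atMost_shift power_0_left)
      qed
      then obtain a where a: "\<And>i m. i < n \<Longrightarrow> hcomp m (c i) = cst (a i m) * y ^ m" by metis
      have "hcomp t (c i * u i) = (\<Sum>j<D. cst (a i (t - j)) * w (i, j))" if i: "i < n" for i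
      proof -
        have "hcomp t (c i * u i) = (\<Sum>j\<le>t. hcomp j (u i) * hcomp (t - j) (c i))"
          by (simp only: mult.commute[of "c i"] hcomp_mult)
        also have "\<dots> = (\<Sum>j\<in>{..<D} \<inter> {..t}. cst (a i (t - j)) * w (i, j))"
        proof (intro sum.mono_neutral_cong_right)
          show "\<forall>j\<in>{..t} - {..<D} \<inter> {..t}. hcomp j (u i) * hcomp (t - j) (c i) = 0"
          proof
            fix j assume "j \<in> {..t} - {..<D} \<inter> {..t}"
            then have "D \<le> j" by auto
            then show "hcomp j (u i) * hcomp (t - j) (c i) = 0" using D[OF i] by simp
          qed
          show "hcomp j (u i) * hcomp (t - j) (c i) = cst (a i (t - j)) * w (i, j)"
            if "j \<in> {..<D} \<inter> {..t}" for j
            using a[OF i] that by (simp add: w_def mult_ac)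
        qed auto
        also have "\<dots> = (\<Sum>j<D. cst (a i (t - j)) * w (i, j))"
          by (intro sum.mono_neutral_left) (auto simp: w_def)
        finally show ?thesis .
      qed
      then have "hcomp t (\<Sum>i<n. c i * u i) = (\<Sum>i<n. \<Sum>j<D. cst (a i (t - j)) * w (i, j))"
        by (simp add: hcomp_sum)
      also have "\<dots> = (\<Sum>p\<in>A. cst (a (fst p) (t - snd p)) * w p)"
        unfolding A_def by (simp add: sum.cartesian_product case_prod_unfold)
      finally have "f - (\<Sum>p\<in>A. cst (a (fst p) (t - snd p)) * w p) \<in> J"
        using hideal_hcomp[OF J c(2), of t] hcomp_form[OF f, of t] by (simp add: hcomp_diff)
      then show "\<exists>c. f - (\<Sum>p\<in>A. cst (c p) * w p) \<in> J"
        by (intro exI[of _ "\<lambda>p. a (fst p) (t - snd p)"])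
    next
      fix p assume "p \<in> A"
      have "is_form t (y ^ (t - j) * hcomp j (u i))" if "j \<le> t" for i j
        using is_form_mult[OF is_form_power1[OF y, of "t - j"] is_form_hcomp[of j "u i"]] that by simp
      then show "is_form t (w p)" by (auto simp: w_def split: prod.splits)
    qed (simp add: A_def)
    then show ?thesis by (simp add: A_def)
  qed
  with that show ?thesis by blast
qed

lemma curve_hf_ge:
  fixes J :: "('k::{alg_closed_field, ring_char_0}, 'n::{finite,linorder}) mpoly set"
  assumes J: "curve_ideal J" shows "Suc t \<le> hf J t"
proof -
  obtain x y where xy: "x \<noteq> y" "coords {x, y}" "is_form 1 x" "is_form 1 y" "finite_over {x, y} J" "{x, y} \<subseteq> alg (range var)"
    by (rule curve_parameters[OF J coords_vars finite_over_vars])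
  have "card {..t} \<le> hf J t"
  proof (rule hf_ge[OF curve_idealD(5)[OF J]])
    show "is_form t (x ^ k * y ^ (t - k))" if "k \<in> {..t}" for k
      using is_form_mult[OF is_form_power1[OF xy(3), of k] is_form_power1[OF xy(4), of "t - k"]] that by simp
    fix c assume c: "(\<Sum>k\<le>t. cst (c k) * (x ^ k * y ^ (t - k))) \<in> J"
    define q where "q = (\<Sum>k\<le>t. monom (c k) k)"
    have co: "coeff q k = (if k \<le> t then c k else 0)" for k
      by (simp add: q_def coeff_sum coeff_monom if_distrib sum.delta cong: if_cong)
    have "degree q \<le> t" by (rule degree_le) (simp add: co)
    moreover have "bform x y t q \<in> J" using c by (simp add: bform_def co)
    ultimately have "q = 0" by (rule bform_in_curve_ideal[OF J xy(3-5)])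
    then show "\<forall>k\<in>{..t}. c k = 0" using co by (metis atMost_iff coeff_0)
  qed simp
  then show ?thesis by simp
qed

text \<open>The difference of consecutive values of the Hilbert function is the Hilbert function of a
  plane section and hence bounded. A polynomial bounded on the naturals is constant, so the Hilbert
  polynomial is linear and its slope is the degree.\<close>

lemma curve_hf_step:
  fixes J :: "('k::{alg_closed_field, ring_char_0}, 'n::{finite,linorder}) mpoly set"
  assumes J: "curve_ideal J" and d: "has_degree J d"
  obtains N where "\<And>t. N \<le> t \<Longrightarrow> hf J (Suc t) = hf J t + d"
proof -
  obtain x y where xy: "x \<noteq> y" "coords {x, y}" "is_form 1 x" "is_form 1 y" "finite_over {x, y} J" "{x, y} \<subseteq> alg (range var)"
    by (rule curve_parameters[OF J coords_vars finite_over_vars])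
  let ?K = "idl.span (insert x J)"
  have K: "hideal ?K" by (rule hideal_insert_form[OF curve_idealD(1)[OF J] xy(3)])
  have "{x, y} \<union> J \<subseteq> idl.span ({y} \<union> ?K)" using idl.span_superset[of "insert x J"] by (auto intro: idl.span_base)
  then have "finite_over {y} ?K" by (rule finite_over_trans[OF xy(5)])
  then obtain B where B: "\<And>t. hf ?K t \<le> B" by (rule hf_bounded[OF K xy(4)]) blast
  have nzd: "f \<in> J" if "x * f \<in> J" for f by (rule linear_nonzerodivisor[OF curve_idealD(1,4)[OF J] xy(3-5) that])
  have step: "hf J (Suc t) = hf J t + hf ?K (Suc t)" for t by (rule hf_quotient[OF curve_idealD(1)[OF J] xy(3) nzd])
  obtain p where p: "is_hilbert_polynomial J p" "of_nat d = fact (degree p) * lead_coeff p"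
    using d unfolding has_degree_def by blast
  then obtain N where N: "\<And>t. N \<le> t \<Longrightarrow> poly p (of_nat t) = of_nat (hf J t)"
    unfolding is_hilbert_polynomial_def eventually_sequentially by blast
  define r where "r = pcompose p [:1, 1:] - p"
  have r: "poly r (of_nat t) = of_nat (hf ?K (Suc t))" if "N \<le> t" for t
    using N[of t] N[of "Suc t"] that step[of t] by (simp add: r_def poly_pcompose add.commute)
  have "finite ((\<lambda>t. hf ?K (Suc t)) ` {N..})" by (rule finite_subset[of _ "{..B}"]) (use B in auto)
  then have "\<exists>s\<in>{N..}. infinite {t \<in> {N..}. hf ?K (Suc t) = hf ?K (Suc s)}"
    by (rule pigeonhole_infinite[OF infinite_Ici])
  then obtain c where c: "infinite {t \<in> {N..}. hf ?K (Suc t) = c}" by blast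
  have r_const: "r = [:of_nat c:]"
  proof (rule ccontr)
    assume "r \<noteq> [:of_nat c:]"
    then have "finite {z. poly (r - [:of_nat c:]) z = 0}" by (intro poly_roots_finite) simp
    moreover have "(of_nat :: nat \<Rightarrow> rat) ` {t \<in> {N..}. hf ?K (Suc t) = c} \<subseteq> {z. poly (r - [:of_nat c:]) z = 0}"
      using r by auto
    ultimately have "finite ((of_nat :: nat \<Rightarrow> rat) ` {t \<in> {N..}. hf ?K (Suc t) = c})" by (rule finite_subset[rotated])
    then show False using c finite_imageD[OF _ inj_on_of_nat] by blast
  qed
  have lin: "poly p (of_nat t) = poly p 0 + of_nat c * of_nat t" for t
  proof (induction t)
    case (Suc t)
    have "poly r (of_nat t) = of_nat c" by (simp add: r_const)
    then have "poly p (of_nat (Suc t)) = poly p (of_nat t) + of_nat c"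
      by (simp add: r_def poly_pcompose algebra_simps)
    with Suc show ?case by (simp add: algebra_simps)
  qed simp
  have p_lin: "p = [:poly p 0, of_nat c:]"
  proof (rule ccontr)
    assume "p \<noteq> [:poly p 0, of_nat c:]"
    then have "finite {z. poly (p - [:poly p 0, of_nat c:]) z = 0}" by (intro poly_roots_finite) simp
    moreover have "range (of_nat :: nat \<Rightarrow> rat) \<subseteq> {z. poly (p - [:poly p 0, of_nat c:]) z = 0}"
      using lin by auto
    ultimately have "finite (range (of_nat :: nat \<Rightarrow> rat))" by (rule finite_subset[rotated])
    then show False using finite_imageD[OF _ inj_on_of_nat] by blast
  qed
  have "c \<noteq> 0"
  proof
    assume "c = 0"
    then have eq: "poly p (of_nat t) = poly p 0" for t using lin by simp
    define m where "m = N + hf J N"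
    have "poly p (of_nat m) = of_nat (hf J m)" by (rule N) (simp add: m_def)
    moreover have "poly p (of_nat N) = of_nat (hf J N)" by (rule N) simp
    ultimately have "hf J m = hf J N" unfolding eq by (metis of_nat_eq_iff)
    moreover have "Suc m \<le> hf J m" by (rule curve_hf_ge[OF J])
    ultimately show False unfolding m_def by simp
  qed
  then have deg: "degree p = 1" using arg_cong[OF p_lin, of degree] by simp
  have lead: "lead_coeff p = of_nat c" unfolding deg using arg_cong[OF p_lin, of "\<lambda>p. coeff p 1"] by simp
  have "(of_nat d :: rat) = of_nat c" using p(2) deg lead by simp
  then have "d = c" by simp
  have "hf J (Suc t) = hf J t + d" if t: "N \<le> t" for t
  proof -
    have "(of_nat (hf ?K (Suc t)) :: rat) = of_nat c" using r[OF t] by (simp add: r_const)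
    then show ?thesis using step[of t] \<open>d = c\<close> by simp
  qed
  with that show ?thesis by blast
qed

lemma curve_hf_linear:
  fixes J :: "('k::{alg_closed_field, ring_char_0}, 'n::{finite,linorder}) mpoly set"
  assumes J: "curve_ideal J" and d: "has_degree J d"
  obtains K where "\<And>t. hf J t \<le> d * t + K"
proof -
  obtain N where N: "\<And>t. N \<le> t \<Longrightarrow> hf J (Suc t) = hf J t + d" by (rule curve_hf_step[OF J d]) blast
  define K where "K = (\<Sum>t\<le>N. hf J t)"
  have "hf J t \<le> d * t + K" for t
  proof (cases "t \<le> N")
    case True
    then have "hf J t \<le> K" unfolding K_def by (intro member_le_sum) auto
    then show ?thesis by simp
  next
    case False
    have "hf J (N + m) \<le> d * m + K" for m
    proof (induction m)
      case 0
      show ?case unfolding K_def by (simp add: member_le_sum)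
    next
      case (Suc m)
      then show ?case using N[of "N + m"] by simp
    qed
    from this[of "t - N"] False have "hf J t \<le> d * (t - N) + K" by simp
    also have "\<dots> \<le> d * t + K" by simp
    finally show ?thesis .
  qed
  with that show ?thesis by blast
qed

lemma plane_section_hf:
  fixes J :: "('k::{alg_closed_field, ring_char_0}, 'n::{finite,linorder}) mpoly set"
  assumes J: "curve_ideal J" and d: "has_degree J d" and l: "is_form 1 l" and nzd: "\<And>f. l * f \<in> J \<Longrightarrow> f \<in> J"
  obtains N where "\<And>t. N \<le> t \<Longrightarrow> hf (idl.span (insert l J)) (Suc t) = d"
proof -
  obtain N where N: "\<And>t. N \<le> t \<Longrightarrow> hf J (Suc t) = hf J t + d" by (rule curve_hf_step[OF J d]) blast
  show ?thesis
  proof (rule that[of N])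
    fix t assume "N \<le> t"
    then show "hf (idl.span (insert l J)) (Suc t) = d"
      using N[of t] hf_quotient[OF curve_idealD(1)[OF J] l nzd, of t] by simp
  qed
qed

section \<open>Linear coordinate systems\<close>

lemma coords_duals:
  assumes "coords U"
  obtains e where "\<And>u t. u \<in> U \<Longrightarrow> t \<in> U \<Longrightarrow> eval_poly t (e u) = (if t = u then 1 else 0)"
proof -
  obtain e where "\<forall>u\<in>U. eval_poly u (e u) = 1 \<and> (\<forall>t\<in>U - {u}. eval_poly t (e u) = 0)"
    using coords_dual[OF assms] by metis
  then show ?thesis by (intro that[of e]) auto
qed

lemma eval_linear_sum:
  assumes "is_form 1 l" shows "eval_poly l (\<Sum>i\<in>A. f i) = (\<Sum>i\<in>A. eval_poly l (f i))"
  by (induction A rule: infinite_finite_induct) (auto simp: eval_linear_form(1,4)[OF assms])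

text \<open>A variable outside the subalgebra becomes, after subtracting its values on the dual basis, a form that
  vanishes on that basis; this extends the coordinates and lowers the number of variables outside.\<close>

lemma coords_extend:
  fixes T :: "('k::{field, ring_char_0}, 'n::finite) mpoly set"
  assumes "coords T" obtains U where "T \<subseteq> U" "coords U" "alg U = UNIV"
proof -
  have "\<exists>U. T \<subseteq> U \<and> coords U \<and> alg U = UNIV"
    using assms
  proof (induction "card {i. (var i :: ('k, 'n) mpoly) \<notin> alg T}" arbitrary: T rule: less_induct)
    case less
    show ?case
    proof (cases "\<forall>i. var i \<in> alg T")
      case True
      have "f \<in> alg T" for f by (induction f rule: mpoly_ring_induct) (use True in \<open>auto intro: alg.intros\<close>)
      then show ?thesis using less.prems by blast
    next
      case False
      then obtain i where i: "var i \<notin> alg T" by blast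
      obtain e where e: "\<And>u t. u \<in> T \<Longrightarrow> t \<in> T \<Longrightarrow> eval_poly t (e u) = (if t = u then 1 else 0)"
        by (rule coords_duals[OF less.prems]) blast
      note finT = coords_finite[OF less.prems] and formT = coords_form[OF less.prems]
      define x where "x = var i - (\<Sum>u\<in>T. cst (eval_poly (var i) (e u)) * u)"
      have x: "is_form 1 x" unfolding x_def
        by (intro is_form_diff is_form_var is_form_sum is_form_scale formT)
      have "(\<Sum>u\<in>T. cst (eval_poly (var i) (e u)) * u) \<in> alg T"
        by (intro alg_closed alg.alg_cst alg.alg_base)
      then have "x \<noteq> 0" using i by (auto simp: x_def)
      then obtain v where v: "eval_poly x v \<noteq> 0" using exists_nonzero_value by blast
      have xe: "eval_poly x (e u) = 0" if "u \<in> T" for u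
      proof -
        have "(\<Sum>t\<in>T. eval_poly (var i) (e t) * eval_poly t (e u)) = (\<Sum>t\<in>T. if t = u then eval_poly (var i) (e t) else 0)"
          by (rule sum.cong) (use e that in auto)
        then show ?thesis using finT that by (simp add: x_def eval_poly_simps)
      qed
      define w where "w = v - (\<Sum>u\<in>T. eval_poly u v *s e u)"
      have tw: "eval_poly t w = 0" if "t \<in> T" for t
      proof -
        have "(\<Sum>u\<in>T. eval_poly u v * eval_poly t (e u)) = (\<Sum>u\<in>T. if u = t then eval_poly u v else 0)"
          by (rule sum.cong) (use e that in auto)
        then show ?thesis using finT that eval_linear_form[OF formT[OF that]]
          by (simp add: w_def eval_linear_sum[OF formT[OF that]])
      qed
      have xw: "eval_poly x w = eval_poly x v"
        using xe eval_linear_form[OF x] by (simp add: w_def eval_linear_sum[OF x])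
      have co: "coords (insert x T)"
        unfolding coords_def
      proof (intro conjI ballI)
        fix s assume s: "s \<in> insert x T"
        show "is_form 1 s" using s x formT by blast
        show "\<exists>e. eval_poly s e = 1 \<and> (\<forall>t\<in>insert x T - {s}. eval_poly t e = 0)"
        proof (cases "s = x")
          case True
          have "eval_poly t (inverse (eval_poly x v) *s w) = 0" if "t \<in> T" for t
            using tw[OF that] eval_linear_form(2)[OF formT[OF that]] by simp
          moreover have "eval_poly x (inverse (eval_poly x v) *s w) = 1"
            using xw v eval_linear_form(2)[OF x] by simp
          ultimately show ?thesis using True by (intro exI[of _ "inverse (eval_poly x v) *s w"]) auto
        next
          case False
          then have "s \<in> T" using s by blast
          then show ?thesis using e xe by (intro exI[of _ "e s"]) (auto split: if_splits)
        qed
      qed (use finT in simp)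
      have "var i = x + (\<Sum>u\<in>T. cst (eval_poly (var i) (e u)) * u)" by (simp add: x_def)
      also have "\<dots> \<in> alg (insert x T)"
        by (intro alg_closed alg.alg_cst alg.alg_base) auto
      finally have "var i \<in> alg (insert x T)" .
      then have "{i. (var i :: ('k, 'n) mpoly) \<notin> alg (insert x T)} \<subset> {i. (var i :: ('k, 'n) mpoly) \<notin> alg T}"
        using i alg_mono[of T "insert x T"] by blast
      then have "card {i. (var i :: ('k, 'n) mpoly) \<notin> alg (insert x T)} < card {i. (var i :: ('k, 'n) mpoly) \<notin> alg T}"
        by (rule psubset_card_mono[rotated]) simp
      from less.hyps[OF this co] show ?thesis by blast
    qed
  qed
  with that show ?thesis by blast
qed

lemma full_coords_zero:
  assumes U: "coords U" "alg U = UNIV" and v: "\<And>u. u \<in> U \<Longrightarrow> eval_poly u v = eval_poly u w"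
  shows "v = w"
proof -
  have "v $ i = w $ i" for i
    using eval_alg_cong[of "var i" U v w] U(2) v by auto
  then show ?thesis by (simp add: vec_eq_iff)
qed

lemma common_zero_of_few_forms:
  fixes S :: "('k::field, 'n::finite) mpoly set"
  assumes "finite S" "\<And>s. s \<in> S \<Longrightarrow> is_form 1 s" "card S < CARD('n)"
  obtains v where "v \<noteq> 0" "\<And>s. s \<in> S \<Longrightarrow> eval_poly s v = 0"
proof -
  have "\<exists>b. (\<forall>j\<in>UNIV. b j \<in> UNIV) \<and> (\<exists>j\<in>UNIV. b j \<noteq> 0) \<and>
      (\<forall>s\<in>S. (\<Sum>j\<in>(UNIV :: 'n set). eval_poly s (axis j 1) * b j) = 0)"
    by (rule homogeneous_system_solvable[where B = UNIV]) (use assms in \<open>auto simp: subring_set_def\<close>)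
  then obtain b :: "'n \<Rightarrow> 'k" where b: "\<exists>j. b j \<noteq> 0"
    "\<And>s. s \<in> S \<Longrightarrow> (\<Sum>j\<in>UNIV. eval_poly s (axis j 1) * b j) = 0" by auto
  have vec: "(\<chi> j. b j) = (\<Sum>j\<in>UNIV. b j *s axis j 1)"
    by (simp add: vec_eq_iff axis_def if_distrib cong: if_cong)
  have "eval_poly s (\<chi> j. b j) = 0" if "s \<in> S" for s
    unfolding vec using b(2)[OF that]
    by (simp add: eval_linear_sum[OF assms(2)[OF that]] eval_linear_form(2)[OF assms(2)[OF that]] mult.commute)
  moreover have "(\<chi> j. b j) \<noteq> 0" using b(1) by (auto simp: vec_eq_iff)
  ultimately show ?thesis using that by blast
qed

lemma linear_form_through_points:
  fixes V :: "('k::{field, ring_char_0} ^ 'n::finite) set"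
  assumes "finite V" "card V < CARD('n)"
  obtains l where "is_form 1 l" "l \<noteq> 0" "\<And>v. v \<in> V \<Longrightarrow> eval_poly l v = 0"
proof -
  have "\<exists>b. (\<forall>j\<in>UNIV. b j \<in> UNIV) \<and> (\<exists>j\<in>UNIV. b j \<noteq> 0) \<and> (\<forall>v\<in>V. (\<Sum>j\<in>(UNIV :: 'n set). v $ j * b j) = 0)"
    by (rule homogeneous_system_solvable[where B = UNIV]) (use assms in \<open>auto simp: subring_set_def\<close>)
  then obtain b :: "'n \<Rightarrow> 'k" where b: "\<exists>j. b j \<noteq> 0" "\<And>v. v \<in> V \<Longrightarrow> (\<Sum>j\<in>UNIV. v $ j * b j) = 0" by auto
  define l where "l = (\<Sum>j\<in>UNIV. cst (b j) * var j)"
  have ev: "eval_poly l v = (\<Sum>j\<in>UNIV. v $ j * b j)" for v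
    by (simp add: l_def eval_poly_simps mult.commute)
  obtain j where j: "b j \<noteq> 0" using b(1) by blast
  have "eval_poly l (axis j 1) = b j"
    unfolding ev by (simp add: axis_def if_distrib[of "\<lambda>x. x * _"] cong: if_cong)
  then have "l \<noteq> 0" using j by auto
  moreover have "is_form 1 l" unfolding l_def by (intro is_form_sum is_form_scale is_form_var)
  ultimately show ?thesis using that b(2) ev by auto
qed

lemma full_coords_card:
  fixes U :: "('k::field, 'n::finite) mpoly set"
  assumes U: "coords U" "alg U = UNIV" shows "card U = CARD('n)"
proof (rule antisym)
  note finU = coords_finite[OF U(1)] and formU = coords_form[OF U(1)]
  show "card U \<le> CARD('n)"
  proof (rule ccontr)
    assume gt: "\<not> card U \<le> CARD('n)"
    obtain e where e: "\<And>u t. u \<in> U \<Longrightarrow> t \<in> U \<Longrightarrow> eval_poly t (e u) = (if t = u then 1 else 0)"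
      by (rule coords_duals[OF U(1)]) blast
    have "\<exists>b. (\<forall>j\<in>U. b j \<in> UNIV) \<and> (\<exists>j\<in>U. b j \<noteq> 0) \<and> (\<forall>i\<in>(UNIV :: 'n set). (\<Sum>j\<in>U. e j $ i * b j) = 0)"
      by (rule homogeneous_system_solvable[where B = UNIV]) (use gt finU in \<open>auto simp: subring_set_def\<close>)
    then obtain b where b: "\<exists>j\<in>U. b j \<noteq> 0" "\<And>i. (\<Sum>j\<in>U. e j $ i * b j) = 0" by auto
    have z: "(\<Sum>j\<in>U. b j *s e j) = 0" using b(2) by (simp add: vec_eq_iff mult.commute)
    have "b t = 0" if t: "t \<in> U" for t
    proof -
      have "0 = eval_poly t (\<Sum>j\<in>U. b j *s e j)" unfolding z using eval_linear_form(4)[OF formU[OF t]] by simp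
      also have "\<dots> = (\<Sum>j\<in>U. b j * eval_poly t (e j))"
        by (simp only: eval_linear_sum[OF formU[OF t]] eval_linear_form(2)[OF formU[OF t]])
      also have "\<dots> = (\<Sum>j\<in>U. if j = t then b j else 0)" by (rule sum.cong) (use e t in auto)
      finally show ?thesis using finU t by simp
    qed
    with b(1) show False by blast
  qed
  show "CARD('n) \<le> card U"
  proof (rule ccontr)
    assume "\<not> ?thesis"
    then have lt: "card U < CARD('n)" by simp
    obtain v where v: "v \<noteq> 0" "\<And>s. s \<in> U \<Longrightarrow> eval_poly s v = 0"
      by (rule common_zero_of_few_forms[OF finU formU lt]) blast+
    have "v = 0" by (rule full_coords_zero[OF U]) (use v(2) eval_linear_form(4)[OF formU] in auto)
    with v(1) show False by simp
  qed
qed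

text \<open>The coordinates of the projection from \<open>p\<close>.\<close>

definition lin :: "'k::field ^ 'n::finite \<Rightarrow> ('k, 'n) mpoly set" where
  "lin p = {l. is_form 1 l \<and> eval_poly l p = 0}"

lemma alg_lin_eq:
  fixes T :: "('k::{field, ring_char_0}, 'n::finite) mpoly set"
  assumes U: "coords (insert w T)" "alg (insert w T) = UNIV" "w \<notin> T" and p: "eval_poly w p \<noteq> 0" "\<And>t. t \<in> T \<Longrightarrow> eval_poly t p = 0"
  shows "alg (lin p) = alg T"
proof
  have formT: "\<And>t. t \<in> T \<Longrightarrow> is_form 1 t" and w: "is_form 1 w" using coords_form[OF U(1)] by auto
  show "alg T \<subseteq> alg (lin p)" by (rule alg_mono) (use formT p(2) in \<open>auto simp: lin_def\<close>)
  have finT: "finite T" using coords_finite[OF U(1)] by simp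
  obtain e where e: "\<And>u t. u \<in> insert w T \<Longrightarrow> t \<in> insert w T \<Longrightarrow> eval_poly t (e u) = (if t = u then 1 else 0)"
    by (rule coords_duals[OF U(1)]) blast
  show "alg (lin p) \<subseteq> alg T"
  proof (rule alg_subset)
    fix l assume "l \<in> lin p"
    then have l: "is_form 1 l" "eval_poly l p = 0" by (auto simp: lin_def)
    have "l - (\<Sum>t\<in>T. cst (eval_poly l (e t)) * t) = 0"
    proof (rule ccontr)
      assume "l - (\<Sum>t\<in>T. cst (eval_poly l (e t)) * t) \<noteq> 0"
      then obtain v where v: "eval_poly (l - (\<Sum>t\<in>T. cst (eval_poly l (e t)) * t)) v \<noteq> 0"
        using exists_nonzero_value by blast
      define v' where "v' = (\<Sum>t\<in>T. eval_poly t v *s e t) + (eval_poly w v / eval_poly w p) *s p"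
      have "v' = v"
      proof (rule full_coords_zero[OF U(1,2)])
        fix u assume u: "u \<in> insert w T"
        then have fu: "is_form 1 u" using formT w by blast
        have "eval_poly u v' = (\<Sum>t\<in>T. eval_poly t v * eval_poly u (e t)) + (eval_poly w v / eval_poly w p) * eval_poly u p"
          unfolding v'_def by (simp only: eval_linear_form(1,2)[OF fu] eval_linear_sum[OF fu])
        also have "(\<Sum>t\<in>T. eval_poly t v * eval_poly u (e t)) = (\<Sum>t\<in>T. if t = u then eval_poly t v else 0)"
          by (rule sum.cong) (use e u in auto)
        also have "\<dots> + (eval_poly w v / eval_poly w p) * eval_poly u p = eval_poly u v"
          using u p finT U(3) by (cases "u = w") auto
        finally show "eval_poly u v' = eval_poly u v" .
      qed
      have "eval_poly l v' = (\<Sum>t\<in>T. eval_poly t v * eval_poly l (e t)) + (eval_poly w v / eval_poly w p) * eval_poly l p"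
        unfolding v'_def by (simp only: eval_linear_form(1,2)[OF l(1)] eval_linear_sum[OF l(1)])
      then have "eval_poly l v = (\<Sum>t\<in>T. eval_poly l (e t) * eval_poly t v)"
        using l(2) \<open>v' = v\<close> by (simp add: mult.commute)
      then show False using v by (simp add: eval_poly_simps)
    qed
    then have "l = (\<Sum>t\<in>T. cst (eval_poly l (e t)) * t)" by simp
    also have "\<dots> \<in> alg T" by (intro alg_closed alg.alg_cst alg.alg_base)
    finally show "l \<in> alg T" .
  qed
qed

lemma lin_coords:
  fixes p :: "'k::{field, ring_char_0} ^ 'n::finite"
  assumes "p \<noteq> 0"
  obtains w T where "coords (insert w T)" "alg (insert w T) = UNIV" "w \<notin> T" "eval_poly w p = 1"
    "\<And>t. t \<in> T \<Longrightarrow> eval_poly t p = 0" "card T = CARD('n) - 1" "alg (lin p) = alg T"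
proof -
  obtain i where i: "p $ i \<noteq> 0" using assms by (auto simp: vec_eq_iff)
  define w0 where "w0 = (var i :: ('k, 'n) mpoly)"
  define U where "U = (range var :: ('k, 'n) mpoly set)"
  have U: "coords U" "w0 \<in> U" "eval_poly w0 p \<noteq> 0" using coords_vars i by (auto simp: U_def w0_def)
  define T where "T = pencil U w0 p"
  define w where "w = cst (inverse (p $ i)) * w0"
  have w0: "w0 = cst (p $ i) * w" using i by (simp add: w_def mult_single flip: mult.assoc)
  have van: "\<And>t. t \<in> T \<Longrightarrow> eval_poly t p = 0" unfolding T_def by (rule pencil_vanish[OF U])
  have wp: "eval_poly w p = 1" using i by (simp add: w_def w0_def eval_poly_simps)
  then have nin: "w \<notin> T" using van by fastforce
  have c0: "coords (insert w0 T)" unfolding T_def by (rule coords_insert_pencil[OF U])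
  have nin0: "w0 \<notin> T" unfolding T_def by (rule pencil_notin[OF U])
  have co: "coords (insert w T)"
    unfolding coords_def
  proof (intro conjI ballI)
    show "finite (insert w T)" using coords_finite[OF c0] by simp
    fix s assume s: "s \<in> insert w T"
    show "is_form 1 s" using s coords_form[OF c0] by (auto simp: w_def intro: is_form_scale)
    show "\<exists>e. eval_poly s e = 1 \<and> (\<forall>t\<in>insert w T - {s}. eval_poly t e = 0)"
    proof (cases "s = w")
      case True
      then show ?thesis using wp van by (intro exI[of _ p]) auto
    next
      case False
      then have sT: "s \<in> T" using s by blast
      obtain e where e: "eval_poly s e = 1" "\<forall>t\<in>insert w0 T - {s}. eval_poly t e = 0"
        using coords_dual[OF c0, of s] sT by blast
      moreover have "w0 \<noteq> s" using nin0 sT by blast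
      ultimately have "eval_poly w e = 0" by (simp add: w_def eval_poly_simps)
      then show ?thesis using e by (intro exI[of _ e]) auto
    qed
  qed
  have "alg (insert w0 T) = UNIV"
    using alg_insert_pencil[OF U] alg_vars unfolding T_def U_def by auto
  moreover have "alg (insert w0 T) \<subseteq> alg (insert w T)"
    by (rule alg_subset) (auto simp: w0 intro: alg.intros)
  ultimately have full: "alg (insert w T) = UNIV" by blast
  have "card T = CARD('n) - 1" using card_pencil[OF U] card_vars[where 'k='k and 'n='n] by (simp add: T_def U_def)
  then show ?thesis
    using that[OF co full nin wp van] alg_lin_eq[OF co full nin _ van] wp by simp
qed

text \<open>A form in \<open>J\<close> that does not vanish at \<open>p\<close> makes \<open>w\<close> integral over the linear forms vanishing at
  \<open>p\<close>: the projection from a point off the zero locus is a finite map.\<close>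

lemma finite_over_lin:
  fixes J :: "('k::{field, ring_char_0}, 'n::finite) mpoly set"
  assumes U: "coords (insert w T)" "alg (insert w T) = UNIV" "w \<notin> T"
    and p: "eval_poly w p \<noteq> 0" "\<And>t. t \<in> T \<Longrightarrow> eval_poly t p = 0"
    and J: "idl.subspace J" and g: "g \<in> J" "is_form n g" "eval_poly g p \<noteq> 0"
  shows "finite_over T J"
proof -
  have w: "w \<in> insert w T" by simp
  have eq: "pencil (insert w T) w p = T"
  proof -
    have "pencil (insert w T) w p = (\<lambda>s. s) ` T"
      unfolding pencil_def by (rule image_cong) (use U(3) p(2) in auto)
    then show ?thesis by simp
  qed
  have "finite_over (insert w T) J"
  proof -
    have "var i \<in> idl.span (insert w T \<union> J)" for i
    proof -
      have gens: "s - cst (eval_poly s 0) \<in> idl.span (insert w T \<union> J)" if s: "s \<in> insert w T" for s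
        using eval_linear_form(4)[OF coords_form[OF U(1) s]] idl.span_base[of s "insert w T \<union> J"] s by auto
      have "var i \<in> alg (insert w T)" unfolding U(2) by (rule UNIV_I)
      from alg_minus_value[OF this idl.subspace_span gens]
      have "var i - cst (eval_poly (var i) 0) \<in> idl.span (insert w T \<union> J)" .
      then show ?thesis by simp
    qed
    then show ?thesis unfolding finite_over_def by (metis power_one_right)
  qed
  then have "finite_over (pencil (insert w T) w p) J"
    by (intro finite_over_pencil[OF U(1) w p(1) J _ g(2,1,3)]) (use U(2) in auto)
  with eq show ?thesis by simp
qed

section \<open>Ternary forms\<close>

definition tform :: "('k::field, 'n::finite) mpoly \<Rightarrow> ('k, 'n) mpoly \<Rightarrow> ('k, 'n) mpoly \<Rightarrow> nat \<Rightarrow> (nat \<Rightarrow> 'k poly) \<Rightarrow> ('k, 'n) mpoly" where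
  "tform x y z m r = (\<Sum>k\<le>m. bform x y (m - k) (r k) * z ^ k)"

lemma hcomp_alg3:
  assumes xyz: "is_form 1 x" "is_form 1 y" "is_form 1 z" and f: "f \<in> alg {x, y, z}"
  obtains r where "\<And>k. k \<le> m \<Longrightarrow> degree (r k) \<le> m - k" "hcomp m f = tform x y z m r"
proof -
  have "f \<in> alg (insert z {x, y})" using f by (simp add: insert_commute)
  then obtain q where q: "poly_over (alg {x, y}) q" "f = poly q z" by (rule alg_insert)
  have "\<exists>s. degree s \<le> m - k \<and> hcomp (m - k) (coeff q k) = bform x y (m - k) s" for k
    using hcomp_alg2[OF xyz(1,2), of "coeff q k" "m - k"] q(1) unfolding poly_over_def by blast
  then obtain r where r: "\<And>k. degree (r k) \<le> m - k" "\<And>k. hcomp (m - k) (coeff q k) = bform x y (m - k) (r k)"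
    by metis
  have zk: "hcomp m (coeff q k * z ^ k) = (if k \<le> m then bform x y (m - k) (r k) * z ^ k else 0)" for k
  proof (cases "k \<le> m")
    case True
    then have "hcomp (k + (m - k)) (z ^ k * coeff q k) = z ^ k * hcomp (m - k) (coeff q k)"
      by (intro hcomp_mult_form is_form_power1 xyz)
    then show ?thesis using True r(2)[of k] by (simp add: mult.commute)
  next
    case False
    then have "hcomp m (z ^ k * coeff q k) = 0"
      by (intro hcomp_mult_form_less[OF is_form_power1[OF xyz(3)]]) simp
    then show ?thesis using False by (simp add: mult.commute)
  qed
  have "f = (\<Sum>k\<le>degree q + m. coeff q k * z ^ k)"
    unfolding q(2) poly_altdef by (rule sum.mono_neutral_left) (auto simp: coeff_eq_0)
  then have "hcomp m f = (\<Sum>k\<le>degree q + m. if k \<le> m then bform x y (m - k) (r k) * z ^ k else 0)"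
    by (simp only: hcomp_sum zk)
  also have "\<dots> = tform x y z m r"
    unfolding tform_def by (rule sum.mono_neutral_cong_right) auto
  finally have eq: "hcomp m f = tform x y z m r" .
  show ?thesis by (rule that[OF r(1) eq])
qed

lemma is_form_tform:
  assumes "is_form 1 x" "is_form 1 y" "is_form 1 z" shows "is_form m (tform x y z m r)"
  unfolding tform_def
proof (rule is_form_sum)
  fix k assume "k \<in> {..m}"
  then show "is_form m (bform x y (m - k) (r k) * z ^ k)"
    using is_form_mult[OF is_form_bform[OF assms(1,2), of "m - k"] is_form_power1[OF assms(3), of k]] by simp
qed

lemma eval_bform:
  "eval_poly (bform x y n q) v = (\<Sum>k\<le>n. coeff q k * (eval_poly x v ^ k * eval_poly y v ^ (n - k)))"
  by (simp add: bform_def eval_poly_simps)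

lemma eval_bform_0_1:
  assumes "eval_poly x v = 0" "eval_poly y v = 1" shows "eval_poly (bform x y n q) v = coeff q 0"
  using assms by (simp add: eval_bform sum.atMost_shift)

section \<open>Points of a general plane section\<close>

lemma eval_of_nat: "eval_poly (of_nat n) v = of_nat n"
  by (induction n) (auto simp: eval_poly_add)

lemma eval_poly_poly_map: "eval_poly (poly p f) v = poly (map_poly (\<lambda>b. eval_poly b v) p) (eval_poly f v)"
  by (induction p) (auto simp: map_poly_pCons eval_poly_simps)

text \<open>Over a point \<open>(0 : 1)\<close> of the line where all the derivatives of the relations of the variables
  stay units, the fibre is reduced: near a point \<open>v\<close> of the fibre the relation of each variable
  factors as \<open>(x\<^sub>i - v\<^sub>i) E\<^sub>i\<close> with \<open>E\<^sub>i(v) \<noteq> 0\<close>, and the product of the \<open>E\<^sub>i\<close> isolates \<open>v\<close>.\<close>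

lemma reduced_fibre:
  fixes J :: "('k::{alg_closed_field, field_char_0}, 'n::{finite,linorder}) mpoly set"
  assumes J: "idl.subspace J" "J \<subseteq> J1" and J1: "idl.subspace J1" "module_finite (range cst) J1"
    and B: "\<And>b. b \<in> B \<Longrightarrow> b - cst (eval_poly b v0) \<in> J1" and sub: "subring_set B"
    and rel: "\<And>i. poly_over B (p i)" "\<And>i. poly (p i) (var i) \<in> J"
      "\<And>i. b i \<in> B" "\<And>i. eval_poly (b i) v0 \<noteq> 0" "\<And>i. b i - r i * poly (pderiv (p i)) (var i) \<in> J"
    and f: "\<And>v. v \<in> zeros J1 \<Longrightarrow> eval_poly f v = 0"
  shows "f \<in> J1"
proof (rule ccontr)
  assume "f \<notin> J1"
  let ?C = "colon J1 f"
  have C: "idl.subspace ?C" by (rule ideal_colon[OF J1(1)])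
  have "1 \<notin> ?C" using \<open>f \<notin> J1\<close> by (simp add: mem_colon)
  moreover have "module_finite (range cst) ?C" by (rule module_finite_mono[OF J1(2) colon_superset[OF J1(1)]])
  ultimately have "zeros ?C \<noteq> {}" using finite_dim_ideal_has_zero[OF C] by blast
  then obtain v where vC: "v \<in> zeros ?C" by blast
  then have v: "v \<in> zeros J1" using colon_superset[OF J1(1), of f] unfolding zeros_def by blast
  then have vJ: "v \<in> zeros J" using J(2) unfolding zeros_def by blast
  have valB: "eval_poly c v = eval_poly c v0" if "c \<in> B" for c
    using v B[OF that] unfolding zeros_def by (auto simp: eval_poly_simps)
  have "\<exists>E. E * (var i - cst (v $ i)) \<in> J1 \<and> eval_poly E v \<noteq> 0" for i
  proof -
    define h where "h = map_poly (\<lambda>b. eval_poly b v) (p i)"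
    have root: "poly h (v $ i) = 0"
      using vJ rel(2)[of i] eval_poly_poly_map[of "p i" "var i" v] unfolding zeros_def h_def by auto
    have "pderiv h = map_poly (\<lambda>b. eval_poly b v) (pderiv (p i))"
      by (rule poly_eqI) (simp add: h_def coeff_pderiv coeff_map_poly eval_poly_mult eval_of_nat[of "Suc _"] del: of_nat_Suc)
    then have d: "poly (pderiv h) (v $ i) = eval_poly (poly (pderiv (p i)) (var i)) v"
      using eval_poly_poly_map[of "pderiv (p i)" "var i" v] by simp
    have "eval_poly (b i - r i * poly (pderiv (p i)) (var i)) v = 0"
      using vJ rel(5)[of i] unfolding zeros_def by blast
    then have simple: "poly (pderiv h) (v $ i) \<noteq> 0"
      using rel(4)[of i] valB[OF rel(3)[of i]] unfolding d by (auto simp: eval_poly_simps)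
    obtain e where e: "h = [:- (v $ i), 1:] * e" using root poly_eq_0_iff_dvd by blast
    have "pderiv h = [:- (v $ i), 1:] * pderiv e + e" unfolding e by (simp only: pderiv_mult) (simp add: pderiv_pCons)
    then have "poly (pderiv h) (v $ i) = poly e (v $ i)" by simp
    with simple have ev: "poly e (v $ i) \<noteq> 0" by simp
    have coeff: "coeff (p i) k - cst (coeff h k) \<in> J1" for k
    proof -
      have k: "coeff (p i) k \<in> B" using rel(1)[of i] unfolding poly_over_def by blast
      show ?thesis using B[OF k] valB[OF k] by (simp add: h_def coeff_map_poly)
    qed
    have "degree h \<le> degree (p i)" unfolding h_def by (rule degree_le) (simp add: coeff_map_poly coeff_eq_0)
    then have "degree (map_poly cst h :: ('k, 'n) mpoly poly) \<le> degree (p i)"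
      by (intro degree_le) (simp add: coeff_map_poly coeff_eq_0)
    then have "poly (map_poly cst h) (var i) = (\<Sum>k\<le>degree (p i). coeff (map_poly cst h) k * var i ^ k)"
      unfolding poly_altdef by (intro sum.mono_neutral_left) (auto simp: coeff_eq_0)
    then have "poly (map_poly cst h) (var i) = (\<Sum>k\<le>degree (p i). cst (coeff h k) * var i ^ k)"
      by (simp add: coeff_map_poly)
    then have "poly (p i) (var i) - poly (map_poly cst h) (var i)
        = (\<Sum>k\<le>degree (p i). var i ^ k * (coeff (p i) k - cst (coeff h k)))"
      by (simp add: poly_altdef[of "p i"] right_diff_distrib sum_subtractf mult.commute)
    also have "\<dots> \<in> J1" by (intro idl.subspace_sum[OF J1(1)] ideal_mult_left[OF J1(1)] coeff)
    finally have diff: "poly (p i) (var i) - poly (map_poly cst h) (var i) \<in> J1" .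
    from idl.subspace_diff[OF J1(1) subsetD[OF J(2) rel(2)[of i]] this]
    have "poly (map_poly cst h) (var i) \<in> J1" by simp
    moreover have "poly (map_poly cst h) (var i) = poly (map_poly cst e) (var i) * (var i - cst (v $ i))"
      unfolding e map_poly_cst_mult by (simp add: map_poly_pCons single_uminus algebra_simps)
    moreover have "eval_poly (poly (map_poly cst e) (var i)) v \<noteq> 0" using ev by (simp add: eval_poly_map_cst)
    ultimately show ?thesis by metis
  qed
  then obtain E where E: "\<And>i. E i * (var i - cst (v $ i)) \<in> J1" "\<And>i. eval_poly (E i) v \<noteq> 0" by metis
  define F where "F = (\<Prod>i\<in>UNIV. E i)"
  have FD: "idl.subspace (colon J1 F)" by (rule ideal_colon[OF J1(1)])
  have "var i - cst (v $ i) \<in> colon J1 F" for i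
  proof -
    have "F * (var i - cst (v $ i)) = (\<Prod>j\<in>UNIV - {i}. E j) * (E i * (var i - cst (v $ i)))"
      unfolding F_def by (simp add: prod.remove[of UNIV i] mult_ac)
    then show ?thesis unfolding mem_colon by (metis ideal_mult_left[OF J1(1) E(1)])
  qed
  then have gens: "s - cst (eval_poly s v) \<in> colon J1 F" if "s \<in> range var" for s
    using that by (auto simp del: One_nat_def)
  have "f - cst (eval_poly f v) \<in> colon J1 F" by (rule alg_minus_value[OF alg_vars FD gens])
  then have "f * F \<in> J1" using f[OF v] by (simp add: mem_colon mult.commute)
  then have "F \<in> ?C" by (simp add: mem_colon)
  then have "eval_poly F v = 0" using vC unfolding zeros_def by blast
  then show False using E(2) by (simp add: F_def eval_poly_prod)
qed

text \<open>Dehomogenizing at \<open>y = 1\<close> loses only powers of \<open>y\<close>.\<close>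

lemma dehomogenized_membership:
  assumes K: "hideal K" and y: "is_form 1 y" and f: "is_form t f" "f \<in> idl.span (insert (y - 1) K)"
  obtains N where "y ^ N * f \<in> K"
proof -
  note idK = hideal_ideal[OF K]
  obtain k where k: "f - k * (y - 1) \<in> K" using f(2) mem_span_insert_ideal[OF idK] by blast
  have eq: "f - k * (y - 1) = f + k - y * k" by (simp add: algebra_simps)
  have c0: "hcomp 0 (y * k) = 0" by (rule hcomp_mult_form_less[OF y]) simp
  have cS: "hcomp (Suc j) (y * k) = y * hcomp j k" for j using hcomp_mult_form[OF y, of j k] by simp
  have g: "hcomp j f + hcomp j k - hcomp j (y * k) \<in> K" for j
    using hideal_hcomp[OF K k, of j] unfolding eq by (simp add: hcomp_add hcomp_diff)
  have low: "hcomp j k \<in> K" if "j < t" for j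
    using that
  proof (induction j)
    case 0
    then show ?case using g[of 0] hcomp_form[OF f(1), of 0] c0 by simp
  next
    case (Suc j)
    have "hcomp (Suc j) k - y * hcomp j k \<in> K" using g[of "Suc j"] hcomp_form[OF f(1), of "Suc j"] Suc.prems cS by simp
    moreover have "y * hcomp j k \<in> K" using Suc by (intro ideal_mult_left[OF idK]) simp
    ultimately have "(hcomp (Suc j) k - y * hcomp j k) + y * hcomp j k \<in> K" by (rule idl.subspace_add[OF idK])
    then show ?case by simp
  qed
  have at: "f + hcomp t k \<in> K"
  proof (cases t)
    case 0
    then show ?thesis using g[of 0] hcomp_form[OF f(1), of 0] c0 by simp
  next
    case (Suc s)
    have "f + hcomp t k - y * hcomp s k \<in> K" using g[of t] hcomp_form[OF f(1), of t] cS[of s] Suc by simp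
    moreover have "y * hcomp s k \<in> K" using low[of s] Suc by (intro ideal_mult_left[OF idK]) simp
    ultimately have "(f + hcomp t k - y * hcomp s k) + y * hcomp s k \<in> K" by (rule idl.subspace_add[OF idK])
    then show ?thesis by simp
  qed
  have high: "y ^ N * f + hcomp (t + N) k \<in> K" for N
  proof (induction N)
    case 0
    show ?case using at by simp
  next
    case (Suc N)
    have "hcomp (t + Suc N) k - y * hcomp (t + N) k \<in> K"
      using g[of "t + Suc N"] hcomp_form[OF f(1), of "t + Suc N"] cS[of "t + N"] by simp
    from idl.subspace_add[OF idK ideal_mult_left[OF idK Suc, of y] this]
    show ?case by (simp add: algebra_simps)
  qed
  obtain M where M: "k = (\<Sum>t<M. hcomp t k)" "\<And>t. t \<ge> M \<Longrightarrow> hcomp t k = 0" by (rule sum_hcomp[of k]) blast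
  have "y ^ M * f \<in> K" using high[of M] M(2)[of "t + M"] by simp
  with that show ?thesis by blast
qed

text \<open>The line \<open>x = 0\<close> in the space of parameters is chosen through a point \<open>v\<^sub>0\<close> over which the relations of all
  variables stay separable, so that the fibre over it is reduced. In large degrees a form vanishing at all
  points of the section lies in \<open>J + (x)\<close>. Hence these points are at least as many as the value of the
  Hilbert function of the section in large degrees, which is \<open>d\<close>.\<close>

lemma plane_section_points:
  fixes J :: "('k::{alg_closed_field, field_char_0}, 'n::{finite,linorder}) mpoly set"
  assumes J: "curve_ideal J" and d: "has_degree J d"
  obtains x y V where "is_form 1 x" "is_form 1 y" "finite_over {x, y} J" "coords {x, y}" "x \<noteq> y"
    "finite V" "d \<le> card V" "V \<subseteq> zeros J" "\<And>v. v \<in> V \<Longrightarrow> eval_poly x v = 0" "\<And>v. v \<in> V \<Longrightarrow> eval_poly y v = 1"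
proof -
  note D = curve_idealD[OF J]
  obtain x1 y1 where xy1: "x1 \<noteq> y1" "coords {x1, y1}" "is_form 1 x1" "is_form 1 y1" "finite_over {x1, y1} J" "{x1, y1} \<subseteq> alg (range var)"
    by (rule curve_parameters[OF J coords_vars finite_over_vars])
  define B where "B = alg {x1, y1}"
  have sub: "subring_set B" unfolding B_def by (rule alg_subring)
  have mf: "module_finite B J" unfolding B_def by (rule coords_module_finite[OF xy1(2) D(1) xy1(5)])
  have tf: "f \<in> J" if "b \<in> B" "b \<noteq> 0" "b * f \<in> J" for b f
    using curve_torsion_free[OF J xy1(3-5)] that unfolding B_def by blast
  have "\<exists>p b r. p \<noteq> 0 \<and> poly_over B p \<and> poly p (var i) \<in> J \<and> b \<in> B \<and> b \<noteq> 0 \<and> b - r * poly (pderiv p) (var i) \<in> J" for i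
    by (rule separable_relation[OF sub D(2) mf D(3) tf, where z = "var i"]) blast+
  then obtain p b r where rel: "\<And>i. poly_over B (p i)" "\<And>i. poly (p i) (var i) \<in> J"
      "\<And>i. b i \<in> B" "\<And>i. b i \<noteq> 0" "\<And>i. b i - r i * poly (pderiv (p i)) (var i) \<in> J" by metis
  obtain e1 where e1: "eval_poly x1 e1 = 1" using coords_dual[OF xy1(2), of x1] by blast
  have "x1 * (\<Prod>i\<in>UNIV. b i) \<noteq> 0" using rel(4) e1 by auto
  then obtain v0 where "eval_poly (x1 * (\<Prod>i\<in>UNIV. b i)) v0 \<noteq> 0" using exists_nonzero_value by blast
  then have x1v: "eval_poly x1 v0 \<noteq> 0" and bv: "\<And>i. eval_poly (b i) v0 \<noteq> 0" by (auto simp: eval_poly_simps)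
  define y where "y = cst (inverse (eval_poly x1 v0)) * x1"
  define x where "x = y1 - cst (eval_poly y1 v0) * y"
  have fy: "is_form 1 y" unfolding y_def by (intro is_form_scale xy1)
  have fx: "is_form 1 x" unfolding x_def by (intro is_form_diff is_form_scale xy1 fy)
  have yv: "eval_poly y v0 = 1" using x1v by (simp add: y_def eval_poly_simps)
  have xv: "eval_poly x v0 = 0" using yv by (simp add: x_def eval_poly_simps)
  have x1_eq: "x1 = cst (eval_poly x1 v0) * y" using x1v by (simp add: y_def mult_single flip: mult.assoc)
  have y1_eq: "y1 = x + cst (eval_poly y1 v0) * y" by (simp add: x_def)
  have "x1 \<in> idl.span ({x, y} \<union> J)" by (subst x1_eq) (intro idl.span_scale idl.span_base, simp)
  moreover have "y1 \<in> idl.span ({x, y} \<union> J)" by (subst y1_eq) (intro idl.span_add idl.span_scale idl.span_base, auto)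
  ultimately have fxy: "finite_over {x, y} J" by (intro finite_over_trans[OF xy1(5)]) (auto intro: idl.span_base)
  obtain ea where ea: "eval_poly x1 ea = 1" "eval_poly y1 ea = 0" using coords_dual[OF xy1(2), of x1] xy1(1) by auto
  obtain eb where eb: "eval_poly y1 eb = 1" "eval_poly x1 eb = 0" using coords_dual[OF xy1(2), of y1] xy1(1) by auto
  have xyeb: "eval_poly x eb = 1" "eval_poly y eb = 0" using eb by (auto simp: x_def y_def eval_poly_simps)
  then have neq: "x \<noteq> y" by auto
  have co: "coords {x, y}"
    unfolding coords_def
  proof (intro conjI ballI)
    fix s assume "s \<in> {x, y}"
    then show "\<exists>e. eval_poly s e = 1 \<and> (\<forall>t\<in>{x, y} - {s}. eval_poly t e = 0)"
      using xv yv xyeb by auto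
  qed (use fx fy in auto)
  define J1 where "J1 = idl.span (insert x (insert (y - 1) J))"
  define K where "K = idl.span (insert x J)"
  have J1: "idl.subspace J1" by (simp add: J1_def)
  have JJ1: "J \<subseteq> J1" unfolding J1_def by (auto intro: idl.span_base)
  have K: "hideal K" unfolding K_def by (rule hideal_insert_form[OF D(1) fx])
  have J1K: "J1 \<subseteq> idl.span (insert (y - 1) K)"
    unfolding J1_def
  proof (rule idl.span_minimal)
    have "insert x J \<subseteq> K" unfolding K_def by (rule idl.span_superset)
    then show "insert x (insert (y - 1) J) \<subseteq> idl.span (insert (y - 1) K)" by (auto intro: idl.span_base)
  qed simp
  have gen: "s - cst (eval_poly s v0) \<in> J1" if "s \<in> {x1, y1}" for s
  proof -
    have xJ: "x \<in> J1" and yJ: "y - 1 \<in> J1" unfolding J1_def by (auto intro: idl.span_base)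
    have "x1 - cst (eval_poly x1 v0) = cst (eval_poly x1 v0) * (y - 1)"
      by (subst (1) x1_eq) (simp add: algebra_simps)
    then have "x1 - cst (eval_poly x1 v0) \<in> J1" using ideal_mult_left[OF J1 yJ] by simp
    moreover have "y1 - cst (eval_poly y1 v0) = x + cst (eval_poly y1 v0) * (y - 1)"
      by (subst (1) y1_eq) (simp add: algebra_simps)
    then have "y1 - cst (eval_poly y1 v0) \<in> J1" using idl.subspace_add[OF J1 xJ ideal_mult_left[OF J1 yJ]] by simp
    ultimately show ?thesis using that by blast
  qed
  have mf1: "module_finite (range cst) J1" using module_finite_fibre[OF _ J1 JJ1 gen] mf unfolding B_def by blast
  have valB: "c - cst (eval_poly c v0) \<in> J1" if "c \<in> B" for c
    using alg_minus_value[OF _ J1 gen] that unfolding B_def by blast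
  define V where "V = zeros J1"
  have finV: "finite V" unfolding V_def by (rule finite_zeros[OF J1 mf1])
  have VJ: "V \<subseteq> zeros J" using JJ1 unfolding V_def zeros_def by blast
  have Vx: "eval_poly x v = 0" if "v \<in> V" for v
  proof -
    have "x \<in> J1" unfolding J1_def by (auto intro: idl.span_base)
    then show ?thesis using that unfolding V_def zeros_def by blast
  qed
  have Vy: "eval_poly y v = 1" if "v \<in> V" for v
  proof -
    have "y - 1 \<in> J1" unfolding J1_def by (auto intro: idl.span_base)
    then have "eval_poly (y - 1) v = 0" using that unfolding V_def zeros_def by blast
    then show ?thesis by (simp add: eval_poly_simps)
  qed
  have "d \<le> card V"
  proof (rule ccontr)
    assume lt: "\<not> d \<le> card V"
    have nzd: "f \<in> J" if "x * f \<in> J" for f by (rule linear_nonzerodivisor[OF D(1,4) fx fy fxy that])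
    obtain N where N: "\<And>t. N \<le> t \<Longrightarrow> hf K (Suc t) = d"
      unfolding K_def by (rule plane_section_hf[OF J d fx nzd]) blast+
    have "{x, y} \<union> J \<subseteq> idl.span ({y} \<union> K)"
      using idl.span_superset[of "insert x J"] unfolding K_def by (auto intro: idl.span_base)
    then have "finite_over {y} K" by (rule finite_over_trans[OF fxy])
    then obtain M where M: "\<And>t f. M \<le> t \<Longrightarrow> is_form t f \<Longrightarrow> f \<in> idl.span ({y} \<union> K)"
      by (rule finite_over_imp_large_forms) blast
    note idK = hideal_ideal[OF K]
    have inj: "f \<in> K" if t: "Suc (N + M) \<le> t" and f: "is_form t f" "y * f \<in> K" for t f
    proof -
      have hft: "hf K t = d" using N[of "t - 1"] t by simp
      have hfS: "hf K (Suc t) = d" using N[of t] t by simp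
      obtain T where T: "finite T" "\<And>s. s \<in> T \<Longrightarrow> is_form t s" "card T = hf K t"
        "\<And>c. (\<Sum>s\<in>T. cst (c s) * s) \<in> K \<Longrightarrow> \<forall>s\<in>T. c s = 0"
        "\<And>f. is_form t f \<Longrightarrow> \<exists>c. f - (\<Sum>s\<in>T. cst (c s) * s) \<in> K"
        by (rule hf_basis[OF idK, of t]) blast
      obtain c where c: "f - (\<Sum>s\<in>T. cst (c s) * s) \<in> K" using T(5)[OF f(1)] by blast
      have ysum: "y * (\<Sum>s\<in>T. cst (c s) * s) = (\<Sum>s\<in>T. cst (c s) * (y * s))" for c
        by (simp add: sum_distrib_left mult.left_commute)
      have "y * f - y * (f - (\<Sum>s\<in>T. cst (c s) * s)) \<in> K"
        by (rule idl.subspace_diff[OF idK f(2) ideal_mult_left[OF idK c]])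
      then have yc: "(\<Sum>s\<in>T. cst (c s) * (y * s)) \<in> K" unfolding ysum[symmetric] by (simp add: algebra_simps)
      have span: "\<exists>c. g - (\<Sum>s\<in>T. cst (c s) * (y * s)) \<in> K" if g: "is_form (Suc t) g" for g
      proof -
        have "g \<in> idl.span (insert y K)" using M[OF _ g] t by simp
        then obtain k where "g - k * y \<in> K" using mem_span_insert_ideal[OF idK] by blast
        then have "hcomp (1 + t) (g - y * k) \<in> K" by (intro hideal_hcomp[OF K]) (simp add: mult.commute)
        then have k: "g - y * hcomp t k \<in> K"
          using hcomp_mult_form[OF fy, of t k] hcomp_form[OF g, of "Suc t"] by (simp add: hcomp_diff)
        obtain a where a: "hcomp t k - (\<Sum>s\<in>T. cst (a s) * s) \<in> K" using T(5)[OF is_form_hcomp] by blast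
        have "g - y * hcomp t k + y * (hcomp t k - (\<Sum>s\<in>T. cst (a s) * s)) \<in> K"
          by (rule idl.subspace_add[OF idK k ideal_mult_left[OF idK a]])
        then have "g - (\<Sum>s\<in>T. cst (a s) * (y * s)) \<in> K" unfolding ysum[symmetric] by (simp add: algebra_simps)
        then show ?thesis by blast
      qed
      have yform: "is_form (Suc t) (y * s)" if "s \<in> T" for s
        using is_form_mult[OF fy T(2)[OF that]] by simp
      have "\<forall>s\<in>T. c s = 0"
        by (rule hf_spanning_independent[OF idK T(1) yform _ span yc]) (use T(3) hft hfS in auto)
      then have "(\<Sum>s\<in>T. cst (c s) * s) = 0" by (simp add: sum.neutral)
      then show ?thesis using c by simp
    qed
    define t where "t = Suc (N + M)"
    have inj': "f \<in> K" if "is_form (t + j) f" "y ^ m * f \<in> K" for m j f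
      using that
    proof (induction m arbitrary: f j)
      case (Suc m)
      have "y ^ m * (y * f) \<in> K" using Suc.prems(2) by (simp add: mult_ac)
      moreover have "is_form (t + Suc j) (y * f)" using is_form_mult[OF fy Suc.prems(1)] by simp
      ultimately have "y * f \<in> K" using Suc.IH by blast
      then show ?case using inj[OF _ Suc.prems(1)] by (simp add: t_def)
    qed simp
    obtain T where T: "finite T" "\<And>s. s \<in> T \<Longrightarrow> is_form t s" "card T = hf K t"
      "\<And>c. (\<Sum>s\<in>T. cst (c s) * s) \<in> K \<Longrightarrow> \<forall>s\<in>T. c s = 0"
      "\<And>f. is_form t f \<Longrightarrow> \<exists>c. f - (\<Sum>s\<in>T. cst (c s) * s) \<in> K"
      by (rule hf_basis[OF idK, of t]) blast
    have cardT: "card T = d" using T(3) N[of "N + M"] by (simp add: t_def)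
    have "\<exists>c. (\<forall>s\<in>T. c s \<in> UNIV) \<and> (\<exists>s\<in>T. c s \<noteq> 0) \<and> (\<forall>v\<in>V. (\<Sum>s\<in>T. eval_poly s v * c s) = 0)"
      by (rule homogeneous_system_solvable[where B = UNIV])
         (use finV T(1) lt cardT in \<open>auto simp: subring_set_def\<close>)
    then obtain c where c: "\<exists>s\<in>T. c s \<noteq> 0" "\<And>v. v \<in> V \<Longrightarrow> (\<Sum>s\<in>T. eval_poly s v * c s) = 0" by auto
    define f where "f = (\<Sum>s\<in>T. cst (c s) * s)"
    have f: "is_form t f" unfolding f_def by (intro is_form_sum is_form_scale T(2))
    have fV: "eval_poly f v = 0" if "v \<in> zeros J1" for v
      using c(2)[of v] that by (simp add: f_def eval_poly_simps V_def mult.commute)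
    have "f \<in> J1"
      by (rule reduced_fibre[OF D(5) JJ1 J1 mf1 valB sub rel(1-3) bv rel(5) fV])
    then have "f \<in> idl.span (insert (y - 1) K)" using J1K by blast
    then obtain m where "y ^ m * f \<in> K" by (rule dehomogenized_membership[OF K fy f])
    then have "f \<in> K" using inj'[of 0 f m] f by simp
    then show False using T(4) c(1) unfolding f_def by blast
  qed
  then show ?thesis by (rule that[OF fx fy fxy co neq finV _ VJ Vx Vy])
qed

text \<open>On the section \<open>x = 0, y = 1\<close> the relation becomes a polynomial in \<open>z\<close> of degree at most \<open>m\<close> with
  \<open>card V > m\<close> roots, so it vanishes and the relation is divisible by \<open>x\<close>. Since \<open>x\<close> is a
  nonzerodivisor, the quotient is a relation of smaller degree.\<close>

lemma no_ternary_relation: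
  fixes J :: "('k::{alg_closed_field, field_char_0}, 'n::finite) mpoly set"
  assumes J: "hideal J" "unmixed J" and x: "is_form 1 x" and y: "is_form 1 y" and finite_over: "finite_over {x, y} J"
    and V: "finite V" "V \<subseteq> zeros J" "\<And>v. v \<in> V \<Longrightarrow> eval_poly x v = 0" "\<And>v. v \<in> V \<Longrightarrow> eval_poly y v = 1"
      "inj_on (eval_poly z) V"
    and m: "m < card V" and r: "\<And>k. k \<le> m \<Longrightarrow> degree (r k) \<le> m - k" "tform x y z m r \<in> J"
  shows "\<forall>k\<le>m. r k = 0"
  using m r
proof (induction m arbitrary: r)
  let ?p = "\<lambda>m r. \<Sum>k\<le>m. monom (coeff (r k) 0) k"
  have zero: "coeff (r k) 0 = 0" if "m < card V" "tform x y z m r \<in> J" "k \<le> m" for m k and r :: "nat \<Rightarrow> 'k poly"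
  proof -
    have "poly (?p m r) (eval_poly z v) = 0" if "v \<in> V" for v
    proof -
      have "eval_poly (tform x y z m r) v = 0" using that V(2) \<open>tform x y z m r \<in> J\<close> unfolding zeros_def by blast
      then show ?thesis using eval_bform_0_1[OF V(3,4)[OF that]]
        by (simp add: tform_def eval_poly_simps poly_sum poly_monom)
    qed
    then have sub: "eval_poly z ` V \<subseteq> {a. poly (?p m r) a = 0}" by auto
    have "?p m r = 0"
    proof (rule ccontr)
      assume nz: "?p m r \<noteq> 0"
      have "card V = card (eval_poly z ` V)" by (rule card_image[symmetric, OF V(5)])
      also have "\<dots> \<le> card {a. poly (?p m r) a = 0}" by (rule card_mono[OF poly_roots_finite[OF nz] sub])
      also have "\<dots> \<le> degree (?p m r)" by (rule card_poly_roots_bound[OF nz])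
      also have "\<dots> \<le> m" by (rule degree_sum_le) (auto intro: order_trans[OF degree_monom_le])
      finally show False using that(1) by simp
    qed
    then have "0 = coeff (?p m r) k" by simp
    also have "\<dots> = coeff (r k) 0" using that(3) by (simp add: coeff_sum coeff_monom)
    finally show ?thesis by simp
  qed
  {
    case 0
    then have "degree (r 0) = 0" "coeff (r 0) 0 = 0" using zero[of 0 r 0] by auto
    then show ?case by (metis degree_eq_zeroE coeff_pCons_0 le_zero_eq pCons_0_0)
  next
    case (Suc m)
    note z = zero[OF Suc.prems(1) Suc.prems(3)]
    have "\<exists>q. r k = pCons 0 q" if "k \<le> Suc m" for k
    proof -
      obtain a q where "r k = pCons a q" by (cases "r k") auto
      with z[OF that] show ?thesis by auto
    qed
    then obtain q where q: "\<And>k. k \<le> Suc m \<Longrightarrow> r k = pCons 0 (q k)" by metis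
    have last: "r (Suc m) = 0"
    proof -
      have "degree (r (Suc m)) = 0" using Suc.prems(2)[of "Suc m"] by simp
      then show ?thesis using z[of "Suc m"] by (metis degree_eq_zeroE coeff_pCons_0 order_refl pCons_0_0)
    qed
    have dq: "degree (q k) \<le> m - k" if "k \<le> m" for k
      using Suc.prems(2)[of k] q[of k] that by (cases "q k = 0") auto
    have "tform x y z (Suc m) r = (\<Sum>k\<le>m. bform x y (Suc m - k) (r k) * z ^ k)"
      unfolding tform_def using last by simp
    also have "\<dots> = (\<Sum>k\<le>m. x * (bform x y (m - k) (q k) * z ^ k))"
    proof (rule sum.cong[OF refl])
      fix k assume "k \<in> {..m}"
      then have "Suc m - k = Suc (m - k)" "r k = pCons 0 (q k)" using q by auto
      then show "bform x y (Suc m - k) (r k) * z ^ k = x * (bform x y (m - k) (q k) * z ^ k)"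
        by (simp only: bform_pCons) (simp add: mult.assoc)
    qed
    also have "\<dots> = x * tform x y z m q" by (simp add: tform_def sum_distrib_left)
    finally have "x * tform x y z m q \<in> J" using Suc.prems(3) by simp
    then have "tform x y z m q \<in> J" by (rule linear_nonzerodivisor[OF J x y finite_over])
    then have "\<forall>k\<le>m. q k = 0" using Suc.IH[OF _ dq] Suc.prems(1) by simp
    then show ?case using q last by (metis le_SucE le_SucI pCons_0_0)
  }
qed

section \<open>Openness of the general position condition\<close>

text \<open>Gaussian elimination with polynomial entries: the product of the pivots does not vanish at the given
  point, and the same elimination works wherever it does not vanish.\<close>

lemma independence_open:
  fixes g :: "'i \<Rightarrow> 't \<Rightarrow> ('k::field, 'n::finite) mpoly"
  assumes "finite A"
    and "\<And>c. (\<forall>t\<in>T. (\<Sum>a\<in>A. c a * eval_poly (g a t) p0) = 0) \<Longrightarrow> \<forall>a\<in>A. c a = 0"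
  shows "\<exists>D. eval_poly D p0 \<noteq> 0 \<and> (\<forall>p. eval_poly D p \<noteq> 0 \<longrightarrow>
    (\<forall>c. (\<forall>t\<in>T. (\<Sum>a\<in>A. c a * eval_poly (g a t) p) = 0) \<longrightarrow> (\<forall>a\<in>A. c a = 0)))"
  using assms
proof (induction A arbitrary: g rule: finite_induct)
  case empty
  show ?case by (intro exI[of _ 1]) simp
next
  case (insert b A)
  have "\<exists>t\<in>T. eval_poly (g b t) p0 \<noteq> 0"
  proof (rule ccontr)
    assume "\<not> ?thesis"
    then have "\<forall>t\<in>T. (\<Sum>a\<in>insert b A. (if a = b then 1 else 0) * eval_poly (g a t) p0) = 0"
      using insert.hyps by (auto intro!: sum.neutral)
    from insert.prems[OF this] show False by simp
  qed
  then obtain s where s: "s \<in> T" "eval_poly (g b s) p0 \<noteq> 0" by blast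
  define h where "h a t = g b s * g a t - g a s * g b t" for a t
  have h: "(\<Sum>a\<in>A. c a * eval_poly (h a t) p)
      = eval_poly (g b s) p * (\<Sum>a\<in>A. c a * eval_poly (g a t) p)
        - (\<Sum>a\<in>A. c a * eval_poly (g a s) p) * eval_poly (g b t) p" for c t p
    by (simp add: h_def eval_poly_simps algebra_simps sum_subtractf sum_distrib_left)
  have "\<exists>D. eval_poly D p0 \<noteq> 0 \<and> (\<forall>p. eval_poly D p \<noteq> 0 \<longrightarrow>
    (\<forall>c. (\<forall>t\<in>T. (\<Sum>a\<in>A. c a * eval_poly (h a t) p) = 0) \<longrightarrow> (\<forall>a\<in>A. c a = 0)))"
  proof (rule insert.IH)
    fix c assume c: "\<forall>t\<in>T. (\<Sum>a\<in>A. c a * eval_poly (h a t) p0) = 0"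
    define c' where "c' = c(b := - (\<Sum>a\<in>A. c a * eval_poly (g a s) p0) / eval_poly (g b s) p0)"
    have same: "(\<Sum>a\<in>A. c' a * eval_poly (g a t) p0) = (\<Sum>a\<in>A. c a * eval_poly (g a t) p0)" for t
      using insert.hyps by (intro sum.cong) (auto simp: c'_def)
    have "(\<Sum>a\<in>insert b A. c' a * eval_poly (g a t) p0) = 0" if "t \<in> T" for t
    proof -
      have "eval_poly (g b s) p0 * (\<Sum>a\<in>A. c a * eval_poly (g a t) p0)
          = (\<Sum>a\<in>A. c a * eval_poly (g a s) p0) * eval_poly (g b t) p0"
        using c[rule_format, OF that] unfolding h by simp
      then have "(\<Sum>a\<in>A. c a * eval_poly (g a t) p0)
          = (\<Sum>a\<in>A. c a * eval_poly (g a s) p0) * eval_poly (g b t) p0 / eval_poly (g b s) p0"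
        using s(2) by (simp add: eq_divide_eq mult.commute)
      moreover have "(\<Sum>a\<in>insert b A. c' a * eval_poly (g a t) p0)
          = c' b * eval_poly (g b t) p0 + (\<Sum>a\<in>A. c a * eval_poly (g a t) p0)"
        by (simp only: sum.insert[OF insert.hyps] same)
      moreover have "c' b = - (\<Sum>a\<in>A. c a * eval_poly (g a s) p0) / eval_poly (g b s) p0" by (simp add: c'_def)
      ultimately show ?thesis by simp
    qed
    then have "\<forall>a\<in>insert b A. c' a = 0" by (intro insert.prems) blast
    then have "c' a = 0" if "a \<in> A" for a using that by blast
    moreover have "c' a = c a" if "a \<in> A" for a using that insert.hyps(2) by (auto simp: c'_def)
    ultimately show "\<forall>a\<in>A. c a = 0" by simp
  qed
  then obtain D where D: "eval_poly D p0 \<noteq> 0" "\<And>p c. eval_poly D p \<noteq> 0 \<Longrightarrow>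
    (\<forall>t\<in>T. (\<Sum>a\<in>A. c a * eval_poly (h a t) p) = 0) \<Longrightarrow> \<forall>a\<in>A. c a = 0" by blast
  show ?case
  proof (intro exI[of _ "D * g b s"] conjI allI impI)
    show "eval_poly (D * g b s) p0 \<noteq> 0" using D(1) s(2) by (simp add: eval_poly_mult)
    fix p c assume p: "eval_poly (D * g b s) p \<noteq> 0"
      and c: "\<forall>t\<in>T. (\<Sum>a\<in>insert b A. c a * eval_poly (g a t) p) = 0"
    have nz: "eval_poly D p \<noteq> 0" "eval_poly (g b s) p \<noteq> 0" using p by (auto simp: eval_poly_mult)
    have c': "(\<Sum>a\<in>A. c a * eval_poly (g a t) p) = - (c b * eval_poly (g b t) p)" if "t \<in> T" for t
      using c[rule_format, OF that] insert.hyps by (simp add: eq_neg_iff_add_eq_0 add.commute)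
    have "\<forall>t\<in>T. (\<Sum>a\<in>A. c a * eval_poly (h a t) p) = 0"
      unfolding h using c' s(1) by (simp add: mult_ac)
    then have A: "\<forall>a\<in>A. c a = 0" by (rule D(2)[OF nz(1)])
    then have "(\<Sum>a\<in>A. c a * eval_poly (g a s) p) = 0" by (simp add: sum.neutral)
    then have "c b = 0" using c'[OF s(1)] nz(2) by simp
    with A show "\<forall>a\<in>insert b A. c a = 0" by blast
  qed
qed

text \<open>Families of polynomials whose coefficients depend polynomially on a parameter point.\<close>

inductive pfam :: "('k::field ^ 'n::finite \<Rightarrow> ('k, 'n) mpoly) \<Rightarrow> bool" where
  pfam_term: "pfam (\<lambda>p. cst (eval_poly g p) * f)"
| pfam_add: "pfam \<Phi> \<Longrightarrow> pfam \<Psi> \<Longrightarrow> pfam (\<lambda>p. \<Phi> p + \<Psi> p)"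

lemma pfam_const: "pfam (\<lambda>p. f)"
  using pfam_term[of 1 f] by simp

lemma pfam_mult:
  assumes "pfam \<Phi>" "pfam \<Psi>" shows "pfam (\<lambda>p. \<Phi> p * \<Psi> p)"
  using assms(1)
proof induction
  case (pfam_term g f)
  show ?case using assms(2)
  proof induction
    case (pfam_term g' f')
    have "(\<lambda>p. cst (eval_poly g p) * f * (cst (eval_poly g' p) * f')) = (\<lambda>p. cst (eval_poly (g * g') p) * (f * f'))"
      by (rule ext) (simp only: eval_poly_mult cst_mult mult_ac)
    then show ?case using pfam.pfam_term[of "g * g'" "f * f'"] by simp
  next
    case (pfam_add \<Phi> \<Psi>)
    then show ?case using pfam.pfam_add by (simp add: distrib_left)
  qed
next
  case (pfam_add \<Phi> \<Phi>')
  then show ?case using pfam.pfam_add by (simp add: distrib_right)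
qed

lemma pfam_power: "pfam \<Phi> \<Longrightarrow> pfam (\<lambda>p. \<Phi> p ^ n)"
  by (induction n) (auto intro: pfam_const pfam_mult)

lemma pfam_linear_functional:
  assumes "pfam \<Phi>" and L: "\<And>f g. L (f + g) = L f + L g" "\<And>c f. L (cst c * f) = c * L f"
  shows "\<exists>g. \<forall>p. L (\<Phi> p) = eval_poly g p"
  using assms(1)
proof induction
  case (pfam_term g f)
  show ?case by (intro exI[of _ "g * cst (L f)"]) (simp add: L eval_poly_mult)
next
  case (pfam_add \<Phi> \<Psi>)
  then obtain g h where "\<forall>p. L (\<Phi> p) = eval_poly g p" "\<forall>p. L (\<Psi> p) = eval_poly h p" by blast
  then show ?case by (intro exI[of _ "g + h"]) (simp add: L eval_poly_add)
qed

text \<open>Coordinates modulo an ideal, in a fixed degree.\<close>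

lemma coordinate_functionals:
  fixes J :: "('k::field, 'n::finite) mpoly set"
  assumes J: "idl.subspace J"
  obtains T :: "('k, 'n) mpoly set" and L where "\<And>s f g. L s (f + g) = L s f + L s g" "\<And>s c f. L s (cst c * f) = c * L s f"
    "\<And>f. is_form m f \<Longrightarrow> f \<in> J \<longleftrightarrow> (\<forall>s\<in>T. L s f = 0)"
proof -
  obtain T where T: "finite T" "\<And>s. s \<in> T \<Longrightarrow> is_form m s" "card T = hf J m"
    "\<And>c. (\<Sum>s\<in>T. cst (c s) * s) \<in> J \<Longrightarrow> \<forall>s\<in>T. c s = 0"
    "\<And>f. is_form m f \<Longrightarrow> \<exists>c. f - (\<Sum>s\<in>T. cst (c s) * s) \<in> J"
    by (rule hf_basis[OF J, of m]) blast
  define rep where "rep f c \<longleftrightarrow> (\<forall>s. s \<notin> T \<longrightarrow> c s = 0) \<and> hcomp m f - (\<Sum>s\<in>T. cst (c s) * s) \<in> J" for f c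
  have ex: "\<exists>c. rep f c" for f
  proof -
    obtain c where c: "hcomp m f - (\<Sum>s\<in>T. cst (c s) * s) \<in> J" using T(5)[OF is_form_hcomp] by blast
    have "(\<Sum>s\<in>T. cst (if s \<in> T then c s else 0) * s) = (\<Sum>s\<in>T. cst (c s) * s)" by (rule sum.cong) auto
    with c have "rep f (\<lambda>s. if s \<in> T then c s else 0)" by (simp add: rep_def)
    then show ?thesis by blast
  qed
  have uniq: "c = c'" if "rep f c" "rep f c'" for f c c'
  proof
    fix s
    have "(hcomp m f - (\<Sum>s\<in>T. cst (c' s) * s)) - (hcomp m f - (\<Sum>s\<in>T. cst (c s) * s)) \<in> J"
      by (rule idl.subspace_diff[OF J]) (use that in \<open>auto simp: rep_def\<close>)
    then have "(\<Sum>s\<in>T. cst (c s - c' s) * s) \<in> J"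
      by (simp add: cst_diff left_diff_distrib sum_subtractf)
    from T(4)[OF this] show "c s = c' s" using that by (cases "s \<in> T") (auto simp: rep_def)
  qed
  define L where "L s f = (SOME c. rep f c) s" for s f
  have repL: "rep f (\<lambda>s. L s f)" for f unfolding L_def using someI_ex[OF ex] by simp
  have L_eq: "L s f = c s" if "rep f c" for f c s using uniq[OF repL that] by (rule fun_cong)
  have add: "L s (f + g) = L s f + L s g" for s f g
  proof (rule L_eq)
    have "(hcomp m f - (\<Sum>s\<in>T. cst (L s f) * s)) + (hcomp m g - (\<Sum>s\<in>T. cst (L s g) * s)) \<in> J"
      using repL by (intro idl.subspace_add[OF J]) (auto simp: rep_def)
    then show "rep (f + g) (\<lambda>s. L s f + L s g)"
      using repL by (simp add: rep_def hcomp_add cst_add distrib_right sum.distrib algebra_simps)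
  qed
  have scale: "L s (cst c * f) = c * L s f" for s c f
  proof (rule L_eq)
    have "cst c * (hcomp m f - (\<Sum>s\<in>T. cst (L s f) * s)) \<in> J"
      using repL by (intro ideal_mult_left[OF J]) (auto simp: rep_def)
    then have "cst c * hcomp m f - (\<Sum>s\<in>T. cst (c * L s f) * s) \<in> J"
      by (simp only: cst_mult right_diff_distrib sum_distrib_left mult.assoc)
    then show "rep (cst c * f) (\<lambda>s. c * L s f)" using repL by (simp add: rep_def hcomp_cst_mult)
  qed
  have mem: "f \<in> J \<longleftrightarrow> (\<forall>s\<in>T. L s f = 0)" if f: "is_form m f" for f
  proof
    assume "f \<in> J"
    then have "rep f (\<lambda>_. 0)" using hcomp_form[OF f, of m] by (simp add: rep_def)
    then show "\<forall>s\<in>T. L s f = 0" using L_eq by metis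
  next
    assume "\<forall>s\<in>T. L s f = 0"
    then have "(\<Sum>s\<in>T. cst (L s f) * s) = 0" by (simp add: sum.neutral)
    then show "f \<in> J" using repL[of f] hcomp_form[OF f, of m] by (simp add: rep_def)
  qed
  show ?thesis by (rule that[OF add scale mem])
qed

lemma tform_double_sum:
  "tform x y z m r = (\<Sum>a\<in>Sigma {..m} (\<lambda>k. {..m - k}).
     cst (coeff (r (fst a)) (snd a)) * (x ^ snd a * y ^ (m - fst a - snd a) * z ^ fst a))"
  unfolding tform_def bform_def by (simp add: sum.Sigma case_prod_unfold sum_distrib_right mult.assoc)

text \<open>The points from which the projection maps the zero locus to a plane curve of degree at least \<open>d\<close>. The
  first condition keeps the point off the zero locus.\<close>

definition general_centre :: "('k::field, 'n::finite) mpoly set \<Rightarrow> nat \<Rightarrow> 'k ^ 'n \<Rightarrow> bool" where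
  "general_centre J d p \<longleftrightarrow> (\<exists>g n. g \<in> J \<and> is_form n g \<and> eval_poly g p \<noteq> 0) \<and>
     (\<forall>f m. f \<in> alg (lin p) \<longrightarrow> f \<in> J \<longrightarrow> is_form m f \<longrightarrow> m < d \<longrightarrow> f = 0)"

lemma lin_scale: "c \<noteq> 0 \<Longrightarrow> lin (c *s p) = lin p"
  by (auto simp: lin_def eval_linear_form(2)[unfolded One_nat_def])

text \<open>The point \<open>p\<^sub>0\<close> is chosen such that the points of a plane section are projected from it to
  different points. The condition is open since it is the independence of the monomials in the forms \<open>w(p) t - t(p) w\<close> modulo \<open>J\<close>.\<close>

lemma general_centre_exists_open:
  fixes J :: "('k::{alg_closed_field, field_char_0}, 'n::{finite,linorder}) mpoly set"
  assumes J: "curve_ideal J" and d: "has_degree J d" "0 < d" and n: "CARD('n) = 4"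
  obtains D p0 where "eval_poly D p0 \<noteq> 0" "\<And>p. eval_poly D p \<noteq> 0 \<Longrightarrow> p \<noteq> 0 \<and> general_centre J d p"
proof -
  note C = curve_idealD[OF J]
  obtain x y V where xy: "is_form 1 x" "is_form 1 y" "finite_over {x, y} J" "coords {x, y}" "x \<noteq> y"
    and V: "finite V" "d \<le> card V" "V \<subseteq> zeros J" "\<And>v. v \<in> V \<Longrightarrow> eval_poly x v = 0" "\<And>v. v \<in> V \<Longrightarrow> eval_poly y v = 1"
    by (rule plane_section_points[OF J d(1)]) blast
  obtain U where U: "{x, y} \<subseteq> U" "coords U" "alg U = UNIV" by (rule coords_extend[OF xy(4)])
  have "card (U - {x, y}) = 2"
    using full_coords_card[OF U(2,3)] n U(1) xy(5) coords_finite[OF U(2)] by (simp add: card_Diff_subset)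
  then obtain z w where zw: "U - {x, y} = {z, w}" "z \<noteq> w" by (auto simp: card_2_iff)
  have Ueq: "U = {x, y, z, w}" using zw(1) U(1) by blast
  have dist: "z \<noteq> x" "z \<noteq> y" "w \<noteq> x" "w \<noteq> y" using zw(1) by blast+
  have fz: "is_form 1 z" and fw: "is_form 1 w" using coords_form[OF U(2)] Ueq by auto
  obtain e where e: "\<And>u t. u \<in> U \<Longrightarrow> t \<in> U \<Longrightarrow> eval_poly t (e u) = (if t = u then 1 else 0)"
    by (rule coords_duals[OF U(2)]) blast
  define Bad where "Bad = (\<lambda>(v, v'). - (eval_poly z v - eval_poly z v') / (eval_poly w v - eval_poly w v')) ` (V \<times> V)"
  have "finite Bad" unfolding Bad_def using V(1) by blast
  then obtain a where a: "a \<notin> Bad" using ex_new_if_finite[OF infinite_UNIV_char_0] by blast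
  define \<zeta> where "\<zeta> = z + cst a * w"
  have f\<zeta>: "is_form 1 \<zeta>" unfolding \<zeta>_def by (intro is_form_add is_form_scale fz fw)
  have inj: "inj_on (eval_poly \<zeta>) V"
  proof (rule inj_onI)
    fix v v' assume v: "v \<in> V" "v' \<in> V" and eq: "eval_poly \<zeta> v = eval_poly \<zeta> v'"
    have sum: "(eval_poly z v - eval_poly z v') + a * (eval_poly w v - eval_poly w v') = 0"
      using eq by (simp add: \<zeta>_def eval_poly_simps algebra_simps)
    have ww: "eval_poly w v = eval_poly w v'"
    proof (rule ccontr)
      assume ne: "eval_poly w v \<noteq> eval_poly w v'"
      have "a * (eval_poly w v - eval_poly w v') = - (eval_poly z v - eval_poly z v')"
        using sum by (metis add.commute eq_neg_iff_add_eq_0)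
      then have "a = - (eval_poly z v - eval_poly z v') / (eval_poly w v - eval_poly w v')"
        using ne by (simp add: eq_divide_eq)
      then have "a \<in> Bad" unfolding Bad_def using v by (intro image_eqI[of _ _ "(v, v')"]) auto
      with a show False by simp
    qed
    with sum have zz: "eval_poly z v = eval_poly z v'" by simp
    show "v = v'" by (rule full_coords_zero[OF U(2,3)]) (use Ueq ww zz V(4,5) v in auto)
  qed
  define T where "T = {x, y, \<zeta>}"
  define p0 where "p0 = e w - a *s e z"
  have mem: "x \<in> U" "y \<in> U" "z \<in> U" "w \<in> U" using Ueq by auto
  have ex: "eval_poly x p0 = 0" "eval_poly y p0 = 0" "eval_poly w p0 = 1" "eval_poly \<zeta> p0 = 0"
    using e[OF mem(4)] e[OF mem(3)] mem dist zw(2)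
    by (simp_all add: p0_def eval_linear_form(2,3)[OF xy(1)] eval_linear_form(2,3)[OF xy(2)]
        eval_linear_form(2,3)[OF fw] eval_linear_form(2,3)[OF f\<zeta>])
       (simp add: \<zeta>_def eval_poly_simps)
  have \<zeta>e: "eval_poly \<zeta> (e x) = 0" "eval_poly \<zeta> (e y) = 0" "eval_poly \<zeta> (e z) = 1"
    using e[OF mem(1)] e[OF mem(2)] e[OF mem(3)] mem dist zw(2) by (simp_all add: \<zeta>_def eval_poly_simps)
  have UT: "coords (insert w T)"
    unfolding coords_def
  proof (intro conjI ballI)
    fix s assume s: "s \<in> insert w T"
    show "is_form 1 s" using s xy(1,2) fw f\<zeta> unfolding T_def by blast
    consider "s = w" | "s = x" | "s = y" | "s = \<zeta>" using s unfolding T_def by blast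
    then show "\<exists>e. eval_poly s e = 1 \<and> (\<forall>t\<in>insert w T - {s}. eval_poly t e = 0)"
    proof cases
      case 1
      then show ?thesis using ex unfolding T_def by (intro exI[of _ p0]) auto
    next
      case 2
      then show ?thesis using e[OF mem(1)] mem dist xy(5) \<zeta>e unfolding T_def by (intro exI[of _ "e x"]) auto
    next
      case 3
      then show ?thesis using e[OF mem(2)] mem dist xy(5) \<zeta>e unfolding T_def by (intro exI[of _ "e y"]) auto
    next
      case 4
      then show ?thesis using e[OF mem(3)] mem dist zw(2) \<zeta>e unfolding T_def by (intro exI[of _ "e z"]) auto
    qed
  qed (simp add: T_def)
  have wT: "w \<notin> T" using ex unfolding T_def by auto
  have fullT: "alg (insert w T) = UNIV"
  proof -
    have "z = \<zeta> + cst (- a) * w" by (simp add: \<zeta>_def single_uminus)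
    also have "\<dots> \<in> alg (insert w T)" unfolding T_def by (intro alg.intros) auto
    finally have zT: "z \<in> alg (insert w T)" .
    have "alg U \<subseteq> alg (insert w T)"
      by (rule alg_subset) (use zT in \<open>auto simp: Ueq T_def intro: alg_base\<close>)
    then show ?thesis using U(3) by blast
  qed
  define m where "m = d - 1"
  have md: "m < card V" using d(2) V(2) by (simp add: m_def)
  define A where "A = Sigma {..m} (\<lambda>k. {..m - k})"
  have finA: "finite A" by (simp add: A_def)
  define t' where "t' t p = cst (eval_poly w p) * t + cst (eval_poly (- t) p) * w" for t p
  have pf: "pfam (t' t)" for t
    unfolding t'_def by (intro pfam_add pfam_term)
  have ft': "is_form 1 (t' t p)" if "is_form 1 t" for t p
    unfolding t'_def by (intro is_form_add is_form_scale that fw)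
  define \<Phi> where "\<Phi> b p = t' x p ^ snd b * t' y p ^ (m - fst b - snd b) * t' \<zeta> p ^ fst b" for b p
  obtain B :: "('k, 'n) mpoly set" and L where L: "\<And>s f g. L s (f + g) = L s f + L s g" "\<And>s c f. L s (cst c * f) = c * L s f"
    "\<And>f. is_form m f \<Longrightarrow> f \<in> J \<longleftrightarrow> (\<forall>s\<in>B. L s f = 0)"
    by (rule coordinate_functionals[OF C(5), of m]) blast
  have L0: "L s 0 = 0" for s using L(2)[of s 0 0] by simp
  have Lsum: "L s (\<Sum>b\<in>A. cst (c b) * f b) = (\<Sum>b\<in>A. c b * L s (f b))" for s c and f :: "nat \<times> nat \<Rightarrow> ('k, 'n) mpoly"
    by (induction A rule: infinite_finite_induct) (auto simp: L L0)
  have "pfam (\<Phi> b)" for b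
    unfolding \<Phi>_def using pfam_mult[OF pfam_mult[OF pfam_power[OF pf] pfam_power[OF pf]] pfam_power[OF pf]] .
  then have "\<exists>g. \<forall>p. L s (\<Phi> b p) = eval_poly g p" for b s
    using pfam_linear_functional[of "\<Phi> b" "L s"] L by blast
  then have gx: "\<exists>g. \<forall>p. L s (\<Phi> b p) = eval_poly g p" for b s .
  define g where "g b s = (SOME g. \<forall>p. L s (\<Phi> b p) = eval_poly g p)" for b s
  have g: "L s (\<Phi> b p) = eval_poly (g b s) p" for b s p
    using someI_ex[OF gx[of s b]] unfolding g_def by blast
  have tf: "tform (t' x p) (t' y p) (t' \<zeta> p) m r = (\<Sum>b\<in>A. cst (coeff (r (fst b)) (snd b)) * \<Phi> b p)" for r p
    unfolding tform_double_sum A_def \<Phi>_def ..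
  have ftf: "is_form m (tform (t' x p) (t' y p) (t' \<zeta> p) m r)" for r p
    by (intro is_form_tform ft' xy f\<zeta>)
  have at0: "t' x p0 = x" "t' y p0 = y" "t' \<zeta> p0 = \<zeta>"
    using ex by (simp_all add: t'_def eval_poly_minus)
  have ind0: "\<forall>b\<in>A. c b = 0" if c: "\<forall>s\<in>B. (\<Sum>b\<in>A. c b * eval_poly (g b s) p0) = 0" for c
  proof -
    define r where "r k = (\<Sum>i\<le>m - k. monom (c (k, i)) i)" for k
    have co: "coeff (r k) i = (if i \<le> m - k then c (k, i) else 0)" for k i
      by (simp add: r_def coeff_sum coeff_monom if_distrib sum.delta cong: if_cong)
    have "tform x y \<zeta> m r = (\<Sum>b\<in>A. cst (coeff (r (fst b)) (snd b)) * \<Phi> b p0)" using tf[of p0 r] at0 by simp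
    also have "\<dots> = (\<Sum>b\<in>A. cst (c b) * \<Phi> b p0)"
      by (rule sum.cong) (auto simp: A_def co)
    finally have eq: "tform x y \<zeta> m r = (\<Sum>b\<in>A. cst (c b) * \<Phi> b p0)" .
    have "is_form m (tform x y \<zeta> m r)" by (intro is_form_tform xy f\<zeta>)
    moreover have "\<forall>s\<in>B. L s (tform x y \<zeta> m r) = 0" unfolding eq Lsum g using c by blast
    ultimately have "tform x y \<zeta> m r \<in> J" using L(3) by blast
    moreover have "degree (r k) \<le> m - k" for k by (rule degree_le) (simp add: co)
    ultimately have r0: "\<forall>k\<le>m. r k = 0"
      by (intro no_ternary_relation[OF C(1,4) xy(1-3) V(1,3-5) inj md])
    show ?thesis
    proof
      fix b assume b: "b \<in> A"
      then have "r (fst b) = 0" "snd b \<le> m - fst b" using r0 by (auto simp: A_def)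
      then show "c b = 0" using co[of "fst b" "snd b"] by simp
    qed
  qed
  have "\<exists>D. eval_poly D p0 \<noteq> 0 \<and> (\<forall>p. eval_poly D p \<noteq> 0 \<longrightarrow>
    (\<forall>c. (\<forall>s\<in>B. (\<Sum>b\<in>A. c b * eval_poly (g b s) p) = 0) \<longrightarrow> (\<forall>b\<in>A. c b = 0)))"
    by (rule independence_open[OF finA ind0])
  then obtain D where D: "eval_poly D p0 \<noteq> 0"
    "\<And>p c. eval_poly D p \<noteq> 0 \<Longrightarrow> \<forall>s\<in>B. (\<Sum>b\<in>A. c b * eval_poly (g b s) p) = 0 \<Longrightarrow> \<forall>b\<in>A. c b = 0" by blast
  have "p0 \<noteq> 0" using ex(3) eval_linear_form(4)[OF fw] by auto
  then have "p0 \<notin> zeros J" using finite_over_coord_nonzero[OF xy(3)] ex(1,2) by blast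
  then obtain g1 where g1: "g1 \<in> J" "eval_poly g1 p0 \<noteq> 0" unfolding zeros_def by blast
  obtain N where N: "g1 = (\<Sum>t<N. hcomp t g1)" by (rule sum_hcomp[of g1]) blast
  have "\<exists>t. eval_poly (hcomp t g1) p0 \<noteq> 0"
  proof (rule ccontr)
    assume "\<not> ?thesis"
    then have "eval_poly (\<Sum>t<N. hcomp t g1) p0 = 0" by (simp add: eval_poly_sum)
    then show False using g1(2) N by simp
  qed
  then obtain j where j: "eval_poly (hcomp j g1) p0 \<noteq> 0" by blast
  have g1J: "hcomp j g1 \<in> J" by (rule hideal_hcomp[OF C(1) g1(1)])
  show ?thesis
  proof (rule that[of "D * w * hcomp j g1" p0])
    show "eval_poly (D * w * hcomp j g1) p0 \<noteq> 0" using D(1) ex(3) j by (simp add: eval_poly_mult)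
    fix p assume "eval_poly (D * w * hcomp j g1) p \<noteq> 0"
    then have nz: "eval_poly D p \<noteq> 0" "eval_poly w p \<noteq> 0" "eval_poly (hcomp j g1) p \<noteq> 0" by (auto simp: eval_poly_mult)
    have "p \<noteq> 0" using nz(2) eval_linear_form(4)[OF fw] by auto
    have wU: "w \<in> insert w T" by simp
    let ?Q = "pencil (insert w T) w p"
    note Q = coords_insert_pencil[OF UT wU nz(2)] alg_insert_pencil[OF UT wU nz(2)]
      pencil_notin[OF UT wU nz(2)] pencil_vanish[OF UT wU nz(2)]
    have algQ: "alg (lin p) = alg ?Q"
      by (rule alg_lin_eq[OF Q(1) _ Q(3) nz(2) Q(4)]) (simp_all add: Q(2) fullT)
    have "s \<in> alg {t' x p, t' y p, t' \<zeta> p}" if "s \<in> ?Q" for s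
    proof -
      obtain t where t: "t \<in> T" "s = t - cst (eval_poly t p / eval_poly w p) * w"
        using \<open>s \<in> ?Q\<close> wT unfolding pencil_def by blast
      have "cst (inverse (eval_poly w p)) * t' t p
          = cst (inverse (eval_poly w p)) * (cst (eval_poly w p) * t) + cst (inverse (eval_poly w p) * eval_poly (- t) p) * w"
        unfolding t'_def by (simp only: distrib_left cst_mult mult.assoc)
      also have "\<dots> = s" unfolding cst_inverse[OF nz(2)] t(2)
        by (simp add: eval_poly_minus single_uminus divide_inverse mult.commute)
      finally have s: "s = cst (inverse (eval_poly w p)) * t' t p" by simp
      have "t' t p \<in> {t' x p, t' y p, t' \<zeta> p}" using t(1) unfolding T_def by blast
      then show ?thesis unfolding s by (intro alg.alg_mult alg.alg_cst alg.alg_base)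
    qed
    then have algsub: "alg (lin p) \<subseteq> alg {t' x p, t' y p, t' \<zeta> p}" unfolding algQ by (rule alg_subset)
    have top: "f = 0" if f: "f \<in> alg (lin p)" "f \<in> J" "is_form m f" for f
    proof -
      have "f \<in> alg {t' x p, t' y p, t' \<zeta> p}" using f(1) algsub by blast
      then obtain r where r: "\<And>k. k \<le> m \<Longrightarrow> degree (r k) \<le> m - k"
        "hcomp m f = tform (t' x p) (t' y p) (t' \<zeta> p) m r"
        by (rule hcomp_alg3[OF ft'[OF xy(1)] ft'[OF xy(2)] ft'[OF f\<zeta>], where m = m]) blast
      have eq: "f = (\<Sum>b\<in>A. cst (coeff (r (fst b)) (snd b)) * \<Phi> b p)"
        using r(2) hcomp_form[OF f(3), of m] tf by simp
      have "L s f = 0" if "s \<in> B" for s using L(3)[OF f(3)] f(2) that by blast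
      then have "\<forall>s\<in>B. (\<Sum>b\<in>A. coeff (r (fst b)) (snd b) * eval_poly (g b s) p) = 0"
        unfolding g[symmetric] Lsum[symmetric] eq[symmetric] by blast
      from D(2)[OF nz(1) this] show ?thesis unfolding eq by (simp add: sum.neutral)
    qed
    have "f = 0" if f: "f \<in> alg (lin p)" "f \<in> J" "is_form m' f" "m' < d" for f m'
    proof (rule ccontr)
      assume "f \<noteq> 0"
      have "x - cst (eval_poly x p / eval_poly w p) * w \<in> ?Q" (is "?l \<in> _")
        using ex unfolding pencil_def T_def by auto
      then have l: "?l \<in> alg (lin p)" "is_form 1 ?l" "?l \<noteq> 0"
      proof -
        assume lQ: "?l \<in> ?Q"
        show "?l \<in> alg (lin p)" unfolding algQ using lQ by (rule alg_base)
        show "is_form 1 ?l" by (rule coords_form[OF Q(1)]) (use lQ in blast)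
        obtain e' where "eval_poly ?l e' = 1" using coords_dual[OF Q(1), of ?l] lQ by blast
        then show "?l \<noteq> 0" by auto
      qed
      have "is_form (m' + (m - m')) (f * ?l ^ (m - m'))" by (intro is_form_mult f is_form_power1 l)
      then have "is_form m (f * ?l ^ (m - m'))" using f(4) by (simp add: m_def)
      moreover have "f * ?l ^ (m - m') \<in> alg (lin p)"
        by (rule alg.alg_mult[OF f(1) subring_power[OF alg_subring l(1)]])
      moreover have "f * ?l ^ (m - m') \<in> J" by (rule ideal_mult_right[OF C(5) f(2)])
      ultimately have "f * ?l ^ (m - m') = 0" by (intro top)
      then show False using \<open>f \<noteq> 0\<close> l(3) by simp
    qed
    then have "general_centre J d p" using g1J is_form_hcomp nz(3) unfolding general_centre_def by blast
    with \<open>p \<noteq> 0\<close> show "p \<noteq> 0 \<and> general_centre J d p" ..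
  qed
qed

section \<open>The plane projection of a curve is defined by one monic form\<close>

lemma map_poly_eval_mult:
  "map_poly (\<lambda>b. eval_poly b v) (p * q) = map_poly (\<lambda>b. eval_poly b v) p * map_poly (\<lambda>b. eval_poly b v) q"
  by (rule poly_eqI) (simp add: coeff_map_poly coeff_mult eval_poly_sum eval_poly_mult)

text \<open>Write a component of \<open>b\<close> as a binary form: its value at \<open>v\<close> is a value or a leading coefficient of the
  dehomogenized polynomial, so that the linear factor \<open>l\<close> can be split off.\<close>

lemma linear_form_divides:
  fixes x y :: "('k::{field, ring_char_0}, 'n::finite) mpoly"
  assumes xy: "is_form 1 x" "is_form 1 y"
    and l: "l = y \<and> eval_poly x v = 1 \<and> eval_poly y v = 0 \<or> (\<exists>a. l = x - cst a * y \<and> eval_poly x v = a \<and> eval_poly y v = 1)"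
    and b: "b \<in> alg {x, y}" "\<And>c. c \<noteq> 0 \<Longrightarrow> eval_poly b (c *s v) = 0"
  shows "\<exists>b'\<in>alg {x, y}. b = l * b'"
proof -
  have form: "\<exists>b'\<in>alg {x, y}. hcomp i b = l * b'" for i
  proof -
    obtain p where p: "\<And>c. eval_poly b (c *s v) = poly p c" "\<And>t. coeff p t = eval_poly (hcomp t b) v"
      by (rule eval_scale_components[of b v]) blast
    have "UNIV - {0} \<subseteq> {c. poly p c = 0}" using b(2) p(1) by auto
    moreover have "infinite (UNIV - {0 :: 'k})" using infinite_UNIV_char_0 by (simp add: infinite_remove)
    ultimately have "p = 0" using poly_roots_finite finite_subset by blast
    then have zero: "eval_poly (hcomp i b) v = 0" using p(2)[of i] by simp
    obtain q where q: "degree q \<le> i" "hcomp i b = bform x y i q" using hcomp_alg2[OF xy b(1)] by blast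
    show ?thesis
    proof (cases "q = 0")
      case True
      then show ?thesis using q(2) by (intro bexI[of _ 0]) (auto simp: alg_closed)
    next
      case False
      from l consider "l = y" "eval_poly x v = 1" "eval_poly y v = 0"
        | a where "l = x - cst a * y" "eval_poly x v = a" "eval_poly y v = 1" by blast
      then show ?thesis
      proof cases
        case 1
        have "eval_poly (bform x y i q) v = (\<Sum>k\<le>i. if k = i then coeff q k else 0)"
          unfolding eval_bform by (rule sum.cong) (auto simp: 1 power_0_left)
        then have "coeff q i = 0" using zero q(2) by simp
        then have "degree q \<noteq> i" using False leading_coeff_0_iff by blast
        then obtain j where j: "i = 1 + j" "degree q \<le> j" using q(1) by (cases i) auto
        have "hcomp i b = bform x y (1 + j) q" using q(2) j(1) by (simp only:)
        also have "\<dots> = y ^ 1 * bform x y j q" by (rule bform_shift[OF j(2)])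
        finally have "hcomp i b = l * bform x y j q" by (simp add: 1)
        then show ?thesis using bform_in_alg by blast
      next
        case (2 a)
        have "eval_poly (bform x y i q) v = (\<Sum>k\<le>i. coeff q k * a ^ k)" by (simp add: eval_bform 2)
        also have "\<dots> = poly q a"
          unfolding poly_altdef by (rule sum.mono_neutral_right) (use q(1) in \<open>auto simp: coeff_eq_0\<close>)
        finally have "poly q a = 0" using zero q(2) by simp
        then obtain q' where q': "q = [:- a, 1:] * q'" using poly_eq_0_iff_dvd by blast
        have "q' \<noteq> 0" using False q' by auto
        then have "degree q = Suc (degree q')" unfolding q' by (subst degree_mult_eq) auto
        then obtain j where j: "i = 1 + j" "degree q' \<le> j" using q(1) by (cases i) auto
        have "bform x y 1 [:- a, 1:] * bform x y j q' = bform x y (1 + j) ([:- a, 1:] * q')"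
          by (rule bform_mult) (use j in auto)
        moreover have "bform x y 1 [:- a, 1:] = l" by (simp add: bform_def single_uminus 2)
        ultimately have "l * bform x y j q' = bform x y i q" unfolding q' j(1) by simp
        then have "hcomp i b = l * bform x y j q'" using q(2) by simp
        then show ?thesis using bform_in_alg by blast
      qed
    qed
  qed
  then obtain b' where b': "\<And>i. b' i \<in> alg {x, y}" "\<And>i. hcomp i b = l * b' i" by metis
  obtain N where N: "b = (\<Sum>t<N. hcomp t b)" by (rule sum_hcomp[of b]) blast
  have "(\<Sum>t<N. hcomp t b) = l * (\<Sum>t<N. b' t)" unfolding b'(2) by (simp add: sum_distrib_left)
  then have "b = l * (\<Sum>t<N. b' t)" using N by simp
  moreover have "(\<Sum>t<N. b' t) \<in> alg {x, y}" by (intro alg_closed b'(1))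
  ultimately show ?thesis by blast
qed

lemma poly_over_divide:
  assumes "poly_over (alg S) Q" "\<And>k. \<exists>b'\<in>alg S. coeff Q k = l * b'"
  obtains Q' where "poly_over (alg S) Q'" "Q = smult l Q'"
proof -
  obtain b' where b': "\<And>k. b' k \<in> alg S" "\<And>k. coeff Q k = l * b' k" using assms(2) by metis
  define Q' where "Q' = (\<Sum>k\<le>degree Q. monom (b' k) k)"
  have co: "coeff Q' k = (if k \<le> degree Q then b' k else 0)" for k
    by (simp add: Q'_def coeff_sum coeff_monom if_distrib sum.delta cong: if_cong)
  have "poly_over (alg S) Q'" unfolding poly_over_def co using b'(1) alg_closed(1)[of S] by auto
  moreover have "Q = smult l Q'"
  proof (rule poly_eqI)
    fix k show "coeff Q k = coeff (smult l Q') k"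
      using b'(2)[of k] by (cases "k \<le> degree Q") (auto simp: co coeff_eq_0)
  qed
  ultimately show ?thesis using that by blast
qed

text \<open>Gauss's lemma, in the shape needed here. Let \<open>F\<close> be a form of least degree \<open>e\<close> in
  \<open>J \<inter> K[x,y,z]\<close>, monic in \<open>z\<close>. A relation \<open>q\<close> of smaller degree \<open>n\<close> in \<open>z\<close>, with leading coefficient
  of least degree, divides \<open>F\<close> up to a factor \<open>c\<close> of \<open>K[x,y]\<close>. A linear factor of the leading
  coefficient of \<open>q\<close> divides \<open>c\<close>; it does not divide \<open>q\<close>, so it can be cancelled.
  Hence the leading coefficient is constant, and \<open>q(z)\<close> is a form of degree \<open>n < e\<close>.\<close>

lemma no_relation_of_small_degree:
  fixes J :: "('k::{alg_closed_field, field_char_0}, 'n::{finite,linorder}) mpoly set"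
  assumes J: "curve_ideal J" and xyz: "is_form 1 x" "is_form 1 y" "is_form 1 z" and finite_over: "finite_over {x, y} J"
    and co: "coords {x, y}" "x \<noteq> y"
    and v0: "eval_poly x v0 = 0" "eval_poly y v0 = 0" "eval_poly z v0 \<noteq> 0"
    and F: "poly_over (alg {x, y}) f" "lead_coeff f = 1" "poly f z \<in> J"
    and least: "\<And>g m. g \<in> alg {x, y, z} \<Longrightarrow> g \<in> J \<Longrightarrow> is_form m g \<Longrightarrow> m < e \<Longrightarrow> g = 0"
    and q: "poly_over (alg {x, y}) q" "degree q < e" "poly q z \<in> J"
  shows "q = 0"
proof (rule ccontr)
  assume "q \<noteq> 0"
  note C = curve_idealD[OF J]
  let ?B = "alg {x, y}"
  have formxy: "\<And>s. s \<in> {x, y} \<Longrightarrow> is_form 1 s" using xyz by blast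
  define P where "P q \<longleftrightarrow> q \<noteq> 0 \<and> poly_over ?B q \<and> poly q z \<in> J" for q
  obtain n where n: "\<exists>q. P q \<and> degree q = n" "\<And>q. P q \<Longrightarrow> n \<le> degree q"
  proof -
    have "P q" using \<open>q \<noteq> 0\<close> q by (simp add: P_def)
    then obtain q1 where "P q1" "\<And>q. P q \<Longrightarrow> degree q1 \<le> degree q"
      using ex_has_least_nat[of P q degree] by blast
    then show ?thesis using that by blast
  qed
  have ne: "n < e" using n(2)[of q] q \<open>q \<noteq> 0\<close> by (simp add: P_def)
  define H where "H j q \<longleftrightarrow> P q \<and> degree q = n \<and> (\<forall>k\<le>n. is_form (n + j - k) (coeff q k))" for j q
  have "\<exists>j q. H j q"
  proof -
    obtain q1 where q1: "P q1" "degree q1 = n" using n(1) by blast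
    then have "q1 \<noteq> 0" by (simp add: P_def)
    then have "lead_coeff q1 \<noteq> 0" using leading_coeff_0_iff by blast
    then obtain j where j: "hcomp j (lead_coeff q1) \<noteq> 0"
      using sum_hcomp[of "lead_coeff q1"] by (metis sum.neutral)
    define q2 where "q2 = (\<Sum>k\<le>n. monom (hcomp (n + j - k) (coeff q1 k)) k)"
    have co2: "coeff q2 k = (if k \<le> n then hcomp (n + j - k) (coeff q1 k) else 0)" for k
      by (simp add: q2_def coeff_sum coeff_monom if_distrib sum.delta cong: if_cong)
    have "coeff q2 n \<noteq> 0" using j q1(2) by (simp add: co2)
    moreover have "degree q2 \<le> n" by (rule degree_le) (simp add: co2)
    ultimately have "degree q2 = n" "q2 \<noteq> 0" using le_degree by (fastforce, force)
    moreover have "hcomp t (coeff q1 k) \<in> ?B" for t k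
      by (rule hcomp_alg[OF formxy]) (use q1(1) in \<open>auto simp: P_def poly_over_def\<close>)
    then have "poly_over ?B q2" unfolding poly_over_def co2 using alg_closed(1)[of "{x, y}"] by auto
    moreover have "poly q2 z \<in> J"
    proof -
      have "hcomp (n + j) (coeff q1 k * z ^ k) = hcomp (n + j - k) (coeff q1 k) * z ^ k" if "k \<le> n" for k
        using hcomp_mult_form[OF is_form_power1[OF xyz(3), of k], of "n + j - k" "coeff q1 k"] that
        by (simp add: mult.commute)
      then have "hcomp (n + j) (poly q1 z) = (\<Sum>k\<le>n. hcomp (n + j - k) (coeff q1 k) * z ^ k)"
        unfolding poly_altdef q1(2) hcomp_sum by (intro sum.cong) auto
      also have "\<dots> = poly q2 z" by (simp add: q2_def poly_sum poly_monom)
      finally show ?thesis using hideal_hcomp[OF C(1), of "poly q1 z" "n + j"] q1(1) by (simp add: P_def)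
    qed
    ultimately have "H j q2" by (simp add: H_def P_def co2)
    then show ?thesis by blast
  qed
  then obtain j q where H: "H j q" "\<And>i q'. H i q' \<Longrightarrow> j \<le> i"
    using ex_has_least_nat[of "\<lambda>j. \<exists>q. H j q" _ id] by (metis id_apply)
  have q: "q \<noteq> 0" "poly_over ?B q" "poly q z \<in> J" "degree q = n" "\<And>k. k \<le> n \<Longrightarrow> is_form (n + j - k) (coeff q k)"
    using H(1) by (auto simp: H_def P_def)
  have lc: "lead_coeff q \<in> ?B" "is_form j (lead_coeff q)" "lead_coeff q \<noteq> 0"
    using q(1,2,4) q(5)[of n] by (auto simp: poly_over_def)
  show False
  proof (cases j)
    case 0
    then obtain c where c: "lead_coeff q = cst c" using form_zero_eq_cst lc(2) by blast
    have "eval_poly (coeff q k) v0 = 0" if "k < n" for k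
    proof (rule form_zero_at_common_zero[of _ "{x, y}" "n - k"])
      show "is_form (n - k) (coeff q k)" using q(5)[of k] that 0 by simp
    qed (use q(2) that v0 formxy in \<open>auto simp: poly_over_def\<close>)
    then have "eval_poly (poly q z) v0 = (\<Sum>k\<le>n. if k = n then c * eval_poly z v0 ^ n else 0)"
      unfolding eval_poly_poly q(4) using c q(4) by (intro sum.cong) auto
    moreover have "c \<noteq> 0" using c lc(3) by auto
    ultimately have "eval_poly (poly q z) v0 \<noteq> 0" using v0(3) by simp
    then have "poly q z \<noteq> 0" by auto
    moreover have "is_form n (poly q z)"
      unfolding poly_altdef q(4)
    proof (rule is_form_sum)
      fix k assume "k \<in> {..n}"
      then show "is_form n (coeff q k * z ^ k)"
        using is_form_mult[OF q(5)[of k] is_form_power1[OF xyz(3), of k]] 0 by simp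
    qed
    moreover have "poly q z \<in> alg {x, y, z}"
      using poly_in_alg_insert[OF q(2), of z] by (simp add: insert_commute)
    ultimately show False using least q(3) ne by blast
  next
    case (Suc i)
    obtain s where s: "degree s \<le> j" "hcomp j (lead_coeff q) = bform x y j s"
      using hcomp_alg2[OF xyz(1,2) lc(1)] by blast
    then have lcs: "lead_coeff q = bform x y j s" using hcomp_form[OF lc(2), of j] by simp
    have "s \<noteq> 0" using lcs lc(3) by auto
    obtain l s' where l: "l = y \<or> (\<exists>a. l = x - cst a * y)" "degree s' \<le> i" "s' \<noteq> 0" "bform x y (Suc i) s = l * bform x y i s'"
      by (rule bform_split[of s i, where x = x and y = y]) (use s(1) \<open>s \<noteq> 0\<close> Suc in auto)
    obtain ea where ea: "eval_poly x ea = 1" "eval_poly y ea = 0" using coords_dual[OF co(1), of x] co(2) by auto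
    obtain eb where eb: "eval_poly y eb = 1" "eval_poly x eb = 0" using coords_dual[OF co(1), of y] co(2) by auto
    have "\<exists>v. l = y \<and> eval_poly x v = 1 \<and> eval_poly y v = 0 \<or> (\<exists>a. l = x - cst a * y \<and> eval_poly x v = a \<and> eval_poly y v = 1)"
      using l(1)
    proof
      assume "l = y"
      then show ?thesis using ea by blast
    next
      assume "\<exists>a. l = x - cst a * y"
      then obtain a where a: "l = x - cst a * y" by blast
      have "eval_poly x (eb + a *s ea) = a" "eval_poly y (eb + a *s ea) = 1"
        using ea eb by (simp_all add: eval_linear_form(1,2)[OF xyz(1)] eval_linear_form(1,2)[OF xyz(2)])
      with a show ?thesis by blast
    qed
    then obtain v where v: "l = y \<and> eval_poly x v = 1 \<and> eval_poly y v = 0 \<or> (\<exists>a. l = x - cst a * y \<and> eval_poly x v = a \<and> eval_poly y v = 1)"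
      by blast
    have lB: "l \<in> ?B" using l(1)
    proof
      assume "\<exists>a. l = x - cst a * y"
      then obtain a where a: "l = x - cst a * y" by blast
      show ?thesis unfolding a by (intro alg_closed alg.alg_cst alg.alg_base) auto
    qed (auto intro: alg_base)
    have l1: "is_form 1 l" using l(1) xyz by (auto intro: is_form_diff is_form_scale)
    have lv: "eval_poly l v = 0" using v by (auto simp: eval_poly_simps)
    have lnz: "l \<noteq> 0" using l(4) lcs lc(3) Suc by auto
    note divl = linear_form_divides[OF xyz(1,2) v]
    \<comment> \<open>By minimality of the degree of the leading coefficient, \<open>l\<close> does not divide \<open>q\<close>.\<close>
    have "\<exists>k\<le>n. eval_poly (coeff q k) v \<noteq> 0"
    proof (rule ccontr)
      assume neg: "\<not> ?thesis"
      have "\<exists>b'\<in>?B. coeff q k = l * b'" for k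
      proof (rule divl)
        show "coeff q k \<in> ?B" using q(2) by (simp add: poly_over_def)
        show "eval_poly (coeff q k) (c *s v) = 0" if "c \<noteq> 0" for c
        proof (cases "k \<le> n")
          case True
          then show ?thesis using neg eval_form_scale[OF q(5)[OF True], of c v] by simp
        next
          case False
          then show ?thesis using q(4) by (simp add: coeff_eq_0)
        qed
      qed
      then obtain b' where b': "\<And>k. b' k \<in> ?B" "\<And>k. coeff q k = l * b' k" by metis
      define q' where "q' = (\<Sum>k\<le>n. monom (hcomp (n + i - k) (b' k)) k)"
      have co': "coeff q' k = (if k \<le> n then hcomp (n + i - k) (b' k) else 0)" for k
        by (simp add: q'_def coeff_sum coeff_monom if_distrib sum.delta cong: if_cong)
      have qq': "q = smult l q'"
      proof (rule poly_eqI)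
        fix k
        show "coeff q k = coeff (smult l q') k"
        proof (cases "k \<le> n")
          case True
          then have "n + j - k = 1 + (n + i - k)" using Suc by simp
          then have "hcomp (n + j - k) (l * b' k) = l * hcomp (n + i - k) (b' k)" using hcomp_mult_form[OF l1] by simp
          then show ?thesis using hcomp_form[OF q(5)[OF True], of "n + j - k"] b'(2)[of k] True by (auto simp: co')
        next
          case False
          then show ?thesis using q(4) by (simp add: co' coeff_eq_0)
        qed
      qed
      have "l * poly q' z \<in> J" using q(3) qq' by simp
      then have "poly q' z \<in> J" by (rule curve_torsion_free[OF J xyz(1,2) finite_over lB lnz])
      moreover have "poly_over ?B q'" unfolding poly_over_def co' using hcomp_alg[OF formxy b'(1)] alg_closed(1)[of "{x, y}"] by auto
      moreover have "q' \<noteq> 0" "degree q' = n" using qq' q(1,4) lnz by auto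
      ultimately have "H i q'" by (simp add: H_def P_def co')
      then show False using H(2) Suc by fastforce
    qed
    then obtain k0 where k0: "k0 \<le> n" "eval_poly (coeff q k0) v \<noteq> 0" by blast
    have qmap: "map_poly (\<lambda>b. eval_poly b (c *s v)) q \<noteq> 0" if "c \<noteq> 0" for c
    proof
      assume "map_poly (\<lambda>b. eval_poly b (c *s v)) q = 0"
      then have "coeff (map_poly (\<lambda>b. eval_poly b (c *s v)) q) k0 = 0" by simp
      then show False using k0(2) eval_form_scale[OF q(5)[OF k0(1)], of c v] that by (simp add: coeff_map_poly)
    qed
    \<comment> \<open>Among the multiples \<open>c\<close> of \<open>f\<close> divisible by \<open>q\<close>, take one of least degree.\<close>
    define M where "M N c \<longleftrightarrow> c \<in> ?B \<and> c \<noteq> 0 \<and> (\<forall>t\<ge>N. hcomp t c = 0) \<and> (\<exists>Q. poly_over ?B Q \<and> smult c f = Q * q)" for N c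
    obtain c0 Q0 r0 where div: "c0 \<in> ?B" "c0 \<noteq> 0" "poly_over ?B Q0" "poly_over ?B r0" "smult c0 f = Q0 * q + r0"
        "r0 = 0 \<or> degree r0 < degree q"
      using pseudo_division_over[OF alg_subring q(2,1) F(1)] by blast
    have "poly r0 z = c0 * poly f z - poly Q0 z * poly q z"
      using arg_cong[OF div(5), of "\<lambda>p. poly p z"] by simp
    then have "poly r0 z \<in> J"
      using idl.subspace_diff[OF C(5) ideal_mult_left[OF C(5) F(3)] ideal_mult_left[OF C(5) q(3)]] by simp
    then have "P r0" if "r0 \<noteq> 0" using that div(4) by (simp add: P_def)
    then have "r0 = 0" using n(2)[of r0] div(6) q(4) by fastforce
    obtain N0 where N0: "\<And>t. t \<ge> N0 \<Longrightarrow> hcomp t c0 = 0" by (rule sum_hcomp[of c0]) blast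
    have "M N0 c0" unfolding M_def using div \<open>r0 = 0\<close> N0 by auto
    then obtain N c where N: "M N c" "\<And>i c'. M i c' \<Longrightarrow> N \<le> i"
      using ex_has_least_nat[of "\<lambda>N. \<exists>c. M N c" N0 id] by (metis id_apply)
    obtain Q where Q: "poly_over ?B Q" "smult c f = Q * q" and c: "c \<in> ?B" "c \<noteq> 0" "\<And>t. N \<le> t \<Longrightarrow> hcomp t c = 0"
      using N(1) unfolding M_def by blast
    have lcv: "eval_poly (lead_coeff q) (a *s v) = 0" for a
      using lv eval_linear_form(2)[OF l1, of a v] Suc by (simp add: lcs l(4) eval_poly_mult)
    have "c = lead_coeff (smult c f)" using F(2) by simp
    also have "\<dots> = lead_coeff Q * lead_coeff q" unfolding Q(2) by (rule lead_coeff_mult)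
    finally have cv: "eval_poly c (a *s v) = 0" for a using lcv by (simp add: eval_poly_mult)
    then obtain c' where c': "c' \<in> ?B" "c = l * c'" using divl[OF c(1)] by blast
    have van: "eval_poly (coeff Q k) (a *s v) = 0" if "a \<noteq> 0" for a k
    proof -
      have "map_poly (\<lambda>b. eval_poly b (a *s v)) Q * map_poly (\<lambda>b. eval_poly b (a *s v)) q
          = map_poly (\<lambda>b. eval_poly b (a *s v)) (smult c f)"
        unfolding Q(2) map_poly_eval_mult ..
      also have "\<dots> = 0" by (rule poly_eqI) (simp add: coeff_map_poly eval_poly_mult cv)
      finally have "map_poly (\<lambda>b. eval_poly b (a *s v)) Q = 0" using qmap[OF that] by simp
      then have "coeff (map_poly (\<lambda>b. eval_poly b (a *s v)) Q) k = 0" by simp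
      then show ?thesis by (simp add: coeff_map_poly)
    qed
    have "coeff Q k \<in> ?B" for k using Q(1) by (simp add: poly_over_def)
    note divs = divl[OF this van]
    obtain Q' where Q': "poly_over ?B Q'" "Q = smult l Q'" by (rule poly_over_divide[OF Q(1) divs])
    have "smult l (smult c' f) = smult l (Q' * q)" using Q(2) unfolding c'(2) Q'(2) by simp
    then have "smult l (smult c' f - Q' * q) = 0" by (simp add: smult_diff_right)
    then have Q'': "smult c' f = Q' * q" using lnz by simp
    have c'nz: "c' \<noteq> 0" using c(2) c'(2) by auto
    have "N \<noteq> 0"
    proof
      assume "N = 0"
      then have "c = 0" using c(3) sum_hcomp[of c] by (metis le0 sum.neutral)
      with c(2) show False by simp
    qed
    then obtain N' where N': "N = Suc N'" by (cases N) auto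
    have "hcomp t c' = 0" if "N' \<le> t" for t
    proof -
      have "l * hcomp t c' = hcomp (1 + t) c" unfolding c'(2) by (rule hcomp_mult_form[OF l1, symmetric])
      also have "\<dots> = 0" using c(3) that N' by simp
      finally show ?thesis using lnz by simp
    qed
    then have "M N' c'" unfolding M_def using c'(1) c'nz Q'(1) Q'' by blast
    then show False using N(2) N' by fastforce
  qed
qed

section \<open>The projection from a point off the curve\<close>

lemma finite_over_imp_relation:
  fixes J :: "('k::{alg_closed_field, field_char_0}, 'n::{finite,linorder}) mpoly set"
  assumes J: "curve_ideal J" and T: "coords T" "finite_over T J" "card T \<noteq> 2"
  obtains m f where "f \<in> alg T" "f \<in> J" "is_form m f" "f \<noteq> 0"
proof -
  have "alg T \<inter> J \<noteq> {0}" using curve_normalization_card[OF J T(1,2)] T(3) by blast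
  moreover have "0 \<in> alg T \<inter> J" using alg_closed(1) idl.subspace_0[OF curve_idealD(5)[OF J]] by blast
  ultimately obtain f where f: "f \<in> alg T" "f \<in> J" "f \<noteq> 0" by blast
  obtain j where j: "hcomp j f \<noteq> 0" using f(3) sum_hcomp[of f] by (metis sum.neutral)
  have "hcomp j f \<in> alg T" using hcomp_alg[OF coords_form[OF T(1)] f(1)] by blast
  then show ?thesis using that hideal_hcomp[OF curve_idealD(1)[OF J] f(2)] is_form_hcomp j by blast
qed

text \<open>A coordinate system adapted to the projection from \<open>p\<close>: the linear forms \<open>x, y, z\<close> are coordinates of
  the plane, \<open>x, y\<close> are parameters for the curve, and \<open>q(z)\<close>, monic in \<open>z\<close>, is the equation of the plane
  curve onto which the curve is projected. The last condition says that no nonzero polynomial in \<open>z\<close> of smaller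
  degree vanishes on the curve, whatever its degree in \<open>x, y\<close>.\<close>

definition projection_from :: "('k::field, 'n::finite) mpoly set \<Rightarrow> 'k ^ 'n \<Rightarrow> nat \<Rightarrow>
    ('k, 'n) mpoly \<Rightarrow> ('k, 'n) mpoly \<Rightarrow> ('k, 'n) mpoly \<Rightarrow> ('k, 'n) mpoly \<Rightarrow> ('k, 'n) mpoly poly \<Rightarrow> bool" where
  "projection_from J p e w x y z q \<longleftrightarrow>
     is_form 1 w \<and> is_form 1 x \<and> is_form 1 y \<and> is_form 1 z \<and> eval_poly w p = 1 \<and>
     alg (lin p) = alg {x, y, z} \<and> alg {w, x, y, z} = UNIV \<and> module_finite (alg (lin p)) J \<and>
     {x, y, z} \<subseteq> lin p \<and> finite_over {x, y} J \<and>
     0 < e \<and> poly_over (alg {x, y}) q \<and> lead_coeff q = 1 \<and> degree q = e \<and>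
     poly q z \<in> J \<and> is_form e (poly q z) \<and> poly q z \<noteq> 0 \<and>
     (\<forall>r. poly_over (alg {x, y}) r \<longrightarrow> degree r < e \<longrightarrow> poly r z \<in> J \<longrightarrow> r = 0)"

text \<open>Take a nonzero form \<open>F\<close> of least degree in \<open>J\<close> among those in the linear forms vanishing at \<open>p\<close>, and
  choose \<open>x, y\<close> as the pencil that vanishes at a point \<open>v\<^sub>0\<close> with \<open>F(v\<^sub>0) \<noteq> 0\<close>. The coefficient of the highest
  power of \<open>z\<close> in \<open>F\<close> is then nonzero, since it is \<open>F(v\<^sub>0)\<close> up to a power of \<open>z(v\<^sub>0)\<close>. That no equation has
  smaller degree in \<open>z\<close> is Gauss's lemma.\<close>

lemma projection_exists:
  fixes J :: "('k::{alg_closed_field, field_char_0}, 'n::{finite,linorder}) mpoly set"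
  assumes J: "curve_ideal J" and n: "CARD('n) = 4" and p: "p \<noteq> 0"
    and g: "g \<in> J" "is_form k g" "eval_poly g p \<noteq> 0"
  obtains e w x y z q where "projection_from J p e w x y z q"
proof -
  note C = curve_idealD[OF J]
  obtain w T where T: "coords (insert w T)" "alg (insert w T) = UNIV" "w \<notin> T" "eval_poly w p = 1"
    "\<And>t. t \<in> T \<Longrightarrow> eval_poly t p = 0" "card T = CARD('n) - 1" "alg (lin p) = alg T"
    by (rule lin_coords[OF p]) blast
  have coT: "coords T" by (rule coords_subset[OF T(1)]) blast
  have finT: "finite_over T J" by (rule finite_over_lin[OF T(1-3) _ T(5) C(5) g]) (use T(4) in simp)
  obtain m1 f1 where f1: "f1 \<in> alg T" "f1 \<in> J" "is_form m1 f1" "f1 \<noteq> 0"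
    by (rule finite_over_imp_relation[OF J coT finT]) (use T(6) n in auto)
  define P where "P e \<longleftrightarrow> (\<exists>f\<in>alg T. f \<in> J \<and> is_form e f \<and> f \<noteq> 0)" for e
  have "P m1" using f1 unfolding P_def by blast
  then obtain e where e: "P e" "\<And>m. P m \<Longrightarrow> e \<le> m" using exists_least_iff[of P] by (metis not_le)
  obtain F where F: "F \<in> alg T" "F \<in> J" "is_form e F" "F \<noteq> 0" using e(1) unfolding P_def by blast
  have e0: "0 < e"
  proof (rule ccontr)
    assume "\<not> 0 < e"
    then obtain c where "F = cst c" using form_zero_eq_cst F(3) by blast
    then show False using one_notin_cst[OF C(5,3), of c] F(2,4) by simp
  qed
  obtain v0 where v0: "eval_poly F v0 \<noteq> 0" using exists_nonzero_value[OF F(4)] by blast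
  then obtain z where z: "z \<in> T" "eval_poly z v0 \<noteq> 0"
    using form_zero_at_common_zero[OF F(1,3) e0 coords_form[OF coT]] by blast
  let ?Q = "pencil T z v0"
  have "card ?Q = 2" using card_pencil[OF coT z] T(6) n by simp
  then obtain x y where xy: "?Q = {x, y}" "x \<noteq> y" by (auto simp: card_2_iff)
  have coxy: "coords {x, y}" using coords_pencil[OF coT z] xy(1) by simp
  have finxy: "finite_over {x, y} J" using finite_over_pencil[OF coT z C(5) F(1,3,2) v0 finT] xy(1) by simp
  have fx: "is_form 1 x" and fy: "is_form 1 y" using coords_form[OF coxy] by auto
  have fz: "is_form 1 z" by (rule coords_form[OF coT z(1)])
  have fw: "is_form 1 w" by (rule coords_form[OF T(1)]) simp
  have algT: "alg T = alg {x, y, z}"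
    using alg_insert_pencil[OF coT z] unfolding xy(1) by (simp add: insert_commute)
  have van: "eval_poly x v0 = 0" "eval_poly y v0 = 0" using pencil_vanish[OF coT z] xy(1) by auto
  have "?Q \<subseteq> lin p"
  proof
    fix s assume s: "s \<in> ?Q"
    then obtain t where "t \<in> T" "s = t - cst (eval_poly t v0 / eval_poly z v0) * z" unfolding pencil_def by blast
    then have "eval_poly s p = 0" using T(5) z(1) by (simp add: eval_poly_simps)
    moreover have "is_form 1 s" using s coords_form[OF coxy] xy(1) by simp
    ultimately show "s \<in> lin p" by (simp add: lin_def)
  qed
  then have xyzp: "{x, y, z} \<subseteq> lin p" using xy(1) T(5)[OF z(1)] fz by (auto simp: lin_def)
  have mf: "module_finite (alg (lin p)) J" unfolding T(7) by (rule coords_module_finite[OF coT C(1) finT])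
  have full: "alg {w, x, y, z} = UNIV"
  proof -
    have "alg (insert w T) \<subseteq> alg {w, x, y, z}"
    proof (rule alg_subset)
      fix s assume s: "s \<in> insert w T"
      show "s \<in> alg {w, x, y, z}"
      proof (cases "s = w")
        case False
        then have "s \<in> alg T" using s by (auto intro: alg_base)
        then show ?thesis unfolding algT using alg_mono[of "{x, y, z}" "{w, x, y, z}"] by blast
      qed (auto intro: alg_base)
    qed
    then show ?thesis using T(2) by blast
  qed
  obtain r where r: "\<And>k. k \<le> e \<Longrightarrow> degree (r k) \<le> e - k" "hcomp e F = tform x y z e r"
    by (rule hcomp_alg3[OF fx fy fz, of F e]) (use F(1) algT in auto)
  then have Ft: "F = tform x y z e r" using hcomp_form[OF F(3), of e] by simp
  obtain c where c: "r e = [:c:]" using r(1)[of e] by (auto elim: degree_eq_zeroE)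
  have bv: "eval_poly (bform x y n s) v0 = 0" if "0 < n" for n and s :: "'k poly"
    unfolding eval_bform by (rule sum.neutral) (use that van in \<open>auto simp: power_0_left\<close>)
  have "eval_poly F v0 = (\<Sum>k\<le>e. if k = e then c * eval_poly z v0 ^ e else 0)"
    unfolding Ft tform_def eval_poly_sum
  proof (rule sum.cong[OF refl])
    fix k assume "k \<in> {..e}"
    then consider "k < e" | "k = e" by fastforce
    then show "eval_poly (bform x y (e - k) (r k) * z ^ k) v0 = (if k = e then c * eval_poly z v0 ^ e else 0)"
    proof cases
      case 1
      then show ?thesis by (simp add: eval_poly_mult bv)
    next
      case 2
      then show ?thesis by (simp add: eval_poly_mult eval_poly_power c eval_bform)
    qed
  qed
  then have c0: "c \<noteq> 0" using v0 by auto
  define q where "q = (\<Sum>k\<le>e. monom (cst (inverse c) * bform x y (e - k) (r k)) k)"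
  have co: "coeff q k = (if k \<le> e then cst (inverse c) * bform x y (e - k) (r k) else 0)" for k
    by (simp add: q_def coeff_sum coeff_monom if_distrib sum.delta cong: if_cong)
  have coe: "coeff q e = 1"
    using c0 by (simp add: co c bform_def mult_single)
  have deg: "degree q = e"
  proof (rule antisym)
    show "degree q \<le> e" by (rule degree_le) (simp add: co)
    show "e \<le> degree q" by (rule le_degree) (simp add: coe)
  qed
  have lead: "lead_coeff q = 1" using deg coe by simp
  have over: "poly_over (alg {x, y}) q"
    unfolding poly_over_def co using bform_in_alg[of x y] alg_closed(1)[of "{x, y}"]
    by (auto intro: alg.alg_mult alg.alg_cst)
  have qz: "poly q z = cst (inverse c) * F"
    unfolding Ft tform_def q_def by (simp add: poly_sum poly_monom sum_distrib_left mult.assoc)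
  have qJ: "poly q z \<in> J" unfolding qz by (rule ideal_mult_left[OF C(5) F(2)])
  have qform: "is_form e (poly q z)" unfolding qz by (rule is_form_scale[OF F(3)])
  have least: "f = 0" if "f \<in> alg {x, y, z}" "f \<in> J" "is_form m f" "m < e" for f m
    using e(2)[of m] that algT unfolding P_def by fastforce
  have qnz: "poly q z \<noteq> 0" unfolding qz using F(4) c0 cst_inject[of "inverse c" 0] by simp
  have min: "s = 0" if "poly_over (alg {x, y}) s" "degree s < e" "poly s z \<in> J" for s
    by (rule no_relation_of_small_degree[OF J fx fy fz finxy coxy xy(2) van z(2) over lead qJ least that])
  have "projection_from J p e w x y z q"
    unfolding projection_from_def
    using fw fx fy fz T(4) T(7) algT full mf xyzp finxy e0 over lead deg qJ qform qnz min by blast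
  then show ?thesis by (rule that)
qed

context
  fixes J :: "('k::{alg_closed_field, field_char_0}, 'n::{finite,linorder}) mpoly set" and p e w x y z q
  assumes J: "curve_ideal J" and proj: "projection_from J p e w x y z q"
begin

lemma proj_forms: "is_form 1 w" "is_form 1 x" "is_form 1 y" "is_form 1 z"
  and proj_p: "eval_poly w p = 1" "eval_poly x p = 0" "eval_poly y p = 0" "eval_poly z p = 0"
  and proj_alg: "alg (lin p) = alg {x, y, z}" "alg {w, x, y, z} = UNIV"
  and proj_fin: "module_finite (alg (lin p)) J" "finite_over {x, y} J"
  and proj_q: "0 < e" "poly_over (alg {x, y}) q" "lead_coeff q = 1" "degree q = e" "poly q z \<in> J" "is_form e (poly q z)" "poly q z \<noteq> 0"
  and proj_min: "\<And>r. poly_over (alg {x, y}) r \<Longrightarrow> degree r < e \<Longrightarrow> poly r z \<in> J \<Longrightarrow> r = 0"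
  using proj unfolding projection_from_def lin_def by auto

lemma proj_q_in_alg: "poly q z \<in> alg {x, y, z}"
  using poly_in_alg_insert[OF proj_q(2), of z] by (simp add: insert_commute)

text \<open>The remainder of the division by the monic polynomial \<open>q\<close> has degree less than \<open>e\<close> and lies in \<open>J\<close>, so
  it is zero.\<close>

lemma proj_divides:
  assumes f: "f \<in> alg {x, y, z}" "f \<in> J" shows "\<exists>h\<in>alg {x, y, z}. f = h * poly q z"
proof -
  note C = curve_idealD[OF J]
  have "f \<in> alg (insert z {x, y})" using f(1) by (simp add: insert_commute)
  then obtain u where u: "poly_over (alg {x, y}) u" "f = poly u z" by (rule alg_insert)
  have "q \<noteq> 0" using proj_q(1,4) by auto
  then obtain c Q r where d: "poly_over (alg {x, y}) Q" "poly_over (alg {x, y}) r" "smult c u = Q * q + r"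
      "r = 0 \<or> degree r < degree q" "lead_coeff q = 1 \<longrightarrow> c = 1"
    using pseudo_division_over[OF alg_subring proj_q(2) _ u(1)] by blast
  then have eq: "f = poly Q z * poly q z + poly r z" using proj_q(3) u(2) by (metis poly_add poly_mult smult_1_left)
  have "f - poly Q z * poly q z \<in> J" by (rule idl.subspace_diff[OF C(5) f(2) ideal_mult_left[OF C(5) proj_q(5)]])
  then have "poly r z \<in> J" using eq by simp
  then have "r = 0" using proj_min[OF d(2)] d(4) proj_q(4) by auto
  moreover have "poly Q z \<in> alg {x, y, z}" using poly_in_alg_insert[OF d(1), of z] by (simp add: insert_commute)
  ultimately show ?thesis using eq by (intro bexI[of _ "poly Q z"]) auto
qed

lemma proj_independent:
  assumes "(\<Sum>k<e. bform x y (n k) (r k) * z ^ k) \<in> J" "\<And>k. k < e \<Longrightarrow> degree (r k) \<le> n k"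
  shows "\<forall>k<e. r k = 0"
proof (intro allI impI)
  fix k assume k: "k < e"
  define s where "s = (\<Sum>k<e. monom (bform x y (n k) (r k)) k)"
  have co: "coeff s i = (if i < e then bform x y (n i) (r i) else 0)" for i
    by (simp add: s_def coeff_sum coeff_monom if_distrib sum.delta cong: if_cong)
  have "degree s \<le> e - 1" by (rule degree_le) (use proj_q(1) in \<open>auto simp: co\<close>)
  then have "degree s < e" using proj_q(1) by simp
  moreover have "poly_over (alg {x, y}) s"
    unfolding poly_over_def co using bform_in_alg[of x y] alg_closed(1)[of "{x, y}"] by auto
  moreover have "poly s z \<in> J" using assms(1) by (simp add: s_def poly_sum poly_monom)
  ultimately have "s = 0" by (intro proj_min)
  then have "bform x y (n k) (r k) = 0" using co[of k] k by simp
  then have "bform x y (n k) (r k) \<in> J" using idl.subspace_0[OF curve_idealD(5)[OF J]] by simp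
  then show "r k = 0" by (rule bform_in_curve_ideal[OF J proj_forms(2,3) proj_fin(2) assms(2)[OF k]])
qed

text \<open>The exponents of a basis of the coordinate ring of the plane curve in degree \<open>t\<close>: the first component
  is the exponent of \<open>z\<close>, which stays below \<open>e\<close>, and the second one that of \<open>x\<close>.\<close>

definition pmonos :: "nat \<Rightarrow> (nat \<times> nat) set" where
  "pmonos t = Sigma {..<e} (\<lambda>k. {..t - k})"

definition pmono :: "nat \<Rightarrow> nat \<times> nat \<Rightarrow> ('k, 'n) mpoly" where
  "pmono t a = x ^ snd a * y ^ (t - fst a - snd a) * z ^ fst a"

text \<open>The coefficient of \<open>z\<^sup>k\<close> in a combination of these monomials, dehomogenized at \<open>y = 1\<close>.\<close>

definition prow :: "nat \<Rightarrow> (nat \<times> nat \<Rightarrow> 'k) \<Rightarrow> nat \<Rightarrow> 'k poly" where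
  "prow t c k = (\<Sum>i\<le>t - k. monom (c (k, i)) i)"

lemma coeff_prow: "coeff (prow t c k) i = (if i \<le> t - k then c (k, i) else 0)"
  by (simp add: prow_def coeff_sum coeff_monom if_distrib sum.delta cong: if_cong)

lemma degree_prow: "degree (prow t c k) \<le> t - k"
  by (rule degree_le) (simp add: coeff_prow)

lemma finite_pmonos: "finite (pmonos t)"
  by (simp add: pmonos_def)

lemma card_pmonos: "card (pmonos t) = (\<Sum>k<e. Suc (t - k))"
  by (simp add: pmonos_def)

lemma is_form_pmono:
  assumes "e \<le> Suc t" "a \<in> pmonos t" shows "is_form t (pmono t a)"
proof -
  have "is_form (snd a + (t - fst a - snd a) + fst a) (pmono t a)"
    unfolding pmono_def by (intro is_form_mult is_form_power1 proj_forms)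
  moreover have "snd a + (t - fst a - snd a) + fst a = t" using assms by (auto simp: pmonos_def)
  ultimately show ?thesis by simp
qed

lemma pmono_sum: "(\<Sum>a\<in>pmonos t. cst (c a) * pmono t a) = (\<Sum>k<e. bform x y (t - k) (prow t c k) * z ^ k)"
proof -
  have "bform x y (t - k) (prow t c k) * z ^ k = (\<Sum>i\<le>t - k. cst (c (k, i)) * pmono t (k, i))" for k
    unfolding bform_def by (simp add: coeff_prow pmono_def sum_distrib_right mult.assoc)
  then show ?thesis unfolding pmonos_def by (simp add: sum.Sigma case_prod_unfold)
qed

lemma pmono_independent:
  assumes "(\<Sum>a\<in>pmonos t. cst (c a) * pmono t a) \<in> J" shows "\<forall>a\<in>pmonos t. c a = 0"
proof
  fix a assume a: "a \<in> pmonos t"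
  have "\<forall>k<e. prow t c k = 0"
    by (rule proj_independent[where n = "\<lambda>k. t - k"]) (use assms pmono_sum degree_prow in auto)
  then have "prow t c (fst a) = 0" using a by (auto simp: pmonos_def)
  then have "coeff (prow t c (fst a)) (snd a) = 0" by simp
  then show "c a = 0" using a by (auto simp: coeff_prow pmonos_def)
qed

lemma card_pmonos_ge: "e * s \<le> card (pmonos (e + s))"
proof -
  have "(\<Sum>k<e. s) \<le> (\<Sum>k<e. Suc (e + s - k))" by (rule sum_mono) auto
  then show ?thesis unfolding card_pmonos by simp
qed

text \<open>The coordinate ring of the plane curve embeds into the quotient by \<open>J\<close>, and its Hilbert function grows
  with slope \<open>e\<close>.\<close>

lemma proj_degree_le:
  assumes d: "\<And>t. hf J t \<le> d * t + K" shows "e \<le> d"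
proof (rule ccontr)
  assume "\<not> e \<le> d"
  define s where "s = Suc (d * e + K)"
  have "card (pmonos (e + s)) \<le> hf J (e + s)"
    by (rule hf_ge[OF curve_idealD(5)[OF J] finite_pmonos is_form_pmono pmono_independent]) auto
  then have "e * s \<le> d * (e + s) + K" using card_pmonos_ge[of s] d[of "e + s"] by linarith
  moreover have "Suc d * s \<le> e * s" using \<open>\<not> e \<le> d\<close> by (intro mult_le_mono1) simp
  ultimately have "Suc d * s \<le> d * (e + s) + K" by linarith
  then have "s \<le> d * e + K" by (simp add: algebra_simps)
  then show False by (simp add: s_def)
qed

lemma sum_Suc_diff_choose: "Suc (\<Sum>k<n. Suc (n - k)) = (n + 2) choose 2"
proof (induction n)
  case 0
  show ?case by (simp add: choose_two)
next
  case (Suc n)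
  have "(\<Sum>k<Suc n. Suc (Suc n - k)) = Suc (Suc n) + (\<Sum>k<n. Suc (n - k))"
    by (subst sum.lessThan_Suc_shift) simp
  moreover have "(Suc n + 2) choose 2 = ((n + 2) choose 2) + (n + 2)"
    by (simp add: numeral_2_eq_2)
  ultimately show ?case using Suc by simp
qed

text \<open>If the multiples of \<open>w\<close> by \<open>x\<^sup>e\<^sup>-\<^sup>1\<close> and \<open>y\<^sup>e\<^sup>-\<^sup>1\<close> were both in the coordinate ring of the plane
  curve, comparing them would show that \<open>w\<close> itself is, modulo \<open>J\<close>, a linear form in \<open>x, y, z\<close>.\<close>

lemma proj_extra_form:
  assumes nd: "\<And>l. is_form 1 l \<Longrightarrow> l \<in> J \<Longrightarrow> l = 0"
  shows "\<exists>u. is_form e u \<and> (\<forall>c. u - (\<Sum>a\<in>pmonos e. cst (c a) * pmono e a) \<notin> J)"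
proof (rule ccontr)
  assume neg: "\<not> ?thesis"
  note C = curve_idealD[OF J]
  obtain m where m: "e = Suc m" using proj_q(1) by (cases e) auto
  have "is_form (1 + m) (w * x ^ m)" "is_form (1 + m) (w * y ^ m)"
    by (intro is_form_mult is_form_power1 proj_forms)+
  then have wf: "is_form e (w * x ^ m)" "is_form e (w * y ^ m)" using m by simp_all
  obtain a where "w * x ^ m - (\<Sum>b\<in>pmonos e. cst (a b) * pmono e b) \<in> J" using neg wf(1) by blast
  then have a: "w * x ^ m - (\<Sum>k<e. bform x y (e - k) (prow e a k) * z ^ k) \<in> J" unfolding pmono_sum .
  obtain b where "w * y ^ m - (\<Sum>c\<in>pmonos e. cst (b c) * pmono e c) \<in> J" using neg wf(2) by blast
  then have b: "w * y ^ m - (\<Sum>k<e. bform x y (e - k) (prow e b k) * z ^ k) \<in> J" unfolding pmono_sum .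
  have xm: "x ^ m = bform x y m (monom 1 m)"
    unfolding bform_def by (simp add: coeff_monom if_distrib[of cst] if_distrib[of "\<lambda>c. c * _"] cong: if_cong)
  have xb: "x ^ m * bform x y j s = bform x y (m + j) (monom 1 m * s)" if "degree s \<le> j" for j s
    unfolding xm by (rule bform_mult) (use that degree_monom_le in auto)
  let ?X = "\<Sum>k<e. bform x y (e - k) (prow e a k) * z ^ k" and ?Y = "\<Sum>k<e. bform x y (e - k) (prow e b k) * z ^ k"
  have "x ^ m * (w * y ^ m - ?Y) - y ^ m * (w * x ^ m - ?X) \<in> J"
    by (rule idl.subspace_diff[OF C(5) ideal_mult_left[OF C(5) b] ideal_mult_left[OF C(5) a]])
  then have "y ^ m * ?X - x ^ m * ?Y \<in> J" by (simp add: algebra_simps)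
  also have "y ^ m * ?X - x ^ m * ?Y = (\<Sum>k<e. bform x y (m + (e - k)) (prow e a k - monom 1 m * prow e b k) * z ^ k)"
  proof -
    have "y ^ m * (bform x y (e - k) (prow e a k) * z ^ k) - x ^ m * (bform x y (e - k) (prow e b k) * z ^ k)
        = bform x y (m + (e - k)) (prow e a k - monom 1 m * prow e b k) * z ^ k" for k
    proof -
      have "bform x y (m + (e - k)) (prow e a k - monom 1 m * prow e b k)
          = bform x y (m + (e - k)) (prow e a k) - bform x y (m + (e - k)) (monom 1 m * prow e b k)"
        using bform_add[of x y "m + (e - k)" "prow e a k - monom 1 m * prow e b k" "monom 1 m * prow e b k"] by simp
      then show ?thesis
        unfolding bform_shift[OF degree_prow] xb[OF degree_prow, symmetric] by (simp add: left_diff_distrib mult.assoc)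
    qed
    then show ?thesis by (simp add: sum_distrib_left flip: sum_subtractf)
  qed
  finally have rel: "(\<Sum>k<e. bform x y (m + (e - k)) (prow e a k - monom 1 m * prow e b k) * z ^ k) \<in> J" .
  have degs: "degree (prow e a k - monom 1 m * prow e b k) \<le> m + (e - k)" for k
  proof (rule degree_diff_le)
    show "degree (prow e a k) \<le> m + (e - k)" using degree_prow[of e a k] by simp
    show "degree (monom 1 m * prow e b k) \<le> m + (e - k)"
      using degree_mult_le[of "monom 1 m" "prow e b k"] degree_monom_le[of "1 :: 'k" m] degree_prow[of e b k] by linarith
  qed
  have eq: "prow e a k = monom 1 m * prow e b k" if "k < e" for k
    using proj_independent[where n = "\<lambda>k. m + (e - k)", OF rel degs] that by simp
  have deg: "prow e b k = 0 \<or> degree (prow e b k) + k \<le> 1" if "k < e" for k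
  proof (cases "prow e b k = 0")
    case False
    then have "degree (prow e a k) = m + degree (prow e b k)"
      unfolding eq[OF that] by (subst degree_mult_eq) (auto simp: degree_monom_eq monom_eq_0_iff)
    then have "m + degree (prow e b k) \<le> e - k" using degree_prow[of e a k] by simp
    then have "degree (prow e b k) + k \<le> 1" using m that by arith
    then show ?thesis ..
  qed simp
  have term_eq: "bform x y (e - k) (prow e a k) = x ^ m * bform x y (1 - k) (prow e b k)" if "k < e" for k
  proof (cases "prow e b k = 0")
    case True
    then show ?thesis using eq[OF that] by simp
  next
    case False
    then have "degree (prow e b k) \<le> 1 - k" "e - k = m + (1 - k)" using deg[OF that] m by auto
    then show ?thesis using xb eq[OF that] by simp
  qed
  define l where "l = (\<Sum>k<e. bform x y (1 - k) (prow e b k) * z ^ k)"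
  have "?X = x ^ m * l"
    unfolding l_def sum_distrib_left by (rule sum.cong) (auto simp: term_eq mult.assoc)
  with a have "x ^ m * (w - l) \<in> J" by (simp add: algebra_simps)
  moreover have "x ^ m \<in> alg {x, y}" by (intro alg_closed alg_base) simp
  moreover have "x ^ m \<noteq> 0"
  proof
    assume "x ^ m = 0"
    then have "bform x y m (monom 1 m) \<in> J" using xm idl.subspace_0[OF C(5)] by simp
    then have "monom (1 :: 'k) m = 0"
      by (rule bform_in_curve_ideal[OF J proj_forms(2,3) proj_fin(2) degree_monom_le])
    then show False by (simp add: monom_eq_0_iff)
  qed
  ultimately have "w - l \<in> J" using curve_torsion_free[OF J proj_forms(2,3) proj_fin(2)] by blast
  moreover have "is_form 1 l"
    unfolding l_def
  proof (rule is_form_sum)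
    fix k assume "k \<in> {..<e}"
    show "is_form 1 (bform x y (1 - k) (prow e b k) * z ^ k)"
    proof (cases "prow e b k = 0")
      case False
      then have "1 - k + k = 1" using deg \<open>k \<in> {..<e}\<close> by fastforce
      then show ?thesis
        using is_form_mult[OF is_form_bform[where n = "1 - k" and q = "prow e b k", OF proj_forms(2,3)] is_form_power1[where n = k, OF proj_forms(4)]] by simp
    qed simp
  qed
  ultimately have "w - l = 0" using nd[OF is_form_diff[OF proj_forms(1)]] by blast
  moreover have "eval_poly l p = 0"
  proof -
    have "l \<in> alg {x, y, z}"
    proof -
      have "bform x y n s \<in> alg {x, y, z}" for n s
        using bform_in_alg[of x y n s] alg_mono[of "{x, y}" "{x, y, z}"] by blast
      then show ?thesis unfolding l_def by (intro alg_closed) (auto intro: alg_base)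
    qed
    then show ?thesis
      by (rule form_zero_at_common_zero[OF _ \<open>is_form 1 l\<close>]) (use proj_forms proj_p in auto)
  qed
  ultimately show False using proj_p(1) by simp
qed

lemma proj_hf_ge:
  assumes nd: "\<And>l. is_form 1 l \<Longrightarrow> l \<in> J \<Longrightarrow> l = 0"
  shows "(e + 2) choose 2 \<le> hf J e"
proof -
  note idJ = curve_idealD(5)[OF J]
  obtain u where u: "is_form e u" "\<And>c. u - (\<Sum>a\<in>pmonos e. cst (c a) * pmono e a) \<notin> J"
    using proj_extra_form[OF nd] by blast
  define A where "A = insert None (Some ` pmonos e)"
  define v where "v = case_option u (pmono e)"
  have split: "(\<Sum>i\<in>A. cst (c i) * v i) = cst (c None) * u + (\<Sum>a\<in>pmonos e. cst (c (Some a)) * pmono e a)" for c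
    unfolding A_def using finite_pmonos by (simp add: v_def sum.reindex)
  have "card A \<le> hf J e"
  proof (rule hf_ge[OF idJ])
    show "is_form e (v i)" if "i \<in> A" for i
      using that u(1) is_form_pmono[of e] unfolding A_def v_def by auto
    fix c assume c: "(\<Sum>i\<in>A. cst (c i) * v i) \<in> J"
    have c0: "c None = 0"
    proof (rule ccontr)
      assume nz: "c None \<noteq> 0"
      have "cst (inverse (c None)) * (\<Sum>i\<in>A. cst (c i) * v i) \<in> J" by (rule ideal_mult_left[OF idJ c])
      also have "cst (inverse (c None)) * (\<Sum>i\<in>A. cst (c i) * v i)
          = u - (\<Sum>a\<in>pmonos e. cst (- (inverse (c None) * c (Some a))) * pmono e a)"
        unfolding split distrib_left cst_inverse[OF nz]
        by (simp only: single_uminus cst_mult sum_negf minus_mult_left[symmetric] sum_distrib_left mult.assoc diff_minus_eq_add)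
      finally have "u - (\<Sum>a\<in>pmonos e. cst (- (inverse (c None) * c (Some a))) * pmono e a) \<in> J" .
      with u(2)[of "\<lambda>a. - (inverse (c None) * c (Some a))"] show False by simp
    qed
    then have "(\<Sum>a\<in>pmonos e. cst (c (Some a)) * pmono e a) \<in> J" using c unfolding split by simp
    from pmono_independent[OF this] c0 show "\<forall>i\<in>A. c i = 0" unfolding A_def by auto
  qed (simp add: A_def finite_pmonos)
  moreover have "card A = Suc (card (pmonos e))"
    unfolding A_def using finite_pmonos by (subst card_insert_disjoint) (auto simp: card_image)
  ultimately show ?thesis unfolding card_pmonos sum_Suc_diff_choose by simp
qed

end

text \<open>The upper bound compares Hilbert functions. The lower bound is the choice of a general centre.\<close>

lemma projection_degree:
  fixes J :: "('k::{alg_closed_field, field_char_0}, 'n::{finite,linorder}) mpoly set"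
  assumes J: "curve_ideal J" and proj: "projection_from J p e w x y z q" and general_centre: "general_centre J d p"
    and d: "\<And>t. hf J t \<le> d * t + K"
  shows "e = d"
proof (rule antisym)
  show "e \<le> d" by (rule proj_degree_le[OF J proj d])
  show "d \<le> e"
  proof (rule ccontr)
    assume "\<not> d \<le> e"
    moreover have "poly q z \<in> alg (lin p)" using proj_q_in_alg[OF J proj] proj_alg(1)[OF J proj] by simp
    ultimately have "poly q z = 0" using general_centre proj_q(5,6)[OF J proj] unfolding general_centre_def by (meson not_le)
    then show False using proj_q(7)[OF J proj] by simp
  qed
qed

lemma card_monomials_le:
  assumes "CARD('n::finite) = 4"
  shows "card {a :: 'n \<Rightarrow>\<^sub>0 nat. mono_deg a = t} \<le> (t + 3) choose 3"
proof -
  obtain xs :: "'n list" where xs: "set xs = UNIV" "distinct xs" using finite_distinct_list[of "UNIV :: 'n set"] by auto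
  have len: "length xs = 4" using distinct_card[OF xs(2)] xs(1) assms by simp
  define \<phi> where "\<phi> a = map (Poly_Mapping.lookup a) xs" for a :: "'n \<Rightarrow>\<^sub>0 nat"
  have "inj \<phi>"
  proof (rule injI)
    fix a b assume "\<phi> a = \<phi> b"
    then have "Poly_Mapping.lookup a i = Poly_Mapping.lookup b i" for i using xs(1) by (auto simp: \<phi>_def)
    then show "a = b" by (rule poly_mapping_eqI)
  qed
  moreover have "\<phi> ` {a. mono_deg a = t} \<subseteq> {l. length l = 4 \<and> sum_list l = t}"
    using len xs by (auto simp: \<phi>_def mono_deg_def sum_list_distinct_conv_sum_set)
  moreover have "finite {l :: nat list. length l = 4 \<and> sum_list l = t}"
    by (rule finite_subset[OF _ finite_lists_length_eq[of "{..t}" 4]]) (auto dest: member_le_sum_list)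
  ultimately have "card {a :: 'n \<Rightarrow>\<^sub>0 nat. mono_deg a = t} \<le> card {l :: nat list. length l = 4 \<and> sum_list l = t}"
    using card_inj_on_le[OF inj_on_subset[OF _ subset_UNIV]] by blast
  also have "\<dots> = (t + 3) choose t" using card_length_sum_list[of 4 t] by (simp add: add.commute)
  also have "\<dots> = (t + 3) choose 3" using binomial_symmetric[of t "t + 3"] by simp
  finally show ?thesis .
qed

text \<open>There are \<open>(t + 3 choose 3)\<close> monomials of degree \<open>t\<close>, and Pascal's rule splits this number into the two
  binomial coefficients.\<close>

lemma dim_graded_part_le:
  fixes J :: "('k::field, 'n::finite) mpoly set"
  assumes n: "CARD('n) = 4" and h: "(t + 2) choose 2 \<le> hf J t"
  shows "mpoly.dim (graded_part J t) \<le> (t + 2) choose 3"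
proof -
  have "mpoly.dim (graded_part (UNIV :: ('k, 'n) mpoly set) t)
      \<le> card ((\<lambda>a :: 'n \<Rightarrow>\<^sub>0 nat. Poly_Mapping.single a (1::'k)) ` {a. mono_deg a = t})"
    by (rule mpoly.dim_le_card[OF forms_span_monomials finite_monomials])
  also have "\<dots> \<le> card {a :: 'n \<Rightarrow>\<^sub>0 nat. mono_deg a = t}"
    by (rule card_image_le) (rule finite_subset[OF _ finite_bounded_degree[of "Suc t"]], auto)
  also have "\<dots> \<le> (t + 3) choose 3" by (rule card_monomials_le[OF n])
  also have "\<dots> = ((t + 2) choose 2) + ((t + 2) choose 3)" by (simp add: numeral_3_eq_3 numeral_2_eq_2)
  finally have "mpoly.dim (graded_part (UNIV :: ('k, 'n) mpoly set) t) \<le> ((t + 2) choose 2) + ((t + 2) choose 3)" .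
  moreover have "0 < (t + 2) choose 2" by simp
  ultimately show ?thesis using h unfolding hilbert_function_def by linarith
qed

section \<open>Powers of the ideal of a point\<close>

text \<open>Only the two conditions on components that survive multiplication are recorded: an element of the
  \<open>k\<close>-th power of the ideal of a point has no components of degree below \<open>k\<close>, and its component of
  degree \<open>k\<close> is a cone with that point as vertex.\<close>

definition vanish_order :: "'k::field ^ 'n::finite \<Rightarrow> nat \<Rightarrow> ('k, 'n) mpoly \<Rightarrow> bool" where
  "vanish_order p k f \<longleftrightarrow> (\<forall>t<k. hcomp t f = 0) \<and> hcomp k f \<in> alg (lin p)"

lemma vanish_order_mult:
  assumes f: "vanish_order p k f" and g: "vanish_order p m g" shows "vanish_order p (k + m) (f * g)"
  unfolding vanish_order_def
proof (intro conjI allI impI)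
  fix t assume t: "t < k + m"
  show "hcomp t (f * g) = 0"
    unfolding hcomp_mult
  proof (rule sum.neutral, rule ballI)
    fix i assume "i \<in> {..t}"
    then have "i < k \<or> t - i < m" using t by auto
    then show "hcomp i f * hcomp (t - i) g = 0" using f g by (auto simp: vanish_order_def)
  qed
next
  have "hcomp (k + m) (f * g) = (\<Sum>i\<le>k + m. if i = k then hcomp k f * hcomp m g else 0)"
    unfolding hcomp_mult
  proof (rule sum.cong[OF refl])
    fix i assume "i \<in> {..k + m}"
    then have "i = k \<or> i < k \<or> k + m - i < m" by auto
    then show "hcomp i f * hcomp (k + m - i) g = (if i = k then hcomp k f * hcomp m g else 0)"
      using f g by (auto simp: vanish_order_def)
  qed
  then have "hcomp (k + m) (f * g) = hcomp k f * hcomp m g" by simp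
  then show "hcomp (k + m) (f * g) \<in> alg (lin p)" using f g by (auto simp: vanish_order_def intro: alg_mult)
qed

lemma vanish_order_0: "vanish_order p 0 f"
proof -
  obtain c where "hcomp 0 f = cst c" using form_zero_eq_cst is_form_hcomp by blast
  then show ?thesis by (simp add: vanish_order_def alg_cst)
qed

lemma vanish_order_ideal: "idl.subspace {f. vanish_order p k f}"
proof (rule idl.subspaceI)
  show "c * x \<in> {f. vanish_order p k f}" if "x \<in> {f. vanish_order p k f}" for c x
    using vanish_order_mult[OF vanish_order_0[of p c], of k x] that by simp
qed (auto simp: vanish_order_def hcomp_add alg_closed alg_add)

lemma vanish_order_point_ideal:
  assumes "f \<in> vanishing_ideal {P}" shows "vanish_order (rep_proj P) 1 f"
proof -
  have "{f. homogeneous f \<and> (\<forall>Q\<in>{P}. eval_poly f (rep_proj Q) = 0)} \<subseteq> {f. vanish_order (rep_proj P) 1 f}"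
  proof
    fix f assume "f \<in> {f. homogeneous f \<and> (\<forall>Q\<in>{P}. eval_poly f (rep_proj Q) = 0)}"
    then obtain u where u: "is_form u f" "eval_poly f (rep_proj P) = 0" by (auto simp: homogeneous_def)
    consider "u = 0" | "u = 1" | "2 \<le> u" by linarith
    then have "vanish_order (rep_proj P) 1 f"
    proof cases
      case 1
      then obtain c where "f = cst c" using form_zero_eq_cst u(1) by blast
      then have "f = 0" using u(2) by simp
      then show ?thesis by (simp add: vanish_order_def alg_closed)
    next
      case 2
      then have "f \<in> lin (rep_proj P)" using u by (simp add: lin_def)
      then show ?thesis using hcomp_form[OF u(1)] 2 by (simp add: vanish_order_def alg_base)
    next
      case 3
      then show ?thesis using hcomp_form[OF u(1)] by (simp add: vanish_order_def alg_closed)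
    qed
    then show "f \<in> {f. vanish_order (rep_proj P) 1 f}" by simp
  qed
  then have "vanishing_ideal {P} \<subseteq> {f. vanish_order (rep_proj P) 1 f}"
    unfolding vanishing_ideal_def by (rule idl.span_minimal[OF _ vanish_order_ideal])
  with assms show ?thesis by blast
qed

lemma ideal_power_imp_vanish_order:
  assumes "f \<in> ideal_power (vanishing_ideal {P}) d" shows "vanish_order (rep_proj P) d f"
proof -
  have prod: "vanish_order (rep_proj P) (length fs) (prod_list fs)" if "set fs \<subseteq> vanishing_ideal {P}" for fs
    using that
  proof (induction fs)
    case (Cons g fs)
    then show ?case
      using vanish_order_mult[OF vanish_order_point_ideal[of g P], of "length fs" "prod_list fs"] by simp
  qed (simp add: vanish_order_0)
  have "ideal_power (vanishing_ideal {P}) d \<subseteq> {f. vanish_order (rep_proj P) d f}"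
    unfolding ideal_power_def by (rule idl.span_minimal[OF _ vanish_order_ideal]) (use prod in auto)
  with assms show ?thesis by blast
qed

lemma prod_list_in_ideal_power: "length fs = m \<Longrightarrow> set fs \<subseteq> I \<Longrightarrow> prod_list fs \<in> ideal_power I m"
  unfolding ideal_power_def by (rule idl.span_base) blast

lemma subspace_ideal_power: "idl.subspace (ideal_power I m)"
  unfolding ideal_power_def by (rule idl.subspace_span)

lemma ideal_power_mult:
  assumes "f \<in> ideal_power I k" "g \<in> ideal_power I m" shows "f * g \<in> ideal_power I (k + m)"
  using assms(1) unfolding ideal_power_def[of I k]
proof (induction rule: idl.span_induct_alt)
  case base
  show ?case by (simp add: ideal_power_def idl.span_zero)
next
  case (step c x y)
  have "x * g \<in> ideal_power I (k + m)"
    using assms(2) unfolding ideal_power_def[of I m]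
  proof (induction rule: idl.span_induct_alt)
    case base
    show ?case by (simp add: ideal_power_def idl.span_zero)
  next
    case (step c' x' y')
    obtain fs where fs: "x = prod_list fs" "length fs = k" "set fs \<subseteq> I" using \<open>x \<in> _\<close> by blast
    obtain gs where gs: "x' = prod_list gs" "length gs = m" "set gs \<subseteq> I" using step by blast
    have "x * x' = prod_list (fs @ gs)" using fs gs by simp
    moreover have "prod_list (fs @ gs) \<in> ideal_power I (k + m)"
      by (rule prod_list_in_ideal_power) (use fs gs in auto)
    ultimately have "x * x' \<in> ideal_power I (k + m)" by simp
    then have "c' * (x * x') + x * y' \<in> ideal_power I (k + m)"
      by (rule idl.subspace_add[OF subspace_ideal_power ideal_mult_left[OF subspace_ideal_power] step(2)])
    then show ?case by (simp add: algebra_simps)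
  qed
  then have "c * (x * g) + y * g \<in> ideal_power I (k + m)"
    by (rule idl.subspace_add[OF subspace_ideal_power ideal_mult_left[OF subspace_ideal_power] step(2)])
  then show ?case by (simp add: algebra_simps)
qed

lemma alg_lin_in_ideal_power:
  assumes "f \<in> alg (lin (rep_proj P))" shows "hcomp t f \<in> ideal_power (vanishing_ideal {P}) t"
  using assms
proof (induction arbitrary: t)
  case (alg_cst c)
  have "prod_list [] \<in> ideal_power (vanishing_ideal {P}) 0" by (rule prod_list_in_ideal_power) auto
  then have "cst c * 1 \<in> ideal_power (vanishing_ideal {P}) 0"
    using ideal_mult_left[OF subspace_ideal_power] by fastforce
  then show ?case
    using idl.subspace_0[OF subspace_ideal_power] by (cases "t = 0") (auto simp: hcomp_form[OF is_form_cst])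
next
  case (alg_base l)
  then have l: "is_form 1 l" "eval_poly l (rep_proj P) = 0" by (auto simp: lin_def)
  then have "l \<in> vanishing_ideal {P}"
    unfolding vanishing_ideal_def by (intro idl.span_base) (auto simp: homogeneous_def)
  then have "l \<in> ideal_power (vanishing_ideal {P}) 1"
    using prod_list_in_ideal_power[of "[l]" 1] by simp
  then show ?case using hcomp_form[OF l(1), of t] by (auto simp: ideal_power_def idl.span_zero)
next
  case (alg_add f g)
  then show ?case unfolding hcomp_add ideal_power_def by (intro idl.span_add)
next
  case (alg_mult f g)
  have "hcomp i f * hcomp (t - i) g \<in> ideal_power (vanishing_ideal {P}) t" if "i \<in> {..t}" for i
    using ideal_power_mult[OF alg_mult.IH(1)[of i] alg_mult.IH(2)[of "t - i"]] that by simp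
  then show ?case unfolding hcomp_mult ideal_power_def by (intro idl.span_sum)
qed


section \<open>The cone over the curve\<close>

lemma mem_span2: "v \<in> vec.span {a, b :: 'k::field ^ 'n} \<longleftrightarrow> (\<exists>\<alpha> \<beta>. v = \<alpha> *s a + \<beta> *s b)"
proof -
  have "v \<in> vec.span {a, b} \<longleftrightarrow> (\<exists>\<alpha> \<beta>. v - \<alpha> *s a = \<beta> *s b)"
    by (auto simp: vec.span_breakdown_eq[of v a] vec.span_singleton)
  also have "\<dots> \<longleftrightarrow> (\<exists>\<alpha> \<beta>. v = \<alpha> *s a + \<beta> *s b)" by (metis add.commute diff_eq_eq)
  finally show ?thesis .
qed

lemma eval_alg_lin:
  assumes "f \<in> alg (lin p)" shows "eval_poly f (v + c *s p) = eval_poly f v"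
  by (rule eval_alg_cong[OF assms]) (auto simp: lin_def eval_linear_form(1,2)[unfolded One_nat_def])

context
  fixes J :: "('k::{alg_closed_field, field_char_0}, 'n::{finite,linorder}) mpoly set" and P e w x y z q
  assumes J: "curve_ideal J" and proj: "projection_from J (rep_proj P) e w x y z q"
    and off: "P \<notin> zero_locus J" and ne: "zero_locus J \<noteq> {}"
begin

lemmas pr_forms = proj_forms[OF J proj] and pr_p = proj_p[OF J proj] and pr_alg = proj_alg[OF J proj]
  and pr_fin = proj_fin[OF J proj] and pr_q = proj_q[OF J proj]

lemma cone_form_in_alg: "poly q z \<in> alg (lin (rep_proj P))"
  using proj_q_in_alg[OF J proj] pr_alg(1) by simp

lemma cone_divides: "f \<in> alg (lin (rep_proj P)) \<Longrightarrow> f \<in> J \<Longrightarrow> \<exists>h\<in>alg {x, y, z}. f = h * poly q z"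
  using proj_divides[OF J proj] pr_alg(1) by simp

lemma cone_homogeneous: "homogeneous (poly q z)"
  using pr_q(6) by (auto simp: homogeneous_def)

text \<open>An equation in the linear forms vanishing at \<open>P\<close> is constant along the lines through \<open>P\<close>, so it
  vanishes on the cone as soon as it vanishes on the curve. Conversely, the projection is finite: at a zero
  \<open>R \<noteq> P\<close> of \<open>q(z)\<close> all equations of the plane curve vanish, and a point of the curve lies over the image
  of \<open>R\<close>.\<close>

lemma cone_eq_zero_locus: "proj_cone P (zero_locus J) = zero_locus {poly q z}"
proof (intro equalityI subsetI)
  note C = curve_idealD[OF J]
  fix R assume "R \<in> proj_cone P (zero_locus J)"
  then obtain Q a b where Q: "Q \<in> zero_locus J" "rep_proj R = a *s rep_proj P + b *s rep_proj Q"
    unfolding proj_cone_def proj_line_def mem_span2 by blast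
  have "eval_poly (poly q z) (rep_proj R) = eval_poly (poly q z) (b *s rep_proj Q)"
    unfolding Q(2) add.commute[of "a *s rep_proj P"] by (rule eval_alg_lin[OF cone_form_in_alg])
  also have "\<dots> = b ^ e * eval_poly (poly q z) (rep_proj Q)" by (rule eval_form_scale[OF pr_q(6)])
  also have "\<dots> = 0" using Q(1) pr_q(5) mem_zero_locus_iff[OF C(1), of Q] by (simp add: zeros_def)
  finally show "R \<in> zero_locus {poly q z}" by (simp add: zero_locus_def)
next
  note C = curve_idealD[OF J]
  fix R assume R: "R \<in> zero_locus {poly q z}"
  then have FR: "eval_poly (poly q z) (rep_proj R) = 0" using cone_homogeneous by (simp add: zero_locus_def)
  show "R \<in> proj_cone P (zero_locus J)"
  proof (cases "R = P")
    case True
    obtain Q where "Q \<in> zero_locus J" using ne by blast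
    moreover have "rep_proj P = 1 *s rep_proj P + 0 *s rep_proj Q" by simp
    then have "P \<in> proj_line P Q" unfolding proj_line_def mem_span2 by blast
    ultimately show ?thesis using True off unfolding proj_cone_def by blast
  next
    case False
    have vanish: "eval_poly b (rep_proj R) = 0" if "b \<in> alg (lin (rep_proj P))" "b \<in> J" for b
      using cone_divides[OF that] FR by (auto simp: eval_poly_mult)
    obtain v where v: "v \<in> zeros J" "\<And>b. b \<in> alg (lin (rep_proj P)) \<Longrightarrow> eval_poly b v = eval_poly b (rep_proj R)"
      by (rule lying_over[OF C(5) pr_fin(1) vanish]) blast+
    have lv: "eval_poly l v = eval_poly l (rep_proj R)" if "is_form 1 l" "eval_poly l (rep_proj P) = 0" for l
      using v(2)[of l] that by (simp add: lin_def alg_base)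
    have "v \<noteq> 0"
    proof
      assume "v = 0"
      have "eval_poly l (rep_proj R) = 0" if "is_form 1 l" "eval_poly l (rep_proj P) = 0" for l
        using lv[OF that] \<open>v = 0\<close> eval_linear_form(4)[OF that(1)] by simp
      then obtain c where "rep_proj R = c *s rep_proj P"
        by (rule proportional_if_linear_forms_vanish[OF rep_proj_nonzero[of P]]) blast+
      then show False using False proj_eq_iff[of P R] by blast
    qed
    then obtain Q c where Q: "c \<noteq> 0" "rep_proj Q = c *s v" "Q \<in> zero_locus J"
      by (rule zeros_point[OF C(1) v(1)])
    have "eval_poly l (rep_proj R - v) = 0" if "is_form 1 l" "eval_poly l (rep_proj P) = 0" for l
      using lv[OF that] eval_linear_form(3)[OF that(1)] by simp
    then obtain a where "rep_proj R - v = a *s rep_proj P"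
      by (rule proportional_if_linear_forms_vanish[OF rep_proj_nonzero[of P]]) blast+
    moreover have "v = inverse c *s rep_proj Q" using Q(1,2) by simp
    ultimately have "rep_proj R = a *s rep_proj P + inverse c *s rep_proj Q" by (metis diff_eq_eq)
    then have "R \<in> proj_line P Q" unfolding proj_line_def mem_span2 by blast
    then show ?thesis using Q(3) off unfolding proj_cone_def by blast
  qed
qed

text \<open>A form vanishing on the cone is expanded in powers of \<open>w\<close>; restricted to a line through the
  vertex it is a polynomial in the parameter, so that its coefficients vanish on the curve.\<close>

lemma vanishing_ideal_cone: "vanishing_ideal (proj_cone P (zero_locus J)) = ideal_gen {poly q z}"
proof
  note C = curve_idealD[OF J]
  show "ideal_gen {poly q z} \<subseteq> vanishing_ideal (proj_cone P (zero_locus J))"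
    unfolding vanishing_ideal_def cone_eq_zero_locus
    by (rule idl.span_mono) (use cone_homogeneous in \<open>auto simp: zero_locus_def\<close>)
  have "f \<in> ideal_gen {poly q z}"
    if f: "homogeneous f" "\<forall>R\<in>zero_locus {poly q z}. eval_poly f (rep_proj R) = 0" for f
  proof -
    obtain t where t: "is_form t f" using f(1) by (auto simp: homogeneous_def)
    obtain R0 where R0: "R0 \<in> zero_locus {poly q z}"
    proof -
      obtain Q where "Q \<in> zero_locus J" using ne by blast
      then have "Q \<in> zero_locus {poly q z}" using pr_q(5) by (auto simp: zero_locus_def)
      then show ?thesis using that by blast
    qed
    have f0: "eval_poly f 0 = 0"
    proof (cases "t = 0")
      case True
      then obtain c where "f = cst c" using form_zero_eq_cst t by blast
      then show ?thesis using f(2) R0 by auto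
    next
      case False
      then show ?thesis using eval_form_zero[OF t] by simp
    qed
    have cone0: "eval_poly f v = 0" if v: "eval_poly (poly q z) v = 0" for v
    proof (cases "v = 0")
      case False
      obtain R c where R: "c \<noteq> 0" "rep_proj R = c *s v" by (rule exists_proj_point[OF False])
      have "eval_poly (poly q z) (rep_proj R) = 0" unfolding R(2) eval_form_scale[OF pr_q(6)] using v by simp
      then have "R \<in> zero_locus {poly q z}" by (simp add: zero_locus_def)
      then have "eval_poly f (rep_proj R) = 0" using f(2) by blast
      then show ?thesis using R(1) unfolding R(2) eval_form_scale[OF t] by simp
    qed (use f0 in simp)
    have "f \<in> alg (insert w {x, y, z})" using pr_alg(2) by simp
    then obtain u where u: "poly_over (alg {x, y, z}) u" "f = poly u w" by (rule alg_insert)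
    have uk: "coeff u k \<in> alg (lin (rep_proj P))" for k using u(1) pr_alg(1) by (simp add: poly_over_def)
    have "coeff u k \<in> J" for k
    proof (rule nullstellensatz[OF C(1,2)])
      fix v assume v: "v \<in> zeros J"
      define h where "h = map_poly (\<lambda>b. eval_poly b v) u"
      have "poly h (eval_poly w v + c) = 0" for c
      proof -
        have "eval_poly (poly q z) (v + c *s rep_proj P) = eval_poly (poly q z) v"
          by (rule eval_alg_lin[OF cone_form_in_alg])
        also have "\<dots> = 0" using v pr_q(5) by (simp add: zeros_def)
        finally have "eval_poly f (v + c *s rep_proj P) = 0" by (rule cone0)
        moreover have "map_poly (\<lambda>b. eval_poly b (v + c *s rep_proj P)) u = h"
          by (rule poly_eqI) (simp add: h_def coeff_map_poly eval_alg_lin[OF uk])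
        moreover have "eval_poly w (v + c *s rep_proj P) = eval_poly w v + c"
          using pr_p(1) by (simp add: eval_linear_form(1,2)[OF pr_forms(1)])
        ultimately show ?thesis unfolding u(2) eval_poly_poly_map by simp
      qed
      then have "poly h a = 0" for a by (metis add_diff_cancel_left' add.commute diff_add_cancel)
      then have "h = 0" using poly_all_0_iff_0 by blast
      then have "coeff h k = 0" by simp
      then show "eval_poly (coeff u k) v = 0" by (simp add: h_def coeff_map_poly)
    qed
    then have "\<exists>h. coeff u k = h * poly q z" for k using cone_divides[OF uk] by blast
    then obtain h where h: "\<And>k. coeff u k = h k * poly q z" by metis
    have "f = (\<Sum>k\<le>degree u. (h k * w ^ k) * poly q z)"
      unfolding u(2) poly_altdef[of u] by (rule sum.cong) (auto simp: h mult_ac)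
    also have "\<dots> \<in> ideal_gen {poly q z}" by (intro idl.span_sum idl.span_scale idl.span_base) simp
    finally show ?thesis .
  qed
  then show "vanishing_ideal (proj_cone P (zero_locus J)) \<subseteq> ideal_gen {poly q z}"
    unfolding vanishing_ideal_def cone_eq_zero_locus by (intro idl.span_minimal) auto
qed

text \<open>A form of degree \<open>e\<close> and multiplicity \<open>e\<close> at \<open>P\<close> is an equation of the plane curve, hence a multiple of
  \<open>q(z)\<close>, which has the same degree.\<close>

lemma graded_part_cone:
  "graded_part (J \<inter> ideal_power (vanishing_ideal {P}) e) e = mpoly.span {poly q z}"
proof (intro equalityI subsetI)
  note C = curve_idealD[OF J]
  fix f assume "f \<in> graded_part (J \<inter> ideal_power (vanishing_ideal {P}) e) e"
  then have f: "f \<in> J" "f \<in> ideal_power (vanishing_ideal {P}) e" "is_form e f" by (auto simp: graded_part_def)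
  have "f \<in> alg (lin (rep_proj P))"
    using ideal_power_imp_vanish_order[OF f(2)] hcomp_form[OF f(3), of e] by (simp add: vanish_order_def)
  then obtain h where h: "f = h * poly q z" using cone_divides f(1) by blast
  have "f = hcomp (e + 0) (poly q z * h)" using hcomp_form[OF f(3), of e] h by (simp add: mult.commute)
  also have "\<dots> = poly q z * hcomp 0 h" by (rule hcomp_mult_form[OF pr_q(6)])
  finally have eq: "f = poly q z * hcomp 0 h" .
  obtain c where "hcomp 0 h = cst c" using form_zero_eq_cst is_form_hcomp by blast
  then have "f = scale_poly c (poly q z)" using eq by (simp add: scale_poly_def mult.commute)
  then show "f \<in> mpoly.span {poly q z}" by (simp add: mpoly.span_scale mpoly.span_base)
next
  note C = curve_idealD[OF J]
  fix f assume "f \<in> mpoly.span {poly q z}"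
  then obtain c where c: "f = cst c * poly q z" by (auto simp: mpoly.span_singleton scale_poly_def)
  have form: "is_form e f" unfolding c by (rule is_form_scale[OF pr_q(6)])
  have "f \<in> alg (lin (rep_proj P))" unfolding c by (intro alg_mult alg_cst cone_form_in_alg)
  then have "f \<in> ideal_power (vanishing_ideal {P}) e"
    using alg_lin_in_ideal_power[of f P e] hcomp_form[OF form, of e] by simp
  moreover have "f \<in> J" unfolding c by (rule ideal_mult_left[OF C(5) pr_q(5)])
  ultimately show "f \<in> graded_part (J \<inter> ideal_power (vanishing_ideal {P}) e) e"
    using form by (simp add: graded_part_def)
qed

lemma dim_graded_part_cone: "mpoly.dim (graded_part (J \<inter> ideal_power (vanishing_ideal {P}) e) e) = 1"
proof -
  have "mpoly.independent {poly q z}" using pr_q(7) by simp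
  then have "mpoly.dim (mpoly.span {poly q z}) = card {poly q z}"
    by (intro mpoly.dim_span_eq_card_independent)
  then show ?thesis unfolding graded_part_cone by simp
qed

text \<open>The space in question is spanned by \<open>q(z)\<close>, while the expected dimension is at most \<open>0\<close> by the bound on
  the Hilbert function.\<close>

lemma unexpected_cone:
  assumes n: "CARD('n) = 4" and nd: "\<And>l. is_form 1 l \<Longrightarrow> l \<in> J \<Longrightarrow> l = 0"
  shows "closedin zariski (proj_cone P (zero_locus J))"
    "unexpected_hypersurface J e e P (vanishing_ideal (proj_cone P (zero_locus J)))"
    "unexpected_hypersurface J e e P S \<Longrightarrow> S = vanishing_ideal (proj_cone P (zero_locus J))"
proof -
  show "closedin zariski (proj_cone P (zero_locus J))"
    unfolding cone_eq_zero_locus by (rule closedin_zero_locus)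
  have "mpoly.dim (graded_part J e) \<le> (e + 2) choose 3"
    by (rule dim_graded_part_le[OF n proj_hf_ge[OF J proj nd]])
  then have un: "unexpected_at J e e P"
    unfolding unexpected_at_def dim_graded_part_cone by (simp add: n Let_def)
  show "unexpected_hypersurface J e e P (vanishing_ideal (proj_cone P (zero_locus J)))"
    unfolding unexpected_hypersurface_def graded_part_cone vanishing_ideal_cone
    using un pr_q(7) by (auto intro!: bexI[of _ "poly q z"] mpoly.span_base)
  assume "unexpected_hypersurface J e e P S"
  then obtain G where G: "G \<in> mpoly.span {poly q z}" "G \<noteq> 0" "S = ideal_gen {G}"
    unfolding unexpected_hypersurface_def graded_part_cone by blast
  then obtain c where c: "G = cst c * poly q z" by (auto simp: mpoly.span_singleton scale_poly_def)
  then have c0: "c \<noteq> 0" using G(2) by auto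
  have "G \<in> ideal_gen {poly q z}" unfolding c by (intro idl.span_scale idl.span_base) simp
  moreover have "cst (inverse c) * G \<in> ideal_gen {G}" by (intro idl.span_scale idl.span_base) simp
  then have "poly q z \<in> ideal_gen {G}" unfolding c cst_inverse[OF c0] .
  ultimately have "ideal_gen {G} = ideal_gen {poly q z}" by (simp add: idl.span_eq)
  then show "S = vanishing_ideal (proj_cone P (zero_locus J))" using G(3) vanishing_ideal_cone by simp
qed

end

section \<open>Points over given values of the parameters\<close>

lemma form_nonzero_off_zeros:
  assumes J: "hideal J" and p: "p \<notin> zeros J"
  obtains g k where "g \<in> J" "is_form k g" "eval_poly g p \<noteq> 0"
proof -
  obtain f where f: "f \<in> J" "eval_poly f p \<noteq> 0" using p unfolding zeros_def by blast
  obtain N where N: "f = (\<Sum>t<N. hcomp t f)" by (rule sum_hcomp) blast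
  have "eval_poly f p = (\<Sum>t<N. eval_poly (hcomp t f) p)" by (subst N) (rule eval_poly_sum)
  then obtain t where t: "eval_poly (hcomp t f) p \<noteq> 0" using f(2) by (metis sum.neutral)
  have "hcomp t f \<in> J" using J f(1) unfolding hideal_def by blast
  then show ?thesis using t by (rule that[OF _ is_form_hcomp])
qed

text \<open>The two parameters are independent on the curve, so that they take all pairs of values.\<close>

lemma curve_point_over:
  fixes J :: "('k::{alg_closed_field, field_char_0}, 'n::{finite,linorder}) mpoly set"
  assumes J: "curve_ideal J" and xy: "coords {x, y}" "x \<noteq> y" "finite_over {x, y} J"
  obtains v where "v \<in> zeros J" "eval_poly x v = a" "eval_poly y v = b"
proof -
  have fx: "is_form 1 x" and fy: "is_form 1 y" using coords_form[OF xy(1)] by auto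
  obtain v1 where v1: "eval_poly x v1 = 1" "eval_poly y v1 = 0" using coords_dual[OF xy(1), of x] xy(2) by auto
  obtain v2 where v2: "eval_poly y v2 = 1" "eval_poly x v2 = 0" using coords_dual[OF xy(1), of y] xy(2) by auto
  define v0 where "v0 = a *s v1 + b *s v2"
  have ev: "eval_poly x v0 = a" "eval_poly y v0 = b"
    by (simp_all add: v0_def eval_linear_form[OF fx] eval_linear_form[OF fy] v1 v2)
  have van: "eval_poly f v0 = 0" if "f \<in> alg {x, y}" "f \<in> J" for f
  proof -
    have "f \<in> {0}" unfolding curve_alg_Int[OF J fx fy xy(3), symmetric] using that by (rule IntI)
    then show ?thesis by simp
  qed
  obtain v where v: "v \<in> zeros J" "\<And>f. f \<in> alg {x, y} \<Longrightarrow> eval_poly f v = eval_poly f v0"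
    by (rule lying_over[OF curve_idealD(5)[OF J] coords_module_finite[OF xy(1) curve_idealD(1)[OF J] xy(3)] van]) blast+
  show ?thesis by (rule that[OF v(1)]) (auto simp: v(2)[OF alg.alg_base] ev)
qed

section \<open>Curves of degree one and two\<close>

text \<open>Forms that annihilate each other modulo a radical ideal live on different parts of the zero
  set, so their multiples are independent: multiplying a relation \<open>\<Sum> g\<^sub>i h\<^sub>i \<in> C\<close> by \<open>g\<^sub>i h\<^sub>i\<close> leaves
  only \<open>(g\<^sub>i h\<^sub>i)\<^sup>2\<close>. The Hilbert function therefore decomposes over such a family, and the number
  of components of a curve is bounded by its degree.\<close>
lemma sum_hf_colon_le:
  fixes C :: "('k::field, 'n::finite) mpoly set"
  assumes C: "hideal C" "radical_ideal C" and I: "finite I"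
    and g: "\<And>i. i \<in> I \<Longrightarrow> is_form (a i) (g i)" "\<And>i j. i \<in> I \<Longrightarrow> j \<in> I \<Longrightarrow> i \<noteq> j \<Longrightarrow> g i * g j \<in> C"
    and t: "\<And>i. i \<in> I \<Longrightarrow> a i + m i = t"
  shows "(\<Sum>i\<in>I. hf (colon C (g i)) (m i)) \<le> hf C t"
proof -
  have sub: "idl.subspace C" using C(1) unfolding hideal_def by blast
  have "\<forall>i\<in>I. \<exists>T. finite T \<and> (\<forall>s\<in>T. is_form (m i) s) \<and> card T = hf (colon C (g i)) (m i) \<and>
      (\<forall>c. (\<Sum>s\<in>T. cst (c s) * s) \<in> colon C (g i) \<longrightarrow> (\<forall>s\<in>T. c s = 0))"
  proof
    fix i assume "i \<in> I"
    then have "idl.subspace (colon C (g i))" using hideal_colon[OF C(1) g(1)] unfolding hideal_def by blast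
    then obtain T where "finite T" "\<And>s. s \<in> T \<Longrightarrow> is_form (m i) s" "card T = hf (colon C (g i)) (m i)"
      "\<And>c. (\<Sum>s\<in>T. cst (c s) * s) \<in> colon C (g i) \<Longrightarrow> \<forall>s\<in>T. c s = 0"
      by (rule hf_basis[where t = "m i"]) blast
    then show "\<exists>T. finite T \<and> (\<forall>s\<in>T. is_form (m i) s) \<and> card T = hf (colon C (g i)) (m i) \<and>
      (\<forall>c. (\<Sum>s\<in>T. cst (c s) * s) \<in> colon C (g i) \<longrightarrow> (\<forall>s\<in>T. c s = 0))"
      by blast
  qed
  from bchoice[OF this] obtain T where T0: "\<forall>i\<in>I. finite (T i) \<and> (\<forall>s\<in>T i. is_form (m i) s) \<and>
      card (T i) = hf (colon C (g i)) (m i) \<and>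
      (\<forall>c. (\<Sum>s\<in>T i. cst (c s) * s) \<in> colon C (g i) \<longrightarrow> (\<forall>s\<in>T i. c s = 0))" ..
  have T1: "finite (T i)" and T2: "\<And>s. s \<in> T i \<Longrightarrow> is_form (m i) s" and T3: "card (T i) = hf (colon C (g i)) (m i)"
    and T4: "\<And>c. (\<Sum>s\<in>T i. cst (c s) * s) \<in> colon C (g i) \<Longrightarrow> \<forall>s\<in>T i. c s = 0" if "i \<in> I" for i
    using bspec[OF T0 that] by blast+
  have "card (Sigma I T) \<le> hf C t"
  proof (rule hf_ge[OF sub, where u = "\<lambda>(i, s). g i * s"])
    show "finite (Sigma I T)" using I T1 by blast
    show "is_form t (case p of (i, s) \<Rightarrow> g i * s)" if p: "p \<in> Sigma I T" for p
    proof -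
      obtain i s where "p = (i, s)" "i \<in> I" "s \<in> T i" using p by blast
      then show ?thesis using is_form_mult[OF g(1)[of i] T2[of i s]] t[of i] by simp
    qed
    fix c assume rel: "(\<Sum>p\<in>Sigma I T. cst (c p) * (case p of (i, s) \<Rightarrow> g i * s)) \<in> C"
    define h where "h i = (\<Sum>s\<in>T i. cst (c (i, s)) * s)" for i
    have "(\<Sum>p\<in>Sigma I T. cst (c p) * (case p of (i, s) \<Rightarrow> g i * s))
        = (\<Sum>(i, s)\<in>Sigma I T. cst (c (i, s)) * (g i * s))"
      by (rule sum.cong) auto
    also have "\<dots> = (\<Sum>i\<in>I. \<Sum>s\<in>T i. cst (c (i, s)) * (g i * s))"
      by (rule sum.Sigma[symmetric]) (use I T1 in auto)
    also have "\<dots> = (\<Sum>i\<in>I. g i * h i)"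
      by (simp add: h_def sum_distrib_left mult.left_commute)
    finally have S: "(\<Sum>i\<in>I. g i * h i) \<in> C" using rel by simp
    have "h i \<in> colon C (g i)" if i: "i \<in> I" for i
    proof -
      have "(\<Sum>j\<in>I. g j * h j) = g i * h i + (\<Sum>j\<in>I - {i}. g j * h j)" by (rule sum.remove[OF I i])
      then have "(g i * h i) ^ 2 = g i * h i * (\<Sum>j\<in>I. g j * h j) - g i * h i * (\<Sum>j\<in>I - {i}. g j * h j)"
        by (simp add: power2_eq_square algebra_simps)
      moreover have "g i * h i * (\<Sum>j\<in>I. g j * h j) \<in> C" by (rule ideal_mult_left[OF sub S])
      moreover have "g i * h i * (\<Sum>j\<in>I - {i}. g j * h j) \<in> C"
        unfolding sum_distrib_left
      proof (rule idl.subspace_sum[OF sub])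
        fix j assume "j \<in> I - {i}"
        then have "i \<noteq> j" "j \<in> I" by auto
        then have "(h i * h j) * (g i * g j) \<in> C" using i by (intro ideal_mult_left[OF sub g(2)])
        then show "g i * h i * (g j * h j) \<in> C" by (simp add: mult_ac)
      qed
      ultimately have "(g i * h i) ^ 2 \<in> C" using idl.subspace_diff[OF sub] by simp
      then show ?thesis using C(2) unfolding radical_ideal_def colon_def by blast
    qed
    then have "\<forall>s\<in>T i. c (i, s) = 0" if "i \<in> I" for i
      using T4[OF that, of "\<lambda>s. c (i, s)"] that unfolding h_def by blast
    then show "\<forall>p\<in>Sigma I T. c p = 0" by blast
  qed
  then show ?thesis using I T1 T3 by simp
qed

text \<open>A curve of degree one is a line. Projecting from a point off the curve gives a linear form
  in the ideal; a second centre, off the plane found first, gives an independent one. The curve lies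
  on the line cut out by both, and it covers that line since the two parameters take all values.\<close>
lemma line_if_hf_le:
  fixes J :: "('k::{alg_closed_field, field_char_0}, 'n::{finite,linorder}) mpoly set"
  assumes J: "curve_ideal J" and n: "CARD('n) = 4" and h: "\<And>t. hf J (t + a) \<le> t + K"
  obtains u v where "zeros J = {b *s u + c *s v | b c. True}" "\<And>b c. b *s u + c *s v = 0 \<Longrightarrow> b = 0 \<and> c = 0"
proof -
  note C = curve_idealD[OF J]
  have h': "hf J t \<le> 1 * t + (K + (\<Sum>i<a. hf J i))" for t
  proof (cases "a \<le> t")
    case True
    then show ?thesis using h[of "t - a"] by simp
  next
    case False
    then have "hf J t \<le> (\<Sum>i<a. hf J i)" by (intro member_le_sum) auto
    then show ?thesis by simp
  qed
  have linear: "\<exists>F. F \<in> J \<and> is_form 1 F \<and> F \<noteq> 0 \<and> eval_poly F p = 0"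
    if p: "p \<noteq> 0" "g \<in> J" "is_form k g" "eval_poly g p \<noteq> 0" for p g k
  proof -
    obtain e w x y z q where pr: "projection_from J p e w x y z q"
      by (rule projection_exists[OF J n p]) blast
    have "e \<le> 1" by (rule proj_degree_le[OF J pr h'])
    then have e: "e = 1" using proj_q(1)[OF J pr] by simp
    have F: "is_form 1 (poly q z)" using proj_q(6)[OF J pr] e by simp
    have "eval_poly s p = eval_poly s 0" if "s \<in> {x, y, z}" for s
      using that proj_p[OF J pr] eval_form_zero[of 1 s] proj_forms[OF J pr] by auto
    then have "eval_poly (poly q z) p = eval_poly (poly q z) 0"
      by (rule eval_alg_cong[OF proj_q_in_alg[OF J pr]])
    then show ?thesis using F proj_q(5,7)[OF J pr] eval_form_zero[OF F] by auto
  qed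
  obtain x y where xy: "x \<noteq> y" "coords {x, y}" "is_form 1 x" "is_form 1 y" "finite_over {x, y} J"
    by (rule curve_parameters[OF J coords_vars finite_over_vars]) blast
  have "card {x, y} < CARD('n)" using n card_insert_le_m1[of 2 "{y}" x] by simp
  moreover have "is_form 1 s" if "s \<in> {x, y}" for s using that xy(3,4) by auto
  ultimately obtain p where p: "p \<noteq> 0" "\<And>s. s \<in> {x, y} \<Longrightarrow> eval_poly s p = 0"
    using common_zero_of_few_forms[of "{x, y}"] by (metis finite.emptyI finite.insertI)
  have "p \<notin> zeros J" using finite_over_coord_nonzero[OF xy(5) _ p(2)] p(1) by blast
  then obtain g k where "g \<in> J" "is_form k g" "eval_poly g p \<noteq> 0" by (rule form_nonzero_off_zeros[OF C(1)])
  then obtain F where F: "F \<in> J" "is_form 1 F" "F \<noteq> 0" using linear[OF p(1)] by blast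
  obtain p' where p': "eval_poly F p' \<noteq> 0" by (rule exists_nonzero_value[OF F(3)])
  then have "p' \<noteq> 0" using eval_form_zero[OF F(2)] by auto
  then obtain G where G: "G \<in> J" "is_form 1 G" "G \<noteq> 0" "eval_poly G p' = 0"
    using linear[OF _ F(1,2) p'] by blast
  obtain r' where r': "eval_poly G r' \<noteq> 0" by (rule exists_nonzero_value[OF G(3)])
  define r where "r = r' + (- (eval_poly F r' / eval_poly F p')) *s p'"
  have r: "eval_poly F r = 0" "eval_poly G r \<noteq> 0"
    using r' p' by (simp_all add: r_def eval_linear_form[OF F(2)] eval_linear_form[OF G(2)] G(4))
  obtain u where u: "u \<in> zeros J" "eval_poly x u = 1" "eval_poly y u = 0"
    by (rule curve_point_over[OF J xy(2,1,5), of 1 0])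
  obtain v where v: "v \<in> zeros J" "eval_poly x v = 0" "eval_poly y v = 1"
    by (rule curve_point_over[OF J xy(2,1,5), of 0 1])
  note lin_eval = eval_linear_form[OF xy(3)] eval_linear_form[OF xy(4)] eval_linear_form[OF F(2)] eval_linear_form[OF G(2)]
  have ind: "b = 0 \<and> c = 0" if e: "b *s u + c *s v = 0" for b c
  proof -
    have "eval_poly x (b *s u + c *s v) = 0" "eval_poly y (b *s u + c *s v) = 0"
      unfolding e using eval_form_zero[OF xy(3)] eval_form_zero[OF xy(4)] by simp_all
    then show ?thesis by (simp add: lin_eval u v)
  qed
  have span: "w = eval_poly x w *s u + eval_poly y w *s v" if w: "w \<in> zeros J" for w
  proof -
    define d where "d = w + (- eval_poly x w) *s u + (- eval_poly y w) *s v"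
    have van: "eval_poly F s = 0" "eval_poly G s = 0" if "s \<in> zeros J" for s
      using that F(1) G(1) unfolding zeros_def by auto
    have d: "eval_poly x d = 0" "eval_poly y d = 0" "eval_poly F d = 0" "eval_poly G d = 0"
      by (simp_all add: d_def lin_eval u(2,3) v(2,3) van[OF u(1)] van[OF v(1)] van[OF w])
    let ?c = "\<lambda>i j. ([u, v, p', r, d] ! j) $ i"
    have "\<exists>b :: nat \<Rightarrow> 'k. (\<forall>j\<in>{..<5}. b j \<in> UNIV) \<and> (\<exists>j\<in>{..<5}. b j \<noteq> 0) \<and>
        (\<forall>i\<in>UNIV. (\<Sum>j<5. ?c i j * b j) = 0)"
      by (rule homogeneous_system_solvable) (auto simp: n subring_set_def)
    then obtain b :: "nat \<Rightarrow> 'k" where b: "\<exists>j<5. b j \<noteq> 0" "\<And>i. (\<Sum>j<5. ?c i j * b j) = 0" by auto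
    have rel: "b 0 *s u + b 1 *s v + b 2 *s p' + b 3 *s r + b 4 *s d = 0"
      using b(2) by (simp add: vec_eq_iff eval_nat_numeral algebra_simps)
    have at0: "eval_poly f (b 0 *s u + b 1 *s v + b 2 *s p' + b 3 *s r + b 4 *s d) = 0" if "is_form 1 f" for f
      unfolding rel using eval_form_zero[OF that] by simp
    have b2: "b 2 = 0" using at0[OF F(2)] p' by (simp add: lin_eval d r van[OF u(1)] van[OF v(1)])
    have b3: "b 3 = 0" using at0[OF G(2)] r b2 by (simp add: lin_eval d van[OF u(1)] van[OF v(1)])
    have b0: "b 0 = 0" using at0[OF xy(3)] b2 b3 by (simp add: lin_eval d u v)
    have b1: "b 1 = 0" using at0[OF xy(4)] b2 b3 by (simp add: lin_eval d u v)
    have "b 4 *s d = 0" using rel b0 b1 b2 b3 by simp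
    moreover have "b 4 \<noteq> 0" using b(1) b0 b1 b2 b3 by (auto simp: eval_nat_numeral less_Suc_eq)
    ultimately have "d = 0" by (simp add: vector_mul_eq_0)
    then show ?thesis by (simp add: d_def vec_eq_iff algebra_simps)
  qed
  have z: "zeros J = {b *s u + c *s v | b c. True}"
  proof (intro equalityI subsetI)
    fix w assume "w \<in> zeros J"
    then show "w \<in> {b *s u + c *s v | b c. True}" using span by blast
  next
    fix w assume "w \<in> {b *s u + c *s v | b c. True}"
    then obtain b c where w: "w = b *s u + c *s v" by blast
    obtain w' where "w' \<in> zeros J" "eval_poly x w' = b" "eval_poly y w' = c"
      by (rule curve_point_over[OF J xy(2,1,5)])
    then show "w \<in> zeros J" using span[of w'] w by simp
  qed
  show ?thesis by (rule that[OF z ind])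
qed

lemma is_line_if_zeros:
  fixes J :: "('k::field, 'n::finite) mpoly set"
  assumes J: "hideal J" and z: "zeros J = {b *s u + c *s v | b c. True}"
    and ind: "\<And>b c. b *s u + c *s v = 0 \<Longrightarrow> b = 0 \<and> c = 0"
  shows "is_line (zero_locus J)"
proof -
  have "u \<noteq> 0" using ind[of 1 0] by auto
  then obtain P c where P: "c \<noteq> 0" "rep_proj P = c *s u" by (rule exists_proj_point)
  have "v \<noteq> 0" using ind[of 0 1] by auto
  then obtain Q c' where Q: "c' \<noteq> 0" "rep_proj Q = c' *s v" by (rule exists_proj_point)
  have "P \<noteq> Q"
  proof
    assume "P = Q"
    then have "c *s u + (- c') *s v = 0" using P(2) Q(2) by simp
    then show False using ind P(1) by blast
  qed
  moreover have "zero_locus J = proj_line P Q"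
  proof (rule set_eqI)
    fix R
    have "rep_proj R \<in> zeros J \<longleftrightarrow> (\<exists>b d. rep_proj R = b *s u + d *s v)" unfolding z by blast
    also have "\<dots> \<longleftrightarrow> (\<exists>b d. rep_proj R = b *s (c *s u) + d *s (c' *s v))"
    proof
      assume "\<exists>b d. rep_proj R = b *s u + d *s v"
      then obtain b d where "rep_proj R = b *s u + d *s v" by blast
      then have "rep_proj R = (b / c) *s (c *s u) + (d / c') *s (c' *s v)" using P(1) Q(1) by simp
      then show "\<exists>b d. rep_proj R = b *s (c *s u) + d *s (c' *s v)" by blast
    qed (metis vector_smult_assoc)
    also have "\<dots> \<longleftrightarrow> rep_proj R \<in> vec.span {rep_proj P, rep_proj Q}"
      unfolding P(2) Q(2) mem_span2 ..
    finally show "R \<in> zero_locus J \<longleftrightarrow> R \<in> proj_line P Q"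
      using mem_zero_locus_iff[OF J] by (simp add: proj_line_def)
  qed
  ultimately show ?thesis unfolding is_line_def by blast
qed

text \<open>The plane through three points of a curve of degree two meets it in too many points to be
  transversal, so its equation \<open>l\<close> is a zero divisor: \<open>l s\<close> vanishes on the curve for some form
  \<open>s\<close> that does not.\<close>
lemma degree_two_zero_divisor:
  fixes J :: "('k::{alg_closed_field, field_char_0}, 'n::{finite,linorder}) mpoly set"
  assumes J: "curve_ideal J" and d: "has_degree J 2" and n: "CARD('n) = 4"
  obtains l s j where "is_form 1 l" "l \<noteq> 0" "is_form j s" "s \<notin> J" "s * l \<in> J"
proof -
  note C = curve_idealD[OF J]
  obtain x y where xy: "x \<noteq> y" "coords {x, y}" "is_form 1 x" "is_form 1 y" "finite_over {x, y} J"
    by (rule curve_parameters[OF J coords_vars finite_over_vars]) blast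
  obtain v0 where v0: "v0 \<in> zeros J" "eval_poly x v0 = 1" "eval_poly y v0 = 0"
    by (rule curve_point_over[OF J xy(2,1,5), of 1 0])
  obtain v1 where v1: "v1 \<in> zeros J" "eval_poly x v1 = 0" "eval_poly y v1 = 1"
    by (rule curve_point_over[OF J xy(2,1,5), of 0 1])
  obtain v2 where v2: "v2 \<in> zeros J" "eval_poly x v2 = 1" "eval_poly y v2 = 1"
    by (rule curve_point_over[OF J xy(2,1,5), of 1 1])
  have "card {v0, v1, v2} \<le> 3" by (rule card_insert_le_m1) (auto intro: card_insert_le_m1)
  then have "card {v0, v1, v2} < CARD('n)" using n by simp
  then obtain l where l: "is_form 1 l" "l \<noteq> 0" "\<And>v. v \<in> {v0, v1, v2} \<Longrightarrow> eval_poly l v = 0"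
    using linear_form_through_points[of "{v0, v1, v2}"] by blast
  have "\<exists>f. l * f \<in> J \<and> f \<notin> J"
  proof (rule ccontr)
    assume "\<not> (\<exists>f. l * f \<in> J \<and> f \<notin> J)"
    then have nzd: "\<And>f. l * f \<in> J \<Longrightarrow> f \<in> J" by blast
    obtain N where N: "\<And>t. N \<le> t \<Longrightarrow> hf (idl.span (insert l J)) (Suc t) = 2"
      by (rule plane_section_hf[OF J d l(1) nzd]) blast+
    have van: "eval_poly f v = 0" if f: "f \<in> idl.span (insert l J)" and v: "v \<in> {v0, v1, v2}" for f v
    proof -
      obtain k where "f - k * l \<in> idl.span J" using f unfolding idl.span_breakdown_eq[of f l] by blast
      then have "f - k * l \<in> J" using C(5) by (simp add: idl.span_eq_iff[THEN iffD2])
      moreover have "v \<in> zeros J" using v v0 v1 v2 by auto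
      ultimately have "eval_poly (f - k * l) v = 0" unfolding zeros_def by blast
      then show ?thesis using l(3)[OF v] by (simp add: eval_poly_simps)
    qed
    define u where "u i = (if i = 0 then x ^ Suc N * (x - y) else if i = 1 then y ^ Suc N * (y - x) else y ^ Suc N * x)"
      for i :: nat
    have "card {0, 1, 2 :: nat} \<le> hf (idl.span (insert l J)) (Suc (Suc N))"
    proof (rule hf_ge[where u = u])
      fix i
      have "is_form (Suc N + 1) (x ^ Suc N * (x - y))" "is_form (Suc N + 1) (y ^ Suc N * (y - x))"
        "is_form (Suc N + 1) (y ^ Suc N * x)"
        by (rule is_form_mult[OF is_form_power1 is_form_diff]; rule xy; fail) (rule is_form_mult[OF is_form_power1 is_form_diff]; rule xy; fail | rule is_form_mult[OF is_form_power1]; rule xy; fail)+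
      then show "is_form (Suc (Suc N)) (u i)" by (simp add: u_def)
    next
      fix c assume "(\<Sum>i\<in>{0, 1, 2}. cst (c i) * u i) \<in> idl.span (insert l J)"
      then have "eval_poly (\<Sum>i\<in>{0, 1, 2}. cst (c i) * u i) v = 0" if "v \<in> {v0, v1, v2}" for v
        using van that by blast
      from this[of v0] this[of v1] this[of v2] show "\<forall>i\<in>{0, 1, 2}. c i = 0"
        by (simp add: u_def eval_poly_simps eval_poly_power v0 v1 v2)
    qed simp_all
    then show False using N[of "Suc N"] by simp
  qed
  then obtain f where f: "l * f \<in> J" "f \<notin> J" by blast
  obtain j where j: "hcomp j f \<notin> J" by (rule lowest_component[OF C(1) f(2)])
  have "hcomp j f \<in> colon J l"
    using hideal_colon[OF C(1) l(1)] f(1) unfolding hideal_def colon_def by blast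
  then have "hcomp j f * l \<in> J" by (simp add: colon_def mult.commute)
  then show ?thesis using that[OF l(1,2) is_form_hcomp j] by blast
qed

text \<open>With \<open>l s\<close> vanishing on the curve, the ideals of the parts where \<open>s\<close> and \<open>l\<close> do not vanish
  identically have degrees adding up to at most two, so both parts are lines. A point on neither
  line would give a third part. Two meeting lines span a plane.\<close>
lemma degree_two_curve:
  fixes J :: "('k::{alg_closed_field, field_char_0}, 'n::{finite,linorder}) mpoly set"
  assumes J: "curve_ideal J" and d: "has_degree J 2" and n: "CARD('n) = 4"
    and nd: "\<And>l. is_form 1 l \<Longrightarrow> l \<in> J \<Longrightarrow> l = 0"
  shows "\<exists>L M. is_line L \<and> is_line M \<and> L \<inter> M = {} \<and> zero_locus J = L \<union> M"
proof -
  note C = curve_idealD[OF J]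
  obtain l s j where l: "is_form 1 l" "l \<noteq> 0" and s: "is_form j s" "s \<notin> J" and sl: "s * l \<in> J"
    by (rule degree_two_zero_divisor[OF J d n])
  have lJ: "l \<notin> J" using nd l by blast
  note J1 = curve_ideal_colon[OF J s] and J2 = curve_ideal_colon[OF J l(1) lJ]
  obtain K where K: "\<And>t. hf J t \<le> 2 * t + K" by (rule curve_hf_linear[OF J d]) blast
  have two: "hf (colon J s) (t + 1) + hf (colon J l) (t + j) \<le> 2 * (t + j + 1) + K" for t
  proof -
    have "(\<Sum>i\<in>{0, 1 :: nat}. hf (colon J ((if i = 0 then s else l))) (if i = 0 then t + 1 else t + j)) \<le> hf J (t + j + 1)"
      by (rule sum_hf_colon_le[OF C(1,2), where a = "\<lambda>i. if i = 0 then j else 1"])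
        (use l s sl in \<open>auto simp: mult.commute\<close>)
    then show ?thesis using K[of "t + j + 1"] by simp
  qed
  have h1: "hf (colon J s) (t + 1) \<le> t + (j + 1 + K)" for t
    using two[of t] curve_hf_ge[OF J2, of "t + j"] by simp
  have h2: "hf (colon J l) (t + j) \<le> t + (2 * j + K)" for t
    using two[of t] curve_hf_ge[OF J1, of "t + 1"] by simp
  obtain u v where uv: "zeros (colon J s) = {b *s u + c *s v | b c. True}" "\<And>b c. b *s u + c *s v = 0 \<Longrightarrow> b = 0 \<and> c = 0"
    by (rule line_if_hf_le[OF J1 n h1]) blast
  obtain u' v' where uv': "zeros (colon J l) = {b *s u' + c *s v' | b c. True}" "\<And>b c. b *s u' + c *s v' = 0 \<Longrightarrow> b = 0 \<and> c = 0"
    by (rule line_if_hf_le[OF J2 n h2]) blast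
  have sub: "zeros (colon J f) \<subseteq> zeros J" for f
    using ideal_mult_left[OF C(5)] unfolding zeros_def colon_def by blast
  have "zeros J \<subseteq> zeros (colon J s) \<union> zeros (colon J l)"
  proof
    fix w assume w: "w \<in> zeros J"
    show "w \<in> zeros (colon J s) \<union> zeros (colon J l)"
    proof (rule ccontr)
      assume not: "w \<notin> zeros (colon J s) \<union> zeros (colon J l)"
      obtain f a where f: "f \<in> colon J s" "is_form a f" "eval_poly f w \<noteq> 0"
        by (rule form_nonzero_off_zeros[OF curve_idealD(1)[OF J1], of w]) (use not in auto)
      obtain g b where g: "g \<in> colon J l" "is_form b g" "eval_poly g w \<noteq> 0"
        by (rule form_nonzero_off_zeros[OF curve_idealD(1)[OF J2], of w]) (use not in auto)
      have fg: "is_form (a + b) (f * g)" by (rule is_form_mult[OF f(2) g(2)])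
      have fgJ: "f * g \<notin> J" using w f(3) g(3) unfolding zeros_def by (auto simp: eval_poly_mult)
      have "g * (s * f) \<in> J" "f * (l * g) \<in> J"
        using f(1) g(1) ideal_mult_left[OF C(5)] unfolding colon_def by auto
      then have sfg: "s * (f * g) \<in> J" "l * (f * g) \<in> J" by (simp_all add: mult_ac)
      define t where "t = K + j + a + b + 1"
      have "(\<Sum>i\<in>{0, 1, 2 :: nat}. hf (colon J (if i = 0 then s else if i = 1 then l else f * g))
          (if i = 0 then t - j else if i = 1 then t - 1 else t - (a + b))) \<le> hf J t"
        by (rule sum_hf_colon_le[OF C(1,2), where a = "\<lambda>i. if i = 0 then j else if i = 1 then 1 else a + b"])
          (use l s sl fg sfg in \<open>auto simp: mult.commute t_def\<close>)
      then have "hf (colon J s) (t - j) + hf (colon J l) (t - 1) + hf (colon J (f * g)) (t - (a + b)) \<le> 2 * t + K"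
        using K[of t] by simp
      then show False
        using curve_hf_ge[OF J1, of "t - j"] curve_hf_ge[OF J2, of "t - 1"]
          curve_hf_ge[OF curve_ideal_colon[OF J fg fgJ], of "t - (a + b)"] by (simp add: t_def)
    qed
  qed
  then have zJ: "zeros J = zeros (colon J s) \<union> zeros (colon J l)" using sub by blast
  have disj: "zero_locus (colon J s) \<inter> zero_locus (colon J l) = {}"
  proof (rule ccontr)
    assume "\<not> ?thesis"
    then obtain P where P: "P \<in> zero_locus (colon J s)" "P \<in> zero_locus (colon J l)" by blast
    obtain b c where bc: "rep_proj P = b *s u + c *s v"
      using P(1) unfolding mem_zero_locus_iff[OF curve_idealD(1)[OF J1]] uv by blast
    obtain b' c' where bc': "rep_proj P = b' *s u' + c' *s v'"
      using P(2) unfolding mem_zero_locus_iff[OF curve_idealD(1)[OF J2]] uv' by blast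
    \<comment> \<open>Of the two spanning vectors of the second line, the common point recovers one from the other.\<close>
    define q where "q = (if b' = 0 then u' else v')"
    have "card {u, v, q} \<le> 3" by (rule card_insert_le_m1) (auto intro: card_insert_le_m1)
    then have "card {u, v, q} < CARD('n)" using n by simp
    then obtain k where k: "is_form 1 k" "k \<noteq> 0" "\<And>w. w \<in> {u, v, q} \<Longrightarrow> eval_poly k w = 0"
      using linear_form_through_points[of "{u, v, q}"] by blast
    have kuv: "eval_poly k u = 0" "eval_poly k v = 0" "eval_poly k q = 0" using k(3) by auto
    have "eval_poly k (b *s u + c *s v) = 0" using kuv by (simp add: eval_linear_form[OF k(1)])
    then have rel: "b' * eval_poly k u' + c' * eval_poly k v' = 0"
      unfolding bc[symmetric] bc' by (simp add: eval_linear_form[OF k(1)])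
    have "b' \<noteq> 0 \<or> c' \<noteq> 0" using bc' rep_proj_nonzero[of P] by auto
    then have "eval_poly k u' = 0" "eval_poly k v' = 0"
      using rel kuv(3) by (auto simp: q_def split: if_splits)
    then have "eval_poly k w = 0" if "w \<in> zeros J" for w
      using that kuv unfolding zJ uv(1) uv'(1) by (auto simp: eval_linear_form[OF k(1)])
    then have "k \<in> J" by (rule nullstellensatz[OF C(1,2)])
    then show False using nd k(1,2) by blast
  qed
  have "zero_locus J = zero_locus (colon J s) \<union> zero_locus (colon J l)"
    using zJ unfolding set_eq_iff Un_iff mem_zero_locus_iff[OF C(1)]
      mem_zero_locus_iff[OF curve_idealD(1)[OF J1]] mem_zero_locus_iff[OF curve_idealD(1)[OF J2]] by blast
  then show ?thesis
    using disj is_line_if_zeros[OF curve_idealD(1)[OF J1] uv] is_line_if_zeros[OF curve_idealD(1)[OF J2] uv'] by blast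
qed

section \<open>Cones over a curve with a general vertex\<close>

lemma general_centre_scale:
  assumes c: "c \<noteq> 0" and g: "general_centre J d (c *s p)" shows "general_centre J d p"
proof -
  have "eval_poly f p \<noteq> 0" if "is_form n f" "eval_poly f (c *s p) \<noteq> 0" for f n
    using eval_form_scale[OF that(1), of c p] that(2) by auto
  then show ?thesis using g unfolding general_centre_def lin_scale[OF c] by blast
qed

text \<open>The generic condition on the centre is the non-vanishing of a polynomial on affine space. One
  of its homogeneous components does not vanish identically, and where that component does not vanish
  on a line through the origin, the polynomial does not vanish at some point of that line.\<close>
lemma general_centre_on_open_set:
  fixes J :: "('k::{alg_closed_field, field_char_0}, 'n::{finite,linorder}) mpoly set"
  assumes J: "curve_ideal J" and d: "has_degree J d" "0 < d" and n: "CARD('n) = 4"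
  obtains U where "openin zariski U" "U \<noteq> {}" "\<And>P. P \<in> U \<Longrightarrow> general_centre J d (rep_proj P)"
proof -
  obtain D p where D: "eval_poly D p \<noteq> 0" "\<And>p. eval_poly D p \<noteq> 0 \<Longrightarrow> p \<noteq> 0 \<and> general_centre J d p"
    by (rule general_centre_exists_open[OF J d n]) blast
  obtain N where N: "D = (\<Sum>t<N. hcomp t D)" by (rule sum_hcomp) blast
  have "eval_poly D p = (\<Sum>t<N. eval_poly (hcomp t D) p)" by (subst N) (rule eval_poly_sum)
  then obtain t where t: "eval_poly (hcomp t D) p \<noteq> 0" using D(1) by (metis sum.neutral)
  have hom: "homogeneous (hcomp t D)" unfolding homogeneous_def using is_form_hcomp by blast
  have "p \<noteq> 0" using D by blast
  then obtain P c where P: "c \<noteq> 0" "rep_proj P = c *s p" by (rule exists_proj_point)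
  have "eval_poly (hcomp t D) (rep_proj P) \<noteq> 0"
    unfolding P(2) eval_form_scale[OF is_form_hcomp] using t P(1) by simp
  then have "P \<in> - zero_locus {hcomp t D}" using hom by (auto simp: zero_locus_def)
  moreover have "general_centre J d (rep_proj P)" if "P \<in> - zero_locus {hcomp t D}" for P
  proof -
    obtain f where f: "\<And>c. eval_poly D (c *s rep_proj P) = poly f c" "\<And>t. coeff f t = eval_poly (hcomp t D) (rep_proj P)"
      by (rule eval_scale_components) blast
    have "f \<noteq> 0" using that f(2)[of t] by (auto simp: zero_locus_def)
    then have "[:0, 1:] * f \<noteq> 0" by simp
    then obtain c where "poly ([:0, 1:] * f) c \<noteq> 0" using poly_all_0_iff_0 by blast
    then have c: "c \<noteq> 0" "eval_poly D (c *s rep_proj P) \<noteq> 0" using f(1) by auto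
    then show ?thesis using general_centre_scale[OF c(1)] D(2) by blast
  qed
  ultimately show ?thesis using that[of "- zero_locus {hcomp t D}"] by (auto simp: openin_zariski)
qed

theorem proposition2p1:
  fixes C :: "('k::{alg_closed_field, field_char_0}, 4) mpoly set"
    and d :: nat
  assumes "closed_subscheme C"
    and "is_curve C"
    and "is_reduced C"
    and "equidimensional C"
    and "nondegenerate C"
    and "has_degree C d"
  shows "d \<ge> 2 \<and>
    (d = 2 \<longrightarrow> (\<exists>L M. is_line L \<and> is_line M \<and> L \<inter> M = {} \<and> zero_locus C = L \<union> M)) \<and>
    for_general_point (\<lambda>P.
      closedin zariski (proj_cone P (zero_locus C)) \<and>
      unexpected_hypersurface C d d P (vanishing_ideal (proj_cone P (zero_locus C))) \<and>
      (\<forall>S. unexpected_hypersurface C d d P S \<longrightarrow> S = vanishing_ideal (proj_cone P (zero_locus C))))"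
proof -
  have n: "CARD(4) = 4" by simp
  have J: "curve_ideal C" by (rule curve_ideal_if_curve[OF assms(1-4)])
  note I = curve_idealD[OF J]
  have nd: "l = 0" if "is_form 1 l" "l \<in> C" for l
  proof (rule ccontr)
    assume "l \<noteq> 0"
    moreover have "ideal_gen {l} \<subseteq> C" by (rule idl.span_minimal) (use that(2) I(5) in auto)
    ultimately show False using assms(5) that(1) unfolding nondegenerate_def by blast
  qed
  obtain K where K: "\<And>t. hf C t \<le> d * t + K" by (rule curve_hf_linear[OF J assms(6)]) blast
  have d0: "0 < d"
  proof (rule ccontr)
    assume "\<not> 0 < d"
    then show False using K[of K] curve_hf_ge[OF J, of K] by simp
  qed
  have ne: "zero_locus C \<noteq> {}"
  proof -
    obtain x y where xy: "x \<noteq> y" "coords {x, y}" "is_form 1 x" "is_form 1 y" "finite_over {x, y} C"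
      by (rule curve_parameters[OF J coords_vars finite_over_vars]) blast
    obtain v where v: "v \<in> zeros C" "eval_poly x v = 1" by (rule curve_point_over[OF J xy(2,1,5), of 1 0]) blast
    then have "v \<noteq> 0" using eval_form_zero[OF xy(3)] by auto
    then show ?thesis using zeros_point[OF I(1) v(1)] by blast
  qed
  obtain U where U: "openin zariski U" "U \<noteq> {}" "\<And>P. P \<in> U \<Longrightarrow> general_centre C d (rep_proj P)"
    by (rule general_centre_on_open_set[OF J assms(6) d0 n]) blast
  have projection: "P \<notin> zero_locus C \<and> (\<exists>w x y z q. projection_from C (rep_proj P) d w x y z q)" if P: "P \<in> U" for P
  proof -
    obtain g k where g: "g \<in> C" "is_form k g" "eval_poly g (rep_proj P) \<noteq> 0"
      using U(3)[OF P] unfolding general_centre_def by blast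
    obtain e w x y z q where pr: "projection_from C (rep_proj P) e w x y z q"
      by (rule projection_exists[OF J n rep_proj_nonzero g]) blast
    moreover have "e = d" by (rule projection_degree[OF J pr U(3)[OF P] K])
    moreover have "P \<notin> zero_locus C"
      unfolding mem_zero_locus_iff[OF I(1)] using g(1,3) unfolding zeros_def by blast
    ultimately show ?thesis by blast
  qed
  have "d \<noteq> 1"
  proof
    assume d1: "d = 1"
    obtain P where "P \<in> U" using U(2) by blast
    then obtain w x y z q where pr: "projection_from C (rep_proj P) 1 w x y z q" using projection d1 by blast
    show False using nd[of "poly q z"] proj_q[OF J pr] by blast
  qed
  then have d2: "2 \<le> d" using d0 by simp
  have "d = 2 \<longrightarrow> (\<exists>L M. is_line L \<and> is_line M \<and> L \<inter> M = {} \<and> zero_locus C = L \<union> M)"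
    using degree_two_curve[OF J _ n nd] assms(6) by blast
  moreover have "closedin zariski (proj_cone P (zero_locus C)) \<and>
      unexpected_hypersurface C d d P (vanishing_ideal (proj_cone P (zero_locus C))) \<and>
      (\<forall>S. unexpected_hypersurface C d d P S \<longrightarrow> S = vanishing_ideal (proj_cone P (zero_locus C)))" if P: "P \<in> U" for P
  proof -
    obtain w x y z q where off: "P \<notin> zero_locus C" and pr: "projection_from C (rep_proj P) d w x y z q"
      using projection[OF P] by blast
    show ?thesis using unexpected_cone[OF J pr off ne n nd] by blast
  qed
  ultimately show ?thesis using d2 U(1,2) unfolding for_general_point_def by blast
qed

end
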